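(* Let $\dot x=A(t)x$ be a linear system with $A:[0,\infty)\to\mathbb{R}^{d\times d}$ continuous and bounded, with Lyapunov exponents $\lambda_1>\dots>\lambda_p$ and multiplicities $d_1,\dots,d_p$, $d_1+\dots+d_p=d$. If the system is regular and $(d_1+\dots+d_l)$-dimensionally strongly fast invertible for every $l=1,\dots,p$, then there exists a Lyapunov transformation reducing the system to block diagonal form $$\dot y=\operatorname{diag}(B_1(t),\dots,B_p(t))\,y,$$ where $B_i(t)\in\mathbb{R}^{d_i\times d_i}$ is upper triangular, such that the following hold: (i) for each $i=1,\dots,p$, all non-trivial solutions of $\dot y_i=B_i(t)y_i$ have characteristic exponent $\lambda_i$; (ii) there is a constant $b>0$ such that $$\|Y_i(t,s)^{-1}\|^{-1}\ \geq\ b\,\|Y_{i+1}(t,s)\|$$ for all $t\geq s\ge 0$ and $i=1,\dots,p-1$, where $Y_i(t,s)$ denotes the Cauchy matrix of $\dot y_i=B_i(t)y_i$. Conversely, any block diagonal system $\dot y=B(t)y$ with $B=\operatorname{diag}(B_1,\dots,B_p)$ continuous and bounded, with upper triangular blocks $B_i(t)\in\mathbb{R}^{d_i\times d_i}$, satisfying (i) and (ii) for numbers $\lambda_1>\dots>\lambda_p$, is $(d_1+\dots+d_l)$-dimensionally strongly fast invertible for every $l=1,\dots,p$.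
   Context: Norms are Euclidean norms and the associated operator norms. For a linear system $\dot x=A(t)x$ on $[0,\infty)$ with continuous bounded $A$, $X(t)$ denotes a fundamental matrix and $X(t,s)=X(t)X(s)^{-1}$, $t\ge s\ge 0$, the Cauchy matrix. Characteristic exponent of a solution $x$: $\chi[x]=\limsup_{t\to\infty}\frac1t\log\|x(t)\|$. The Lyapunov exponents $\lambda_1>\dots>\lambda_p$ are the distinct values of $\chi[x]$ over non-trivial solutions $x$. With $V_i=\{x \text{ solution}: \chi[x]\le\lambda_i\}$ and $V_{p+1}=\{0\}$, the multiplicity of $\lambda_i$ is $d_i=\dim V_i-\dim V_{i+1}$. The system is called regular if $\sum_{i=1}^p d_i\lambda_i=\liminf_{t\to\infty}\frac1t\log|\det X(t)|$. The system is called $L$-dimensionally strongly fast invertible ($1\le L\le d$) if $$c_{FI,L}:=\sup_{t\ge s\ge\tau\ge 0}\ \prod_{k=1}^L\frac{\sigma_k(X(t,s))\,\sigma_k(X(s,\tau))}{\sigma_k(X(t,\tau))}<\infty,$$ where $\sigma_1\ge\dots\ge\sigma_d$ denote singular values. A Lyapunov transformation is a change of variables $x=L(t)y$ with $L:[0,\infty)\to\mathbb{R}^{d\times d}$ continuously differentiable, everywhere invertible, and $L,L^{-1},\dot L$ bounded; the transformed system is $\dot y=B(t)y$ with $B=L^{-1}AL-L^{-1}\dot L$. *)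

theory Defs
  imports
    Complex_Main
    "HOL-Library.Extended_Real"
    "HOL-Library.Liminf_Limsup"
    "HOL-Library.FuncSet"
    "HOL-Computational_Algebra.Polynomial"
    "Jordan_Normal_Form.Matrix"
    "Jordan_Normal_Form.Determinant"
    "Jordan_Normal_Form.Char_Poly"
    "Jordan_Normal_Form.Gauss_Jordan_Elimination"
    "Jordan_Normal_Form.VS_Connect"
begin

section \<open>Norms, inverses and singular values\<close>

definition euclid_norm :: "real vec \<Rightarrow> real" where
  "euclid_norm v = sqrt (scalar_prod v v)"

text \<open>The unit ball rather than the unit sphere is used so that the supremum is never
  taken over an empty set.\<close>

definition op_norm :: "real mat \<Rightarrow> real" where
  "op_norm M = (SUP v\<in>{v \<in> carrier_vec (dim_col M). euclid_norm v \<le> 1}. euclid_norm (M *\<^sub>v v))"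

abbreviation inv_mat :: "real mat \<Rightarrow> real mat" where
  "inv_mat M \<equiv> the (mat_inverse M)"

text \<open>Square roots of the eigenvalues of \<open>M\<^sup>T M\<close>, counted with algebraic multiplicity,
  in decreasing order; the index \<open>k\<close> starts at 1.\<close>

definition singular_value :: "nat \<Rightarrow> real mat \<Rightarrow> real" where
  "singular_value k M =
     rev (map sqrt (sorted_list_of_multiset (proots (char_poly (transpose_mat M * M))))) ! (k - 1)"


section \<open>Matrix functions and linear systems on the half-line\<close>

text \<open>Functions on \<open>[0,\<infinity>)\<close> have type \<open>real \<Rightarrow> _\<close>; values at negative times are never used.
  Continuity and differentiability of matrix functions are entrywise, and one-sided at 0.\<close>

definition mat_fun :: "nat \<Rightarrow> (real \<Rightarrow> real mat) \<Rightarrow> bool" where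
  "mat_fun d F \<longleftrightarrow> (\<forall>t\<ge>0. F t \<in> carrier_mat d d)"

definition mat_continuous :: "nat \<Rightarrow> (real \<Rightarrow> real mat) \<Rightarrow> bool" where
  "mat_continuous d F \<longleftrightarrow> mat_fun d F \<and>
     (\<forall>i<d. \<forall>j<d. continuous_on {0..} (\<lambda>t. F t $$ (i, j)))"

definition mat_bounded :: "(real \<Rightarrow> real mat) \<Rightarrow> bool" where
  "mat_bounded F \<longleftrightarrow> (\<exists>K. \<forall>t\<ge>0. op_norm (F t) \<le> K)"

definition has_mat_derivative ::
    "nat \<Rightarrow> (real \<Rightarrow> real mat) \<Rightarrow> (real \<Rightarrow> real mat) \<Rightarrow> bool" where
  "has_mat_derivative d F F' \<longleftrightarrow> mat_fun d F \<and> mat_fun d F' \<and>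
     (\<forall>t\<ge>0. \<forall>i<d. \<forall>j<d.
        ((\<lambda>s. F s $$ (i, j)) has_real_derivative F' t $$ (i, j)) (at t within {0..}))"

text \<open>Solutions are extensional functions on \<open>[0,\<infinity>)\<close>, so that two solutions are equal as soon as
  they agree on \<open>[0,\<infinity>)\<close> and the solution space has its usual dimension.\<close>

definition solutions :: "nat \<Rightarrow> (real \<Rightarrow> real mat) \<Rightarrow> (real \<Rightarrow> real vec) set" where
  "solutions d A = {x \<in> {0..} \<rightarrow>\<^sub>E carrier_vec d.
     \<forall>t\<ge>0. \<forall>i<d. ((\<lambda>s. x s $ i) has_real_derivative (A t *\<^sub>v x t) $ i) (at t within {0..})}"

definition zero_solution :: "nat \<Rightarrow> real \<Rightarrow> real vec" where
  "zero_solution d = (\<lambda>t\<in>{0..}. 0\<^sub>v d)"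

definition fundamental_matrix :: "nat \<Rightarrow> (real \<Rightarrow> real mat) \<Rightarrow> (real \<Rightarrow> real mat) \<Rightarrow> bool" where
  "fundamental_matrix d A X \<longleftrightarrow> has_mat_derivative d X (\<lambda>t. A t * X t) \<and>
     (\<forall>t\<ge>0. invertible_mat (X t))"

text \<open>The Cauchy matrix and regularity do not depend on which fundamental matrix is chosen.\<close>

definition fund_mat :: "nat \<Rightarrow> (real \<Rightarrow> real mat) \<Rightarrow> real \<Rightarrow> real mat" where
  "fund_mat d A = (SOME X. fundamental_matrix d A X)"

definition cauchy_matrix :: "nat \<Rightarrow> (real \<Rightarrow> real mat) \<Rightarrow> real \<Rightarrow> real \<Rightarrow> real mat" where
  "cauchy_matrix d A t s = fund_mat d A t * inv_mat (fund_mat d A s)"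


section \<open>Lyapunov exponents and regularity\<close>

text \<open>The convention \<open>log 0 = -\<infinity>\<close> is made explicit because \<open>ln 0 = 0\<close> in the library;
  thus the trivial solution has exponent \<open>-\<infinity>\<close> and lies in every \<open>V\<^sub>i\<close>.\<close>

definition char_exponent :: "(real \<Rightarrow> real vec) \<Rightarrow> ereal" where
  "char_exponent x = Limsup at_top (\<lambda>t.
     if euclid_norm (x t) = 0 then -\<infinity> else ereal (1 / t * ln (euclid_norm (x t))))"

definition lyapunov_exponents :: "nat \<Rightarrow> (real \<Rightarrow> real mat) \<Rightarrow> ereal set" where
  "lyapunov_exponents d A = char_exponent ` (solutions d A - {zero_solution d})"

text \<open>Dimension of a linear space of functions \<open>[0,\<infinity>) \<rightarrow> \<real>\<^sup>d\<close>; the ring fields \<open>mult\<close> and \<open>one\<close>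
  of the module record are irrelevant.\<close>

definition fun_space :: "nat \<Rightarrow> (real \<Rightarrow> real vec) set \<Rightarrow> (real, real \<Rightarrow> real vec) module" where
  "fun_space d V = \<lparr>carrier = V, mult = undefined, one = undefined,
     zero = zero_solution d,
     add = (\<lambda>x y. \<lambda>t\<in>{0..}. x t + y t),
     smult = (\<lambda>c x. \<lambda>t\<in>{0..}. c \<cdot>\<^sub>v x t)\<rparr>"

definition fun_dim :: "nat \<Rightarrow> (real \<Rightarrow> real vec) set \<Rightarrow> nat" where
  "fun_dim d V = vectorspace.dim (class_ring :: real ring) (fun_space d V)"

definition lyapunov_filtration ::
    "nat \<Rightarrow> (real \<Rightarrow> real mat) \<Rightarrow> nat \<Rightarrow> (nat \<Rightarrow> real) \<Rightarrow> nat \<Rightarrow> (real \<Rightarrow> real vec) set" where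
  "lyapunov_filtration d A p lam i =
     (if i = p + 1 then {zero_solution d}
      else {x \<in> solutions d A. char_exponent x \<le> ereal (lam i)})"

text \<open>The Lyapunov exponents are exactly \<open>lam 1 > \<dots> > lam p\<close>, with multiplicities
  \<open>m 1, \<dots>, m p\<close>. The difference of dimensions is taken in the integers.\<close>

definition has_lyapunov_spectrum ::
    "nat \<Rightarrow> (real \<Rightarrow> real mat) \<Rightarrow> nat \<Rightarrow> (nat \<Rightarrow> real) \<Rightarrow> (nat \<Rightarrow> nat) \<Rightarrow> bool" where
  "has_lyapunov_spectrum d A p lam m \<longleftrightarrow>
     strict_antimono_on {1..p} lam \<and>
     lyapunov_exponents d A = (\<lambda>i. ereal (lam i)) ` {1..p} \<and>
     (\<forall>i\<in>{1..p}. int (m i) = int (fun_dim d (lyapunov_filtration d A p lam i))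
                          - int (fun_dim d (lyapunov_filtration d A p lam (i + 1))))"

definition regular_system ::
    "nat \<Rightarrow> (real \<Rightarrow> real mat) \<Rightarrow> nat \<Rightarrow> (nat \<Rightarrow> real) \<Rightarrow> (nat \<Rightarrow> nat) \<Rightarrow> bool" where
  "regular_system d A p lam m \<longleftrightarrow>
     ereal (\<Sum>i=1..p. real (m i) * lam i) =
     Liminf at_top (\<lambda>t. ereal (1 / t * ln \<bar>Determinant.det (fund_mat d A t)\<bar>))"


section \<open>Strong fast invertibility\<close>

definition fast_invertibility_const :: "nat \<Rightarrow> (real \<Rightarrow> real mat) \<Rightarrow> nat \<Rightarrow> ereal" where
  "fast_invertibility_const d A L =
     (SUP (t, s, u)\<in>{(t, s, u). t \<ge> s \<and> s \<ge> u \<and> u \<ge> 0}.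
        ereal (\<Prod>k=1..L. singular_value k (cauchy_matrix d A t s)
                           * singular_value k (cauchy_matrix d A s u)
                           / singular_value k (cauchy_matrix d A t u)))"

definition strongly_fast_invertible :: "nat \<Rightarrow> (real \<Rightarrow> real mat) \<Rightarrow> nat \<Rightarrow> bool" where
  "strongly_fast_invertible d A L \<longleftrightarrow>
     1 \<le> L \<and> L \<le> d \<and> fast_invertibility_const d A L < \<infinity>"


section \<open>Lyapunov transformations and block diagonal systems\<close>

definition lyapunov_transformation ::
    "nat \<Rightarrow> (real \<Rightarrow> real mat) \<Rightarrow> (real \<Rightarrow> real mat) \<Rightarrow> bool" where
  "lyapunov_transformation d L L' \<longleftrightarrow>
     has_mat_derivative d L L' \<and> mat_continuous d L' \<and>
     (\<forall>t\<ge>0. invertible_mat (L t)) \<and>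
     mat_bounded L \<and> mat_bounded (\<lambda>t. inv_mat (L t)) \<and> mat_bounded L'"

definition lyapunov_reducible ::
    "nat \<Rightarrow> (real \<Rightarrow> real mat) \<Rightarrow> (real \<Rightarrow> real mat) \<Rightarrow> bool" where
  "lyapunov_reducible d A B \<longleftrightarrow>
     (\<exists>L L'. lyapunov_transformation d L L' \<and>
        (\<forall>t\<ge>0. B t = inv_mat (L t) * A t * L t - inv_mat (L t) * L' t))"

definition block_diag :: "nat \<Rightarrow> (nat \<Rightarrow> real \<Rightarrow> real mat) \<Rightarrow> real \<Rightarrow> real mat" where
  "block_diag p B t = diag_block_mat (map (\<lambda>i. B i t) [1..<p + 1])"

definition triangular_blocks ::
    "nat \<Rightarrow> (nat \<Rightarrow> nat) \<Rightarrow> (nat \<Rightarrow> real \<Rightarrow> real mat) \<Rightarrow> bool" where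
  "triangular_blocks p m B \<longleftrightarrow>
     (\<forall>i\<in>{1..p}. \<forall>t\<ge>0. B i t \<in> carrier_mat (m i) (m i) \<and> upper_triangular (B i t))"

definition block_exponents ::
    "nat \<Rightarrow> (nat \<Rightarrow> nat) \<Rightarrow> (nat \<Rightarrow> real) \<Rightarrow> (nat \<Rightarrow> real \<Rightarrow> real mat) \<Rightarrow> bool" where
  "block_exponents p m lam B \<longleftrightarrow>
     (\<forall>i\<in>{1..p}. \<forall>y\<in>solutions (m i) (B i) - {zero_solution (m i)}.
        char_exponent y = ereal (lam i))"

definition block_domination ::
    "nat \<Rightarrow> (nat \<Rightarrow> nat) \<Rightarrow> (nat \<Rightarrow> real \<Rightarrow> real mat) \<Rightarrow> bool" where
  "block_domination p m B \<longleftrightarrow>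
     (\<exists>b>0. \<forall>t s. \<forall>i\<in>{1..<p}. t \<ge> s \<and> s \<ge> 0 \<longrightarrow>
        inverse (op_norm (inv_mat (cauchy_matrix (m i) (B i) t s)))
          \<ge> b * op_norm (cauchy_matrix (m (i + 1)) (B (i + 1)) t s))"

end

theory Submission
  imports
    "HOL-Analysis.Henstock_Kurzweil_Integration"
    "HOL-Analysis.L2_Norm"
    "Jordan_Normal_Form.Schur_Decomposition"
    Defs
begin

text \<open>The forward direction rests on a comparison of volumes. Choose a fundamental matrix \<open>\<Phi>\<close> whose columns
  are adapted to the Lyapunov filtration and ordered by decreasing exponent, let \<open>L\<close> be the number of
  columns that belong to the first \<open>l\<close> exponents, and let \<open>\<rho> t\<close> be the \<open>L\<close>-dimensional volume spanned by
  the first \<open>L\<close> columns of \<open>\<Phi> t\<close>. The volume \<open>\<bar>det (\<Phi> t)\<bar>\<close> is at most \<open>\<rho> t\<close> times the norms of the other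
  columns, and by regularity it grows with the rate \<open>\<Sum> d\<^sub>i \<lambda>\<^sub>i\<close>; hence \<open>\<rho>\<close> grows with the largest rate that
  the exponents allow, and every other choice of \<open>L\<close> columns spans an exponentially smaller volume
  (\<open>select_cols_small\<close>). The product of the \<open>L\<close> largest singular values of \<open>X(t, 0)\<close> is therefore bounded by
  a multiple of \<open>\<rho> t\<close>, and strong fast invertibility becomes a statement on volumes: between any two
  times no \<open>L\<close>-frame is expanded by more than a constant times the expansion of the first \<open>L\<close> columns
  (\<open>volume_dominated\<close>).

  From this domination everything else follows by exchanging a single vector of a frame. Let \<open>a\<close> be a
  combination of the first \<open>L\<close> columns and \<open>b\<close> a combination of the others. At late times a frame that
  contains \<open>b\<close> has negligible volume, so \<open>a\<close> and \<open>a + b\<close> are interchangeable there; going back in time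
  gives \<open>\<bar>\<Phi> s a\<bar> \<le> K \<bar>\<Phi> s (a + b)\<bar>\<close>, that is, the angle between the two spaces of solutions is bounded
  below (\<open>norm_fast_le\<close>). With this angle, comparing the frames completed by \<open>a\<close> and by \<open>b\<close> shows that
  solutions with the smaller exponents never expand faster, up to a constant, than those with the
  larger ones (\<open>fast_dominates_slow\<close>).

  The transformation is then Gram--Schmidt within each block of columns: \<open>X\<^sub>k = Q\<^sub>k R\<^sub>k\<close> with \<open>R\<^sub>k\<close> upper
  triangular, and \<open>L = [Q\<^sub>1 \<dots> Q\<^sub>p]\<close>. It is bounded because the columns of each \<open>Q\<^sub>k\<close> are orthonormal, and its
  inverse is bounded because the angles at all block boundaries are. The triangular factors satisfy
  \<open>R\<^sub>k' = B\<^sub>k R\<^sub>k\<close>, where \<open>B\<^sub>k\<close> is triangular and determined by the bounded matrix \<open>Q\<^sub>k\<^sup>T (A + A\<^sup>T) Q\<^sub>k\<close>; since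
  \<open>\<bar>R\<^sub>k v\<bar> = \<bar>X\<^sub>k v\<bar>\<close>, exponents and domination carry over from \<open>\<Phi>\<close> to the blocks.

  Conversely, the singular values of a block diagonal Cauchy matrix are those of its blocks taken
  together. By the domination hypothesis those of later blocks are at most a constant times any
  singular value of the first \<open>l\<close> blocks, so the product of the \<open>L\<close> largest ones differs from the
  determinant of the first \<open>l\<close> blocks by a bounded factor, and determinants are multiplicative
  (\<open>dominated_blocks\<close>).\<close>

unbundle no vec_syntax
unbundle no inner_syntax

section \<open>Euclidean norms and operator norms\<close>

lemma euclid_norm_L2_set: "euclid_norm v = L2_set (\<lambda>i. v $ i) {..<dim_vec v}"
  unfolding euclid_norm_def L2_set_def scalar_prod_def
  by (simp add: power2_eq_square lessThan_atLeast0)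

lemma euclid_norm_nonneg [simp]: "0 \<le> euclid_norm v"
  by (simp add: euclid_norm_L2_set)

lemma euclid_norm_power2: "(euclid_norm v)\<^sup>2 = v \<bullet> v"
  unfolding euclid_norm_def
  by (simp add: scalar_prod_def sum_nonneg)

lemma euclid_norm_zero [simp]: "euclid_norm (0\<^sub>v n) = 0"
  by (simp add: euclid_norm_def)

lemma euclid_norm_eq_0_iff: "v \<in> carrier_vec n \<Longrightarrow> euclid_norm v = 0 \<longleftrightarrow> v = 0\<^sub>v n"
  by (auto simp: euclid_norm_L2_set L2_set_eq_0_iff intro!: eq_vecI)

lemma euclid_norm_triangle:
  assumes "v \<in> carrier_vec n" "w \<in> carrier_vec n"
  shows "euclid_norm (v + w) \<le> euclid_norm v + euclid_norm w"
proof -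
  have "L2_set (\<lambda>i. (v + w) $ i) {..<n} = L2_set (\<lambda>i. v $ i + w $ i) {..<n}"
    using assms by (intro L2_set_cong) auto
  then show ?thesis
    using assms L2_set_triangle_ineq[of "\<lambda>i. v $ i" "\<lambda>i. w $ i" "{..<n}"] by (simp add: euclid_norm_L2_set)
qed

lemma euclid_norm_smult: "euclid_norm (c \<cdot>\<^sub>v v) = \<bar>c\<bar> * euclid_norm v"
  by (simp add: euclid_norm_def real_sqrt_mult flip: mult.assoc)

lemma euclid_norm_uminus: "euclid_norm (- v) = euclid_norm v"
  by (simp add: euclid_norm_L2_set L2_set_def)

lemma scalar_prod_le_euclid_norm:
  assumes "v \<in> carrier_vec n" "w \<in> carrier_vec n"
  shows "\<bar>v \<bullet> w\<bar> \<le> euclid_norm v * euclid_norm w"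
proof -
  have "\<bar>v \<bullet> w\<bar> \<le> (\<Sum>i<n. \<bar>v $ i\<bar> * \<bar>w $ i\<bar>)"
    using assms by (auto simp: scalar_prod_def lessThan_atLeast0 abs_mult[symmetric] sum_abs)
  also have "\<dots> \<le> euclid_norm v * euclid_norm w"
    using L2_set_mult_ineq[of "\<lambda>i. v $ i" "\<lambda>i. w $ i" "{..<n}"] assms
    by (simp add: euclid_norm_L2_set)
  finally show ?thesis .
qed

lemma abs_vec_index_le_euclid_norm: "i < dim_vec v \<Longrightarrow> \<bar>v $ i\<bar> \<le> euclid_norm v"
  unfolding euclid_norm_L2_set using member_le_L2_set[of "{..<dim_vec v}" i "\<lambda>i. \<bar>v $ i\<bar>"]
  by (simp add: L2_set_def)

lemma euclid_norm_le_sum: "euclid_norm v \<le> (\<Sum>i<dim_vec v. \<bar>v $ i\<bar>)"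
  unfolding euclid_norm_L2_set using L2_set_le_sum_abs .

lemma euclid_norm_le_of_abs_le:
  assumes "v \<in> carrier_vec n" "\<And>i. i < n \<Longrightarrow> \<bar>v $ i\<bar> \<le> M"
  shows "euclid_norm v \<le> real n * M"
  using euclid_norm_le_sum[of v] assms sum_bounded_above[of "{..<n}" "\<lambda>i. \<bar>v $ i\<bar>" M] by simp

lemma euclid_norm_exists_large_entry:
  assumes "v \<in> carrier_vec n" "0 < n"
  shows "\<exists>j<n. euclid_norm v \<le> real n * \<bar>v $ j\<bar>"
proof (rule ccontr)
  assume "\<not> ?thesis"
  then have "\<bar>v $ j\<bar> < euclid_norm v / real n" if "j < n" for j
    using that assms(2) by (simp add: field_simps not_le)
  then have "(\<Sum>j<n. \<bar>v $ j\<bar>) < (\<Sum>j<n. euclid_norm v / real n)"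
    using assms(2) by (intro sum_strict_mono) auto
  then show False
    using euclid_norm_le_sum[of v] assms by simp
qed

lemma mult_mat_vec_norm_le_entries:
  assumes "M \<in> carrier_mat n k" "v \<in> carrier_vec k"
    and "\<And>i j. i < n \<Longrightarrow> j < k \<Longrightarrow> \<bar>M $$ (i, j)\<bar> \<le> K"
  shows "euclid_norm (M *\<^sub>v v) \<le> real n * (real k * K) * euclid_norm v"
proof -
  have "\<bar>(M *\<^sub>v v) $ i\<bar> \<le> real k * K * euclid_norm v" if i: "i < n" for i
  proof -
    have "\<bar>(M *\<^sub>v v) $ i\<bar> \<le> (\<Sum>j<k. \<bar>M $$ (i, j) * v $ j\<bar>)"
      using assms i by (auto simp: scalar_prod_def lessThan_atLeast0 intro!: sum_abs[THEN order_trans])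
    also have "\<dots> \<le> (\<Sum>j<k. K * euclid_norm v)"
      using assms i abs_vec_index_le_euclid_norm[of _ v]
      by (intro sum_mono) (auto simp: abs_mult intro!: mult_mono order_trans[OF abs_ge_zero assms(3)])
    finally show ?thesis by simp
  qed
  then have "euclid_norm (M *\<^sub>v v) \<le> real n * (real k * K * euclid_norm v)"
    using assms by (intro euclid_norm_le_of_abs_le) auto
  then show ?thesis by (simp add: mult.assoc)
qed

lemma exists_entry_bound:
  fixes f :: "nat \<Rightarrow> nat \<Rightarrow> real"
  shows "\<exists>K\<ge>0. \<forall>i<n. \<forall>j<k. \<bar>f i j\<bar> \<le> K"
proof (intro exI conjI allI impI)
  show "0 \<le> (\<Sum>i<n. \<Sum>j<k. \<bar>f i j\<bar>)" by (intro sum_nonneg) auto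
  fix i j assume "i < n" "j < k"
  then have "\<bar>f i j\<bar> \<le> (\<Sum>j<k. \<bar>f i j\<bar>)"
    by (intro member_le_sum[of j "{..<k}" "\<lambda>j. \<bar>f i j\<bar>"]) auto
  also have "\<dots> \<le> (\<Sum>i<n. \<Sum>j<k. \<bar>f i j\<bar>)"
    using \<open>i < n\<close> by (intro member_le_sum[of i "{..<n}" "\<lambda>i. \<Sum>j<k. \<bar>f i j\<bar>"] sum_nonneg) auto
  finally show "\<bar>f i j\<bar> \<le> (\<Sum>i<n. \<Sum>j<k. \<bar>f i j\<bar>)" .
qed

lemma op_norm_bdd_above:
  "bdd_above ((\<lambda>v. euclid_norm (M *\<^sub>v v)) ` {v \<in> carrier_vec (dim_col M). euclid_norm v \<le> 1})"
proof -
  obtain K where K: "K \<ge> 0" "\<And>i j. i < dim_row M \<Longrightarrow> j < dim_col M \<Longrightarrow> \<bar>M $$ (i, j)\<bar> \<le> K"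
    using exists_entry_bound[of "dim_row M" "dim_col M" "\<lambda>i j. M $$ (i, j)"] by blast
  show ?thesis
  proof (rule bdd_aboveI2)
    fix v assume v: "v \<in> {v \<in> carrier_vec (dim_col M). euclid_norm v \<le> 1}"
    have "euclid_norm (M *\<^sub>v v) \<le> real (dim_row M) * (real (dim_col M) * K) * euclid_norm v"
      using v K by (intro mult_mat_vec_norm_le_entries) auto
    also have "\<dots> \<le> real (dim_row M) * (real (dim_col M) * K) * 1"
      using v K by (intro mult_left_mono) auto
    finally show "euclid_norm (M *\<^sub>v v) \<le> real (dim_row M) * (real (dim_col M) * K)" by simp
  qed
qed

lemma op_norm_le:
  assumes "M \<in> carrier_mat n k" "\<And>v. v \<in> carrier_vec k \<Longrightarrow> euclid_norm (M *\<^sub>v v) \<le> K * euclid_norm v" "0 \<le> K"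
  shows "op_norm M \<le> K"
  unfolding op_norm_def
proof (rule cSUP_least)
  show "{v \<in> carrier_vec (dim_col M). euclid_norm v \<le> 1} \<noteq> {}"
    by (auto intro!: exI[of _ "0\<^sub>v (dim_col M)"])
  fix v assume "v \<in> {v \<in> carrier_vec (dim_col M). euclid_norm v \<le> 1}"
  then have v: "v \<in> carrier_vec k" "euclid_norm v \<le> 1" using assms(1) by auto
  have "euclid_norm (M *\<^sub>v v) \<le> K * euclid_norm v" using v assms(2) by blast
  also have "\<dots> \<le> K * 1" using v assms(3) by (intro mult_left_mono) auto
  finally show "euclid_norm (M *\<^sub>v v) \<le> K" by simp
qed

lemma mult_mat_vec_norm_le:
  assumes "M \<in> carrier_mat n k" "v \<in> carrier_vec k"
  shows "euclid_norm (M *\<^sub>v v) \<le> op_norm M * euclid_norm v"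
proof (cases "euclid_norm v = 0")
  case True
  then have "v = 0\<^sub>v k" using euclid_norm_eq_0_iff assms by blast
  then have "M *\<^sub>v v = 0\<^sub>v n" using assms by auto
  then show ?thesis using True by simp
next
  case False
  then have p: "euclid_norm v > 0" using euclid_norm_nonneg[of v] by linarith
  let ?w = "inverse (euclid_norm v) \<cdot>\<^sub>v v"
  have "euclid_norm (M *\<^sub>v ?w) \<le> op_norm M"
    unfolding op_norm_def
    using assms p by (intro cSUP_upper[OF _ op_norm_bdd_above]) (auto simp: euclid_norm_smult)
  also have "M *\<^sub>v ?w = inverse (euclid_norm v) \<cdot>\<^sub>v (M *\<^sub>v v)"
    using assms by (simp add: mult_mat_vec)
  finally show ?thesis using p by (simp add: euclid_norm_smult field_simps)
qed

lemma op_norm_nonneg: "0 \<le> op_norm M"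
proof -
  have "euclid_norm (M *\<^sub>v 0\<^sub>v (dim_col M)) \<le> op_norm M"
    unfolding op_norm_def by (intro cSUP_upper[OF _ op_norm_bdd_above]) auto
  then show ?thesis using euclid_norm_nonneg order_trans by blast
qed

lemma abs_mat_index_le_op_norm:
  assumes "M \<in> carrier_mat n k" "i < n" "j < k"
  shows "\<bar>M $$ (i, j)\<bar> \<le> op_norm M"
proof -
  have "\<bar>M $$ (i, j)\<bar> = \<bar>(M *\<^sub>v unit_vec k j) $ i\<bar>"
    using assms by (simp add: scalar_prod_right_unit)
  also have "\<dots> \<le> euclid_norm (M *\<^sub>v unit_vec k j)"
    using assms by (intro abs_vec_index_le_euclid_norm) auto
  also have "\<dots> \<le> op_norm M * euclid_norm (unit_vec k j)"
    using assms by (intro mult_mat_vec_norm_le) auto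
  also have "euclid_norm (unit_vec k j) = 1"
    using assms by (simp add: euclid_norm_def)
  finally show ?thesis by simp
qed

lemma mat_bounded_iff_entries_bounded:
  assumes "mat_fun n F"
  shows "mat_bounded F \<longleftrightarrow> (\<exists>K. \<forall>t\<ge>0. \<forall>i<n. \<forall>j<n. \<bar>F t $$ (i, j)\<bar> \<le> K)"
proof
  assume "mat_bounded F"
  then show "\<exists>K. \<forall>t\<ge>0. \<forall>i<n. \<forall>j<n. \<bar>F t $$ (i, j)\<bar> \<le> K"
    using abs_mat_index_le_op_norm assms unfolding mat_bounded_def mat_fun_def by (meson order_trans)
next
  assume "\<exists>K. \<forall>t\<ge>0. \<forall>i<n. \<forall>j<n. \<bar>F t $$ (i, j)\<bar> \<le> K"
  then obtain K where K: "\<And>t i j. t \<ge> 0 \<Longrightarrow> i < n \<Longrightarrow> j < n \<Longrightarrow> \<bar>F t $$ (i, j)\<bar> \<le> K" by blast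
  have "op_norm (F t) \<le> real n * (real n * max 0 K)" if t: "t \<ge> 0" for t
  proof (rule op_norm_le[of _ n n])
    show "F t \<in> carrier_mat n n" using assms t by (auto simp: mat_fun_def)
    then show "euclid_norm (F t *\<^sub>v v) \<le> real n * (real n * max 0 K) * euclid_norm v"
      if "v \<in> carrier_vec n" for v
      using K[OF t] that by (intro mult_mat_vec_norm_le_entries) (auto simp: le_max_iff_disj)
  qed simp
  then show "mat_bounded F" unfolding mat_bounded_def by blast
qed

lemma inv_mat_inverse:
  assumes M: "M \<in> carrier_mat n n" "Determinant.det M \<noteq> 0"
  shows "inv_mat M \<in> carrier_mat n n" "M * inv_mat M = 1\<^sub>m n" "inv_mat M * M = 1\<^sub>m n"
proof -
  obtain B where "mat_inverse M = Some B"
    using mat_inverse(1)[OF M(1), of "()"] det_non_zero_imp_unit[OF M, of "()"]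
    by (cases "mat_inverse M") auto
  then show "inv_mat M \<in> carrier_mat n n" "M * inv_mat M = 1\<^sub>m n" "inv_mat M * M = 1\<^sub>m n"
    using mat_inverse(2)[OF M(1)] by auto
qed

lemma inv_mat_unique:
  assumes "M \<in> carrier_mat n n" "N \<in> carrier_mat n n" "N * M = 1\<^sub>m n"
  shows "inv_mat M = N" "Determinant.det M \<noteq> 0"
proof -
  have "Determinant.det N * Determinant.det M = 1"
    using assms by (simp flip: det_mult)
  then show d: "Determinant.det M \<noteq> 0" by auto
  note i = inv_mat_inverse[OF assms(1) d]
  have "inv_mat M = (N * M) * inv_mat M" using assms i by auto
  also have "\<dots> = N * (M * inv_mat M)" using assms i by (intro assoc_mult_mat) auto
  also have "\<dots> = N" using assms i by simp
  finally show "inv_mat M = N" .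
qed

lemma invertible_mat_iff_det_nonzero:
  assumes "M \<in> carrier_mat n n"
  shows "invertible_mat (M :: real mat) \<longleftrightarrow> Determinant.det M \<noteq> 0"
proof
  assume "invertible_mat M"
  then obtain B where B: "inverts_mat M B" "inverts_mat B M" unfolding invertible_mat_def by blast
  then have "M * B = 1\<^sub>m n" "B * M = 1\<^sub>m (dim_row B)" using assms by (auto simp: inverts_mat_def)
  then have "B \<in> carrier_mat n n" 
    by (metis assms carrier_matD carrier_matI index_mult_mat(2,3) index_one_mat(2,3))
  then show "Determinant.det M \<noteq> 0"
    using assms \<open>M * B = 1\<^sub>m n\<close> det_mult[OF assms \<open>B \<in> carrier_mat n n\<close>] by auto
next
  assume "Determinant.det M \<noteq> 0"
  note i = inv_mat_inverse[OF assms this]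
  show "invertible_mat M"
    unfolding invertible_mat_def inverts_mat_def using assms i by (intro conjI exI[of _ "inv_mat M"]) auto
qed

section \<open>Volumes of frames\<close>

abbreviation gdet :: "real mat \<Rightarrow> real" where
  "gdet Z \<equiv> Determinant.det (transpose_mat Z * Z)"

definition vol :: "real mat \<Rightarrow> real" where
  "vol Z = sqrt (gdet Z)"

text \<open>All maps, and not only the increasing ones, index the minors. No order on sets of rows has to be chosen
  then, at the price of a factor \<open>fact L\<close> in the Cauchy--Binet formula.\<close>

abbreviation index_maps :: "nat \<Rightarrow> nat \<Rightarrow> (nat \<Rightarrow> nat) set" where
  "index_maps L d \<equiv> {0..<L} \<rightarrow>\<^sub>E {0..<d}"

definition minor :: "real mat \<Rightarrow> (nat \<Rightarrow> nat) \<Rightarrow> real" where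
  "minor Z g = Determinant.det (mat (dim_col Z) (dim_col Z) (\<lambda>(i, j). Z $$ (g i, j)))"

definition select_cols :: "real mat \<Rightarrow> nat \<Rightarrow> (nat \<Rightarrow> nat) \<Rightarrow> real mat" where
  "select_cols M L g = mat (dim_row M) L (\<lambda>(i, j). M $$ (i, g j))"

lemma finite_index_maps [simp]: "finite (index_maps L d)"
  by (intro finite_PiE) auto

lemma det_colwise:
  assumes "A \<in> carrier_mat n n"
  shows "Determinant.det A = (\<Sum>p\<in>{p. p permutes {0..<n}}. signof p * (\<Prod>j=0..<n. A $$ (p j, j)))"
proof -
  have p: "p j < n" if "p permutes {0..<n}" "j < n" for p j
    using that permutes_in_image[of p "{0..<n}" j] by simp
  have "Determinant.det A = Determinant.det (transpose_mat A)" using det_transpose[OF assms] by simp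
  also have "\<dots> = (\<Sum>p\<in>{p. p permutes {0..<n}}. signof p * (\<Prod>j=0..<n. transpose_mat A $$ (j, p j)))"
    using assms by (intro det_def') auto
  also have "\<dots> = (\<Sum>p\<in>{p. p permutes {0..<n}}. signof p * (\<Prod>j=0..<n. A $$ (p j, j)))"
    using assms p by (intro sum.cong refl arg_cong2[of _ _ _ _ "(*)"] prod.cong) auto
  finally show ?thesis .
qed

lemma det_mult_expand:
  fixes A B :: "real mat"
  assumes "A \<in> carrier_mat L d" "B \<in> carrier_mat d L"
  shows "Determinant.det (A * B) =
    (\<Sum>g\<in>index_maps L d. (\<Prod>j=0..<L. B $$ (g j, j)) * Determinant.det (mat L L (\<lambda>(i, j). A $$ (i, g j))))"
proof -
  let ?P = "{p. p permutes {0..<L}}"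
  have p: "p j < L" if "p permutes {0..<L}" "j < L" for p j
    using that permutes_in_image[of p "{0..<L}" j] by simp
  have "Determinant.det (A * B) = (\<Sum>p\<in>?P. signof p * (\<Prod>j=0..<L. (A * B) $$ (p j, j)))"
    using assms by (intro det_colwise) auto
  also have "\<dots> = (\<Sum>p\<in>?P. signof p * (\<Prod>j=0..<L. \<Sum>k=0..<d. A $$ (p j, k) * B $$ (k, j)))"
    using assms p by (intro sum.cong refl arg_cong2[of _ _ _ _ "(*)"] prod.cong) (auto simp: scalar_prod_def)
  also have "\<dots> = (\<Sum>p\<in>?P. \<Sum>g\<in>index_maps L d. signof p * (\<Prod>j=0..<L. A $$ (p j, g j) * B $$ (g j, j)))"
    by (intro sum.cong refl) (subst prod_sum_PiE, auto simp: sum_distrib_left)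
  also have "\<dots> = (\<Sum>g\<in>index_maps L d. \<Sum>p\<in>?P. signof p * (\<Prod>j=0..<L. A $$ (p j, g j) * B $$ (g j, j)))"
    by (rule sum.swap)
  also have "\<dots> = (\<Sum>g\<in>index_maps L d. (\<Prod>j=0..<L. B $$ (g j, j)) * Determinant.det (mat L L (\<lambda>(i, j). A $$ (i, g j))))"
  proof (intro sum.cong refl)
    fix g
    have "Determinant.det (mat L L (\<lambda>(i, j). A $$ (i, g j))) =
      (\<Sum>q\<in>?P. signof q * (\<Prod>j=0..<L. mat L L (\<lambda>(i, j). A $$ (i, g j)) $$ (q j, j)))"
      by (intro det_colwise) auto
    also have "\<dots> = (\<Sum>q\<in>?P. signof q * (\<Prod>j=0..<L. A $$ (q j, g j)))"
      using p by (intro sum.cong refl arg_cong2[of _ _ _ _ "(*)"] prod.cong) auto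
    finally have e: "Determinant.det (mat L L (\<lambda>(i, j). A $$ (i, g j))) = (\<Sum>q\<in>?P. signof q * (\<Prod>j=0..<L. A $$ (q j, g j)))" .
    show "(\<Sum>p\<in>?P. signof p * (\<Prod>j=0..<L. A $$ (p j, g j) * B $$ (g j, j))) =
      (\<Prod>j=0..<L. B $$ (g j, j)) * Determinant.det (mat L L (\<lambda>(i, j). A $$ (i, g j)))"
      unfolding e sum_distrib_left prod.distrib by (intro sum.cong refl) simp
  qed
  finally show ?thesis .
qed

lemma minor_permute:
  assumes "Z \<in> carrier_mat d L" "p permutes {0..<L}"
  shows "minor Z (g \<circ> p) = signof p * minor Z g"
proof -
  have p: "p j < L" if "j < L" for j
    using that assms permutes_in_image[of p "{0..<L}" j] by simp
  let ?M = "mat L L (\<lambda>(i, j). Z $$ (g i, j))"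
  have "minor Z (g \<circ> p) = Determinant.det (mat L L (\<lambda>(i, j). ?M $$ (p i, j)))"
    unfolding minor_def using assms p by (intro arg_cong[of _ _ Determinant.det]) (auto intro!: eq_matI)
  also have "\<dots> = signof p * Determinant.det ?M"
    using assms by (intro det_permute_rows) auto
  finally show ?thesis using assms by (simp add: minor_def)
qed

text \<open>Expanding the columns of the second factor gives a sum over all row choices \<open>g\<close>. Averaging it over
  the reorderings of \<open>g\<close> turns the product of entries into a second minor.\<close>

lemma weighted_Cauchy_Binet:
  fixes \<delta> :: "nat \<Rightarrow> real"
  assumes Z: "Z \<in> carrier_mat d L"
  shows "fact L * Determinant.det (transpose_mat Z * mat d L (\<lambda>(i, j). \<delta> i * Z $$ (i, j))) =
    (\<Sum>g\<in>index_maps L d. (\<Prod>j=0..<L. \<delta> (g j)) * (minor Z g)\<^sup>2)"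
proof -
  let ?P = "{p. p permutes {0..<L}}" and ?B = "mat d L (\<lambda>(i, j). \<delta> i * Z $$ (i, j))"
  define F where "F = (\<lambda>g. (\<Prod>j=0..<L. \<delta> (g j) * Z $$ (g j, j)) * minor Z g)"
  have D: "Determinant.det (transpose_mat Z * ?B) = (\<Sum>g\<in>index_maps L d. F g)"
  proof -
    have "Determinant.det (transpose_mat Z * ?B) =
      (\<Sum>g\<in>index_maps L d. (\<Prod>j=0..<L. ?B $$ (g j, j)) * Determinant.det (mat L L (\<lambda>(i, j). transpose_mat Z $$ (i, g j))))"
      using Z by (intro det_mult_expand) auto
    also have "\<dots> = (\<Sum>g\<in>index_maps L d. F g)"
      unfolding F_def
    proof (intro sum.cong refl arg_cong2[of _ _ _ _ "(*)"] prod.cong)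
      fix g assume g: "g \<in> index_maps L d"
      then have gb: "g j < d" if "j < L" for j using that by (auto simp: PiE_def Pi_def)
      show "?B $$ (g j, j) = \<delta> (g j) * Z $$ (g j, j)" if "j \<in> {0..<L}" for j
        using gb that by simp
      have "mat L L (\<lambda>(i, j). transpose_mat Z $$ (i, g j)) = transpose_mat (mat L L (\<lambda>(i, j). Z $$ (g i, j)))"
        using gb Z by (intro eq_matI) auto
      then show "Determinant.det (mat L L (\<lambda>(i, j). transpose_mat Z $$ (i, g j))) = minor Z g"
        using Z by (simp add: minor_def det_transpose[of _ L])
    qed
    finally show ?thesis .
  qed
  have S: "(\<Sum>g\<in>index_maps L d. F g) = (\<Sum>g\<in>index_maps L d. F (g \<circ> p))" if p: "p permutes {0..<L}" for p
  proof (rule sum.reindex_bij_witness[of _ "\<lambda>g. g \<circ> p" "\<lambda>g. g \<circ> inv_into UNIV p"])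
    fix g assume g: "g \<in> index_maps L d"
    show "g \<circ> inv_into UNIV p \<circ> p = g" "g \<circ> p \<circ> inv_into UNIV p = g"
      using permutes_inv_o[OF p] by (auto simp: comp_assoc)
    have "g \<circ> q \<in> index_maps L d" if "q permutes {0..<L}" for q
    proof (rule PiE_I)
      fix x assume "x \<in> {0..<L}"
      then show "(g \<circ> q) x \<in> {0..<d}" using g permutes_in_image[OF that, of x] by (auto simp: PiE_def Pi_def)
    next
      fix x assume "x \<notin> {0..<L}"
      then show "(g \<circ> q) x = undefined" using g permutes_not_in[OF that, of x] by (auto simp: PiE_def extensional_def)
    qed
    then show "g \<circ> inv_into UNIV p \<in> index_maps L d" "g \<circ> p \<in> index_maps L d"
      using p permutes_inv by blast+
    show "F ((g \<circ> inv_into UNIV p) \<circ> p) = F g" 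
      using permutes_inv_o[OF p] by (simp only: comp_assoc comp_id)
  qed
  have "fact L * (\<Sum>g\<in>index_maps L d. F g) = (\<Sum>p\<in>?P. \<Sum>g\<in>index_maps L d. F g)"
    by (simp add: card_permutations)
  also have "\<dots> = (\<Sum>p\<in>?P. \<Sum>g\<in>index_maps L d. F (g \<circ> p))"
    by (rule sum.cong[OF refl], rule S, simp)
  also have "\<dots> = (\<Sum>g\<in>index_maps L d. \<Sum>p\<in>?P. F (g \<circ> p))" by (rule sum.swap)
  also have "\<dots> = (\<Sum>g\<in>index_maps L d. (\<Prod>j=0..<L. \<delta> (g j)) * (minor Z g)\<^sup>2)"
  proof (intro sum.cong refl)
    fix g assume g: "g \<in> index_maps L d"
    have "F (g \<circ> p) = (\<Prod>j=0..<L. \<delta> (g j)) * minor Z g * (signof p * (\<Prod>j=0..<L. Z $$ (g (p j), j)))"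
      if p: "p permutes {0..<L}" for p
    proof -
      have "(\<Prod>j=0..<L. \<delta> (g (p j))) = (\<Prod>j=0..<L. \<delta> (g j))"
        using prod.permute[OF p, of "\<lambda>j. \<delta> (g j)"] by (simp add: o_def)
      then show ?thesis
        using minor_permute[OF Z p, of g] by (simp add: F_def prod.distrib)
    qed
    then have "(\<Sum>p\<in>?P. F (g \<circ> p)) =
      (\<Prod>j=0..<L. \<delta> (g j)) * minor Z g * (\<Sum>p\<in>?P. signof p * (\<Prod>j=0..<L. Z $$ (g (p j), j)))"
      by (simp add: sum_distrib_left)
    also have "(\<Sum>p\<in>?P. signof p * (\<Prod>j=0..<L. Z $$ (g (p j), j))) = minor Z g"
    proof -
      have p: "p j < L" if "p permutes {0..<L}" "j < L" for p j
        using that permutes_in_image[of p "{0..<L}" j] by simp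
      have "minor Z g = (\<Sum>p\<in>?P. signof p * (\<Prod>j=0..<L. mat L L (\<lambda>(i, j). Z $$ (g i, j)) $$ (p j, j)))"
        unfolding minor_def using Z by (subst det_colwise[of _ L]) auto
      also have "\<dots> = (\<Sum>p\<in>?P. signof p * (\<Prod>j=0..<L. Z $$ (g (p j), j)))"
        using p by (intro sum.cong refl arg_cong2[of _ _ _ _ "(*)"] prod.cong) auto
      finally show ?thesis by simp
    qed
    finally show "(\<Sum>p\<in>?P. F (g \<circ> p)) = (\<Prod>j=0..<L. \<delta> (g j)) * (minor Z g)\<^sup>2"
      by (simp add: power2_eq_square mult.assoc o_def)
  qed
  finally show ?thesis using D by simp
qed

lemma Cauchy_Binet:
  assumes "Z \<in> carrier_mat d L"
  shows "fact L * gdet Z = (\<Sum>g\<in>index_maps L d. (minor Z g)\<^sup>2)"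
proof -
  have "mat d L (\<lambda>(i, j). 1 * Z $$ (i, j)) = Z" using assms by (intro eq_matI) auto
  then show ?thesis using weighted_Cauchy_Binet[OF assms, of "\<lambda>_. 1"] by simp
qed

lemma gdet_nonneg: "0 \<le> gdet Z"
proof -
  have "0 \<le> fact (dim_col Z) * gdet Z"
    by (subst Cauchy_Binet[of _ "dim_row Z"]) (auto intro: sum_nonneg)
  moreover have "0 < (fact (dim_col Z) :: real)" by simp
  ultimately show ?thesis using zero_le_mult_iff[of "fact (dim_col Z)" "gdet Z"] by linarith
qed

lemma vol_nonneg [simp]: "0 \<le> vol Z" using gdet_nonneg by (simp add: vol_def)

lemma vol_power2: "(vol Z)\<^sup>2 = gdet Z" using gdet_nonneg by (simp add: vol_def)

text \<open>The volume is thus a Euclidean norm of a vector of minors. As minors are linear in each column, the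
  triangle inequality carries over to volumes.\<close>

lemma vol_eq_L2_set:
  assumes "Z \<in> carrier_mat d L"
  shows "vol Z = L2_set (minor Z) (index_maps L d) / sqrt (fact L)"
proof -
  have "gdet Z = (\<Sum>g\<in>index_maps L d. (minor Z g)\<^sup>2) / fact L"
    using Cauchy_Binet[OF assms] by (simp add: field_simps)
  then show ?thesis by (simp add: vol_def L2_set_def real_sqrt_divide)
qed

lemma L2_set_sum_le:
  assumes "finite G"
  shows "L2_set (\<lambda>x. \<Sum>g\<in>G. c g * f g x) A \<le> (\<Sum>g\<in>G. \<bar>c g\<bar> * L2_set (f g) A)"
  using assms
proof (induction G)
  case empty
  then show ?case by (simp add: L2_set_def)
next
  case (insert g G)
  have "L2_set (\<lambda>x. c g * f g x + (\<Sum>g\<in>G. c g * f g x)) A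
    \<le> L2_set (\<lambda>x. c g * f g x) A + L2_set (\<lambda>x. \<Sum>g\<in>G. c g * f g x) A"
    by (rule L2_set_triangle_ineq)
  also have "L2_set (\<lambda>x. c g * f g x) A = \<bar>c g\<bar> * L2_set (f g) A"
    by (simp add: L2_set_def power_mult_distrib sum_distrib_left[symmetric] real_sqrt_mult)
  finally show ?case using insert by simp
qed

text \<open>Expanding every column of \<open>M * C\<close> in the columns of \<open>M\<close> bounds its volume by the volumes spanned by
  columns of \<open>M\<close>.\<close>

lemma vol_mult_expand:
  assumes M: "M \<in> carrier_mat n d" and C: "C \<in> carrier_mat d L"
  shows "vol (M * C) \<le> (\<Sum>g\<in>index_maps L d. (\<Prod>j=0..<L. \<bar>C $$ (g j, j)\<bar>) * vol (select_cols M L g))"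
proof -
  have mi: "minor (M * C) h =
    (\<Sum>g\<in>index_maps L d. (\<Prod>j=0..<L. C $$ (g j, j)) * minor (select_cols M L g) h)"
    if h: "h \<in> index_maps L n" for h
  proof -
    have hb: "h i < n" if "i < L" for i using h that by (auto simp: PiE_def Pi_def)
    let ?A = "mat L d (\<lambda>(i, j). M $$ (h i, j))"
    have "mat L L (\<lambda>(i, j). (M * C) $$ (h i, j)) = ?A * C"
      using M C hb by (intro eq_matI) (auto simp: scalar_prod_def)
    then have "minor (M * C) h = Determinant.det (?A * C)" using C by (simp add: minor_def)
    also have "\<dots> = (\<Sum>g\<in>index_maps L d. (\<Prod>j=0..<L. C $$ (g j, j)) * Determinant.det (mat L L (\<lambda>(i, j). ?A $$ (i, g j))))"
      using C by (intro det_mult_expand) auto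
    also have "\<dots> = (\<Sum>g\<in>index_maps L d. (\<Prod>j=0..<L. C $$ (g j, j)) * minor (select_cols M L g) h)"
    proof (intro sum.cong refl arg_cong2[of _ _ _ _ "(*)"])
      fix g assume "g \<in> index_maps L d"
      then have gb: "g j < d" if "j < L" for j using that by (auto simp: PiE_def Pi_def)
      show "Determinant.det (mat L L (\<lambda>(i, j). ?A $$ (i, g j))) = minor (select_cols M L g) h"
        unfolding minor_def select_cols_def using M hb gb
        by (intro arg_cong[of _ _ Determinant.det] eq_matI) auto
    qed
    finally show ?thesis .
  qed
  have "vol (M * C) = L2_set (minor (M * C)) (index_maps L n) / sqrt (fact L)"
    using M C by (intro vol_eq_L2_set) auto
  also have "\<dots> = L2_set (\<lambda>h. \<Sum>g\<in>index_maps L d. (\<Prod>j=0..<L. C $$ (g j, j)) * minor (select_cols M L g) h) (index_maps L n) / sqrt (fact L)"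
    using mi by (intro arg_cong2[of _ _ _ _ "(/)"] L2_set_cong) auto
  also have "\<dots> \<le> (\<Sum>g\<in>index_maps L d. \<bar>\<Prod>j=0..<L. C $$ (g j, j)\<bar> * L2_set (minor (select_cols M L g)) (index_maps L n)) / sqrt (fact L)"
    by (intro divide_right_mono L2_set_sum_le) auto
  also have "\<dots> = (\<Sum>g\<in>index_maps L d. (\<Prod>j=0..<L. \<bar>C $$ (g j, j)\<bar>) * vol (select_cols M L g))"
    unfolding sum_divide_distrib using M
    by (intro sum.cong refl, subst vol_eq_L2_set[of _ n L]) (auto simp: select_cols_def abs_prod)
  finally show ?thesis .
qed

lemma vol_mult_square:
  assumes "Z \<in> carrier_mat d L" "R \<in> carrier_mat L L"
  shows "vol (Z * R) = vol Z * \<bar>Determinant.det R\<bar>"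
proof -
  have G: "transpose_mat Z * Z \<in> carrier_mat L L" "transpose_mat Z * Z * R \<in> carrier_mat L L"
    "transpose_mat R \<in> carrier_mat L L" using assms by auto
  have "transpose_mat (Z * R) * (Z * R) = transpose_mat R * ((transpose_mat Z * Z) * R)"
    using assms by (simp add: transpose_mult[of Z d L R L] assoc_mult_mat[of _ L d _ L _ L] assoc_mult_mat[of _ L L _ d _ L])
  then have "gdet (Z * R) = Determinant.det R * (gdet Z * Determinant.det R)"
    by (simp only: det_mult[OF G(3,2)] det_mult[OF G(1) assms(2)] det_transpose[OF assms(2)])
  also have "\<dots> = gdet Z * (Determinant.det R)\<^sup>2" by (simp add: power2_eq_square)
  finally show ?thesis by (simp add: vol_def real_sqrt_mult)
qed

lemma vol_square:
  assumes "M \<in> carrier_mat n n"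
  shows "vol M = \<bar>Determinant.det M\<bar>"
proof -
  have "gdet M = Determinant.det M * Determinant.det M"
    using det_mult[OF _ assms, of "transpose_mat M"] det_transpose[OF assms] assms by (metis transpose_carrier_mat)
  then show ?thesis by (simp add: vol_def)
qed

lemma replace_col_carrier [simp]: "Z \<in> carrier_mat d L \<Longrightarrow> replace_col Z v j \<in> carrier_mat d L"
  unfolding replace_col_def by (rule carrier_matI) auto

lemma replace_col_dim [simp]:
  "dim_row (replace_col Z v j) = dim_row Z" "dim_col (replace_col Z v j) = dim_col Z"
  by (simp_all add: replace_col_def)

lemma replace_col_index:
  "i < dim_row Z \<Longrightarrow> k < dim_col Z \<Longrightarrow> replace_col Z v j $$ (i, k) = (if k = j then v $ i else Z $$ (i, k))"
  by (simp add: replace_col_def)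

lemma det_replace_col_laplace:
  assumes "A \<in> carrier_mat n n" "j < n"
  shows "Determinant.det (replace_col A v j) = (\<Sum>i<n. v $ i * cofactor A i j)"
proof -
  have "Determinant.det (replace_col A v j) = (\<Sum>i<n. replace_col A v j $$ (i, j) * cofactor (replace_col A v j) i j)"
    using assms by (intro laplace_expansion_column) auto
  also have "\<dots> = (\<Sum>i<n. v $ i * cofactor A i j)"
  proof (intro sum.cong refl arg_cong2[of _ _ _ _ "(*)"])
    fix i assume i: "i \<in> {..<n}"
    show "replace_col A v j $$ (i, j) = v $ i" using i assms by (auto simp: replace_col_index)
    have "mat_delete (replace_col A v j) i j = mat_delete A i j"
      using assms by (intro eq_matI) (auto simp: mat_delete_def replace_col_def)
    then show "cofactor (replace_col A v j) i j = cofactor A i j" by (simp add: cofactor_def)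
  qed
  finally show ?thesis .
qed

lemma minor_replace_col:
  assumes "Z \<in> carrier_mat d L" "j < L" "g \<in> index_maps L d"
  shows "minor (replace_col Z v j) g = (\<Sum>i<L. v $ g i * cofactor (mat L L (\<lambda>(i, j). Z $$ (g i, j))) i j)"
proof -
  have gb: "g j < d" if "j < L" for j using that assms by (auto simp: PiE_def Pi_def)
  have "mat L L (\<lambda>(i, k). replace_col Z v j $$ (g i, k)) =
     replace_col (mat L L (\<lambda>(i, j). Z $$ (g i, j))) (vec L (\<lambda>i. v $ g i)) j"
    using gb assms by (intro eq_matI) (auto simp: replace_col_def)
  then have "minor (replace_col Z v j) g = Determinant.det (replace_col (mat L L (\<lambda>(i, j). Z $$ (g i, j))) (vec L (\<lambda>i. v $ g i)) j)"
    using assms by (simp add: minor_def replace_col_def)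
  also have "\<dots> = (\<Sum>i<L. v $ g i * cofactor (mat L L (\<lambda>(i, j). Z $$ (g i, j))) i j)"
    using assms by (subst det_replace_col_laplace[of _ L]) auto
  finally show ?thesis .
qed

lemma vol_replace_col_add:
  assumes Z: "Z \<in> carrier_mat d L" "j < L" and u: "u \<in> carrier_vec d" and v: "v \<in> carrier_vec d"
  shows "vol (replace_col Z (u + v) j) \<le> vol (replace_col Z u j) + vol (replace_col Z v j)"
proof -
  have "minor (replace_col Z (u + v) j) g = minor (replace_col Z u j) g + minor (replace_col Z v j) g"
    if g: "g \<in> index_maps L d" for g
  proof -
    have gb: "g j < d" if "j < L" for j using that g by (auto simp: PiE_def Pi_def)
    then show ?thesis
      unfolding minor_replace_col[OF Z g] sum.distrib[symmetric]
      using u v by (intro sum.cong refl) (simp add: distrib_right)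
  qed
  then have *: "L2_set (minor (replace_col Z (u + v) j)) (index_maps L d)
     = L2_set (\<lambda>g. minor (replace_col Z u j) g + minor (replace_col Z v j) g) (index_maps L d)"
    by (intro L2_set_cong refl)
  have ineq: "a / s \<le> b / s + c / s" if "a \<le> b + c" "0 \<le> s" for a b c s :: real
    using divide_right_mono[OF that] by (simp add: add_divide_distrib)
  have t: "L2_set (minor (replace_col Z (u + v) j)) (index_maps L d)
     \<le> L2_set (minor (replace_col Z u j)) (index_maps L d) + L2_set (minor (replace_col Z v j)) (index_maps L d)"
    using L2_set_triangle_ineq[of "minor (replace_col Z u j)" "minor (replace_col Z v j)" "index_maps L d"] * by linarith
  have e: "vol (replace_col Z w j) = L2_set (minor (replace_col Z w j)) (index_maps L d) / sqrt (fact L)" for w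
    using Z by (intro vol_eq_L2_set) simp
  show ?thesis
    unfolding e by (rule ineq[OF t]) simp
qed

lemma vol_select_cols_not_inj:
  assumes M: "M \<in> carrier_mat n d" and g: "g \<in> index_maps L d" "\<not> inj_on g {0..<L}"
  shows "vol (select_cols M L g) = 0"
proof -
  obtain a b where ab: "a < L" "b < L" "a \<noteq> b" "g a = g b"
    using g(2) by (auto simp: inj_on_def)
  have "minor (select_cols M L g) h = 0" if h: "h \<in> index_maps L n" for h
  proof -
    have hb: "h j < n" if "j < L" for j using that h by (auto simp: PiE_def Pi_def)
    have gb: "g j < d" if "j < L" for j using that g by (auto simp: PiE_def Pi_def)
    let ?M = "mat L L (\<lambda>(i, j). select_cols M L g $$ (h i, j))"
    have "Determinant.det ?M = 0"
      using ab M hb gb by (intro Determinant.det_identical_columns[of _ L a b]) (auto simp: select_cols_def intro!: eq_vecI)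
    then show ?thesis by (simp add: minor_def select_cols_def)
  qed
  then have "L2_set (minor (select_cols M L g)) (index_maps L n) = 0"
    by (simp add: L2_set_eq_0_iff)
  then show ?thesis
    using M by (subst vol_eq_L2_set[of _ n L]) (auto simp: select_cols_def)
qed

lemma vol_select_cols_permute:
  assumes M: "M \<in> carrier_mat n d" "L \<le> d" and g: "g \<in> index_maps L d" "inj_on g {0..<L}" "g ` {0..<L} = {0..<L}"
  shows "vol (select_cols M L g) = vol (select_cols M L (\<lambda>j. j))"
proof -
  define p where "p = (\<lambda>i. if i < L then g i else i)"
  have p: "p permutes {0..<L}"
  proof (rule bij_imp_permutes)
    have "bij_betw g {0..<L} {0..<L}" using g by (simp add: bij_betw_def)
    then show "bij_betw p {0..<L} {0..<L}" by (rule bij_betw_cong[THEN iffD1, rotated]) (auto simp: p_def)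
  qed (auto simp: p_def)
  have pL: "p j < L" if "j < L" for j
    using that permutes_in_image[OF p, of j] by simp
  have "\<bar>minor (select_cols M L g) h\<bar> = \<bar>minor (select_cols M L (\<lambda>j. j)) h\<bar>" if h: "h \<in> index_maps L n" for h
  proof -
    have hb: "h j < n" if "j < L" for j using that h by (auto simp: PiE_def Pi_def)
    let ?A = "mat L L (\<lambda>(i, j). select_cols M L (\<lambda>j. j) $$ (h j, i))"
    have "mat L L (\<lambda>(i, j). select_cols M L g $$ (h i, j)) = transpose_mat (mat L L (\<lambda>(i, j). ?A $$ (p i, j)))"
      using hb pL M(1) by (intro eq_matI) (auto simp: select_cols_def p_def)
    then have "minor (select_cols M L g) h = Determinant.det (mat L L (\<lambda>(i, j). ?A $$ (p i, j)))"
      by (simp add: minor_def select_cols_def det_transpose[of _ L])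
    also have "\<dots> = signof p * Determinant.det ?A" using p by (intro det_permute_rows) auto
    also have "?A = transpose_mat (mat L L (\<lambda>(i, j). select_cols M L (\<lambda>j. j) $$ (h i, j)))"
      by (intro eq_matI) auto
    also have "Determinant.det \<dots> = minor (select_cols M L (\<lambda>j. j)) h"
      by (simp add: minor_def select_cols_def det_transpose[of _ L])
    finally show ?thesis by (simp add: abs_mult sign_def)
  qed
  then have "(minor (select_cols M L g) h)\<^sup>2 = (minor (select_cols M L (\<lambda>j. j)) h)\<^sup>2" if "h \<in> index_maps L n" for h
    using that by (metis power2_abs)
  then have e: "L2_set (minor (select_cols M L g)) (index_maps L n) = L2_set (minor (select_cols M L (\<lambda>j. j))) (index_maps L n)"
    unfolding L2_set_def by (intro arg_cong[of _ _ sqrt] sum.cong) auto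
  have c: "select_cols M L f \<in> carrier_mat n L" for f using M by (auto simp: select_cols_def)
  show ?thesis unfolding vol_eq_L2_set[OF c] e ..
qed

text \<open>A Hadamard inequality with a crude constant, which only depends on the dimensions.\<close>

lemma vol_le_prod_col_norms:
  assumes Z: "Z \<in> carrier_mat n L"
  shows "vol Z \<le> real n ^ L * fact L * (\<Prod>j=0..<L. euclid_norm (col Z j))"
proof -
  let ?N = "\<Prod>j=0..<L. euclid_norm (col Z j)" and ?P = "{p. p permutes {0..<L}}"
  have "\<bar>minor Z g\<bar> \<le> fact L * ?N" if g: "g \<in> index_maps L n" for g
  proof -
    have gb: "g j < n" if "j < L" for j using that g by (auto simp: PiE_def Pi_def)
    have p: "p j < L" if "p permutes {0..<L}" "j < L" for p j
      using that permutes_in_image[of p "{0..<L}" j] by simp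
    have "minor Z g = (\<Sum>p\<in>?P. signof p * (\<Prod>j=0..<L. mat L L (\<lambda>(i, j). Z $$ (g i, j)) $$ (p j, j)))"
      unfolding minor_def using Z by (subst det_colwise[of _ L]) auto
    then have "\<bar>minor Z g\<bar> \<le> (\<Sum>p\<in>?P. \<bar>signof p * (\<Prod>j=0..<L. mat L L (\<lambda>(i, j). Z $$ (g i, j)) $$ (p j, j))\<bar>)"
      by (simp only: sum_abs)
    also have "\<dots> \<le> (\<Sum>p\<in>?P. ?N)"
    proof (rule sum_mono)
      fix q assume q: "q \<in> ?P"
      have "\<bar>signof q * (\<Prod>j=0..<L. mat L L (\<lambda>(i, j). Z $$ (g i, j)) $$ (q j, j))\<bar> =
        (\<Prod>j=0..<L. \<bar>Z $$ (g (q j), j)\<bar>)"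
        using p q by (simp add: abs_mult abs_prod sign_def)
      also have "\<dots> \<le> ?N"
      proof (rule prod_mono)
        fix j assume j: "j \<in> {0..<L}"
        then have "Z $$ (g (q j), j) = col Z j $ g (q j)" using Z gb p q by auto
        then show "0 \<le> \<bar>Z $$ (g (q j), j)\<bar> \<and> \<bar>Z $$ (g (q j), j)\<bar> \<le> euclid_norm (col Z j)"
          using abs_vec_index_le_euclid_norm[of "g (q j)" "col Z j"] Z gb p q j by auto
      qed
      finally show "\<bar>signof q * (\<Prod>j=0..<L. mat L L (\<lambda>(i, j). Z $$ (g i, j)) $$ (q j, j))\<bar> \<le> ?N" .
    qed
    also have "\<dots> = fact L * ?N" by (simp add: card_permutations)
    finally show ?thesis .
  qed
  then have "(\<Sum>g\<in>index_maps L n. \<bar>minor Z g\<bar>) \<le> (\<Sum>g\<in>index_maps L n. fact L * ?N)"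
    by (rule sum_mono)
  also have "\<dots> = real n ^ L * fact L * ?N" by (simp add: card_PiE)
  finally have s: "(\<Sum>g\<in>index_maps L n. \<bar>minor Z g\<bar>) \<le> real n ^ L * fact L * ?N" .
  have "vol Z = L2_set (minor Z) (index_maps L n) / sqrt (fact L)" using Z by (rule vol_eq_L2_set)
  also have "\<dots> \<le> L2_set (minor Z) (index_maps L n) / 1"
    by (intro divide_left_mono) auto
  also have "\<dots> \<le> (\<Sum>g\<in>index_maps L n. \<bar>minor Z g\<bar>)" using L2_set_le_sum_abs by simp
  finally show ?thesis using s by linarith
qed

text \<open>A set of \<open>L\<close> indices other than the first \<open>L\<close> misses one of these and contains a later one instead, so
  its sum falls short by at least the gap after position \<open>L\<close>.\<close>

lemma sum_injective_index_le:
  fixes \<mu> :: "nat \<Rightarrow> real"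
  assumes anti: "\<And>i j. i \<le> j \<Longrightarrow> j < d \<Longrightarrow> \<mu> j \<le> \<mu> i"
    and g: "g \<in> index_maps L d" "inj_on g {0..<L}"
  shows "(\<Sum>j=0..<L. \<mu> (g j)) \<le> (\<Sum>j=0..<L. \<mu> j)"
    and "g ` {0..<L} \<noteq> {0..<L} \<Longrightarrow> (\<Sum>j=0..<L. \<mu> (g j)) \<le> (\<Sum>j=0..<L. \<mu> j) - (\<mu> (L - 1) - \<mu> L)"
proof -
  let ?A = "{0..<L}" and ?I = "g ` {0..<L}"
  have gI: "?I \<subseteq> {0..<d}" using g by (auto simp: PiE_def Pi_def)
  have cI: "card ?I = L" using g by (simp add: card_image)
  have Ld: "L \<le> d" using card_mono[OF _ gI] cI by simp
  have e: "(\<Sum>j=0..<L. \<mu> (g j)) = sum \<mu> ?I" using g by (simp add: sum.reindex)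
  have 1: "sum \<mu> ?I = sum \<mu> (?I \<inter> ?A) + sum \<mu> (?I - ?A)"
    by (subst sum.union_disjoint[symmetric]) (auto intro!: sum.cong)
  have 2: "sum \<mu> ?A = sum \<mu> (?I \<inter> ?A) + sum \<mu> (?A - ?I)"
    by (subst sum.union_disjoint[symmetric]) (auto intro!: sum.cong)
  have c: "card (?I - ?A) = card (?A - ?I)"
    using card_Diff_subset_Int[of ?I ?A] card_Diff_subset_Int[of ?A ?I] cI by (simp add: Int_commute)
  define r where "r = card (?A - ?I)"
  have main: "r = 0 \<and> ?I = ?A \<or> (1 \<le> r \<and> sum \<mu> ?I \<le> sum \<mu> ?A - real r * (\<mu> (L - 1) - \<mu> L) \<and> L < d \<and> 0 < L)"
  proof (cases "r = 0")
    case True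
    then have "?A \<subseteq> ?I" by (simp add: r_def)
    moreover from this have "?I = ?A" using cI by (metis card_subset_eq finite_imageI finite_atLeastLessThan card_atLeastLessThan minus_nat.diff_0)
    ultimately show ?thesis using True by simp
  next
    case False
    then have "?I - ?A \<noteq> {}" "?A - ?I \<noteq> {}" using c r_def by (metis card.empty)+
    then have L: "L < d" "0 < L" using gI by auto
    have "sum \<mu> (?I - ?A) \<le> real (card (?I - ?A)) * \<mu> L"
    proof (rule sum_bounded_above)
      fix i assume "i \<in> ?I - ?A"
      then have "L \<le> i" "i < d" using gI by auto
      then show "\<mu> i \<le> \<mu> L" by (rule anti)
    qed
    moreover have "real (card (?A - ?I)) * \<mu> (L - 1) \<le> sum \<mu> (?A - ?I)"
    proof (rule sum_bounded_below)
      fix i assume "i \<in> ?A - ?I"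
      then have "i \<le> L - 1" "L - 1 < d" using L by auto
      then show "\<mu> (L - 1) \<le> \<mu> i" by (rule anti)
    qed
    ultimately have "sum \<mu> ?I \<le> sum \<mu> ?A - real r * (\<mu> (L - 1) - \<mu> L)"
      using 1 2 c by (simp add: r_def algebra_simps)
    then show ?thesis using False L by simp
  qed
  have gap: "\<mu> (L - 1) - \<mu> L \<ge> 0" if "L < d" using anti[of "L - 1" L] that by simp
  show "(\<Sum>j=0..<L. \<mu> (g j)) \<le> (\<Sum>j=0..<L. \<mu> j)"
    using main gap unfolding e by (smt (verit) mult_nonneg_nonneg of_nat_0_le_iff)
  assume "?I \<noteq> ?A"
  with main have "1 \<le> r" "sum \<mu> ?I \<le> sum \<mu> ?A - real r * (\<mu> (L - 1) - \<mu> L)" "L < d" by auto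
  moreover have "\<mu> (L - 1) - \<mu> L \<le> real r * (\<mu> (L - 1) - \<mu> L)"
    using mult_right_mono[of 1 "real r" "\<mu> (L - 1) - \<mu> L"] \<open>1 \<le> r\<close> gap \<open>L < d\<close> by simp
  ultimately show "(\<Sum>j=0..<L. \<mu> (g j)) \<le> (\<Sum>j=0..<L. \<mu> j) - (\<mu> (L - 1) - \<mu> L)"
    unfolding e by (simp only:)
qed

text \<open>In the weighted Cauchy--Binet formula every nonzero minor carries a product of \<open>L\<close> different weights,
  which is at most the product of the \<open>L\<close> largest ones.\<close>

lemma weighted_gdet_le:
  fixes \<delta> :: "nat \<Rightarrow> real"
  assumes Z: "Z \<in> carrier_mat d L" and pos: "\<And>i. i < d \<Longrightarrow> 0 < \<delta> i"
    and anti: "\<And>i j. i \<le> j \<Longrightarrow> j < d \<Longrightarrow> \<delta> j \<le> \<delta> i"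
  shows "Determinant.det (transpose_mat Z * mat d L (\<lambda>(i, j). \<delta> i * Z $$ (i, j))) \<le> (\<Prod>j=0..<L. \<delta> j) * gdet Z"
proof -
  have le: "(\<Prod>j=0..<L. \<delta> (g j)) * (minor Z g)\<^sup>2 \<le> (\<Prod>j=0..<L. \<delta> j) * (minor Z g)\<^sup>2"
    if g: "g \<in> index_maps L d" for g
  proof (cases "inj_on g {0..<L}")
    case True
    have gb: "g j < d" if "j < L" for j using that g by (auto simp: PiE_def Pi_def)
    have "g ` {0..<L} \<subseteq> {0..<d}" using g by (auto simp: PiE_def Pi_def)
    then have Ld: "L \<le> d" using card_inj_on_le[OF True, of "{0..<d}"] by simp
    have "(\<Sum>j=0..<L. ln (\<delta> (g j))) \<le> (\<Sum>j=0..<L. ln (\<delta> j))"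
      using sum_injective_index_le(1)[of d "\<lambda>j. ln (\<delta> j)" g L] anti pos g True by simp
    then have "exp (\<Sum>j=0..<L. ln (\<delta> (g j))) \<le> exp (\<Sum>j=0..<L. ln (\<delta> j))" by simp
    moreover have "exp (\<Sum>j=0..<L. ln (\<delta> (g j))) = (\<Prod>j=0..<L. \<delta> (g j))"
      using gb pos by (subst exp_sum) (auto intro!: prod.cong)
    moreover have "exp (\<Sum>j=0..<L. ln (\<delta> j)) = (\<Prod>j=0..<L. \<delta> j)"
      using Ld pos by (subst exp_sum) (auto intro!: prod.cong)
    ultimately show ?thesis by (intro mult_right_mono) auto
  next
    case False
    then obtain a b where ab: "a < L" "b < L" "a \<noteq> b" "g a = g b" by (auto simp: inj_on_def)
    have "Determinant.det (mat L L (\<lambda>(i, j). Z $$ (g i, j))) = 0"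
      using ab Z by (intro Determinant.det_identical_rows[of _ L a b]) (auto intro!: eq_vecI)
    then show ?thesis using Z by (simp add: minor_def)
  qed
  have "fact L * Determinant.det (transpose_mat Z * mat d L (\<lambda>(i, j). \<delta> i * Z $$ (i, j))) \<le>
    (\<Prod>j=0..<L. \<delta> j) * (fact L * gdet Z)"
    unfolding weighted_Cauchy_Binet[OF Z] Cauchy_Binet[OF Z] sum_distrib_left using le by (rule sum_mono)
  then have "fact L * Determinant.det (transpose_mat Z * mat d L (\<lambda>(i, j). \<delta> i * Z $$ (i, j))) \<le>
    fact L * ((\<Prod>j=0..<L. \<delta> j) * gdet Z)" by (simp only: mult.left_commute)
  then show ?thesis by (rule mult_left_le_imp_le) simp
qed

subsection \<open>Volume and distance to the span of the other columns\<close>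

text \<open>The Gram determinant of the columns other than the \<open>j\<close>-th.\<close>

definition rest_gdet :: "real mat \<Rightarrow> nat \<Rightarrow> real" where
  "rest_gdet Z j = cofactor (transpose_mat Z * Z) j j"

text \<open>Coefficients of the part of the \<open>j\<close>-th column that is orthogonal to the other columns, multiplied by
  \<open>rest_gdet Z j\<close> so that they are polynomials in the entries of \<open>Z\<close>.\<close>

definition residual_coeffs :: "real mat \<Rightarrow> nat \<Rightarrow> real vec" where
  "residual_coeffs Z j = col (adj_mat (transpose_mat Z * Z)) j"

lemma rest_gdet_replace_col:
  assumes Z: "Z \<in> carrier_mat d L" "j < L"
  shows "rest_gdet (replace_col Z v j) j = rest_gdet Z j"
proof -
  let ?Y = "replace_col Z v j"
  have Y: "?Y \<in> carrier_mat d L" using Z by simp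
  have c: "col ?Y k = col Z k" if "k < L" "k \<noteq> j" for k
    using that Z by (intro eq_vecI) (auto simp: replace_col_def)
  have "mat_delete (transpose_mat ?Y * ?Y) j j = mat_delete (transpose_mat Z * Z) j j"
    using Z Y c by (intro eq_matI) (auto simp: mat_delete_def)
  then show ?thesis by (simp add: rest_gdet_def cofactor_def)
qed

lemma residual_coeffs:
  assumes Z: "Z \<in> carrier_mat d L" "j < L"
  shows "residual_coeffs Z j \<in> carrier_vec L" "residual_coeffs Z j $ j = rest_gdet Z j"
    "\<And>k. k < L \<Longrightarrow> col Z k \<bullet> (Z *\<^sub>v residual_coeffs Z j) = (if k = j then gdet Z else 0)"
    "(Z *\<^sub>v residual_coeffs Z j) \<bullet> (Z *\<^sub>v residual_coeffs Z j) = gdet Z * rest_gdet Z j"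
proof -
  let ?G = "transpose_mat Z * Z" and ?w = "residual_coeffs Z j"
  have G: "?G \<in> carrier_mat L L" using Z by auto
  note a = adj_mat[OF G]
  show w: "?w \<in> carrier_vec L" using a Z(2) by (simp add: residual_coeffs_def)
  show wj: "?w $ j = rest_gdet Z j"
    using a Z G by (simp add: residual_coeffs_def rest_gdet_def adj_mat_def)
  have "?G *\<^sub>v ?w = col (?G * adj_mat ?G) j"
    unfolding residual_coeffs_def by (rule col_mult2[symmetric, OF G a(1) Z(2)])
  also have "\<dots> = gdet Z \<cdot>\<^sub>v unit_vec L j"
    unfolding a(2) using Z(2) by (intro eq_vecI) auto
  also have "?G *\<^sub>v ?w = transpose_mat Z *\<^sub>v (Z *\<^sub>v ?w)"
    using Z w by (intro assoc_mult_mat_vec) auto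
  finally have e: "transpose_mat Z *\<^sub>v (Z *\<^sub>v ?w) = gdet Z \<cdot>\<^sub>v unit_vec L j" .
  have d: "col Z k \<bullet> (Z *\<^sub>v ?w) = (gdet Z \<cdot>\<^sub>v unit_vec L j) $ k" if "k < L" for k
    unfolding e[symmetric] using that Z by simp
  then show "col Z k \<bullet> (Z *\<^sub>v ?w) = (if k = j then gdet Z else 0)" if "k < L" for k
    using that Z by simp
  have "(Z *\<^sub>v ?w) \<bullet> (Z *\<^sub>v ?w) = (transpose_mat Z *\<^sub>v (Z *\<^sub>v ?w)) \<bullet> ?w"
    using Z w by (subst transpose_vec_mult_scalar[of Z d L]) auto
  also have "\<dots> = gdet Z * rest_gdet Z j" unfolding e using w wj Z by simp
  finally show "(Z *\<^sub>v ?w) \<bullet> (Z *\<^sub>v ?w) = gdet Z * rest_gdet Z j" .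
qed

text \<open>Volume is base times height, and the height is at most the length of the column.\<close>

lemma gdet_le_rest_gdet:
  assumes Z: "Z \<in> carrier_mat d L" "j < L" and pos: "0 < gdet Z \<or> 0 \<le> rest_gdet Z j"
  shows "gdet Z \<le> (euclid_norm (col Z j))\<^sup>2 * rest_gdet Z j"
proof (cases "gdet Z = 0")
  case True
  then show ?thesis using pos by simp
next
  case False
  then have g: "0 < gdet Z" using gdet_nonneg[of Z] by linarith
  let ?u = "Z *\<^sub>v residual_coeffs Z j"
  note r = residual_coeffs[OF Z]
  have "gdet Z = col Z j \<bullet> ?u" using r(3)[OF Z(2)] by simp
  then have "gdet Z \<le> euclid_norm (col Z j) * euclid_norm ?u"
    using scalar_prod_le_euclid_norm[of "col Z j" d ?u] Z r(1) by auto
  then have "(gdet Z)\<^sup>2 \<le> (euclid_norm (col Z j) * euclid_norm ?u)\<^sup>2"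
    using g by (intro power_mono) auto
  also have "\<dots> = (euclid_norm (col Z j))\<^sup>2 * (gdet Z * rest_gdet Z j)"
    by (simp add: power_mult_distrib euclid_norm_power2 r(4))
  finally have "gdet Z * gdet Z \<le> gdet Z * ((euclid_norm (col Z j))\<^sup>2 * rest_gdet Z j)"
    by (simp only: power2_eq_square mult_ac)
  then show ?thesis using g by (rule mult_left_le_imp_le)
qed

text \<open>The orthogonal part of the \<open>j\<close>-th column, rescaled, is a combination of the columns in which that
  column has coefficient 1, so a lower bound for all such combinations bounds the height.\<close>

lemma rest_gdet_le_gdet:
  assumes Z: "Z \<in> carrier_mat d L" "j < L" and \<kappa>: "0 \<le> \<kappa>"
    and far: "\<And>c. c \<in> carrier_vec L \<Longrightarrow> c $ j = 1 \<Longrightarrow> \<kappa> \<le> euclid_norm (Z *\<^sub>v c)"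
  shows "\<kappa>\<^sup>2 * rest_gdet Z j \<le> gdet Z"
proof (cases "rest_gdet Z j \<le> 0")
  case True
  then have "\<kappa>\<^sup>2 * rest_gdet Z j \<le> 0" by (simp add: mult_nonneg_nonpos)
  then show ?thesis using gdet_nonneg[of Z] by linarith
next
  case False
  define m where "m = rest_gdet Z j"
  have m: "0 < m" using False by (simp add: m_def)
  let ?w = "residual_coeffs Z j"
  note r = residual_coeffs[OF Z]
  have "\<kappa> \<le> euclid_norm (Z *\<^sub>v (inverse m \<cdot>\<^sub>v ?w))"
    using r m Z by (intro far) (auto simp: m_def)
  also have "Z *\<^sub>v (inverse m \<cdot>\<^sub>v ?w) = inverse m \<cdot>\<^sub>v (Z *\<^sub>v ?w)" using Z r by (simp add: mult_mat_vec)
  finally have "m * \<kappa> \<le> euclid_norm (Z *\<^sub>v ?w)" using m by (simp add: euclid_norm_smult field_simps)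
  then have "(m * \<kappa>)\<^sup>2 \<le> (euclid_norm (Z *\<^sub>v ?w))\<^sup>2" using m \<kappa> by (intro power_mono) auto
  then have "m * (\<kappa>\<^sup>2 * m) \<le> m * gdet Z" 
    unfolding euclid_norm_power2 r(4) by (simp add: power_mult_distrib power2_eq_square mult_ac m_def)
  then show ?thesis using m unfolding m_def by (rule mult_left_le_imp_le)
qed

section \<open>Orthonormalisation and singular values\<close>

abbreviation first_cols :: "real mat \<Rightarrow> nat \<Rightarrow> real mat" where
  "first_cols X j \<equiv> select_cols X j (\<lambda>k. k)"

lemma first_cols_carrier: "X \<in> carrier_mat d m \<Longrightarrow> first_cols X j \<in> carrier_mat d j"
  by (auto simp: select_cols_def)

lemma col_first_cols: "X \<in> carrier_mat d m \<Longrightarrow> k < j \<Longrightarrow> j \<le> m \<Longrightarrow> col (first_cols X j) k = col X k"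
  by (intro eq_vecI) (auto simp: select_cols_def)

lemma first_cols_all: "X \<in> carrier_mat d m \<Longrightarrow> first_cols X m = X"
  by (intro eq_matI) (auto simp: select_cols_def)

lemma rest_gdet_first_cols:
  assumes X: "X \<in> carrier_mat d m" "j < m"
  shows "rest_gdet (first_cols X (Suc j)) j = gdet (first_cols X j)"
proof -
  note c = first_cols_carrier[OF X(1)]
  have "mat_delete (transpose_mat (first_cols X (Suc j)) * first_cols X (Suc j)) j j = transpose_mat (first_cols X j) * first_cols X j"
    using X by (intro eq_matI) (auto simp: mat_delete_def select_cols_def scalar_prod_def intro!: sum.cong)
  moreover have "(-1) ^ (j + j) = (1::real)" by (simp flip: mult_2)
  ultimately show ?thesis by (simp add: rest_gdet_def cofactor_def)
qed

lemma gdet_first_cols_pos: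
  assumes X: "X \<in> carrier_mat d m" "0 < gdet X" "j \<le> m"
  shows "0 < gdet (first_cols X j)"
  using X(3)
proof (induction rule: inc_induct)
  case base
  then show ?case using X first_cols_all by metis
next
  case (step k)
  have "gdet (first_cols X (Suc k)) \<le> (euclid_norm (col (first_cols X (Suc k)) k))\<^sup>2 * gdet (first_cols X k)"
    using gdet_le_rest_gdet[OF first_cols_carrier[OF X(1), of "Suc k"], of k] rest_gdet_first_cols[OF X(1), of k] step by simp
  with step(3) have "0 < (euclid_norm (col (first_cols X (Suc k)) k))\<^sup>2 * gdet (first_cols X k)" by linarith
  then show ?case using gdet_nonneg[of "first_cols X k"] by (auto simp: zero_less_mult_iff)
qed

lemma vol_first_cols_pos:
  assumes M: "M \<in> carrier_mat n n" "Determinant.det M \<noteq> 0" and j: "j \<le> n"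
  shows "0 < vol (first_cols M j)"
proof -
  have "0 < gdet M"
    using vol_square[OF M(1)] vol_power2[of M] M(2) by (metis zero_less_abs_iff zero_less_power)
  then show ?thesis using gdet_first_cols_pos[OF M(1) _ j] by (simp add: vol_def)
qed

abbreviation initial_frame :: "nat \<Rightarrow> nat \<Rightarrow> real mat" where
  "initial_frame d L \<equiv> mat d L (\<lambda>(i, j). if i = j then 1 else 0)"

lemma mult_initial_frame:
  assumes M: "M \<in> carrier_mat n d" and L: "L \<le> d"
  shows "M * initial_frame d L = first_cols M L"
proof (rule eq_matI)
  fix i j assume "i < dim_row (first_cols M L)" "j < dim_col (first_cols M L)"
  then have ij: "i < n" "j < L" using M by (auto simp: select_cols_def)
  have "(M * initial_frame d L) $$ (i, j) = (\<Sum>k\<in>{0..<d}. M $$ (i, k) * (if k = j then 1 else 0))"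
    using ij M by (auto simp: scalar_prod_def intro!: sum.cong)
  also have "\<dots> = M $$ (i, j)" using ij L by (simp add: sum.delta if_distrib cong: if_cong)
  finally show "(M * initial_frame d L) $$ (i, j) = first_cols M L $$ (i, j)"
    using ij M by (simp add: select_cols_def)
qed (use M in \<open>auto simp: select_cols_def\<close>)

definition orthonormalizer :: "real mat \<Rightarrow> real mat" where
  "orthonormalizer X = mat (dim_col X) (dim_col X) (\<lambda>(k, j).
     if k \<le> j then residual_coeffs (first_cols X (Suc j)) j $ k
       / sqrt (gdet (first_cols X j) * gdet (first_cols X (Suc j))) else 0)"

lemma mult_mat_vec_cong_initial:
  assumes X: "X \<in> carrier_mat d m" "j < m" and w: "w \<in> carrier_vec (Suc j)"
    and v: "v \<in> carrier_vec m" "\<And>k. k < m \<Longrightarrow> v $ k = (if k \<le> j then c * w $ k else 0)"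
  shows "X *\<^sub>v v = c \<cdot>\<^sub>v (first_cols X (Suc j) *\<^sub>v w)"
proof (rule eq_vecI)
  fix i assume "i < dim_vec (c \<cdot>\<^sub>v (first_cols X (Suc j) *\<^sub>v w))"
  then have i: "i < d" using X by (simp add: select_cols_def)
  have "(X *\<^sub>v v) $ i = (\<Sum>k\<in>{0..<m}. X $$ (i, k) * (if k \<le> j then c * w $ k else 0))"
    using X i v by (auto simp: scalar_prod_def intro!: sum.cong)
  also have "\<dots> = (\<Sum>k\<in>{0..<Suc j}. X $$ (i, k) * (c * w $ k))"
    using X(2) by (intro sum.mono_neutral_cong_right) auto
  also have "\<dots> = (c \<cdot>\<^sub>v (first_cols X (Suc j) *\<^sub>v w)) $ i"
    using X i w by (auto simp: scalar_prod_def select_cols_def sum_distrib_left algebra_simps intro!: sum.cong)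
  finally show "(X *\<^sub>v v) $ i = (c \<cdot>\<^sub>v (first_cols X (Suc j) *\<^sub>v w)) $ i" .
qed (use X in \<open>auto simp: select_cols_def\<close>)

text \<open>Gram--Schmidt in closed form: the coefficients are cofactors of Gram matrices, so they inherit
  every regularity property of the entries of \<open>X\<close>.\<close>

lemma orthonormalizer:
  assumes X: "X \<in> carrier_mat d m" "0 < gdet X"
  defines "T \<equiv> orthonormalizer X"
  shows "T \<in> carrier_mat m m" "upper_triangular T"
    "transpose_mat (X * T) * (X * T) = 1\<^sub>m m"
    "upper_triangular (transpose_mat (X * T) * X)"
    "T * (transpose_mat (X * T) * X) = 1\<^sub>m m" "(transpose_mat (X * T) * X) * T = 1\<^sub>m m"
    "Determinant.det T \<noteq> 0"
proof -
  show T: "T \<in> carrier_mat m m" using X by (auto simp: T_def orthonormalizer_def)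
  show "upper_triangular T" using X by (auto simp: T_def orthonormalizer_def)
  let ?g = "\<lambda>j. gdet (first_cols X j)"
  define c where "c = (\<lambda>j. 1 / sqrt (?g j * ?g (Suc j)))"
  let ?u = "\<lambda>j. first_cols X (Suc j) *\<^sub>v residual_coeffs (first_cols X (Suc j)) j"
  have gp: "0 < ?g j" if "j \<le> m" for j using gdet_first_cols_pos[OF X that] .
  note r = residual_coeffs[OF first_cols_carrier[OF X(1)] lessI]
  have q: "col (X * T) j = c j \<cdot>\<^sub>v ?u j" if j: "j < m" for j
  proof -
    have "col (X * T) j = X *\<^sub>v col T j" using col_mult2[OF X(1) T j] .
    also have "\<dots> = c j \<cdot>\<^sub>v ?u j"
      using X j r(1) T
      by (intro mult_mat_vec_cong_initial[where d = d and m = m]) (auto simp: T_def orthonormalizer_def c_def)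
    finally show ?thesis .
  qed
  have qcar: "col (X * T) j \<in> carrier_vec d" if "j < m" for j
    using X T that by (intro carrier_vecI) simp
  have cu: "col X k \<bullet> ?u j = (if k = j then ?g (Suc j) else 0)" if "k \<le> j" "j < m" for k j
    using r(3)[of k j] col_first_cols[OF X(1), of k "Suc j"] that by simp
  have cq: "col X k \<bullet> col (X * T) j = (if k = j then c j * ?g (Suc j) else 0)" if "k \<le> j" "j < m" for k j
    using cu[OF that] that X r(1)[of j] q[of j] first_cols_carrier[OF X(1), of "Suc j"] by auto
  have off: "col (X * T) i \<bullet> col (X * T) j = 0" if "i < j" "j < m" for i j
  proof -
    have i: "i < m" using that by simp
    have "col (X * T) i \<bullet> col (X * T) j = (X *\<^sub>v col T i) \<bullet> col (X * T) j"
      using col_mult2[OF X(1) T i] by simp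
    also have "\<dots> = col (X * T) j \<bullet> (X *\<^sub>v col T i)"
      using X T that by (intro comm_scalar_prod[of _ d]) auto
    also have "\<dots> = (transpose_mat X *\<^sub>v col (X * T) j) \<bullet> col T i"
      using X T that by (subst transpose_vec_mult_scalar[of X d m]) auto
    also have "\<dots> = 0"
    proof -
      have "(transpose_mat X *\<^sub>v col (X * T) j) $ k * col T i $ k = 0" if k: "k < m" for k
      proof (cases "k \<le> i")
        case True
        then have "(transpose_mat X *\<^sub>v col (X * T) j) $ k = 0"
          using cq[of k j] \<open>i < j\<close> \<open>j < m\<close> k X by simp
        then show ?thesis by simp
      next
        case False
        then have "col T i $ k = 0" using k i T X by (simp add: T_def orthonormalizer_def)
        then show ?thesis by simp
      qed
      then show ?thesis using T by (auto simp: scalar_prod_def intro!: sum.neutral)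
    qed
    finally show ?thesis .
  qed
  have diag: "col (X * T) j \<bullet> col (X * T) j = 1" if j: "j < m" for j
  proof -
    have "col (X * T) j \<bullet> col (X * T) j = c j * (c j * (?u j \<bullet> ?u j))"
      unfolding q[OF j] using r(1)[of j] first_cols_carrier[OF X(1), of "Suc j"] by simp
    also have "?u j \<bullet> ?u j = ?g (Suc j) * ?g j"
      using r(4)[of j] rest_gdet_first_cols[OF X(1) j] by simp
    also have "c j * (c j * (?g (Suc j) * ?g j)) = 1"
      using gp[of j] gp[of "Suc j"] j by (simp add: c_def field_simps flip: real_sqrt_mult)
    finally show ?thesis .
  qed
  show ortho: "transpose_mat (X * T) * (X * T) = 1\<^sub>m m"
  proof (rule eq_matI)
    fix i j assume "i < dim_row (1\<^sub>m m)" "j < dim_col (1\<^sub>m m)"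
    then have ij: "i < m" "j < m" by auto
    then have "(transpose_mat (X * T) * (X * T)) $$ (i, j) = col (X * T) i \<bullet> col (X * T) j"
      using X T by simp
    also have "\<dots> = (1\<^sub>m m) $$ (i, j)"
      using off[of i j] off[of j i] diag[of i] ij comm_scalar_prod[OF qcar qcar, of i j]
      by (cases i j rule: linorder_cases) auto
    finally show "(transpose_mat (X * T) * (X * T)) $$ (i, j) = (1\<^sub>m m) $$ (i, j)" .
  qed (use X T in auto)
  have R: "transpose_mat (X * T) * X \<in> carrier_mat m m" using X T by auto
  show "upper_triangular (transpose_mat (X * T) * X)"
  proof (rule upper_triangularI)
    fix i j assume "j < i" "i < dim_row (transpose_mat (X * T) * X)"
    then have ij: "j < i" "i < m" using X T by auto
    then have "(transpose_mat (X * T) * X) $$ (i, j) = col (X * T) i \<bullet> col X j" using X T by simp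
    also have "\<dots> = col X j \<bullet> col (X * T) i"
      using ij X T by (intro comm_scalar_prod[of _ d]) auto
    also have "\<dots> = 0" using cq[of j i] ij by simp
    finally show "(transpose_mat (X * T) * X) $$ (i, j) = 0" .
  qed
  show RT: "(transpose_mat (X * T) * X) * T = 1\<^sub>m m"
    unfolding ortho[symmetric] using X T by (intro assoc_mult_mat[of _ m d _ m _ m]) auto
  show "T * (transpose_mat (X * T) * X) = 1\<^sub>m m"
    using mat_mult_left_right_inverse[OF R T RT] .
  show "Determinant.det T \<noteq> 0" using inv_mat_unique(2)[OF T R RT] .
qed

lemma upper_triangular_mult:
  fixes A B :: "real mat"
  assumes A: "A \<in> carrier_mat n n" "upper_triangular A" and B: "B \<in> carrier_mat n n" "upper_triangular B"
  shows "upper_triangular (A * B)" "\<And>i. i < n \<Longrightarrow> (A * B) $$ (i, i) = A $$ (i, i) * B $$ (i, i)"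
proof -
  show "upper_triangular (A * B)"
  proof (rule upper_triangularI)
    fix i j assume "j < i" "i < dim_row (A * B)"
    then have ij: "j < i" "i < n" using A by auto
    have "A $$ (i, k) * B $$ (k, j) = 0" if "k < n" for k
      using upper_triangularD[OF A(2), of k i] upper_triangularD[OF B(2), of j k] A B ij that
      by (cases "k < i") auto
    then show "(A * B) $$ (i, j) = 0" using A B ij by (auto simp: scalar_prod_def intro!: sum.neutral)
  qed
  fix i assume i: "i < n"
  have "(A * B) $$ (i, i) = (\<Sum>k\<in>{0..<n}. A $$ (i, k) * B $$ (k, i))"
    using A B i by (auto simp: scalar_prod_def)
  also have "\<dots> = (\<Sum>k\<in>{i}. A $$ (i, k) * B $$ (k, i))"
  proof (rule sum.mono_neutral_right)
    show "\<forall>k\<in>{0..<n} - {i}. A $$ (i, k) * B $$ (k, i) = 0"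
    proof
      fix k assume k: "k \<in> {0..<n} - {i}"
      then show "A $$ (i, k) * B $$ (k, i) = 0"
        using upper_triangularD[OF A(2), of k i] upper_triangularD[OF B(2), of i k] A B i
        by (cases "k < i") auto
    qed
  qed (use i in auto)
  finally show "(A * B) $$ (i, i) = A $$ (i, i) * B $$ (i, i)" by simp
qed

text \<open>Over the complex numbers the characteristic polynomial splits. For an eigenvector \<open>v\<close> the number
  \<open>v\<^sup>* S v\<close> is real and equals the eigenvalue times \<open>\<bar>v\<bar>\<^sup>2\<close>, so all roots are real.\<close>

lemma symmetric_char_poly_splits:
  fixes S :: "real mat"
  assumes S: "S \<in> carrier_mat n n" and sym: "transpose_mat S = S"
  shows "\<exists>es. char_poly S = (\<Prod>e\<leftarrow>es. [:- e, 1:]) \<and> length es = n"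
proof -
  interpret cr: comm_ring_hom complex_of_real by unfold_locales auto
  interpret cp: map_poly_comm_ring_hom complex_of_real ..
  let ?S = "map_mat complex_of_real S"
  have SC: "?S \<in> carrier_mat n n" using S by simp
  obtain as where as: "char_poly ?S = (\<Prod>a\<leftarrow>as. [:- a, 1:])" "length as = n"
    using char_poly_factorized[OF SC] by blast
  have S_sym: "S $$ (i, j) = S $$ (j, i)" if "i < n" "j < n" for i j
    using arg_cong[OF sym, of "\<lambda>M. M $$ (i, j)"] S that by simp
  have real: "complex_of_real (Re a) = a" if a: "a \<in> set as" for a
  proof -
    have "poly (char_poly ?S) a = 0"
      unfolding as(1) poly_prod_list_zero_iff using a by (auto intro!: bexI[of _ a])
    then have "eigenvalue ?S a" using eigenvalue_root_char_poly[OF SC] by blast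
    then obtain v where v: "v \<in> carrier_vec n" "v \<noteq> 0\<^sub>v n" "?S *\<^sub>v v = a \<cdot>\<^sub>v v"
      unfolding eigenvalue_def eigenvector_def using S by auto
    have ev: "(\<Sum>j<n. complex_of_real (S $$ (i, j)) * v $ j) = a * v $ i" if "i < n" for i
      using arg_cong[OF v(3), of "\<lambda>w. w $ i"] S v(1) that by (simp add: scalar_prod_def lessThan_atLeast0)
    define q where "q = (\<Sum>i<n. \<Sum>j<n. cnj (v $ i) * (complex_of_real (S $$ (i, j)) * v $ j))"
    define N where "N = (\<Sum>i<n. (cmod (v $ i))\<^sup>2)"
    have "cnj q = (\<Sum>i<n. \<Sum>j<n. v $ i * (complex_of_real (S $$ (i, j)) * cnj (v $ j)))"
      by (simp add: q_def)
    also have "\<dots> = (\<Sum>j<n. \<Sum>i<n. v $ i * (complex_of_real (S $$ (i, j)) * cnj (v $ j)))"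
      by (rule sum.swap)
    also have "\<dots> = q" unfolding q_def
      using S_sym by (intro sum.cong refl) (auto simp: mult_ac)
    finally have qr: "cnj q = q" .
    have "q = (\<Sum>i<n. cnj (v $ i) * (a * v $ i))"
      unfolding q_def sum_distrib_left[symmetric] using ev by (intro sum.cong refl) auto
    also have "\<dots> = (\<Sum>i<n. a * complex_of_real ((cmod (v $ i))\<^sup>2))"
    proof (rule sum.cong[OF refl])
      fix i show "cnj (v $ i) * (a * v $ i) = a * complex_of_real ((cmod (v $ i))\<^sup>2)"
        using complex_norm_square[of "v $ i"] by (simp add: mult_ac)
    qed
    also have "\<dots> = a * complex_of_real N" by (simp add: N_def sum_distrib_left)
    finally have qa: "q = a * complex_of_real N" .
    have "N \<noteq> 0"
    proof
      assume "N = 0"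
      then have "\<forall>i\<in>{..<n}. (cmod (v $ i))\<^sup>2 = 0" unfolding N_def by (subst sum_nonneg_eq_0_iff[symmetric]) auto
      then have "v = 0\<^sub>v n" using v(1) by (intro eq_vecI) auto
      with v(2) show False by simp
    qed
    then have "cnj a = a" using qr unfolding qa by simp
    then have "Im a = 0" by (metis Reals_cnj_iff complex_is_Real_iff)
    then show ?thesis by (simp add: complex_eq_iff)
  qed
  define es where "es = map Re as"
  have as_es: "as = map complex_of_real es"
    using real by (simp add: es_def o_def map_idI)
  have "map_poly complex_of_real (char_poly S) = (\<Prod>a\<leftarrow>as. [:- a, 1:])"
    using of_real_hom.char_poly_hom[OF S, where 'a = complex] as(1) by simp
  also have "\<dots> = map_poly complex_of_real (\<Prod>e\<leftarrow>es. [:- e, 1:])"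
    unfolding as_es cp.hom_prod_list by (simp add: o_def)
  finally have "complex_of_real (coeff (char_poly S) i) = complex_of_real (coeff (\<Prod>e\<leftarrow>es. [:- e, 1:]) i)" for i
    by (metis coeff_map_poly of_real_0)
  then have "char_poly S = (\<Prod>e\<leftarrow>es. [:- e, 1:])" by (intro poly_eqI) (simp only: of_real_eq_iff)
  moreover have "length es = n" using as(2) by (simp add: es_def)
  ultimately show ?thesis by blast
qed

lemma gram_orthonormal_mult:
  fixes U W :: "real mat"
  assumes U: "U \<in> carrier_mat n m" "transpose_mat U * U = 1\<^sub>m m" and W: "W \<in> carrier_mat m k"
  shows "transpose_mat (U * W) * (U * W) = transpose_mat W * W"
proof -
  have "transpose_mat (U * W) * (U * W) = transpose_mat W * transpose_mat U * (U * W)"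
    using U(1) W by (simp add: transpose_mult)
  also have "\<dots> = transpose_mat W * (transpose_mat U * (U * W))"
    using U(1) W by (intro assoc_mult_mat[of _ k m _ n _ k]) auto
  also have "transpose_mat U * (U * W) = (transpose_mat U * U) * W"
    using U(1) W by (intro assoc_mult_mat[symmetric, of _ m n _ m _ k]) auto
  also have "\<dots> = W" unfolding U(2) using W by simp
  finally show ?thesis .
qed

lemma euclid_norm_orthonormal_mult:
  assumes U: "U \<in> carrier_mat n m" "transpose_mat U * U = 1\<^sub>m m" and v: "v \<in> carrier_vec m"
  shows "euclid_norm (U *\<^sub>v v) = euclid_norm v"
proof -
  have "(U *\<^sub>v v) \<bullet> (U *\<^sub>v v) = (transpose_mat U *\<^sub>v (U *\<^sub>v v)) \<bullet> v"
    using U(1) v by (subst transpose_vec_mult_scalar[of U n m]) auto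
  also have "transpose_mat U *\<^sub>v (U *\<^sub>v v) = (transpose_mat U * U) *\<^sub>v v"
    using U(1) v by (intro assoc_mult_mat_vec[symmetric, of _ m n _ m]) auto
  also have "\<dots> = v" unfolding U(2) using v by simp
  finally show ?thesis by (simp add: euclid_norm_def)
qed

lemma mat_diag_dims [simp]: "dim_row (mat_diag n f) = n" "dim_col (mat_diag n f) = n"
  by (simp_all add: mat_diag_def)

lemma det_mat_diag: "Determinant.det (mat_diag n f) = (\<Prod>i=0..<n. f i)" for f :: "nat \<Rightarrow> real"
proof -
  have "Determinant.det (mat_diag n f) = prod_list (map f [0..<n])"
    by (subst det_upper_triangular[of _ n])
      (auto simp: mat_diag_def diag_mat_def intro!: arg_cong[of _ _ prod_list])
  also have "\<dots> = (\<Prod>i=0..<n. f i)" by (induction n) auto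
  finally show ?thesis .
qed

lemma sqrt_prod: "sqrt (\<Prod>i=0..<n. f i) = (\<Prod>i=0..<n. sqrt (f i))" for n :: nat
  by (induction n) (simp_all add: real_sqrt_mult)

lemma proots_linear_factors: "proots (\<Prod>e\<leftarrow>es. [:- e, 1:]) = mset es" for es :: "real list"
proof (induction es)
  case (Cons a es)
  have "(\<Prod>e\<leftarrow>es. [:- e, 1:]) \<noteq> 0" by (auto simp: prod_list_zero_iff)
  then have "proots ([:- a, 1:] * (\<Prod>e\<leftarrow>es. [:- e, 1:])) = proots [:- a, 1:] + proots (\<Prod>e\<leftarrow>es. [:- e, 1:])"
    by (intro proots_mult) auto
  then show ?case using Cons by simp
qed simp

text \<open>The Schur decomposition makes \<open>S\<close> similar to a triangular matrix with the sorted eigenvalues on the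
  diagonal. Orthonormalising the basis by Gram--Schmidt is a triangular change of basis and keeps this
  form; the result is symmetric and triangular, hence diagonal.\<close>

theorem symmetric_diagonalization:
  fixes S :: "real mat"
  assumes S: "S \<in> carrier_mat n n" and sym: "transpose_mat S = S"
  shows "\<exists>U es. U \<in> carrier_mat n n \<and> transpose_mat U * U = 1\<^sub>m n \<and> U * transpose_mat U = 1\<^sub>m n \<and>
    length es = n \<and> sorted_wrt (\<ge>) es \<and> proots (char_poly S) = mset es \<and>
    transpose_mat U * S * U = mat_diag n (\<lambda>i. es ! i)"
proof -
  obtain as where as: "char_poly S = (\<Prod>e\<leftarrow>as. [:- e, 1:])" "length as = n"
    using symmetric_char_poly_splits[OF S sym] by blast
  define es where "es = rev (sort as)"
  have len: "length es = n" using as by (simp add: es_def)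
  have srt: "sorted_wrt (\<ge>) es" by (simp add: es_def sorted_wrt_rev)
  have m: "mset es = mset as" by (simp add: es_def)
  have "(\<Prod>e\<leftarrow>es. [:- e, 1:]) = (\<Prod>e\<leftarrow>as. [:- e, 1:])"
    by (metis m mset_map prod_mset_prod_list)
  then have cp: "char_poly S = (\<Prod>e\<leftarrow>es. [:- e, 1:])" using as by simp
  have pr: "proots (char_poly S) = mset es" unfolding cp by (rule proots_linear_factors)
  obtain B P Q where "schur_decomposition S es = (B, P, Q)" by (cases "schur_decomposition S es")
  from schur_decomposition[OF S cp this]
  have w: "similar_mat_wit S B P Q" and ut: "upper_triangular B" and dB: "diag_mat B = es" by auto
  from similar_mat_witD2[OF S w]
  have PQ: "P * Q = 1\<^sub>m n" "Q * P = 1\<^sub>m n" "S = P * B * Q"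
    and c: "B \<in> carrier_mat n n" "P \<in> carrier_mat n n" "Q \<in> carrier_mat n n" by auto
  have "Determinant.det P \<noteq> 0" using inv_mat_unique(2)[OF c(2,3) PQ(2)] .
  then have gp: "0 < gdet P"
    using vol_square[OF c(2)] vol_power2[of P] by (metis zero_less_abs_iff zero_less_power)
  define T where "T = orthonormalizer P"
  define U where "U = P * T"
  define R where "R = transpose_mat U * P"
  note o = orthonormalizer[OF c(2) gp, folded T_def, folded U_def, folded R_def]
  have cc: "U \<in> carrier_mat n n" "R \<in> carrier_mat n n" "T \<in> carrier_mat n n"
    using o(1) c by (auto simp: U_def R_def)
  have UU: "U * transpose_mat U = 1\<^sub>m n"
    using mat_mult_left_right_inverse[of "transpose_mat U" n U] cc o(3) by auto
  define D where "D = transpose_mat U * S * U"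
  have "D = transpose_mat U * (P * B * Q) * (P * T)" unfolding D_def PQ(3) U_def ..
  also have "\<dots> = transpose_mat U * (P * B) * ((Q * P) * T)"
    using c cc by (simp add: assoc_mult_mat[of _ n n _ n _ n])
  also have "\<dots> = R * B * T"
    using c cc PQ by (simp add: R_def assoc_mult_mat[of _ n n _ n _ n])
  finally have D: "D = R * B * T" .
  have Rii: "R $$ (i, i) * T $$ (i, i) = 1" if "i < n" for i
    using upper_triangular_mult(2)[OF cc(2) o(4) cc(3) o(2) that] that unfolding o(6) by simp
  note RB = upper_triangular_mult[OF cc(2) o(4) c(1) ut]
  have RBc: "R * B \<in> carrier_mat n n" using cc c by simp
  note RBT = upper_triangular_mult[OF RBc RB(1) cc(3) o(2)]
  have Dc: "D \<in> carrier_mat n n" using cc S by (auto simp: D_def)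
  have Dsym: "transpose_mat D = D"
    unfolding D_def using cc S sym
    by (simp add: transpose_mult[of _ n n _ n] assoc_mult_mat[of _ n n _ n _ n])
  have "D = mat_diag n (\<lambda>i. es ! i)"
  proof (rule eq_matI)
    fix i j assume "i < dim_row (mat_diag n (\<lambda>i. es ! i))" "j < dim_col (mat_diag n (\<lambda>i. es ! i))"
    then have ij: "i < n" "j < n" by auto
    have low: "D $$ (a, b) = 0" if "b < a" "a < n" for a b
      using upper_triangularD[OF RBT(1), of b a] that RBc D by auto
    have tr: "D $$ (a, b) = D $$ (b, a)" if "a < n" "b < n" for a b
      using arg_cong[OF Dsym, of "\<lambda>M. M $$ (a, b)"] that Dc by simp
    have dg: "D $$ (i, i) = es ! i"
      using RBT(2)[OF ij(1)] RB(2)[OF ij(1)] Rii[OF ij(1)] arg_cong[OF dB, of "\<lambda>l. l ! i"] ij(1) c(1)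
      by (simp add: D diag_mat_def)
    show "D $$ (i, j) = mat_diag n (\<lambda>i. es ! i) $$ (i, j)"
      using ij low[of j i] low[of i j] tr[of i j] dg
      by (cases i j rule: linorder_cases) (auto simp: mat_diag_def)
  qed (use Dc in auto)
  then show ?thesis using cc o(3) UU len srt pr unfolding D_def by blast
qed

lemma diagonalized_Gram:
  assumes M: "M \<in> carrier_mat n n" "Determinant.det M \<noteq> 0"
  shows "\<exists>U es. U \<in> carrier_mat n n \<and> transpose_mat U * U = 1\<^sub>m n \<and> U * transpose_mat U = 1\<^sub>m n \<and>
    length es = n \<and> sorted_wrt (\<ge>) es \<and> proots (char_poly (transpose_mat M * M)) = mset es \<and>
    transpose_mat U * (transpose_mat M * M) * U = mat_diag n (\<lambda>i. es ! i) \<and> (\<forall>i<n. 0 < es ! i) \<and>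
    (\<forall>i<n. singular_value (Suc i) M = sqrt (es ! i))"
proof -
  let ?S = "transpose_mat M * M"
  have S: "?S \<in> carrier_mat n n" using M by auto
  have "transpose_mat ?S = ?S" using M by (simp add: transpose_mult[of _ n n _ n])
  from symmetric_diagonalization[OF S this] obtain U es where
    U: "U \<in> carrier_mat n n" "transpose_mat U * U = 1\<^sub>m n" "U * transpose_mat U = 1\<^sub>m n"
    and es: "length es = n" "sorted_wrt (\<ge>) es" "proots (char_poly ?S) = mset es"
    and D: "transpose_mat U * ?S * U = mat_diag n (\<lambda>i. es ! i)" by blast
  have pos: "0 < es ! i" if i: "i < n" for i
  proof -
    let ?w = "M *\<^sub>v col U i"
    have cU: "col U i \<in> carrier_vec n" using U i by auto
    have cw: "?w \<in> carrier_vec n" using M U i by auto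
    have "es ! i = (transpose_mat U * ?S * U) $$ (i, i)" unfolding D using i by (simp add: mat_diag_def)
    also have "transpose_mat U * ?S * U = transpose_mat (M * U) * (M * U)"
      using M U by (simp add: transpose_mult[of _ n n _ n] assoc_mult_mat[of _ n n _ n _ n])
    also have "\<dots> $$ (i, i) = col (M * U) i \<bullet> col (M * U) i" using M U i by simp
    also have "col (M * U) i = ?w" using col_mult2[OF M(1) U(1) i] .
    finally have e: "es ! i = (euclid_norm ?w)\<^sup>2" by (simp add: euclid_norm_power2)
    have "?w \<noteq> 0\<^sub>v n"
    proof
      assume "?w = 0\<^sub>v n"
      then have "inv_mat M *\<^sub>v ?w = 0\<^sub>v n" using inv_mat_inverse(1)[OF M] by (auto intro!: eq_vecI)
      moreover have "inv_mat M *\<^sub>v ?w = col U i"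
        using inv_mat_inverse[OF M] M cU by (simp add: assoc_mult_mat_vec[symmetric, of _ n n _ n])
      ultimately have "col U i = 0\<^sub>v n" by simp
      moreover have "(transpose_mat U * U) $$ (i, i) = col U i \<bullet> col U i" using U(1) i by simp
      ultimately show False unfolding U(2) using i by simp
    qed
    then have "euclid_norm ?w \<noteq> 0" using euclid_norm_eq_0_iff[OF cw] by simp
    then show ?thesis unfolding e by simp
  qed
  have sv: "singular_value (Suc i) M = sqrt (es ! i)" if i: "i < n" for i
  proof -
    have "sorted (rev es)" using es(2) by (simp add: sorted_wrt_rev)
    then have "sorted_list_of_multiset (mset es) = rev es"
      by (metis mset_rev sorted_list_of_multiset_mset sorted_sort_id)
    then have "rev (map sqrt (sorted_list_of_multiset (mset es))) = map sqrt es"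
      by (simp add: rev_map)
    then show ?thesis using i es(1,3) by (simp add: singular_value_def)
  qed
  show ?thesis using U es D pos sv by blast
qed

lemma singular_value_pos:
  "M \<in> carrier_mat n n \<Longrightarrow> Determinant.det M \<noteq> 0 \<Longrightarrow> k \<in> {1..n} \<Longrightarrow> 0 < singular_value k M"
  using diagonalized_Gram[of M n] by (cases k) auto

text \<open>The product of the \<open>L\<close> largest singular values is the largest expansion of \<open>L\<close>-dimensional volume. Through
  this property singular values are replaced by volumes.\<close>

lemma singular_value_product:
  assumes M: "M \<in> carrier_mat n n" "Determinant.det M \<noteq> 0" and L: "L \<le> n"
  shows "\<And>Z. Z \<in> carrier_mat n L \<Longrightarrow> vol (M * Z) \<le> (\<Prod>k=1..L. singular_value k M) * vol Z"
    "\<exists>Z\<in>carrier_mat n L. transpose_mat Z * Z = 1\<^sub>m L \<and> vol (M * Z) = (\<Prod>k=1..L. singular_value k M)"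
proof -
  let ?S = "transpose_mat M * M"
  obtain U es where
    U: "U \<in> carrier_mat n n" "transpose_mat U * U = 1\<^sub>m n" "U * transpose_mat U = 1\<^sub>m n"
    and es: "length es = n" "sorted_wrt (\<ge>) es"
    and D: "transpose_mat U * ?S * U = mat_diag n (\<lambda>i. es ! i)"
    and pos: "\<And>i. i < n \<Longrightarrow> 0 < es ! i"
    and sv: "\<And>i. i < n \<Longrightarrow> singular_value (Suc i) M = sqrt (es ! i)"
    using diagonalized_Gram[OF M] by auto
  have "(\<Prod>k=1..L. singular_value k M) = (\<Prod>i=0..<L. singular_value (Suc i) M)"
    by (rule prod.reindex_bij_witness[of _ Suc "\<lambda>k. k - 1"]) auto
  also have "\<dots> = (\<Prod>i=0..<L. sqrt (es ! i))" using sv L by (intro prod.cong) auto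
  finally have P: "(\<Prod>k=1..L. singular_value k M) = sqrt (\<Prod>i=0..<L. es ! i)" by (simp only: sqrt_prod)
  have anti: "es ! j \<le> es ! i" if "i \<le> j" "j < n" for i j
    using es that by (cases "i = j") (auto simp: sorted_wrt_iff_nth_less)
  have gd: "gdet (M * (U * W)) = Determinant.det (transpose_mat W * mat n L (\<lambda>(i, j). es ! i * W $$ (i, j)))"
    if W: "W \<in> carrier_mat n L" for W
  proof -
    have "transpose_mat (M * (U * W)) * (M * (U * W)) = transpose_mat W * (transpose_mat U * ?S * U * W)"
      using M U W by (simp add: transpose_mult[of _ n n _ n] transpose_mult[of _ n n _ L] assoc_mult_mat[of _ n n _ n _ n]
          assoc_mult_mat[of _ L n _ n _ n] assoc_mult_mat[of _ L n _ n _ L] assoc_mult_mat[of _ n n _ n _ L])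
    also have "transpose_mat U * ?S * U * W = mat n L (\<lambda>(i, j). es ! i * W $$ (i, j))"
      unfolding D using mat_diag_mult_left[OF W] by simp
    finally show ?thesis by simp
  qed
  have gU: "gdet (U * W) = gdet W" if W: "W \<in> carrier_mat n L" for W
    using gram_orthonormal_mult[OF U(1,2) W] by simp
  show "vol (M * Z) \<le> (\<Prod>k=1..L. singular_value k M) * vol Z" if Z: "Z \<in> carrier_mat n L" for Z
  proof -
    let ?W = "transpose_mat U * Z"
    have W: "?W \<in> carrier_mat n L" using U Z by auto
    have "U * ?W = (U * transpose_mat U) * Z" using U Z by (intro assoc_mult_mat[symmetric]) auto
    then have ZW: "U * ?W = Z" unfolding U(3) using Z by simp
    have "gdet (M * Z) \<le> (\<Prod>j=0..<L. es ! j) * gdet Z"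
      using weighted_gdet_le[OF W, of "\<lambda>i. es ! i"] pos anti
      unfolding gd[OF W, unfolded ZW] gU[OF W, unfolded ZW] by blast
    then have "vol (M * Z) \<le> sqrt ((\<Prod>j=0..<L. es ! j) * gdet Z)"
      unfolding vol_def by (rule real_sqrt_le_mono)
    then show ?thesis unfolding P by (simp add: real_sqrt_mult vol_def)
  qed
  let ?J = "mat n L (\<lambda>(i, j). if i = j then 1 else 0 :: real)"
  have J: "?J \<in> carrier_mat n L" by simp
  have JD: "transpose_mat ?J * mat n L (\<lambda>(i, j). f i * ?J $$ (i, j)) = mat_diag L f" for f
  proof (rule eq_matI)
    fix i j assume "i < dim_row (mat_diag L f)" "j < dim_col (mat_diag L f)"
    then have ij: "i < L" "j < L" by auto
    have "(transpose_mat ?J * mat n L (\<lambda>(i, j). f i * ?J $$ (i, j))) $$ (i, j) =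
      (\<Sum>k\<in>{0..<n}. (if k = i then 1 else 0) * (f k * (if k = j then 1 else 0)))"
      using ij L by (auto simp: scalar_prod_def intro!: sum.cong)
    also have "\<dots> = (\<Sum>k\<in>{i}. (if k = i then 1 else 0) * (f k * (if k = j then 1 else 0)))"
      using ij L by (intro sum.mono_neutral_right) auto
    finally show "(transpose_mat ?J * mat n L (\<lambda>(i, j). f i * ?J $$ (i, j))) $$ (i, j) = mat_diag L f $$ (i, j)"
      using ij by (simp add: mat_diag_def)
  qed auto
  have J1: "transpose_mat ?J * ?J = 1\<^sub>m L"
  proof -
    have "mat n L (\<lambda>(i, j). 1 * ?J $$ (i, j)) = ?J" by (intro eq_matI) auto
    then show ?thesis using JD[of "\<lambda>_. 1"] by simp
  qed
  have "gdet (M * (U * ?J)) = (\<Prod>i=0..<L. es ! i)"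
    unfolding gd[OF J] JD by (rule det_mat_diag)
  then have 1: "vol (M * (U * ?J)) = (\<Prod>k=1..L. singular_value k M)"
    unfolding vol_def P by simp
  have 2: "transpose_mat (U * ?J) * (U * ?J) = 1\<^sub>m L"
    unfolding gram_orthonormal_mult[OF U(1,2) J] by (rule J1)
  show "\<exists>Z\<in>carrier_mat n L. transpose_mat Z * Z = 1\<^sub>m L \<and> vol (M * Z) = (\<Prod>k=1..L. singular_value k M)"
    using 1 2 U J by (intro bexI[of _ "U * ?J"]) auto
qed

section \<open>Linear systems\<close>

text \<open>The functions \<open>x n\<close> are the iterated integrals of Picard. Their exponential bounds allow summing and
  differentiating the series term by term on the whole half-line.\<close>

lemma dominated_series_solution:
  fixes x :: "nat \<Rightarrow> nat \<Rightarrow> real \<Rightarrow> real" and a :: "nat \<Rightarrow> nat \<Rightarrow> real \<Rightarrow> real"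
  assumes x0: "\<And>i t. i < d \<Longrightarrow> x 0 i t = c i"
    and x_at0: "\<And>n i. i < d \<Longrightarrow> x (Suc n) i 0 = 0"
    and der: "\<And>n i t. i < d \<Longrightarrow> 0 \<le> t \<Longrightarrow>
      (x (Suc n) i has_real_derivative (\<Sum>j<d. a i j t * x n j t)) (at t within {0..})"
    and bd: "\<And>i j t. i < d \<Longrightarrow> j < d \<Longrightarrow> 0 \<le> t \<Longrightarrow> \<bar>a i j t\<bar> \<le> K" and K: "0 \<le> K"
  shows "\<exists>y. (\<forall>i<d. y i 0 = c i) \<and>
    (\<forall>i<d. \<forall>t\<ge>0. (y i has_real_derivative (\<Sum>j<d. a i j t * y j t)) (at t within {0..}))"
proof -
  define M where "M = (\<Sum>i<d. \<bar>c i\<bar>)"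
  define k where "k = real d * K"
  have k0: "0 \<le> k" and M0: "0 \<le> M" using K by (auto simp: k_def M_def intro: sum_nonneg)
  have bound: "\<bar>x n i t\<bar> \<le> M * (k ^ n * t ^ n / fact n)" if "i < d" "0 \<le> t" for n i t
    using that
  proof (induction n arbitrary: i t)
    case 0
    then show ?case using x0 member_le_sum[of i "{..<d}" "\<lambda>i. \<bar>c i\<bar>"] by (simp add: M_def)
  next
    case (Suc n)
    define b where "b = (\<lambda>t. M * k ^ Suc n / fact (Suc n) * t ^ Suc n)"
    define b' where "b' = (\<lambda>s. M * (k * (k ^ n * s ^ n / fact n)))"
    have db: "(b has_real_derivative b' s) (at s within A)" for s A
    proof -
      have "(b has_real_derivative M * k ^ Suc n / fact (Suc n) * (real (Suc n) * s ^ n)) (at s within A)"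
        unfolding b_def using DERIV_cmult[OF DERIV_pow[of "Suc n" s A], of "M * k ^ Suc n / fact (Suc n)"] by simp
      moreover have "M * k ^ Suc n / fact (Suc n) * (real (Suc n) * s ^ n) = b' s"
        unfolding b'_def fact_Suc of_nat_mult by (simp del: of_nat_Suc)
      ultimately show ?thesis by simp
    qed
    have dx: "\<bar>\<Sum>j<d. a i j s * x n j s\<bar> \<le> b' s" if s: "0 \<le> s" for s
    proof -
      have "\<bar>\<Sum>j<d. a i j s * x n j s\<bar> \<le> (\<Sum>j<d. \<bar>a i j s * x n j s\<bar>)" by (rule sum_abs)
      also have "\<dots> \<le> (\<Sum>j<d. K * (M * (k ^ n * s ^ n / fact n)))"
        unfolding abs_mult using bd Suc s K by (intro sum_mono mult_mono) auto
      also have "\<dots> = b' s" by (simp add: k_def b'_def)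
      finally show ?thesis .
    qed
    have mono: "f 0 \<le> f t"
      if f: "\<And>s. 0 \<le> s \<Longrightarrow> (f has_real_derivative f' s) (at s within {0..})" "\<And>s. 0 \<le> s \<Longrightarrow> 0 \<le> f' s" for f f'
    proof (rule DERIV_nonneg_imp_increasing_open[OF Suc(3)])
      fix s assume s: "0 < s" "s < t"
      then have "(f has_real_derivative f' s) (at s)"
        using f(1)[of s] at_within_interior[of s "{0..}"] by simp
      then show "\<exists>y. (f has_real_derivative y) (at s) \<and> 0 \<le> y" using f(2)[of s] s by auto
    next
      show "continuous_on {0..t} f"
        by (rule continuous_on_subset[of "{0..}"])
           (use f(1) in \<open>auto intro!: DERIV_continuous_on\<close>)
    qed
    have "b 0 - x (Suc n) i 0 \<le> b t - x (Suc n) i t"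
    proof (rule mono)
      show "((\<lambda>s. b s - x (Suc n) i s) has_real_derivative b' s - (\<Sum>j<d. a i j s * x n j s)) (at s within {0..})"
        if "0 \<le> s" for s using that Suc(2) by (intro DERIV_diff db der)
      show "0 \<le> b' s - (\<Sum>j<d. a i j s * x n j s)" if "0 \<le> s" for s
        using dx[OF that] by linarith
    qed
    moreover have "b 0 + x (Suc n) i 0 \<le> b t + x (Suc n) i t"
    proof (rule mono)
      show "((\<lambda>s. b s + x (Suc n) i s) has_real_derivative b' s + (\<Sum>j<d. a i j s * x n j s)) (at s within {0..})"
        if "0 \<le> s" for s using that Suc(2) by (intro DERIV_add db der)
      show "0 \<le> b' s + (\<Sum>j<d. a i j s * x n j s)" if "0 \<le> s" for s
        using dx[OF that] by linarith
    qed
    ultimately show ?case using x_at0[OF Suc(2), of n] by (simp add: abs_le_iff b_def)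
  qed
  have summ: "summable (\<lambda>n. M * (k ^ n * t ^ n / fact n))" for t
    using summable_exp[of "k * t"] by (intro summable_mult) (simp add: power_mult_distrib field_simps)
  define y where "y = (\<lambda>i t. \<Sum>n. x n i t)"
  have sx: "summable (\<lambda>n. x n i t)" if "i < d" "0 \<le> t" for i t
    using bound[OF that] by (intro summable_comparison_test'[OF summ[of t], of 0]) auto
  define f' where "f' = (\<lambda>i n t. case n of 0 \<Rightarrow> 0 | Suc m \<Rightarrow> (\<Sum>j<d. a i j t * x m j t))"
  have main: "(y i has_real_derivative (\<Sum>j<d. a i j t * y j t)) (at t within {0..})" if i: "i < d" and t: "0 \<le> t" for i t
  proof -
    let ?S = "{0..t + 1}"
    have "\<exists>g. \<forall>s\<in>?S. (\<lambda>n. x n i s) sums g s \<and> (g has_real_derivative (\<Sum>n. f' i n s)) (at s within ?S)"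
    proof (rule has_field_derivative_series)
      show "convex ?S" by simp
      fix n s assume s: "s \<in> ?S"
      show "(x n i has_real_derivative f' i n s) (at s within ?S)"
      proof (cases n)
        case 0
        have "((\<lambda>s. c i) has_real_derivative 0) (at s within ?S)" by simp
        moreover have "x 0 i = (\<lambda>s. c i)" using x0[OF i] by auto
        ultimately show ?thesis by (simp add: 0 f'_def)
      next
        case (Suc m)
        have "(x n i has_real_derivative f' i n s) (at s within {0..})"
          using der[OF i, of s m] s by (simp add: Suc f'_def)
        then show ?thesis by (rule DERIV_subset) auto
      qed
    next
      show "uniform_limit ?S (\<lambda>n s. \<Sum>k<n. f' i k s) (\<lambda>s. \<Sum>n. f' i n s) sequentially"
      proof (rule Weierstrass_m_test)
        let ?B = "\<lambda>n. case n of 0 \<Rightarrow> 0 | Suc m \<Rightarrow> k * (M * (k ^ m * (t + 1) ^ m / fact m))"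
        show "summable ?B"
          using summable_mult[OF summ[of "t + 1"], of k] by (subst summable_Suc_iff[symmetric]) simp
        fix n s assume s: "s \<in> ?S"
        show "norm (f' i n s) \<le> ?B n"
        proof (cases n)
          case (Suc m)
          have "\<bar>\<Sum>j<d. a i j s * x m j s\<bar> \<le> (\<Sum>j<d. \<bar>a i j s * x m j s\<bar>)" by (rule sum_abs)
          also have "\<dots> \<le> (\<Sum>j<d. K * (M * (k ^ m * (t + 1) ^ m / fact m)))"
          proof (rule sum_mono)
            fix j assume j: "j \<in> {..<d}"
            have "\<bar>x m j s\<bar> \<le> M * (k ^ m * s ^ m / fact m)" using bound[of j s m] j s by simp
            also have "\<dots> \<le> M * (k ^ m * (t + 1) ^ m / fact m)"
              using s M0 k0 by (intro mult_left_mono divide_right_mono power_mono) auto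
            finally show "\<bar>a i j s * x m j s\<bar> \<le> K * (M * (k ^ m * (t + 1) ^ m / fact m))"
              unfolding abs_mult using bd[OF i, of j s] j s K by (intro mult_mono) auto
          qed
          finally show ?thesis by (simp add: Suc f'_def k_def)
        qed (simp add: f'_def)
      qed
      show "0 \<in> ?S" using t by simp
      show "summable (\<lambda>n. x n i 0)" using sx[OF i, of 0] by simp
    qed
    then obtain g where g: "\<And>s. s \<in> ?S \<Longrightarrow> (\<lambda>n. x n i s) sums g s"
      "\<And>s. s \<in> ?S \<Longrightarrow> (g has_real_derivative (\<Sum>n. f' i n s)) (at s within ?S)" by blast
    have gy: "g s = y i s" if "s \<in> ?S" for s using sums_unique[OF g(1)[OF that]] by (simp add: y_def)
    have "(\<Sum>n. f' i n t) = (\<Sum>n. \<Sum>j<d. a i j t * x n j t)"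
    proof -
      have s1: "summable (\<lambda>n. \<Sum>j<d. a i j t * x n j t)"
        using sx t by (intro summable_sum summable_mult) auto
      then have "(\<lambda>n. f' i (Suc n) t) sums (\<Sum>n. \<Sum>j<d. a i j t * x n j t)"
        by (simp add: f'_def summable_sums)
      then have "(\<lambda>n. f' i n t) sums ((\<Sum>n. \<Sum>j<d. a i j t * x n j t) + f' i 0 t)"
        by (subst (asm) sums_Suc_iff) simp
      then show ?thesis by (simp add: sums_iff f'_def)
    qed
    also have "\<dots> = (\<Sum>j<d. \<Sum>n. a i j t * x n j t)"
      using sx t by (intro suminf_sum summable_mult) auto
    also have "\<dots> = (\<Sum>j<d. a i j t * y j t)"
      unfolding y_def using sx t by (intro sum.cong refl suminf_mult) auto
    finally have e: "(\<Sum>n. f' i n t) = (\<Sum>j<d. a i j t * y j t)" .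
    have "(g has_real_derivative (\<Sum>j<d. a i j t * y j t)) (at t within ?S)"
      using g(2)[of t] t unfolding e by simp
    then have "(y i has_real_derivative (\<Sum>j<d. a i j t * y j t)) (at t within ?S)"
      using gy t by (intro has_field_derivative_transform_within[of g _ t ?S 1 "y i"]) auto
    moreover have "at t within ?S = at t within {0..}"
      using t by (intro at_within_nhd[of t "{..<t+1}"]) auto
    ultimately show ?thesis by simp
  qed
  have "y i 0 = c i" if i: "i < d" for i
  proof -
    have "(\<lambda>n. x n i 0) sums (\<Sum>n\<in>{0}. x n i 0)"
      using x_at0[OF i] by (intro sums_finite) (auto simp: gr0_conv_Suc)
    then show ?thesis using x0[OF i] by (simp add: y_def sums_iff)
  qed
  with main show ?thesis by blast
qed

lemma linear_system_solvable:
  fixes a :: "nat \<Rightarrow> nat \<Rightarrow> real \<Rightarrow> real"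
  assumes cont: "\<And>i j. i < d \<Longrightarrow> j < d \<Longrightarrow> continuous_on {0..} (a i j)"
    and bd: "\<And>i j t. i < d \<Longrightarrow> j < d \<Longrightarrow> 0 \<le> t \<Longrightarrow> \<bar>a i j t\<bar> \<le> K"
  shows "\<exists>y. (\<forall>i<d. y i 0 = c i) \<and>
    (\<forall>i<d. \<forall>t\<ge>0. (y i has_real_derivative (\<Sum>j<d. a i j t * y j t)) (at t within {0..}))"
proof -
  define x where "x = rec_nat (\<lambda>i t. c i) (\<lambda>n x i t. integral {0..t} (\<lambda>s. \<Sum>j<d. a i j s * x j s))"
  have antiderivative: "((\<lambda>t. integral {0..t} f) has_real_derivative f t) (at t within {0..})"
    if f: "continuous_on {0..} f" and t: "0 \<le> t" for f :: "real \<Rightarrow> real" and t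
  proof -
    have "((\<lambda>t. integral {0..t} f) has_real_derivative f t) (at t within {0..t + 1})"
      using t by (intro integral_has_real_derivative continuous_on_subset[OF f]) auto
    moreover have "at t within {0..t + 1} = at t within {0..}"
      using t by (intro at_within_nhd[of t "{..<t+1}"]) auto
    ultimately show ?thesis by simp
  qed
  have xc: "continuous_on {0..} (x n i)" if "i < d" for n i
    using that
  proof (induction n arbitrary: i)
    case (Suc n)
    have "continuous_on {0..} (\<lambda>s. \<Sum>j<d. a i j s * x n j s)"
      using cont Suc by (intro continuous_intros) auto
    from antiderivative[OF this] show ?case
      by (intro DERIV_continuous_on) (auto simp: x_def)
  qed (simp add: x_def)
  have der: "(x (Suc n) i has_real_derivative (\<Sum>j<d. a i j t * x n j t)) (at t within {0..})"
    if "i < d" "0 \<le> t" for n i t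
  proof -
    have "continuous_on {0..} (\<lambda>s. \<Sum>j<d. a i j s * x n j s)"
      using cont xc that by (intro continuous_intros) auto
    from antiderivative[OF this that(2)] show ?thesis by (simp add: x_def)
  qed
  show ?thesis
  proof (rule dominated_series_solution[of d x c a "max 0 K"])
    fix i j t assume "i < d" "j < d" "0 \<le> (t::real)"
    then show "\<bar>a i j t\<bar> \<le> max 0 K" using bd[of i j t] by linarith
  qed (use der in \<open>auto simp: x_def\<close>)
qed

lemma DERIV_cong_half_line:
  fixes f g :: "real \<Rightarrow> real"
  assumes "(f has_real_derivative D) (at t within {0..})" "0 \<le> t" "\<And>s. 0 \<le> s \<Longrightarrow> f s = g s"
  shows "(g has_real_derivative D) (at t within {0..})"
  by (rule has_field_derivative_transform_within[of f D t "{0..}" 1 g]) (use assms in auto)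

lemma mult_mat_vec_index_sum:
  assumes "M \<in> carrier_mat n m" "v \<in> carrier_vec m" "i < n"
  shows "(M *\<^sub>v v) $ i = (\<Sum>k<m. M $$ (i, k) * v $ k)"
  using assms by (simp add: scalar_prod_def lessThan_atLeast0)

lemma constant_on_half_line:
  fixes f :: "real \<Rightarrow> real"
  assumes "\<And>t. 0 \<le> t \<Longrightarrow> (f has_real_derivative 0) (at t within {0..})" "0 \<le> t"
  shows "f t = f 0"
proof -
  obtain c where "\<And>x. x \<in> {0..} \<Longrightarrow> f x = c"
    using has_field_derivative_zero_constant[of "{0..}" f] assms(1) by auto
  then show ?thesis using assms(2) by simp
qed

lemma has_mat_derivative_mult:
  assumes F: "has_mat_derivative d F F'" and G: "has_mat_derivative d G G'"
  shows "has_mat_derivative d (\<lambda>t. F t * G t) (\<lambda>t. F' t * G t + F t * G' t)"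
  unfolding has_mat_derivative_def
proof (intro conjI allI impI)
  have c: "F t \<in> carrier_mat d d" "F' t \<in> carrier_mat d d" "G t \<in> carrier_mat d d" "G' t \<in> carrier_mat d d"
    if "0 \<le> t" for t using that F G by (auto simp: has_mat_derivative_def mat_fun_def)
  show "mat_fun d (\<lambda>t. F t * G t)" "mat_fun d (\<lambda>t. F' t * G t + F t * G' t)"
    unfolding mat_fun_def using c by (auto intro!: mult_carrier_mat add_carrier_mat)
  fix t :: real and i j assume t: "0 \<le> t" and ij: "i < d" "j < d"
  have "((\<lambda>s. \<Sum>k<d. F s $$ (i, k) * G s $$ (k, j)) has_real_derivative
    (\<Sum>k<d. F' t $$ (i, k) * G t $$ (k, j) + G' t $$ (k, j) * F t $$ (i, k))) (at t within {0..})"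
    using F G t ij by (intro DERIV_sum DERIV_mult) (auto simp: has_mat_derivative_def)
  also have "(\<Sum>k<d. F' t $$ (i, k) * G t $$ (k, j) + G' t $$ (k, j) * F t $$ (i, k)) = (F' t * G t + F t * G' t) $$ (i, j)"
    using c[OF t] ij by (simp add: scalar_prod_def lessThan_atLeast0 sum.distrib mult.commute)
  finally show "((\<lambda>s. (F s * G s) $$ (i, j)) has_real_derivative (F' t * G t + F t * G' t) $$ (i, j)) (at t within {0..})"
  proof (rule DERIV_cong_half_line[OF _ t])
    fix s :: real assume s: "0 \<le> s"
    show "(\<Sum>k<d. F s $$ (i, k) * G s $$ (k, j)) = (F s * G s) $$ (i, j)"
      using c[OF s] ij by (simp add: scalar_prod_def lessThan_atLeast0)
  qed
qed

lemma has_mat_derivative_cong: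
  assumes "has_mat_derivative d F F'" "\<And>t. 0 \<le> t \<Longrightarrow> F t = G t" "\<And>t. 0 \<le> t \<Longrightarrow> F' t = G' t"
  shows "has_mat_derivative d G G'"
  unfolding has_mat_derivative_def
proof (intro conjI allI impI)
  show "mat_fun d G" "mat_fun d G'" using assms by (auto simp: has_mat_derivative_def mat_fun_def)
  fix t :: real and i j assume t: "0 \<le> t" and ij: "i < d" "j < d"
  then have "((\<lambda>s. F s $$ (i, j)) has_real_derivative F' t $$ (i, j)) (at t within {0..})"
    using assms(1) by (simp add: has_mat_derivative_def)
  then have "((\<lambda>s. F s $$ (i, j)) has_real_derivative G' t $$ (i, j)) (at t within {0..})"
    unfolding assms(3)[OF t] .
  then show "((\<lambda>s. G s $$ (i, j)) has_real_derivative G' t $$ (i, j)) (at t within {0..})"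
    by (rule DERIV_cong_half_line[OF _ t]) (simp add: assms(2))
qed

lemma zero_mat_derivative_constant:
  assumes "has_mat_derivative d F (\<lambda>t. 0\<^sub>m d d)" "0 \<le> t"
  shows "F t = F 0"
proof (rule eq_matI)
  have c: "F s \<in> carrier_mat d d" if "0 \<le> s" for s
    using assms(1) that by (auto simp: has_mat_derivative_def mat_fun_def)
  show "dim_row (F t) = dim_row (F 0)" "dim_col (F t) = dim_col (F 0)"
    using c[OF assms(2)] c[of 0] by auto
  fix i j assume "i < dim_row (F 0)" "j < dim_col (F 0)"
  then have ij: "i < d" "j < d" using c[of 0] by auto
  show "F t $$ (i, j) = F 0 $$ (i, j)"
  proof (rule constant_on_half_line[OF _ assms(2)])
    fix s :: real assume "0 \<le> s"
    then show "((\<lambda>t. F t $$ (i, j)) has_real_derivative 0) (at s within {0..})"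
      using assms(1) ij unfolding has_mat_derivative_def by (metis index_zero_mat(1))
  qed
qed

definition bounded_system :: "nat \<Rightarrow> (real \<Rightarrow> real mat) \<Rightarrow> bool" where
  "bounded_system d A \<longleftrightarrow> mat_continuous d A \<and> mat_bounded A"

lemma bounded_system_carrier: "bounded_system d A \<Longrightarrow> 0 \<le> t \<Longrightarrow> A t \<in> carrier_mat d d"
  by (simp add: bounded_system_def mat_continuous_def mat_fun_def)

lemma bounded_systemI:
  assumes "\<And>t. 0 \<le> t \<Longrightarrow> A t \<in> carrier_mat d d"
    "\<And>i j. i < d \<Longrightarrow> j < d \<Longrightarrow> continuous_on {0..} (\<lambda>t. A t $$ (i, j))"
    "\<And>i j. i < d \<Longrightarrow> j < d \<Longrightarrow> \<exists>K. \<forall>t\<ge>0. \<bar>A t $$ (i, j)\<bar> \<le> K"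
  shows "bounded_system d A"
proof -
  have f: "mat_fun d A" using assms(1) by (simp add: mat_fun_def)
  obtain K where K: "\<And>i j t. i < d \<Longrightarrow> j < d \<Longrightarrow> 0 \<le> t \<Longrightarrow> \<bar>A t $$ (i, j)\<bar> \<le> K i j"
    using assms(3) by metis
  have "\<exists>M\<ge>0. \<forall>i<d. \<forall>j<d. \<bar>K i j\<bar> \<le> M" by (rule exists_entry_bound)
  then obtain M where M: "\<And>i j. i < d \<Longrightarrow> j < d \<Longrightarrow> \<bar>K i j\<bar> \<le> M" by blast
  have "\<bar>A t $$ (i, j)\<bar> \<le> M" if "0 \<le> t" "i < d" "j < d" for t i j
    using K[OF that(2,3,1)] M[OF that(2,3)] by linarith
  then have "mat_bounded A" using mat_bounded_iff_entries_bounded[OF f] by blast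
  then show ?thesis using f assms(2) by (simp add: bounded_system_def mat_continuous_def)
qed

lemma bounded_system_entry:
  assumes "bounded_system d A"
  shows "\<And>i j. i < d \<Longrightarrow> j < d \<Longrightarrow> continuous_on {0..} (\<lambda>t. A t $$ (i, j))"
    "\<exists>K\<ge>0. \<forall>t\<ge>0. \<forall>i<d. \<forall>j<d. \<bar>A t $$ (i, j)\<bar> \<le> K"
proof -
  show "continuous_on {0..} (\<lambda>t. A t $$ (i, j))" if "i < d" "j < d" for i j
    using assms that by (simp add: bounded_system_def mat_continuous_def)
  have "mat_fun d A" using assms by (simp add: bounded_system_def mat_continuous_def)
  then obtain K where "\<forall>t\<ge>0. \<forall>i<d. \<forall>j<d. \<bar>A t $$ (i, j)\<bar> \<le> K"
    using assms mat_bounded_iff_entries_bounded[of d A] by (auto simp: bounded_system_def)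
  then have "\<forall>t\<ge>0. \<forall>i<d. \<forall>j<d. \<bar>A t $$ (i, j)\<bar> \<le> max 0 K" by (simp add: le_max_iff_disj)
  then show "\<exists>K\<ge>0. \<forall>t\<ge>0. \<forall>i<d. \<forall>j<d. \<bar>A t $$ (i, j)\<bar> \<le> K" by (intro exI[of _ "max 0 K"]) auto
qed

lemma matrix_solution_exists:
  assumes A: "bounded_system d A" and C: "C \<in> carrier_mat d d"
  shows "\<exists>X. has_mat_derivative d X (\<lambda>t. A t * X t) \<and> X 0 = C"
proof -
  obtain K where K: "\<And>t i j. 0 \<le> t \<Longrightarrow> i < d \<Longrightarrow> j < d \<Longrightarrow> \<bar>A t $$ (i, j)\<bar> \<le> K"
    using bounded_system_entry(2)[OF A] by blast
  have "\<exists>y. (\<forall>i<d. y i 0 = C $$ (i, k)) \<and>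
    (\<forall>i<d. \<forall>t\<ge>0. (y i has_real_derivative (\<Sum>j<d. A t $$ (i, j) * y j t)) (at t within {0..}))" for k
    by (rule linear_system_solvable[of d "\<lambda>i j t. A t $$ (i, j)" K]) (use bounded_system_entry(1)[OF A] K in auto)
  then obtain y where y0: "\<And>k i. i < d \<Longrightarrow> y k i 0 = C $$ (i, k)"
    and y: "\<And>k i t. i < d \<Longrightarrow> 0 \<le> t \<Longrightarrow> (y k i has_real_derivative (\<Sum>j<d. A t $$ (i, j) * y k j t)) (at t within {0..})"
    by metis
  define X where "X = (\<lambda>t. mat d d (\<lambda>(i, k). y k i t))"
  have "has_mat_derivative d X (\<lambda>t. A t * X t)"
    unfolding has_mat_derivative_def
  proof (intro conjI allI impI)
    show "mat_fun d X" by (simp add: mat_fun_def X_def)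
    show "mat_fun d (\<lambda>t. A t * X t)"
      using bounded_system_carrier[OF A] by (auto simp: mat_fun_def X_def intro!: mult_carrier_mat)
    fix t :: real and i j assume t: "0 \<le> t" and ij: "i < d" "j < d"
    have "(A t * X t) $$ (i, j) = (\<Sum>k<d. A t $$ (i, k) * y j k t)"
      using bounded_system_carrier[OF A t] ij by (simp add: X_def scalar_prod_def lessThan_atLeast0)
    moreover have "(\<lambda>s. X s $$ (i, j)) = y j i" using ij by (simp add: X_def)
    ultimately show "((\<lambda>s. X s $$ (i, j)) has_real_derivative (A t * X t) $$ (i, j)) (at t within {0..})"
      using y[OF ij(1) t, of j] by simp
  qed
  moreover have "X 0 = C" using C y0 by (intro eq_matI) (auto simp: X_def)
  ultimately show ?thesis by blast
qed

lemma has_mat_derivative_transpose: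
  assumes "has_mat_derivative d F F'"
  shows "has_mat_derivative d (\<lambda>t. transpose_mat (F t)) (\<lambda>t. transpose_mat (F' t))"
  unfolding has_mat_derivative_def
proof (intro conjI allI impI)
  have c: "F t \<in> carrier_mat d d" "F' t \<in> carrier_mat d d" if "0 \<le> t" for t
    using that assms by (auto simp: has_mat_derivative_def mat_fun_def)
  then show "mat_fun d (\<lambda>t. transpose_mat (F t))" "mat_fun d (\<lambda>t. transpose_mat (F' t))"
    by (auto simp: mat_fun_def)
  fix t :: real and i j assume t: "0 \<le> t" and ij: "i < d" "j < d"
  then have "((\<lambda>s. F s $$ (j, i)) has_real_derivative F' t $$ (j, i)) (at t within {0..})"
    using assms by (simp add: has_mat_derivative_def)
  then have "((\<lambda>s. F s $$ (j, i)) has_real_derivative transpose_mat (F' t) $$ (i, j)) (at t within {0..})"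
    using c[OF t] ij by simp
  moreover have "F s $$ (j, i) = transpose_mat (F s) $$ (i, j)" if "0 \<le> s" for s using c[OF that] ij by simp
  ultimately show "((\<lambda>s. transpose_mat (F s) $$ (i, j)) has_real_derivative transpose_mat (F' t) $$ (i, j)) (at t within {0..})"
    by (rule DERIV_cong_half_line[OF _ t])
qed

text \<open>If \<open>Z\<close> solves the adjoint equation, then \<open>Z X\<close> has derivative zero; hence \<open>Z\<close> is the inverse of \<open>X\<close>, which is
  thereby invertible at all times.\<close>

lemma principal_matrix_exists:
  assumes A: "bounded_system d A"
  shows "\<exists>X Z. has_mat_derivative d X (\<lambda>t. A t * X t) \<and> has_mat_derivative d Z (\<lambda>t. - (Z t * A t)) \<and>
    X 0 = 1\<^sub>m d \<and> Z 0 = 1\<^sub>m d \<and> (\<forall>t\<ge>0. Z t * X t = 1\<^sub>m d \<and> X t * Z t = 1\<^sub>m d)"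
proof -
  note Ac = bounded_system_carrier[OF A]
  obtain X where X: "has_mat_derivative d X (\<lambda>t. A t * X t)" "X 0 = 1\<^sub>m d"
    using matrix_solution_exists[OF A one_carrier_mat] by blast
  let ?A = "\<lambda>t. - transpose_mat (A t)"
  obtain K where K: "\<And>t i j. 0 \<le> t \<Longrightarrow> i < d \<Longrightarrow> j < d \<Longrightarrow> \<bar>A t $$ (i, j)\<bar> \<le> K"
    using bounded_system_entry(2)[OF A] by blast
  have "bounded_system d ?A"
  proof (rule bounded_systemI)
    show "?A t \<in> carrier_mat d d" if "0 \<le> t" for t using Ac[OF that] by simp
    fix i j assume ij: "i < d" "j < d"
    have e: "?A t $$ (i, j) = - (A t $$ (j, i))" if "0 \<le> t" for t using Ac[OF that] ij by simp
    show "continuous_on {0..} (\<lambda>t. ?A t $$ (i, j))"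
      using bounded_system_entry(1)[OF A ij(2,1)] e
      by (subst continuous_on_cong[OF refl, of _ _ "\<lambda>t. - (A t $$ (j, i))"]) (auto intro: continuous_intros)
    show "\<exists>K. \<forall>t\<ge>0. \<bar>?A t $$ (i, j)\<bar> \<le> K"
      by (rule exI[of _ K]) (use e K[OF _ ij(2,1)] in simp)
  qed
  then obtain W where W: "has_mat_derivative d W (\<lambda>t. ?A t * W t)" "W 0 = 1\<^sub>m d"
    using matrix_solution_exists[OF _ one_carrier_mat] by blast
  have Wc: "W t \<in> carrier_mat d d" and Xc: "X t \<in> carrier_mat d d" if "0 \<le> t" for t
    using W(1) X(1) that by (auto simp: has_mat_derivative_def mat_fun_def)
  define Z where "Z = (\<lambda>t. transpose_mat (W t))"
  have Z: "has_mat_derivative d Z (\<lambda>t. - (Z t * A t))"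
  proof (rule has_mat_derivative_cong[OF has_mat_derivative_transpose[OF W(1)]])
    fix t :: real assume t: "0 \<le> t"
    show "transpose_mat (W t) = Z t" by (simp add: Z_def)
    show "transpose_mat (?A t * W t) = - (Z t * A t)"
      using Ac[OF t] Wc[OF t] by (intro eq_matI) (auto simp: Z_def scalar_prod_def sum_negf mult.commute)
  qed
  have Zc: "Z t \<in> carrier_mat d d" if "0 \<le> t" for t using Wc[OF that] by (simp add: Z_def)
  have Z0: "Z 0 = 1\<^sub>m d" using W(2) by (simp add: Z_def)
  have "has_mat_derivative d (\<lambda>t. Z t * X t) (\<lambda>t. 0\<^sub>m d d)"
  proof (rule has_mat_derivative_cong[OF has_mat_derivative_mult[OF Z X(1)]])
    fix t :: real assume t: "0 \<le> t"
    have "- (Z t * A t) * X t + Z t * (A t * X t) = - (Z t * A t * X t) + Z t * A t * X t"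
      using assoc_mult_mat[OF Zc[OF t] Ac[OF t] Xc[OF t]] mult_carrier_mat[OF Zc[OF t] Ac[OF t]] Xc[OF t]
        uminus_mult_left_mat[of "Z t * A t" "X t"] Ac[OF t] by simp
    also have "\<dots> = 0\<^sub>m d d" using Zc[OF t] Xc[OF t] by (intro uminus_l_inv_mat) (use Ac[OF t] in auto)
    finally show "- (Z t * A t) * X t + Z t * (A t * X t) = 0\<^sub>m d d" .
  qed simp
  from zero_mat_derivative_constant[OF this]
  have ZX: "Z t * X t = 1\<^sub>m d" if "0 \<le> t" for t using that Z0 X(2) by simp
  have "X t * Z t = 1\<^sub>m d" if "0 \<le> t" for t
    using mat_mult_left_right_inverse[OF Zc Xc ZX] that by blast
  then show ?thesis using X Z Z0 ZX by blast
qed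

lemma fundamental_matrix_carrier:
  "fundamental_matrix d A X \<Longrightarrow> 0 \<le> t \<Longrightarrow> X t \<in> carrier_mat d d"
  by (simp add: fundamental_matrix_def has_mat_derivative_def mat_fun_def)

lemma fundamental_matrix_det:
  "fundamental_matrix d A X \<Longrightarrow> 0 \<le> t \<Longrightarrow> Determinant.det (X t) \<noteq> 0"
  using fundamental_matrix_carrier[of d A X t] invertible_mat_iff_det_nonzero by (auto simp: fundamental_matrix_def)

lemma fundamental_matrix_exists:
  assumes A: "bounded_system d A"
  shows "\<exists>X. fundamental_matrix d A X \<and> X 0 = 1\<^sub>m d"
proof -
  obtain X Z where X: "has_mat_derivative d X (\<lambda>t. A t * X t)" "X 0 = 1\<^sub>m d"
    and Z: "has_mat_derivative d Z (\<lambda>t. - (Z t * A t))" "\<And>t. 0 \<le> t \<Longrightarrow> Z t * X t = 1\<^sub>m d"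
    using principal_matrix_exists[OF A] by blast
  have c: "X t \<in> carrier_mat d d" "Z t \<in> carrier_mat d d" if "0 \<le> t" for t
    using X(1) Z(1) that by (auto simp: has_mat_derivative_def mat_fun_def)
  have "invertible_mat (X t)" if "0 \<le> t" for t
    using inv_mat_unique(2)[OF c(1) c(2) Z(2)] that c(1)[OF that] invertible_mat_iff_det_nonzero by blast
  then show ?thesis using X by (auto simp: fundamental_matrix_def)
qed

lemma solution_carrier: "x \<in> solutions d A \<Longrightarrow> 0 \<le> t \<Longrightarrow> x t \<in> carrier_vec d"
  by (auto simp: solutions_def PiE_def Pi_def)

text \<open>A solution multiplied by a fundamental matrix of the adjoint equation is constant. This is uniqueness.\<close>

lemma solution_determined:
  assumes A: "bounded_system d A" and X: "fundamental_matrix d A X" and x: "x \<in> solutions d A" and t: "0 \<le> t"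
  shows "x t = X t *\<^sub>v (inv_mat (X 0) *\<^sub>v x 0)"
proof -
  note Ac = bounded_system_carrier[OF A]
  obtain Y Z where Z: "has_mat_derivative d Z (\<lambda>t. - (Z t * A t))" "Z 0 = 1\<^sub>m d"
    and Y: "has_mat_derivative d Y (\<lambda>t. A t * Y t)" "\<And>t. 0 \<le> t \<Longrightarrow> Y t * Z t = 1\<^sub>m d"
    using principal_matrix_exists[OF A] by blast
  have Zc: "Z t \<in> carrier_mat d d" and Yc: "Y t \<in> carrier_mat d d" if "0 \<le> t" for t
    using Z(1) Y(1) that by (auto simp: has_mat_derivative_def mat_fun_def)
  have main: "z t = Y t *\<^sub>v z 0" if z: "z \<in> solutions d A" and t: "0 \<le> t" for z t
  proof -
    note zc = solution_carrier[OF z]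
    have "Z t *\<^sub>v z t = Z 0 *\<^sub>v z 0"
    proof (rule eq_vecI)
      show "dim_vec (Z t *\<^sub>v z t) = dim_vec (Z 0 *\<^sub>v z 0)" using Zc[OF t] Zc[of 0] by simp
      fix i assume "i < dim_vec (Z 0 *\<^sub>v z 0)"
      then have i: "i < d" using Zc[of 0] by simp
      have e: "(Z s *\<^sub>v z s) $ i = (\<Sum>k<d. Z s $$ (i, k) * z s $ k)" if "0 \<le> s" for s
        using Zc[OF that] zc[OF that] i by (simp add: scalar_prod_def lessThan_atLeast0)
      have "(\<Sum>k<d. Z t $$ (i, k) * z t $ k) = (\<Sum>k<d. Z 0 $$ (i, k) * z 0 $ k)"
      proof (rule constant_on_half_line[OF _ t])
        fix s :: real assume s: "0 \<le> s"
        have "((\<lambda>s. \<Sum>k<d. Z s $$ (i, k) * z s $ k) has_real_derivative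
          (\<Sum>k<d. (- (Z s * A s)) $$ (i, k) * z s $ k + (A s *\<^sub>v z s) $ k * Z s $$ (i, k))) (at s within {0..})"
          using Z(1) z s i by (intro DERIV_sum DERIV_mult) (auto simp: has_mat_derivative_def solutions_def)
        moreover have "(\<Sum>k<d. (- (Z s * A s)) $$ (i, k) * z s $ k + (A s *\<^sub>v z s) $ k * Z s $$ (i, k)) = 0"
        proof -
          have "(\<Sum>k<d. (Z s * A s) $$ (i, k) * z s $ k) = ((Z s * A s) *\<^sub>v z s) $ i"
            using mult_mat_vec_index_sum[OF mult_carrier_mat[OF Zc[OF s] Ac[OF s]] zc[OF s] i] ..
          also have "(Z s * A s) *\<^sub>v z s = Z s *\<^sub>v (A s *\<^sub>v z s)"
            using Zc[OF s] Ac[OF s] zc[OF s] by (intro assoc_mult_mat_vec) auto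
          also have "\<dots> $ i = (\<Sum>k<d. Z s $$ (i, k) * (A s *\<^sub>v z s) $ k)"
            by (rule mult_mat_vec_index_sum[OF Zc[OF s] mult_mat_vec_carrier[OF Ac[OF s] zc[OF s]] i])
          finally have "(\<Sum>k<d. (Z s * A s) $$ (i, k) * z s $ k) = (\<Sum>k<d. Z s $$ (i, k) * (A s *\<^sub>v z s) $ k)" .
          moreover have "(\<Sum>k<d. (- (Z s * A s)) $$ (i, k) * z s $ k + (A s *\<^sub>v z s) $ k * Z s $$ (i, k)) =
            (\<Sum>k<d. - ((Z s * A s) $$ (i, k) * z s $ k) + Z s $$ (i, k) * (A s *\<^sub>v z s) $ k)"
            using Zc[OF s] Ac[OF s] i by (intro sum.cong refl) simp
          ultimately show ?thesis by (simp only: sum.distrib sum_negf)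
        qed
        ultimately show "((\<lambda>s. \<Sum>k<d. Z s $$ (i, k) * z s $ k) has_real_derivative 0) (at s within {0..})"
          by simp
      qed
      then show "(Z t *\<^sub>v z t) $ i = (Z 0 *\<^sub>v z 0) $ i" using e[OF t] e[of 0] by simp
    qed
    also have "\<dots> = z 0" using Z(2) zc[of 0] by simp
    finally have "Y t *\<^sub>v (Z t *\<^sub>v z t) = Y t *\<^sub>v z 0" by simp
    moreover have "Y t *\<^sub>v (Z t *\<^sub>v z t) = (Y t * Z t) *\<^sub>v z t"
      using Yc[OF t] Zc[OF t] zc[OF t] by (intro assoc_mult_mat_vec[symmetric]) auto
    ultimately show ?thesis using Y(2)[OF t] zc[OF t] by simp
  qed
  note Xc = fundamental_matrix_carrier[OF X]
  have XY: "X t = Y t * X 0" if t: "0 \<le> t" for t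
  proof (rule mat_col_eqI)
    fix k assume "k < dim_col (Y t * X 0)"
    then have k: "k < d" using Xc[of 0] by simp
    define z where "z = (\<lambda>t\<in>{0..}. col (X t) k)"
    have "z \<in> solutions d A"
      unfolding solutions_def
    proof (intro CollectI conjI allI impI PiE_I)
      show "z t \<in> carrier_vec d" if "t \<in> {0..}" for t using Xc[of t] that k by (simp add: z_def)
      show "z t = undefined" if "t \<notin> {0..}" for t using that by (simp add: z_def)
      fix t :: real and i assume t: "0 \<le> t" and i: "i < d"
      have "((\<lambda>s. X s $$ (i, k)) has_real_derivative (A t * X t) $$ (i, k)) (at t within {0..})"
        using X t i k by (simp add: fundamental_matrix_def has_mat_derivative_def)
      then have "((\<lambda>s. X s $$ (i, k)) has_real_derivative (A t *\<^sub>v z t) $ i) (at t within {0..})"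
        using Ac[OF t] Xc[OF t] t i k by (simp add: z_def)
      moreover have "X s $$ (i, k) = z s $ i" if "0 \<le> s" for s using Xc[OF that] that i k by (simp add: z_def)
      ultimately show "((\<lambda>s. z s $ i) has_real_derivative (A t *\<^sub>v z t) $ i) (at t within {0..})"
        by (rule DERIV_cong_half_line[OF _ t])
    qed
    from main[OF this t] have "col (X t) k = Y t *\<^sub>v col (X 0) k" using t by (simp add: z_def)
    then show "col (X t) k = col (Y t * X 0) k" using col_mult2[OF Yc[OF t] Xc[of 0] k] by simp
  qed (use Xc[OF t] Xc[of 0] Yc[OF t] in auto)
  note i = inv_mat_inverse[OF Xc[of 0] fundamental_matrix_det[OF X], simplified]
  have x0: "x 0 \<in> carrier_vec d" using solution_carrier[OF x, of 0] by simp
  have "X t *\<^sub>v (inv_mat (X 0) *\<^sub>v x 0) = Y t *\<^sub>v (X 0 *\<^sub>v (inv_mat (X 0) *\<^sub>v x 0))"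
    unfolding XY[OF t] using Yc[OF t] Xc[of 0] i(1) x0 by (intro assoc_mult_mat_vec) auto
  also have "X 0 *\<^sub>v (inv_mat (X 0) *\<^sub>v x 0) = (X 0 * inv_mat (X 0)) *\<^sub>v x 0"
    using Xc[of 0] i(1) x0 by (intro assoc_mult_mat_vec[symmetric]) auto
  also have "Y t *\<^sub>v \<dots> = x t" unfolding i(2) using main[OF x t] solution_carrier[OF x, of 0] by simp
  finally show ?thesis ..
qed

definition solution_of :: "(real \<Rightarrow> real mat) \<Rightarrow> real vec \<Rightarrow> real \<Rightarrow> real vec" where
  "solution_of X c = (\<lambda>t\<in>{0..}. X t *\<^sub>v c)"

lemma solution_of_in_solutions:
  assumes A: "bounded_system d A" and X: "fundamental_matrix d A X" and c: "c \<in> carrier_vec d"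
  shows "solution_of X c \<in> solutions d A"
  unfolding solutions_def
proof (intro CollectI conjI allI impI PiE_I)
  note Ac = bounded_system_carrier[OF A] and Xc = fundamental_matrix_carrier[OF X]
  show "solution_of X c t \<in> carrier_vec d" if "t \<in> {0..}" for t
    using Xc[of t] c that by (auto simp: solution_of_def)
  show "solution_of X c t = undefined" if "t \<notin> {0..}" for t using that by (simp add: solution_of_def)
  fix t :: real and i assume t: "0 \<le> t" and i: "i < d"
  have e: "(\<Sum>k<d. X s $$ (i, k) * c $ k) = solution_of X c s $ i" if "0 \<le> s" for s
    using mult_mat_vec_index_sum[OF Xc[OF that] c i] that by (simp add: solution_of_def)
  have "((\<lambda>s. \<Sum>k<d. X s $$ (i, k) * c $ k) has_real_derivative
    (\<Sum>k<d. (A t * X t) $$ (i, k) * c $ k)) (at t within {0..})"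
    using X t i by (intro DERIV_sum DERIV_cmult_right) (auto simp: fundamental_matrix_def has_mat_derivative_def)
  also have "(\<Sum>k<d. (A t * X t) $$ (i, k) * c $ k) = ((A t * X t) *\<^sub>v c) $ i"
    by (rule mult_mat_vec_index_sum[OF mult_carrier_mat[OF Ac[OF t] Xc[OF t]] c i, symmetric])
  also have "(A t * X t) *\<^sub>v c = A t *\<^sub>v solution_of X c t"
    using assoc_mult_mat_vec[OF Ac[OF t] Xc[OF t] c] t by (simp add: solution_of_def)
  finally show "((\<lambda>s. solution_of X c s $ i) has_real_derivative (A t *\<^sub>v solution_of X c t) $ i) (at t within {0..})"
    by (rule DERIV_cong_half_line[OF _ t]) (rule e)
qed

lemma solutions_eq_image:
  assumes A: "bounded_system d A" and X: "fundamental_matrix d A X"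
  shows "solutions d A = solution_of X ` carrier_vec d"
proof
  note i = inv_mat_inverse[OF fundamental_matrix_carrier[OF X, of 0] fundamental_matrix_det[OF X], simplified]
  show "solutions d A \<subseteq> solution_of X ` carrier_vec d"
  proof
    fix x assume x: "x \<in> solutions d A"
    have "x = solution_of X (inv_mat (X 0) *\<^sub>v x 0)"
    proof
      fix t show "x t = solution_of X (inv_mat (X 0) *\<^sub>v x 0) t"
        using solution_determined[OF A X x, of t] x
        by (cases "0 \<le> t") (auto simp: solution_of_def solutions_def PiE_def extensional_def)
    qed
    moreover have "inv_mat (X 0) *\<^sub>v x 0 \<in> carrier_vec d" 
      using mult_mat_vec_carrier[OF i(1) solution_carrier[OF x]] by simp
    ultimately show "x \<in> solution_of X ` carrier_vec d" by blast
  qed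
  show "solution_of X ` carrier_vec d \<subseteq> solutions d A" using solution_of_in_solutions[OF A X] by blast
qed

lemma mult_mat_vec_eq_0:
  fixes M :: "real mat"
  assumes "M \<in> carrier_mat n n" "Determinant.det M \<noteq> 0" "c \<in> carrier_vec n" "M *\<^sub>v c = 0\<^sub>v n"
  shows "c = 0\<^sub>v n"
  using assms det_0_iff_vec_prod_zero_field[OF assms(1)] by blast

lemma fundamental_matrix_quotient:
  assumes A: "bounded_system d A" and X: "fundamental_matrix d A X" and Y: "fundamental_matrix d A Y" and t: "0 \<le> t"
  shows "Y t = X t * (inv_mat (X 0) * Y 0)"
proof (rule mat_col_eqI)
  note Xc = fundamental_matrix_carrier[OF X] and Yc = fundamental_matrix_carrier[OF Y]
  note i = inv_mat_inverse[OF Xc[of 0] fundamental_matrix_det[OF X], simplified]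
  fix k assume "k < dim_col (X t * (inv_mat (X 0) * Y 0))"
  then have k: "k < d" using Yc[of 0] by simp
  have cY: "col (Y s) k = solution_of Y (unit_vec d k) s" if "0 \<le> s" for s
    using Yc[OF that] k that by (intro eq_vecI) (auto simp: solution_of_def)
  have "solution_of Y (unit_vec d k) \<in> solutions d A" by (rule solution_of_in_solutions[OF A Y]) simp
  from solution_determined[OF A X this t]
  have "col (Y t) k = X t *\<^sub>v (inv_mat (X 0) *\<^sub>v col (Y 0) k)" using cY[OF t] cY[of 0] by simp
  also have "\<dots> = col (X t * (inv_mat (X 0) * Y 0)) k"
    using col_mult2[OF i(1) Yc[of 0] k] col_mult2[OF Xc[OF t] _ k, of "inv_mat (X 0) * Y 0"] i(1) Yc[of 0] by auto
  finally show "col (Y t) k = col (X t * (inv_mat (X 0) * Y 0)) k" .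
qed (use fundamental_matrix_carrier[OF X t] fundamental_matrix_carrier[OF Y t] fundamental_matrix_carrier[OF Y, of 0] in auto)

lemma inv_mat_mult:
  fixes M N :: "real mat"
  assumes M: "M \<in> carrier_mat n n" "Determinant.det M \<noteq> 0" and N: "N \<in> carrier_mat n n" "Determinant.det N \<noteq> 0"
  shows "inv_mat (M * N) = inv_mat N * inv_mat M"
proof (rule inv_mat_unique(1)[of _ n])
  note i = inv_mat_inverse[OF M] and j = inv_mat_inverse[OF N]
  have "inv_mat N * inv_mat M * (M * N) = inv_mat N * (inv_mat M * M * N)"
    using M(1) N(1) i(1) j(1) by (simp add: assoc_mult_mat[of _ n n _ n _ n])
  also have "\<dots> = 1\<^sub>m n" unfolding i(3) using N(1) j(3) by simp
  finally show "inv_mat N * inv_mat M * (M * N) = 1\<^sub>m n" .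
  show "M * N \<in> carrier_mat n n" "inv_mat N * inv_mat M \<in> carrier_mat n n" using M N i j by auto
qed

lemma cauchy_matrix_eq:
  assumes A: "bounded_system d A" and X: "fundamental_matrix d A X" and t: "0 \<le> t" and s: "0 \<le> s"
  shows "cauchy_matrix d A t s = X t * inv_mat (X s)"
proof -
  have Y: "fundamental_matrix d A (fund_mat d A)"
    unfolding fund_mat_def using fundamental_matrix_exists[OF A] by (metis someI_ex)
  note Xc = fundamental_matrix_carrier[OF X] and Yc = fundamental_matrix_carrier[OF Y]
  note Xd = fundamental_matrix_det[OF X] and Yd = fundamental_matrix_det[OF Y]
  define C where "C = inv_mat (X 0) * fund_mat d A 0"
  have i: "inv_mat (X 0) \<in> carrier_mat d d" using inv_mat_inverse(1)[OF Xc Xd] by simp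
  have C: "C \<in> carrier_mat d d" using i Yc[of 0] by (auto simp: C_def)
  have e: "fund_mat d A r = X r * C" if "0 \<le> r" for r
    unfolding C_def by (rule fundamental_matrix_quotient[OF A X Y that])
  have "Determinant.det C \<noteq> 0"
    using Yd[OF s] unfolding e[OF s] det_mult[OF Xc[OF s] C] by auto
  note iC = inv_mat_inverse[OF C this] and iX = inv_mat_inverse[OF Xc[OF s] Xd[OF s]]
  have "cauchy_matrix d A t s = X t * C * (inv_mat C * inv_mat (X s))"
    unfolding cauchy_matrix_def e[OF t] e[OF s] using inv_mat_mult[OF Xc[OF s] Xd[OF s] C \<open>Determinant.det C \<noteq> 0\<close>] by simp
  also have "\<dots> = X t * (C * inv_mat C * inv_mat (X s))"
    using Xc[OF t] C iC(1) iX(1) by (simp only: assoc_mult_mat[of _ d d _ d _ d] mult_carrier_mat[of _ d d _ d])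
  also have "\<dots> = X t * inv_mat (X s)" unfolding iC(2) using iX(1) by simp
  finally show ?thesis .
qed

section \<open>Frames of nearly maximal volume growth\<close>

lemma mult_replace_col:
  assumes M: "M \<in> carrier_mat n d" and Z: "Z \<in> carrier_mat d L" and v: "v \<in> carrier_vec d" and j: "j < L"
  shows "M * replace_col Z v j = replace_col (M * Z) (M *\<^sub>v v) j"
proof (rule eq_matI)
  fix i k assume "i < dim_row (replace_col (M * Z) (M *\<^sub>v v) j)" "k < dim_col (replace_col (M * Z) (M *\<^sub>v v) j)"
  then have ik: "i < n" "k < L" using M Z by auto
  have "col (replace_col Z v j) k = (if k = j then v else col Z k)"
    using ik Z v by (intro eq_vecI) (auto simp: replace_col_def)
  then show "(M * replace_col Z v j) $$ (i, k) = replace_col (M * Z) (M *\<^sub>v v) j $$ (i, k)"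
    using ik M Z by (simp add: replace_col_index)
qed (use M Z in auto)

lemma col_replace_col: "Z \<in> carrier_mat d L \<Longrightarrow> v \<in> carrier_vec d \<Longrightarrow> j < L \<Longrightarrow> col (replace_col Z v j) j = v"
  by (intro eq_vecI) (auto simp: replace_col_def)

lemma rest_gdet_orthonormal:
  assumes Q: "Q \<in> carrier_mat d L" "transpose_mat Q * Q = 1\<^sub>m L" and j: "j < L"
  shows "rest_gdet Q j = 1"
proof -
  have "mat_delete (1\<^sub>m L :: real mat) j j = 1\<^sub>m (L - 1)"
    using j by (intro eq_matI) (auto simp: mat_delete_def)
  moreover have "(-1) ^ (j + j) = (1::real)" by (simp flip: mult_2)
  ultimately show ?thesis unfolding rest_gdet_def cofactor_def Q(2) by simp
qed

text \<open>The other columns are orthonormal, so the volume is at most the length of the new column.\<close>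

lemma vol_replace_col_orthonormal:
  assumes Q: "Q \<in> carrier_mat d L" "transpose_mat Q * Q = 1\<^sub>m L" and j: "j < L" and v: "v \<in> carrier_vec d"
  shows "vol (replace_col Q v j) \<le> euclid_norm v"
proof -
  have "gdet (replace_col Q v j) \<le> (euclid_norm v)\<^sup>2 * rest_gdet (replace_col Q v j) j"
    using gdet_le_rest_gdet[OF replace_col_carrier[OF Q(1), of v j] j] col_replace_col[OF Q(1) v j]
      rest_gdet_replace_col[OF Q(1) j, of v] rest_gdet_orthonormal[OF Q j] by simp
  also have "\<dots> = (euclid_norm v)\<^sup>2"
    using rest_gdet_replace_col[OF Q(1) j, of v] rest_gdet_orthonormal[OF Q j] by simp
  finally show ?thesis unfolding vol_def by (intro real_le_lsqrt) auto
qed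

text \<open>The first \<open>L\<close> columns of \<open>\<Phi>\<close> play the role of the fast solutions. The inequality \<open>dominates\<close> is what
  strong fast invertibility becomes once products of singular values are replaced by volumes; the limit
  \<open>negligible\<close> expresses the gap between the exponents.\<close>

locale volume_dominated =
  fixes d L :: nat and \<Phi> :: "real \<Rightarrow> real mat" and C :: real
  assumes L: "0 < L" "L \<le> d"
    and \<Phi>: "\<And>t. 0 \<le> t \<Longrightarrow> \<Phi> t \<in> carrier_mat d d" "\<And>t. 0 \<le> t \<Longrightarrow> Determinant.det (\<Phi> t) \<noteq> 0"
    and dominates: "\<And>s t Z. 0 \<le> s \<Longrightarrow> s \<le> t \<Longrightarrow> Z \<in> carrier_mat d L \<Longrightarrow>
      vol (\<Phi> t * Z) * vol (first_cols (\<Phi> s) L) \<le> C * vol (first_cols (\<Phi> t) L) * vol (\<Phi> s * Z)"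
    and negligible: "\<And>Z j. Z \<in> carrier_mat d L \<Longrightarrow> j < L \<Longrightarrow> (\<And>i. i < L \<Longrightarrow> Z $$ (i, j) = 0) \<Longrightarrow>
      ((\<lambda>t. vol (\<Phi> t * Z) / vol (first_cols (\<Phi> t) L)) \<longlongrightarrow> 0) at_top"
begin

abbreviation \<rho> :: "real \<Rightarrow> real" where "\<rho> t \<equiv> vol (first_cols (\<Phi> t) L)"

abbreviation fast :: "real vec set" where
  "fast \<equiv> {a \<in> carrier_vec d. \<forall>i. L \<le> i \<longrightarrow> i < d \<longrightarrow> a $ i = 0}"

abbreviation slow :: "real vec set" where
  "slow \<equiv> {b \<in> carrier_vec d. \<forall>i<L. b $ i = 0}"

lemma \<rho>_pos: "0 \<le> t \<Longrightarrow> 0 < \<rho> t"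
  using vol_first_cols_pos[OF \<Phi>] L by simp

lemma C_nonneg: "0 \<le> C"
proof -
  let ?J = "initial_frame d L"
  have "\<Phi> 0 * ?J = first_cols (\<Phi> 0) L" using mult_initial_frame[OF \<Phi>(1)] L by simp
  then have "\<rho> 0 * \<rho> 0 \<le> C * \<rho> 0 * \<rho> 0" using dominates[of 0 0 ?J] by simp
  then show ?thesis using \<rho>_pos[of 0] by (simp add: mult.assoc)
qed

text \<open>Orthonormalise the fast columns at time \<open>s\<close> by a constant matrix, and let \<open>Z\<close> be the resulting frame of
  initial coefficients. The norm of \<open>\<Phi> s a\<close> is controlled by its largest coordinate \<open>\<gamma>\<close> in this frame. By
  Cramer's rule the same \<open>\<gamma>\<close> is, at every other time, the relative volume of the frame in which the
  corresponding vector is replaced by \<open>a\<close>, so it can be estimated at a time of one's choice.\<close>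

lemma orthonormal_coefficients:
  assumes s: "0 \<le> s"
  shows "\<exists>Z \<delta>. Z \<in> carrier_mat d L \<and> 0 < \<delta> \<and> \<rho> s * \<delta> = 1 \<and>
    transpose_mat (\<Phi> s * Z) * (\<Phi> s * Z) = 1\<^sub>m L \<and> (\<forall>k<L. col Z k \<in> fast) \<and>
    (\<forall>a\<in>fast. \<exists>j<L. \<exists>\<gamma>. euclid_norm (\<Phi> s *\<^sub>v a) \<le> real L * \<bar>\<gamma>\<bar> \<and>
      (\<forall>t\<ge>0. vol (\<Phi> t * replace_col Z a j) = \<rho> t * \<bar>\<gamma>\<bar> * \<delta>))"
proof -
  let ?J = "initial_frame d L"
  have J: "?J \<in> carrier_mat d L" by simp
  have PJ: "\<Phi> t * ?J = first_cols (\<Phi> t) L" if "0 \<le> t" for t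
    using mult_initial_frame[OF \<Phi>(1)[OF that]] L by simp
  note P = \<Phi>(1)[OF s]
  have X: "first_cols (\<Phi> s) L \<in> carrier_mat d L" using first_cols_carrier[OF P] .
  have "0 < gdet (first_cols (\<Phi> s) L)" using \<rho>_pos[OF s] by (simp add: vol_def)
  define T where "T = orthonormalizer (first_cols (\<Phi> s) L)"
  note o = orthonormalizer[OF X \<open>0 < gdet (first_cols (\<Phi> s) L)\<close>, folded T_def]
  define Z where "Z = ?J * T"
  define \<delta> where "\<delta> = \<bar>Determinant.det T\<bar>"
  have Z: "Z \<in> carrier_mat d L" unfolding Z_def using mult_carrier_mat[OF J o(1)] .
  have PZ: "\<Phi> t * Z = first_cols (\<Phi> t) L * T" if t: "0 \<le> t" for t
    unfolding Z_def PJ[OF t, symmetric] using \<Phi>(1)[OF t] J o(1) by (intro assoc_mult_mat[symmetric]) auto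
  have pos: "0 < \<delta>" using o(7) by (simp add: \<delta>_def)
  have ortho: "transpose_mat (\<Phi> s * Z) * (\<Phi> s * Z) = 1\<^sub>m L" unfolding PZ[OF s] by (rule o(3))
  have "vol (\<Phi> s * Z) = 1" unfolding vol_def ortho by simp
  then have one: "\<rho> s * \<delta> = 1" unfolding PZ[OF s] vol_mult_square[OF X o(1)] \<delta>_def .
  have Jv: "?J *\<^sub>v w \<in> carrier_vec d" "\<And>i. i < d \<Longrightarrow> (?J *\<^sub>v w) $ i = (if i < L then w $ i else 0)"
    if w: "w \<in> carrier_vec L" for w
  proof -
    show "?J *\<^sub>v w \<in> carrier_vec d" using mult_mat_vec_carrier[OF J w] .
    fix i assume i: "i < d"
    have "(?J *\<^sub>v w) $ i = (\<Sum>k<L. ?J $$ (i, k) * w $ k)" by (rule mult_mat_vec_index_sum[OF J w i])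
    also have "\<dots> = (\<Sum>k<L. if k = i then w $ k else 0)" using i by (intro sum.cong) auto
    finally show "(?J *\<^sub>v w) $ i = (if i < L then w $ i else 0)" by simp
  qed
  have colZ: "col Z k \<in> fast" if k: "k < L" for k
  proof -
    have "col Z k = ?J *\<^sub>v col T k" unfolding Z_def using col_mult2[OF J o(1) k] .
    then show ?thesis using Jv[of "col T k"] o(1) k by auto
  qed
  have main: "\<exists>j<L. \<exists>\<gamma>. euclid_norm (\<Phi> s *\<^sub>v a) \<le> real L * \<bar>\<gamma>\<bar> \<and>
      (\<forall>t\<ge>0. vol (\<Phi> t * replace_col Z a j) = \<rho> t * \<bar>\<gamma>\<bar> * \<delta>)" if a: "a \<in> fast" for a
  proof -
    define a' where "a' = vec L (\<lambda>i. a $ i)"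
    have a': "a' \<in> carrier_vec L" by (simp add: a'_def)
    have Ja: "?J *\<^sub>v a' = a"
    proof (rule eq_vecI)
      show "dim_vec (?J *\<^sub>v a') = dim_vec a" using a by auto
      fix i assume "i < dim_vec a"
      then have i: "i < d" using a by auto
      show "(?J *\<^sub>v a') $ i = a $ i" unfolding Jv(2)[OF a' i] using a i by (auto simp: a'_def)
    qed
    let ?R = "transpose_mat (first_cols (\<Phi> s) L * T) * first_cols (\<Phi> s) L"
    have R: "?R \<in> carrier_mat L L" using X o(1) by auto
    define y where "y = ?R *\<^sub>v a'"
    have y: "y \<in> carrier_vec L" unfolding y_def using mult_mat_vec_carrier[OF R a'] .
    have Ty: "T *\<^sub>v y = a'"
      unfolding y_def using assoc_mult_mat_vec[OF o(1) R a', symmetric] a' unfolding o(5) by simp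
    have "\<Phi> s *\<^sub>v a = (\<Phi> s * Z) *\<^sub>v y"
    proof -
      have "(\<Phi> s * Z) *\<^sub>v y = \<Phi> s *\<^sub>v (Z *\<^sub>v y)" using assoc_mult_mat_vec[OF P Z y] .
      also have "Z *\<^sub>v y = ?J *\<^sub>v (T *\<^sub>v y)" unfolding Z_def using assoc_mult_mat_vec[OF J o(1) y] .
      finally show ?thesis unfolding Ty Ja by simp
    qed
    then have n: "euclid_norm (\<Phi> s *\<^sub>v a) = euclid_norm y"
      using euclid_norm_orthonormal_mult[OF mult_carrier_mat[OF P Z] ortho y] by simp
    obtain j where j: "j < L" "euclid_norm y \<le> real L * \<bar>y $ j\<bar>"
      using euclid_norm_exists_large_entry[OF y L(1)] by blast
    have "vol (\<Phi> t * replace_col Z a j) = \<rho> t * \<bar>y $ j\<bar> * \<delta>" if t: "0 \<le> t" for t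
    proof -
      have "replace_col Z a j = ?J * replace_col T a' j"
        unfolding mult_replace_col[OF J o(1) a' j(1)] Ja Z_def ..
      then have "\<Phi> t * replace_col Z a j = first_cols (\<Phi> t) L * replace_col T a' j"
        unfolding PJ[OF t, symmetric] using assoc_mult_mat[OF \<Phi>(1)[OF t] J replace_col_carrier[OF o(1)]] by simp
      also have "vol \<dots> = \<rho> t * \<bar>Determinant.det (replace_col T a' j)\<bar>"
        by (rule vol_mult_square[OF first_cols_carrier[OF \<Phi>(1)[OF t]] replace_col_carrier[OF o(1)]])
      also have "Determinant.det (replace_col T a' j) = y $ j * Determinant.det T"
        using cramer_lemma_mat[OF o(1) y j(1)] unfolding Ty .
      finally show ?thesis by (simp add: \<delta>_def abs_mult)
    qed
    then show ?thesis using j n by auto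
  qed
  have "(\<forall>k<L. col Z k \<in> fast) \<and> (\<forall>a\<in>fast. \<exists>j<L. \<exists>\<gamma>. euclid_norm (\<Phi> s *\<^sub>v a) \<le> real L * \<bar>\<gamma>\<bar> \<and>
      (\<forall>t\<ge>0. vol (\<Phi> t * replace_col Z a j) = \<rho> t * \<bar>\<gamma>\<bar> * \<delta>))"
    by (intro conjI ballI allI impI colZ main)
  with Z pos one ortho show ?thesis by (intro exI[of _ Z] exI[of _ \<delta>] conjI) simp_all
qed

text \<open>Write \<open>a = (a + b) - b\<close> in the exchanged vector. At a late time the frame with \<open>b\<close> has negligible volume,
  and the volume of the frame with \<open>a + b\<close> is dominated by its volume at time \<open>s\<close>, which is at most
  \<open>\<bar>\<Phi> s (a + b)\<bar>\<close> because the other vectors are orthonormal there.\<close>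

lemma norm_fast_le:
  assumes s: "0 \<le> s" and a: "a \<in> fast" and b: "b \<in> slow"
  shows "euclid_norm (\<Phi> s *\<^sub>v a) \<le> real L * C * euclid_norm (\<Phi> s *\<^sub>v (a + b))"
proof -
  obtain Z \<delta> where Z: "Z \<in> carrier_mat d L" and \<delta>: "0 < \<delta>" "\<rho> s * \<delta> = 1"
    and Q: "transpose_mat (\<Phi> s * Z) * (\<Phi> s * Z) = 1\<^sub>m L" and colZ: "\<forall>k<L. col Z k \<in> fast"
    and main: "\<forall>a\<in>fast. \<exists>j<L. \<exists>\<gamma>. euclid_norm (\<Phi> s *\<^sub>v a) \<le> real L * \<bar>\<gamma>\<bar> \<and>
      (\<forall>t\<ge>0. vol (\<Phi> t * replace_col Z a j) = \<rho> t * \<bar>\<gamma>\<bar> * \<delta>)"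
    using orthonormal_coefficients[OF s] by (elim exE conjE) (simp only: Ball_def)
  from bspec[OF main a] obtain j \<gamma> where j: "j < L" and n: "euclid_norm (\<Phi> s *\<^sub>v a) \<le> real L * \<bar>\<gamma>\<bar>"
    and v: "\<And>t. 0 \<le> t \<Longrightarrow> vol (\<Phi> t * replace_col Z a j) = \<rho> t * \<bar>\<gamma>\<bar> * \<delta>" by blast
  have ac: "a \<in> carrier_vec d" and bc: "b \<in> carrier_vec d" using a b by auto
  let ?e = "euclid_norm (\<Phi> s *\<^sub>v (a + b))"
  let ?r = "\<lambda>t. vol (\<Phi> t * replace_col Z (- b) j) / \<rho> t"
  have le: "\<bar>\<gamma>\<bar> \<le> C * ?e + \<rho> s * ?r t" if t: "s \<le> t" for t
  proof -
    have t0: "0 \<le> t" using s t by simp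
    have W: "\<Phi> t * Z \<in> carrier_mat d L" using \<Phi>(1)[OF t0] Z by simp
    have e: "\<Phi> t *\<^sub>v a = \<Phi> t *\<^sub>v (a + b) + \<Phi> t *\<^sub>v (- b)"
    proof -
      have "\<Phi> t *\<^sub>v (a + b) + \<Phi> t *\<^sub>v (- b) = \<Phi> t *\<^sub>v (a + b + - b)"
        using \<Phi>(1)[OF t0] ac bc by (intro mult_add_distrib_mat_vec[symmetric]) auto
      also have "a + b + - b = a" using ac bc by (intro eq_vecI) auto
      finally show ?thesis ..
    qed
    have "\<rho> t * \<bar>\<gamma>\<bar> * \<delta> = vol (replace_col (\<Phi> t * Z) (\<Phi> t *\<^sub>v a) j)"
      using v[OF t0] mult_replace_col[OF \<Phi>(1)[OF t0] Z ac j] by simp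
    also have "\<dots> \<le> vol (replace_col (\<Phi> t * Z) (\<Phi> t *\<^sub>v (a + b)) j) + vol (replace_col (\<Phi> t * Z) (\<Phi> t *\<^sub>v (- b)) j)"
      unfolding e using \<Phi>(1)[OF t0] ac bc by (intro vol_replace_col_add[OF W j]) auto
    also have "replace_col (\<Phi> t * Z) (\<Phi> t *\<^sub>v (a + b)) j = \<Phi> t * replace_col Z (a + b) j"
      using ac bc by (intro mult_replace_col[OF \<Phi>(1)[OF t0] Z _ j, symmetric]) auto
    also have "replace_col (\<Phi> t * Z) (\<Phi> t *\<^sub>v (- b)) j = \<Phi> t * replace_col Z (- b) j"
      using bc by (intro mult_replace_col[OF \<Phi>(1)[OF t0] Z _ j, symmetric]) auto
    finally have 1: "\<rho> t * \<bar>\<gamma>\<bar> * \<delta> \<le> vol (\<Phi> t * replace_col Z (a + b) j) + vol (\<Phi> t * replace_col Z (- b) j)" .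
    have "vol (\<Phi> t * replace_col Z (a + b) j) * \<rho> s \<le> C * \<rho> t * vol (\<Phi> s * replace_col Z (a + b) j)"
      using dominates[OF s t] Z by simp
    also have "\<Phi> s * replace_col Z (a + b) j = replace_col (\<Phi> s * Z) (\<Phi> s *\<^sub>v (a + b)) j"
      using ac bc by (intro mult_replace_col[OF \<Phi>(1)[OF s] Z _ j]) auto
    also have "C * \<rho> t * vol \<dots> \<le> C * \<rho> t * ?e"
      using \<Phi>(1)[OF s] Z ac bc Q j C_nonneg \<rho>_pos[OF t0]
      by (intro mult_left_mono vol_replace_col_orthonormal[of _ d L]) auto
    finally have 2: "vol (\<Phi> t * replace_col Z (a + b) j) * \<rho> s \<le> C * \<rho> t * ?e" .
    have "\<rho> t * \<bar>\<gamma>\<bar> * \<delta> * \<rho> s = \<rho> t * \<bar>\<gamma>\<bar> * (\<rho> s * \<delta>)" by (simp only: mult_ac)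
    then have "\<rho> t * \<bar>\<gamma>\<bar> = \<rho> t * \<bar>\<gamma>\<bar> * \<delta> * \<rho> s" unfolding \<delta>(2) by (simp only: mult_1_right)
    also have "\<dots> \<le> (vol (\<Phi> t * replace_col Z (a + b) j) + vol (\<Phi> t * replace_col Z (- b) j)) * \<rho> s"
      using 1 by (intro mult_right_mono) auto
    also have "\<dots> \<le> C * \<rho> t * ?e + vol (\<Phi> t * replace_col Z (- b) j) * \<rho> s"
      using 2 by (simp add: distrib_right)
    also have "\<dots> = \<rho> t * (C * ?e + \<rho> s * ?r t)" using \<rho>_pos[OF t0] by (simp add: field_simps)
    finally show ?thesis using \<rho>_pos[OF t0] by simp
  qed
  have "(?r \<longlongrightarrow> 0) at_top"
    using Z bc b L j by (intro negligible[of _ j]) (auto simp: replace_col_index)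
  then have "((\<lambda>t. C * ?e + \<rho> s * ?r t) \<longlongrightarrow> C * ?e + \<rho> s * 0) at_top" by (intro tendsto_intros)
  moreover have "eventually (\<lambda>t. \<bar>\<gamma>\<bar> \<le> C * ?e + \<rho> s * ?r t) at_top"
    using le eventually_ge_at_top[of s] by (rule eventually_mono[rotated]) 
  ultimately have "\<bar>\<gamma>\<bar> \<le> C * ?e + \<rho> s * 0" by (rule tendsto_lowerbound) simp
  then have "real L * \<bar>\<gamma>\<bar> \<le> real L * (C * ?e)" by (intro mult_left_mono) auto
  then show ?thesis using n by (simp add: mult.assoc)
qed

lemma norm_slow_le:
  assumes s: "0 \<le> s" and a: "a \<in> fast" and b: "b \<in> slow"
  shows "euclid_norm (\<Phi> s *\<^sub>v b) \<le> (1 + real L * C) * euclid_norm (\<Phi> s *\<^sub>v (a + b))"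
proof -
  have c: "a \<in> carrier_vec d" "b \<in> carrier_vec d" using a b by auto
  have "\<Phi> s *\<^sub>v (a + b) + - (\<Phi> s *\<^sub>v a) = \<Phi> s *\<^sub>v b"
    using \<Phi>(1)[OF s] c mult_mat_vec_carrier[OF \<Phi>(1)[OF s] c(1)] mult_mat_vec_carrier[OF \<Phi>(1)[OF s] c(2)]
    by (subst mult_add_distrib_mat_vec[OF \<Phi>(1)[OF s] c]) (auto intro!: eq_vecI)
  then have "euclid_norm (\<Phi> s *\<^sub>v b) \<le> euclid_norm (\<Phi> s *\<^sub>v (a + b)) + euclid_norm (- (\<Phi> s *\<^sub>v a))"
    using euclid_norm_triangle[of "\<Phi> s *\<^sub>v (a + b)" d "- (\<Phi> s *\<^sub>v a)"] \<Phi>(1)[OF s] c by auto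
  then show ?thesis using norm_fast_le[OF assms] by (simp add: euclid_norm_uminus distrib_right)
qed

text \<open>At time \<open>t\<close> complete the same \<open>L - 1\<close> vectors once by \<open>b\<close> and once by \<open>a\<close>. By the angle estimate \<open>b\<close>
  stays away from the span of the fast vectors, so the first volume is at least a constant times
  \<open>\<bar>\<Phi> t b\<bar>\<close> times the volume of the common vectors, while the second one is at most \<open>\<bar>\<Phi> t a\<bar>\<close> times the
  same volume. That unknown factor cancels when both are compared with their values at time \<open>s\<close>.\<close>

lemma fast_dominates_slow:
  assumes s: "0 \<le> s" and t: "s \<le> t" and a: "a \<in> fast" and b: "b \<in> slow"
  shows "euclid_norm (\<Phi> t *\<^sub>v b) * euclid_norm (\<Phi> s *\<^sub>v a) \<le>
    real L * C * (1 + real L * C) * euclid_norm (\<Phi> t *\<^sub>v a) * euclid_norm (\<Phi> s *\<^sub>v b)"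
proof (cases "euclid_norm (\<Phi> s *\<^sub>v a) = 0")
  case True
  then show ?thesis using C_nonneg by (simp add: zero_le_mult_iff)
next
  case False
  have t0: "0 \<le> t" using s t by simp
  obtain Z \<delta> where Z: "Z \<in> carrier_mat d L" and \<delta>: "0 < \<delta>" "\<rho> s * \<delta> = 1"
    and Q: "transpose_mat (\<Phi> s * Z) * (\<Phi> s * Z) = 1\<^sub>m L" and colZ: "\<forall>k<L. col Z k \<in> fast"
    and main: "\<forall>a\<in>fast. \<exists>j<L. \<exists>\<gamma>. euclid_norm (\<Phi> s *\<^sub>v a) \<le> real L * \<bar>\<gamma>\<bar> \<and>
      (\<forall>t\<ge>0. vol (\<Phi> t * replace_col Z a j) = \<rho> t * \<bar>\<gamma>\<bar> * \<delta>)"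
    using orthonormal_coefficients[OF s] by (elim exE conjE) (simp only: Ball_def)
  from bspec[OF main a] obtain j \<gamma> where j: "j < L" and n: "euclid_norm (\<Phi> s *\<^sub>v a) \<le> real L * \<bar>\<gamma>\<bar>"
    and v: "\<And>t. 0 \<le> t \<Longrightarrow> vol (\<Phi> t * replace_col Z a j) = \<rho> t * \<bar>\<gamma>\<bar> * \<delta>" by blast
  have \<gamma>: "0 < \<bar>\<gamma>\<bar>" using False n euclid_norm_nonneg[of "\<Phi> s *\<^sub>v a"] L by (cases "\<gamma> = 0") auto
  have ac: "a \<in> carrier_vec d" and bc: "b \<in> carrier_vec d" using a b by auto
  let ?W = "\<Phi> t * Z"
  have W: "?W \<in> carrier_mat d L" using \<Phi>(1)[OF t0] Z by simp
  have ta: "\<Phi> t *\<^sub>v a \<in> carrier_vec d" and tb: "\<Phi> t *\<^sub>v b \<in> carrier_vec d" and sb: "\<Phi> s *\<^sub>v b \<in> carrier_vec d"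
    using \<Phi>(1)[OF t0] \<Phi>(1)[OF s] ac bc by auto
  define m where "m = rest_gdet ?W j"
  define K where "K = 1 + real L * C"
  have K: "0 < K" using C_nonneg by (simp add: K_def add_pos_nonneg)
  define x where "x = euclid_norm (\<Phi> t *\<^sub>v b)"
  have g: "gdet (replace_col ?W (\<Phi> t *\<^sub>v a) j) = (\<rho> t * \<bar>\<gamma>\<bar> * \<delta>)\<^sup>2"
    unfolding v[OF t0, symmetric] mult_replace_col[OF \<Phi>(1)[OF t0] Z ac j] vol_power2 ..
  have gpos: "0 < (\<rho> t * \<bar>\<gamma>\<bar> * \<delta>)\<^sup>2" using \<rho>_pos[OF t0] \<gamma> \<delta>(1) by simp
  have 3: "(\<rho> t * \<bar>\<gamma>\<bar> * \<delta>)\<^sup>2 \<le> (euclid_norm (\<Phi> t *\<^sub>v a))\<^sup>2 * m"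
    using gdet_le_rest_gdet[OF replace_col_carrier[OF W, of "\<Phi> t *\<^sub>v a" j] j] gpos
    unfolding col_replace_col[OF W ta j] rest_gdet_replace_col[OF W j] m_def[symmetric] g by blast
  \<comment> \<open>\<open>m\<close> is the squared volume of the vectors that both frames share; it cancels in the end.\<close>
  have m: "0 < m"
  proof (rule ccontr)
    assume "\<not> 0 < m"
    then have "(euclid_norm (\<Phi> t *\<^sub>v a))\<^sup>2 * m \<le> 0" by (intro mult_nonneg_nonpos) auto
    then show False using 3 gpos by linarith
  qed
  \<comment> \<open>Any combination with coefficient 1 at \<open>b\<close> is \<open>b\<close> plus a fast vector, to which the angle estimate applies.\<close>
  have 1: "(inverse K * x)\<^sup>2 * m \<le> gdet (replace_col ?W (\<Phi> t *\<^sub>v b) j)"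
    unfolding m_def rest_gdet_replace_col[OF W j, of "\<Phi> t *\<^sub>v b", symmetric]
  proof (rule rest_gdet_le_gdet[OF replace_col_carrier[OF W] j])
    show "0 \<le> inverse K * x" using K by (simp add: x_def)
    fix c :: "real vec" assume c: "c \<in> carrier_vec L" and cj: "c $ j = 1"
    define a' where "a' = replace_col Z b j *\<^sub>v c - b"
    have zb: "replace_col Z b j *\<^sub>v c \<in> carrier_vec d"
      using mult_mat_vec_carrier[OF replace_col_carrier[OF Z] c] .
    have "a' $ i = 0" if i: "L \<le> i" "i < d" for i
    proof -
      have "(replace_col Z b j *\<^sub>v c) $ i = (\<Sum>k<L. replace_col Z b j $$ (i, k) * c $ k)"
        using mult_mat_vec_index_sum[OF replace_col_carrier[OF Z] c i(2)] .
      also have "\<dots> = (\<Sum>k<L. if k = j then b $ i else 0)"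
      proof (rule sum.cong[OF refl])
        fix k assume k: "k \<in> {..<L}"
        then have "Z $$ (i, k) = 0" using colZ i Z by auto
        then show "replace_col Z b j $$ (i, k) * c $ k = (if k = j then b $ i else 0)"
          using k i Z cj by (simp add: replace_col_index)
      qed
      finally show ?thesis using j i bc zb by (simp add: a'_def)
    qed
    then have a': "a' \<in> fast" using bc zb by (auto simp: a'_def)
    have "replace_col ?W (\<Phi> t *\<^sub>v b) j *\<^sub>v c = \<Phi> t *\<^sub>v (replace_col Z b j *\<^sub>v c)"
      unfolding mult_replace_col[OF \<Phi>(1)[OF t0] Z bc j, symmetric]
      using \<Phi>(1)[OF t0] Z c by (intro assoc_mult_mat_vec) auto
    also have "replace_col Z b j *\<^sub>v c = a' + b"
      using bc zb Z by (intro eq_vecI) (auto simp: a'_def)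
    finally have "x \<le> K * euclid_norm (replace_col ?W (\<Phi> t *\<^sub>v b) j *\<^sub>v c)"
      unfolding x_def K_def using norm_slow_le[OF t0 a' b] by simp
    then show "inverse K * x \<le> euclid_norm (replace_col ?W (\<Phi> t *\<^sub>v b) j *\<^sub>v c)"
      using K by (simp add: field_simps)
  qed
  have r1: "inverse K * x * sqrt m \<le> vol (replace_col ?W (\<Phi> t *\<^sub>v b) j)"
    using real_sqrt_le_mono[OF 1] K by (simp add: vol_def real_sqrt_mult x_def)
  have r3: "\<rho> t * \<bar>\<gamma>\<bar> * \<delta> \<le> euclid_norm (\<Phi> t *\<^sub>v a) * sqrt m"
    using real_sqrt_le_mono[OF 3] \<rho>_pos[OF t0] \<delta>(1) by (simp add: real_sqrt_mult)
  have "vol (replace_col ?W (\<Phi> t *\<^sub>v b) j) * \<rho> s \<le> C * \<rho> t * vol (\<Phi> s * replace_col Z b j)"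
    unfolding mult_replace_col[OF \<Phi>(1)[OF t0] Z bc j, symmetric] using dominates[OF s t] Z by simp
  also have "\<dots> \<le> C * \<rho> t * euclid_norm (\<Phi> s *\<^sub>v b)"
    unfolding mult_replace_col[OF \<Phi>(1)[OF s] Z bc j] using \<Phi>(1)[OF s] Z sb Q j C_nonneg \<rho>_pos[OF t0]
    by (intro mult_left_mono vol_replace_col_orthonormal[of _ d L]) auto
  finally have r2: "vol (replace_col ?W (\<Phi> t *\<^sub>v b) j) * \<rho> s \<le> C * \<rho> t * euclid_norm (\<Phi> s *\<^sub>v b)" .
  have "(sqrt m * \<rho> s) * (inverse K * x * \<bar>\<gamma>\<bar>) = (inverse K * x * sqrt m) * \<rho> s * \<bar>\<gamma>\<bar>" by (simp only: mult_ac)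
  also have "\<dots> \<le> vol (replace_col ?W (\<Phi> t *\<^sub>v b) j) * \<rho> s * \<bar>\<gamma>\<bar>"
    using r1 by (intro mult_right_mono) auto
  also have "\<dots> \<le> C * \<rho> t * euclid_norm (\<Phi> s *\<^sub>v b) * \<bar>\<gamma>\<bar>"
    using r2 by (intro mult_right_mono) auto
  also have "\<dots> = C * euclid_norm (\<Phi> s *\<^sub>v b) * \<rho> s * (\<rho> t * \<bar>\<gamma>\<bar> * \<delta>)"
  proof -
    have "C * euclid_norm (\<Phi> s *\<^sub>v b) * \<rho> s * (\<rho> t * \<bar>\<gamma>\<bar> * \<delta>) =
      C * euclid_norm (\<Phi> s *\<^sub>v b) * (\<rho> t * \<bar>\<gamma>\<bar>) * (\<rho> s * \<delta>)" by (simp only: mult_ac)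
    then show ?thesis unfolding \<delta>(2) by (simp only: mult_ac mult_1_right mult_1_left)
  qed
  also have "\<dots> \<le> C * euclid_norm (\<Phi> s *\<^sub>v b) * \<rho> s * (euclid_norm (\<Phi> t *\<^sub>v a) * sqrt m)"
    using r3 C_nonneg by (intro mult_left_mono) auto
  also have "\<dots> = (sqrt m * \<rho> s) * (C * euclid_norm (\<Phi> s *\<^sub>v b) * euclid_norm (\<Phi> t *\<^sub>v a))" by (simp only: mult_ac)
  finally have "inverse K * x * \<bar>\<gamma>\<bar> \<le> C * euclid_norm (\<Phi> s *\<^sub>v b) * euclid_norm (\<Phi> t *\<^sub>v a)"
    by (rule mult_left_le_imp_le) (use m \<rho>_pos[OF s] in simp)
  then have 4: "x * \<bar>\<gamma>\<bar> \<le> K * C * euclid_norm (\<Phi> s *\<^sub>v b) * euclid_norm (\<Phi> t *\<^sub>v a)"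
    using K by (simp add: field_simps)
  have "x * euclid_norm (\<Phi> s *\<^sub>v a) \<le> x * (real L * \<bar>\<gamma>\<bar>)" using n by (intro mult_left_mono) (auto simp: x_def)
  also have "\<dots> = real L * (x * \<bar>\<gamma>\<bar>)" by simp
  also have "\<dots> \<le> real L * (K * C * euclid_norm (\<Phi> s *\<^sub>v b) * euclid_norm (\<Phi> t *\<^sub>v a))"
    using 4 by (intro mult_left_mono) auto
  finally show ?thesis by (simp add: x_def K_def mult_ac)
qed

end

section \<open>Growth rates\<close>

lemma bounded_of_eventually_le_one:
  fixes h :: "real \<Rightarrow> real"
  assumes c: "continuous_on {0..} h" and e: "eventually (\<lambda>t. h t \<le> 1) at_top"
  shows "\<exists>K>0. \<forall>t\<ge>0. h t \<le> K"
proof -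
  obtain T where T: "\<And>t. T \<le> t \<Longrightarrow> h t \<le> 1" using e by (auto simp: eventually_at_top_linorder)
  have "bounded (h ` {0..T})"
    using continuous_on_subset[OF c, of "{0..T}"] by (intro compact_imp_bounded compact_continuous_image) auto
  then obtain B where "\<forall>x\<in>h ` {0..T}. norm x \<le> B" unfolding bounded_iff ..
  then have B: "\<bar>h t\<bar> \<le> B" if "t \<in> {0..T}" for t using that by auto
  have "h t \<le> max 1 B" if "0 \<le> t" for t
    using T[of t] B[of t] that by (cases "T \<le> t") (auto simp: le_max_iff_disj abs_le_iff)
  then show ?thesis by (intro exI[of _ "max 1 B"]) auto
qed

text \<open>The limit superior controls late times only; on the remaining compact interval continuity gives a bound,
  which the constant absorbs.\<close>

lemma exp_bound_of_char_exponent: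
  assumes cont: "continuous_on {0..} (\<lambda>t. euclid_norm (x t))" and \<chi>: "char_exponent x \<le> ereal l" and \<epsilon>: "0 < \<epsilon>"
  shows "\<exists>K>0. \<forall>t\<ge>0. euclid_norm (x t) \<le> K * exp ((l + \<epsilon>) * t)"
proof -
  let ?f = "\<lambda>t. if euclid_norm (x t) = 0 then -\<infinity> else ereal (1 / t * ln (euclid_norm (x t)))"
  let ?h = "\<lambda>t. euclid_norm (x t) * exp (- ((l + \<epsilon>) * t))"
  have "Limsup at_top ?f < ereal (l + \<epsilon>)"
    using le_less_trans[OF \<chi>, of "ereal (l + \<epsilon>)"] \<epsilon> by (simp add: char_exponent_def)
  then have "eventually (\<lambda>t. ?f t < ereal (l + \<epsilon>)) at_top" by (rule Limsup_lessD)
  then have "eventually (\<lambda>t. ?h t \<le> 1) at_top"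
    using eventually_gt_at_top[of 0]
  proof eventually_elim
    case (elim t)
    show ?case
    proof (cases "euclid_norm (x t) = 0")
      case False
      then have p: "0 < euclid_norm (x t)" using euclid_norm_nonneg[of "x t"] by linarith
      have "ln (euclid_norm (x t)) < (l + \<epsilon>) * t" using elim False by (simp add: field_simps)
      then have "euclid_norm (x t) < exp ((l + \<epsilon>) * t)" using p by (metis exp_less_mono exp_ln)
      then show ?thesis by (simp only: exp_minus) (simp add: divide_inverse[symmetric])
    qed simp
  qed
  moreover have "continuous_on {0..} ?h" by (intro continuous_intros cont)
  ultimately obtain K where K: "0 < K" "\<And>t. 0 \<le> t \<Longrightarrow> ?h t \<le> K" using bounded_of_eventually_le_one[of ?h] by blast
  have "euclid_norm (x t) \<le> K * exp ((l + \<epsilon>) * t)" if "0 \<le> t" for t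
    using K(2)[OF that] by (simp only: exp_minus divide_inverse[symmetric]) (simp only: pos_divide_le_eq exp_gt_zero)
  then show ?thesis using K(1) by blast
qed

lemma continuous_on_det:
  assumes "\<And>t. t \<in> S \<Longrightarrow> F t \<in> carrier_mat n n"
    and "\<And>i j. i < n \<Longrightarrow> j < n \<Longrightarrow> continuous_on S (\<lambda>t. F t $$ (i, j))"
  shows "continuous_on S (\<lambda>t. Determinant.det (F t) :: real)"
proof -
  have p: "p i < n" if "p permutes {0..<n}" "i < n" for p i
    using that permutes_in_image[of p "{0..<n}" i] by simp
  have "continuous_on S (\<lambda>t. \<Sum>p\<in>{p. p permutes {0..<n}}. signof p * (\<Prod>i=0..<n. F t $$ (i, p i)))"
    using assms(2) p by (intro continuous_on_sum continuous_on_mult continuous_on_const continuous_on_prod) auto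
  then show ?thesis
    by (rule continuous_on_cong[THEN iffD1, rotated 2]) (auto simp: det_def'[OF assms(1)])
qed

lemma fundamental_matrix_entry_continuous:
  assumes "fundamental_matrix d A X" "i < d" "j < d"
  shows "continuous_on {0..} (\<lambda>t. X t $$ (i, j))"
  using assms by (intro DERIV_continuous_on[where D = "\<lambda>t. (A t * X t) $$ (i, j)"])
    (auto simp: fundamental_matrix_def has_mat_derivative_def)

lemma solution_norm_continuous:
  assumes X: "fundamental_matrix d A X" and c: "c \<in> carrier_vec d"
  shows "continuous_on {0..} (\<lambda>t. euclid_norm (solution_of X c t))"
proof -
  have "continuous_on {0..} (\<lambda>t. sqrt (\<Sum>i<d. (\<Sum>k<d. X t $$ (i, k) * c $ k)\<^sup>2))"
    using fundamental_matrix_entry_continuous[OF X] by (intro continuous_intros) auto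
  then show ?thesis
  proof (rule continuous_on_cong[THEN iffD1, rotated 2])
    fix t :: real assume "t \<in> {0..}"
    then have t: "0 \<le> t" by simp
    note Xc = fundamental_matrix_carrier[OF X t]
    have "euclid_norm (X t *\<^sub>v c) = sqrt (\<Sum>i<d. ((X t *\<^sub>v c) $ i)\<^sup>2)"
      using Xc by (simp add: euclid_norm_L2_set L2_set_def)
    also have "\<dots> = sqrt (\<Sum>i<d. (\<Sum>k<d. X t $$ (i, k) * c $ k)\<^sup>2)"
      using mult_mat_vec_index_sum[OF Xc c] by (intro arg_cong[of _ _ sqrt] sum.cong) auto
    finally show "sqrt (\<Sum>i<d. (\<Sum>k<d. X t $$ (i, k) * c $ k)\<^sup>2) = euclid_norm (solution_of X c t)"
      using t by (simp add: solution_of_def)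
  qed simp
qed

text \<open>Two fundamental matrices differ by a constant invertible factor, so the lower limit may be evaluated on any
  of them.\<close>

lemma regular_det_lower_bound:
  assumes A: "bounded_system d A" and X: "fundamental_matrix d A X"
    and reg: "ereal \<sigma> = Liminf at_top (\<lambda>t. ereal (1 / t * ln \<bar>Determinant.det (fund_mat d A t)\<bar>))" and \<epsilon>: "0 < \<epsilon>"
  shows "\<exists>k>0. \<forall>t\<ge>0. k * exp ((\<sigma> - \<epsilon>) * t) \<le> \<bar>Determinant.det (X t)\<bar>"
proof -
  let ?F = "fund_mat d A"
  have F: "fundamental_matrix d A ?F"
    unfolding fund_mat_def using fundamental_matrix_exists[OF A] by (metis someI_ex)
  note Fc = fundamental_matrix_carrier[OF F] and Fd = fundamental_matrix_det[OF F]
  note Xc = fundamental_matrix_carrier[OF X] and Xd = fundamental_matrix_det[OF X]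
  let ?h = "\<lambda>t. exp ((\<sigma> - \<epsilon>) * t) / \<bar>Determinant.det (?F t)\<bar>"
  have "ereal (\<sigma> - \<epsilon>) < Liminf at_top (\<lambda>t. ereal (1 / t * ln \<bar>Determinant.det (?F t)\<bar>))"
    unfolding reg[symmetric] using \<epsilon> by simp
  then have "eventually (\<lambda>t. ereal (\<sigma> - \<epsilon>) < ereal (1 / t * ln \<bar>Determinant.det (?F t)\<bar>)) at_top"
    by (rule less_LiminfD)
  then have "eventually (\<lambda>t. ?h t \<le> 1) at_top"
    using eventually_gt_at_top[of 0]
  proof eventually_elim
    case (elim t)
    then have p: "0 < \<bar>Determinant.det (?F t)\<bar>" using Fd[of t] by simp
    have "(\<sigma> - \<epsilon>) * t < ln \<bar>Determinant.det (?F t)\<bar>" using elim by (simp add: field_simps)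
    then have "exp ((\<sigma> - \<epsilon>) * t) < \<bar>Determinant.det (?F t)\<bar>" using p by (metis exp_less_mono exp_ln)
    then show ?case using p by (simp add: field_simps)
  qed
  moreover have "continuous_on {0..} ?h"
    using Fc Fd fundamental_matrix_entry_continuous[OF F]
    by (intro continuous_intros continuous_on_det[of _ _ d]) auto
  ultimately obtain K where K: "0 < K" "\<And>t. 0 \<le> t \<Longrightarrow> ?h t \<le> K" using bounded_of_eventually_le_one[of ?h] by blast
  let ?D = "inv_mat (?F 0) * X 0"
  have D: "?D \<in> carrier_mat d d" using inv_mat_inverse(1)[OF Fc Fd, of 0] Xc[of 0] by auto
  have det: "\<bar>Determinant.det (X t)\<bar> = \<bar>Determinant.det (?F t)\<bar> * \<bar>Determinant.det ?D\<bar>" if t: "0 \<le> t" for t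
    unfolding fundamental_matrix_quotient[OF A F X t] using det_mult[OF Fc[OF t] D] by (simp add: abs_mult)
  have Dp: "0 < \<bar>Determinant.det ?D\<bar>" using det[of 0] Xd[of 0] by auto
  have "inverse K * \<bar>Determinant.det ?D\<bar> * exp ((\<sigma> - \<epsilon>) * t) \<le> \<bar>Determinant.det (X t)\<bar>" if t: "0 \<le> t" for t
  proof -
    have "exp ((\<sigma> - \<epsilon>) * t) \<le> K * \<bar>Determinant.det (?F t)\<bar>"
      using K(2)[OF t] Fd[OF t] by (simp add: field_simps)
    then have "inverse K * exp ((\<sigma> - \<epsilon>) * t) \<le> \<bar>Determinant.det (?F t)\<bar>" using K(1) by (simp add: field_simps)
    then have "inverse K * exp ((\<sigma> - \<epsilon>) * t) * \<bar>Determinant.det ?D\<bar> \<le> \<bar>Determinant.det (X t)\<bar>"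
      unfolding det[OF t] by (intro mult_right_mono) auto
    then show ?thesis by (simp only: mult_ac)
  qed
  then show ?thesis using K(1) Dp by (intro exI[of _ "inverse K * \<bar>Determinant.det ?D\<bar>"]) auto
qed

lemma vol_first_cols_Suc_le:
  assumes X: "X \<in> carrier_mat d m" "j < m"
  shows "vol (first_cols X (Suc j)) \<le> vol (first_cols X j) * euclid_norm (col X j)"
proof -
  have "gdet (first_cols X (Suc j)) \<le> (euclid_norm (col (first_cols X (Suc j)) j))\<^sup>2 * gdet (first_cols X j)"
    using gdet_le_rest_gdet[OF first_cols_carrier[OF X(1)] lessI, of j] gdet_nonneg[of "first_cols X j"]
    unfolding rest_gdet_first_cols[OF X] by blast
  also have "col (first_cols X (Suc j)) j = col X j" using col_first_cols[OF X(1)] X(2) by simp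
  finally have "sqrt (gdet (first_cols X (Suc j))) \<le> sqrt ((euclid_norm (col X j))\<^sup>2 * gdet (first_cols X j))"
    by (rule real_sqrt_le_mono)
  then show ?thesis by (simp add: vol_def real_sqrt_mult mult.commute)
qed

text \<open>Hadamard's inequality for the columns from \<open>k\<close> on, relative to the first \<open>k\<close> ones.\<close>

lemma vol_le_first_cols:
  assumes X: "X \<in> carrier_mat d m" "k \<le> m"
  shows "vol X \<le> vol (first_cols X k) * (\<Prod>c=k..<m. euclid_norm (col X c))"
  using X(2)
proof (induction rule: inc_induct)
  case base
  then show ?case using first_cols_all[OF X(1)] by simp
next
  case (step j)
  have "vol X \<le> vol (first_cols X (Suc j)) * (\<Prod>c=Suc j..<m. euclid_norm (col X c))" by fact
  also have "\<dots> \<le> vol (first_cols X j) * euclid_norm (col X j) * (\<Prod>c=Suc j..<m. euclid_norm (col X c))"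
    using vol_first_cols_Suc_le[OF X(1)] step by (intro mult_right_mono prod_nonneg) auto
  also have "\<dots> = vol (first_cols X j) * (\<Prod>c=j..<m. euclid_norm (col X c))"
    using step by (simp add: prod.atLeast_Suc_lessThan mult.assoc)
  finally show ?case .
qed

lemma mult_first_cols:
  assumes "M \<in> carrier_mat n d" "X \<in> carrier_mat d m" "k \<le> m"
  shows "first_cols (M * X) k = M * first_cols X k"
  using assms by (intro eq_matI) (auto simp: select_cols_def scalar_prod_def intro!: sum.cong)

text \<open>The quantitative content of regularity for an adapted fundamental matrix: each column grows at most with
  its exponent, and the determinant at least with the sum of all exponents.\<close>

locale regular_growth =
  fixes d L :: nat and \<Phi> :: "real \<Rightarrow> real mat" and \<mu> :: "nat \<Rightarrow> real"
  assumes L: "0 < L" "L < d"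
    and \<Phi>: "\<And>t. 0 \<le> t \<Longrightarrow> \<Phi> t \<in> carrier_mat d d" "\<And>t. 0 \<le> t \<Longrightarrow> Determinant.det (\<Phi> t) \<noteq> 0"
    and antitone: "\<And>i j. i \<le> j \<Longrightarrow> j < d \<Longrightarrow> \<mu> j \<le> \<mu> i" and gap: "\<mu> L < \<mu> (L - 1)"
    and upper: "\<And>\<epsilon> c. 0 < \<epsilon> \<Longrightarrow> c < d \<Longrightarrow> \<exists>K>0. \<forall>t\<ge>0. euclid_norm (col (\<Phi> t) c) \<le> K * exp ((\<mu> c + \<epsilon>) * t)"
    and lower: "\<And>\<epsilon>. 0 < \<epsilon> \<Longrightarrow> \<exists>k>0. \<forall>t\<ge>0. k * exp (((\<Sum>c=0..<d. \<mu> c) - \<epsilon>) * t) \<le> \<bar>Determinant.det (\<Phi> t)\<bar>"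
begin

abbreviation \<rho> :: "real \<Rightarrow> real" where "\<rho> t \<equiv> vol (first_cols (\<Phi> t) L)"

lemma \<rho>_pos: "0 \<le> t \<Longrightarrow> 0 < \<rho> t"
  using vol_first_cols_pos[OF \<Phi>] L by simp

lemma upper_uniform:
  assumes "0 < \<epsilon>"
  shows "\<exists>K>0. \<forall>c<d. \<forall>t\<ge>0. euclid_norm (col (\<Phi> t) c) \<le> K * exp ((\<mu> c + \<epsilon>) * t)"
proof -
  obtain K where K: "\<And>c. c < d \<Longrightarrow> 0 < K c" "\<And>c t. c < d \<Longrightarrow> 0 \<le> t \<Longrightarrow> euclid_norm (col (\<Phi> t) c) \<le> K c * exp ((\<mu> c + \<epsilon>) * t)"
    using upper[OF assms] by metis
  have le: "K c \<le> (\<Sum>c<d. K c)" if "c < d" for c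
    using that K(1) by (intro member_le_sum) (auto intro: less_imp_le)
  have "0 < (\<Sum>c<d. K c)" using le[of 0] K(1)[of 0] L by simp
  moreover have "euclid_norm (col (\<Phi> t) c) \<le> (\<Sum>c<d. K c) * exp ((\<mu> c + \<epsilon>) * t)" if "c < d" "0 \<le> t" for c t
    by (rule order_trans[OF K(2)[OF that] mult_right_mono[OF le[OF that(1)]]]) simp
  ultimately show ?thesis by blast
qed

text \<open>Every choice of \<open>L\<close> columns other than the first \<open>L\<close> is exponentially smaller than those.
  Regularity enters here: it bounds the volume of the first columns from below by the rate that
  the exponents predict.\<close>

lemma select_cols_small:
  "\<exists>K>0. \<exists>\<eta>>0. \<forall>t\<ge>0. \<forall>g\<in>index_maps L d. g ` {0..<L} \<noteq> {0..<L} \<longrightarrow>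
    vol (select_cols (\<Phi> t) L g) \<le> K * exp (- \<eta> * t) * \<rho> t"
proof -
  define \<gamma> where "\<gamma> = \<mu> (L - 1) - \<mu> L"
  \<comment> \<open>At most \<open>d + 1\<close> errors \<open>\<epsilon>\<close> in the exponents occur below; together they use up a quarter of the gap.\<close>
  define \<epsilon> where "\<epsilon> = \<gamma> / (4 * (real d + 1))"
  have \<gamma>: "0 < \<gamma>" using gap by (simp add: \<gamma>_def)
  have \<epsilon>: "0 < \<epsilon>" using \<gamma> by (simp add: \<epsilon>_def)
  have d\<epsilon>: "(real d + 1) * \<epsilon> = \<gamma> / 4" by (simp add: \<epsilon>_def field_simps)
  obtain K where K: "0 < K" "\<And>c t. c < d \<Longrightarrow> 0 \<le> t \<Longrightarrow> euclid_norm (col (\<Phi> t) c) \<le> K * exp ((\<mu> c + \<epsilon>) * t)"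
    using upper_uniform[OF \<epsilon>] by blast
  obtain k where k: "0 < k" "\<And>t. 0 \<le> t \<Longrightarrow> k * exp (((\<Sum>c=0..<d. \<mu> c) - \<epsilon>) * t) \<le> \<bar>Determinant.det (\<Phi> t)\<bar>"
    using lower[OF \<epsilon>] by blast
  define S where "S = (\<Sum>c=0..<L. \<mu> c)"
  define \<kappa> where "\<kappa> = k / K ^ (d - L)"
  define M where "M = real d ^ L * fact L * K ^ L"
  have \<kappa>: "0 < \<kappa>" using k K by (simp add: \<kappa>_def)
  have M: "0 < M" using K L by (simp add: M_def)
  have prod_bound: "(\<Prod>c\<in>I. euclid_norm (col (\<Phi> t) (g c))) \<le> K ^ card I * exp (((\<Sum>c\<in>I. \<mu> (g c)) + real (card I) * \<epsilon>) * t)"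
    if I: "finite I" "\<And>c. c \<in> I \<Longrightarrow> g c < d" and t: "0 \<le> t" for I t and g :: "nat \<Rightarrow> nat"
  proof -
    have "(\<Prod>c\<in>I. euclid_norm (col (\<Phi> t) (g c))) \<le> (\<Prod>c\<in>I. K * exp ((\<mu> (g c) + \<epsilon>) * t))"
      using K(2) I t by (intro prod_mono) auto
    also have "\<dots> = K ^ card I * (\<Prod>c\<in>I. exp ((\<mu> (g c) + \<epsilon>) * t))" by (simp add: prod.distrib)
    also have "(\<Prod>c\<in>I. exp ((\<mu> (g c) + \<epsilon>) * t)) = exp (\<Sum>c\<in>I. (\<mu> (g c) + \<epsilon>) * t)" using I by (simp add: exp_sum)
    also have "(\<Sum>c\<in>I. (\<mu> (g c) + \<epsilon>) * t) = ((\<Sum>c\<in>I. \<mu> (g c)) + real (card I) * \<epsilon>) * t"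
      by (simp add: sum_distrib_right[symmetric] sum.distrib)
    finally show ?thesis .
  qed
  \<comment> \<open>Dividing the determinant by the norms of the other columns leaves the full rate of the first \<open>L\<close> ones.\<close>
  have low: "\<kappa> * exp ((S - \<gamma> / 4) * t) \<le> \<rho> t" if t: "0 \<le> t" for t
  proof -
    let ?T = "\<Sum>c=L..<d. \<mu> c"
    have "(\<Sum>c=0..<d. \<mu> c) = S + ?T"
      unfolding S_def using L by (subst sum.atLeastLessThan_concat) auto
    then have "k * exp ((S + ?T - \<epsilon>) * t) \<le> vol (\<Phi> t)" using k(2)[OF t] vol_square[OF \<Phi>(1)[OF t]] by simp
    also have "\<dots> \<le> \<rho> t * (\<Prod>c=L..<d. euclid_norm (col (\<Phi> t) c))"
      using vol_le_first_cols[OF \<Phi>(1)[OF t]] L by simp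
    also have "\<dots> \<le> \<rho> t * (K ^ (d - L) * exp ((?T + real (d - L) * \<epsilon>) * t))"
      using prod_bound[of "{L..<d}" "\<lambda>c. c", OF _ _ t] \<rho>_pos[OF t] by (intro mult_left_mono) auto
    finally have "k * exp ((S + ?T - \<epsilon>) * t) \<le> \<rho> t * K ^ (d - L) * exp ((?T + real (d - L) * \<epsilon>) * t)"
      by (simp only: mult.assoc)
    then have "k * (exp ((S + ?T - \<epsilon>) * t) / exp ((?T + real (d - L) * \<epsilon>) * t)) \<le> \<rho> t * K ^ (d - L)"
      by (simp add: field_simps)
    also have "exp ((S + ?T - \<epsilon>) * t) / exp ((?T + real (d - L) * \<epsilon>) * t) = exp ((S - (real (d - L) + 1) * \<epsilon>) * t)"
      by (simp add: exp_diff[symmetric] algebra_simps)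
    finally have 1: "\<kappa> * exp ((S - (real (d - L) + 1) * \<epsilon>) * t) \<le> \<rho> t"
      using K(1) by (simp add: \<kappa>_def field_simps)
    have "(real (d - L) + 1) * \<epsilon> \<le> (real d + 1) * \<epsilon>" using \<epsilon> by (intro mult_right_mono) auto
    then have "(S - \<gamma> / 4) * t \<le> (S - (real (d - L) + 1) * \<epsilon>) * t"
      unfolding d\<epsilon> using t by (intro mult_right_mono) auto
    then have "\<kappa> * exp ((S - \<gamma> / 4) * t) \<le> \<kappa> * exp ((S - (real (d - L) + 1) * \<epsilon>) * t)"
      using \<kappa> by (intro mult_left_mono) auto
    then show ?thesis using 1 by linarith
  qed
  have "vol (select_cols (\<Phi> t) L g) \<le> M / \<kappa> * exp (- (\<gamma> / 2) * t) * \<rho> t"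
    if t: "0 \<le> t" and g: "g \<in> index_maps L d" and img: "g ` {0..<L} \<noteq> {0..<L}" for t g
  proof (cases "inj_on g {0..<L}")
    case False
    then have "vol (select_cols (\<Phi> t) L g) = 0" using vol_select_cols_not_inj[OF \<Phi>(1)[OF t] g] by simp
    then show ?thesis using M \<kappa> \<rho>_pos[OF t] by (simp add: less_imp_le)
  next
    case True
    have gb: "g j < d" if "j < L" for j using that g by (auto simp: PiE_def Pi_def)
    have sc: "select_cols (\<Phi> t) L g \<in> carrier_mat d L" using \<Phi>(1)[OF t] by (auto simp: select_cols_def)
    have "(\<Prod>j=0..<L. euclid_norm (col (select_cols (\<Phi> t) L g) j)) = (\<Prod>j=0..<L. euclid_norm (col (\<Phi> t) (g j)))"
      using gb \<Phi>(1)[OF t] by (intro prod.cong refl arg_cong[of _ _ euclid_norm]) (auto simp: select_cols_def intro!: eq_vecI)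
    also have "\<dots> \<le> K ^ L * exp (((\<Sum>j=0..<L. \<mu> (g j)) + real L * \<epsilon>) * t)"
      using prod_bound[of "{0..<L}" g, OF _ _ t] gb by simp
    finally have pb: "(\<Prod>j=0..<L. euclid_norm (col (select_cols (\<Phi> t) L g) j)) \<le> K ^ L * exp (((\<Sum>j=0..<L. \<mu> (g j)) + real L * \<epsilon>) * t)" .
    have eb: "exp (((\<Sum>j=0..<L. \<mu> (g j)) + real L * \<epsilon>) * t) \<le> exp ((S - \<gamma> + \<gamma> / 4) * t)"
    proof -
      have "(\<Sum>j=0..<L. \<mu> (g j)) \<le> S - \<gamma>"
        using sum_injective_index_le(2)[of d \<mu> g L] antitone g True img by (simp add: S_def \<gamma>_def)
      moreover have "real L * \<epsilon> \<le> (real d + 1) * \<epsilon>" using \<epsilon> L by (intro mult_right_mono) auto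
      ultimately have "(\<Sum>j=0..<L. \<mu> (g j)) + real L * \<epsilon> \<le> S - \<gamma> + \<gamma> / 4" using d\<epsilon> by linarith
      then show ?thesis using t by (simp add: mult_right_mono)
    qed
    have "vol (select_cols (\<Phi> t) L g) \<le> real d ^ L * fact L * (\<Prod>j=0..<L. euclid_norm (col (select_cols (\<Phi> t) L g) j))"
      by (rule vol_le_prod_col_norms[OF sc])
    also have "\<dots> \<le> real d ^ L * fact L * (K ^ L * exp ((S - \<gamma> + \<gamma> / 4) * t))"
      using K(1) by (intro mult_left_mono order_trans[OF pb] eb) auto
    also have "\<dots> = M * exp ((S - \<gamma> + \<gamma> / 4) * t)" by (simp only: M_def mult.assoc)
    also have "exp ((S - \<gamma> + \<gamma> / 4) * t) = exp (- (\<gamma> / 2) * t) * exp ((S - \<gamma> / 4) * t)"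
      by (simp add: exp_add[symmetric] algebra_simps)
    also have "M * (exp (- (\<gamma> / 2) * t) * exp ((S - \<gamma> / 4) * t)) = M / \<kappa> * exp (- (\<gamma> / 2) * t) * (\<kappa> * exp ((S - \<gamma> / 4) * t))"
      using \<kappa> by simp
    also have "\<dots> \<le> M / \<kappa> * exp (- (\<gamma> / 2) * t) * \<rho> t"
      using low[OF t] M \<kappa> by (intro mult_left_mono) auto
    finally show ?thesis .
  qed
  then show ?thesis using M \<kappa> \<gamma> by (intro exI[of _ "M / \<kappa>"] conjI exI[of _ "\<gamma> / 2"]) auto
qed

text \<open>All \<open>L\<close>-tuples of columns span at most a multiple of \<open>\<rho>\<close>: those that permute the first \<open>L\<close> columns span
  exactly \<open>\<rho>\<close>, the others are exponentially small.\<close>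

lemma vol_uniformly_dominated:
  "\<exists>K\<ge>0. \<forall>t\<ge>0. \<forall>Z\<in>carrier_mat d L. (\<forall>i<d. \<forall>j<L. \<bar>Z $$ (i, j)\<bar> \<le> B) \<longrightarrow> vol (\<Phi> t * Z) \<le> K * \<rho> t"
proof -
  obtain K \<eta> where K0: "0 < K" "0 < \<eta>" and K1: "\<forall>t\<ge>0. \<forall>g\<in>index_maps L d. g ` {0..<L} \<noteq> {0..<L} \<longrightarrow>
    vol (select_cols (\<Phi> t) L g) \<le> K * exp (- \<eta> * t) * \<rho> t"
    using select_cols_small by (elim exE conjE) simp
  have K2: "vol (select_cols (\<Phi> t) L g) \<le> K * exp (- \<eta> * t) * \<rho> t"
    if "0 \<le> t" "g \<in> index_maps L d" "g ` {0..<L} \<noteq> {0..<L}" for t g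
    using K1[rule_format, OF that] .
  note K = K0 K2
  have sel: "vol (select_cols (\<Phi> t) L g) \<le> (1 + K) * \<rho> t" if t: "0 \<le> t" and g: "g \<in> index_maps L d" for t g
  proof (cases "g ` {0..<L} = {0..<L}")
    case True
    then have "inj_on g {0..<L}" by (intro eq_card_imp_inj_on) auto
    then have "vol (select_cols (\<Phi> t) L g) = \<rho> t"
      using vol_select_cols_permute[OF \<Phi>(1)[OF t] _ g _ True] L by simp
    then show ?thesis using K(1) \<rho>_pos[OF t] by (simp add: distrib_right)
  next
    case False
    have "K * exp (- \<eta> * t) * \<rho> t \<le> K * 1 * \<rho> t"
      using K t \<rho>_pos[OF t] by (intro mult_right_mono mult_left_mono) auto
    then show ?thesis using K(3)[OF t g False] \<rho>_pos[OF t] by (simp add: distrib_right)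
  qed
  have "vol (\<Phi> t * Z) \<le> (\<Sum>g\<in>index_maps L d. max 0 B ^ L * (1 + K)) * \<rho> t"
    if t: "0 \<le> t" and Z: "Z \<in> carrier_mat d L" and B: "\<And>i j. i < d \<Longrightarrow> j < L \<Longrightarrow> \<bar>Z $$ (i, j)\<bar> \<le> B" for t Z
  proof -
    have "vol (\<Phi> t * Z) \<le> (\<Sum>g\<in>index_maps L d. (\<Prod>j=0..<L. \<bar>Z $$ (g j, j)\<bar>) * vol (select_cols (\<Phi> t) L g))"
      by (rule vol_mult_expand[OF \<Phi>(1)[OF t] Z])
    also have "\<dots> \<le> (\<Sum>g\<in>index_maps L d. max 0 B ^ L * ((1 + K) * \<rho> t))"
    proof (rule sum_mono)
      fix g assume g: "g \<in> index_maps L d"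
      then have gb: "g j < d" if "j < L" for j using that by (auto simp: PiE_def Pi_def)
      have "(\<Prod>j=0..<L. \<bar>Z $$ (g j, j)\<bar>) \<le> (\<Prod>j=0..<L. max 0 B)"
        using B gb by (intro prod_mono) (auto simp: le_max_iff_disj)
      then show "(\<Prod>j=0..<L. \<bar>Z $$ (g j, j)\<bar>) * vol (select_cols (\<Phi> t) L g) \<le> max 0 B ^ L * ((1 + K) * \<rho> t)"
        using sel[OF t g] by (intro mult_mono) auto
    qed
    finally show ?thesis by (simp only: sum_distrib_right mult.assoc)
  qed
  then show ?thesis
    using K(1) by (intro exI[of _ "\<Sum>g\<in>index_maps L d. max 0 B ^ L * (1 + K)"]) (auto intro!: sum_nonneg)
qed

text \<open>If some vector of the frame has no component along the first \<open>L\<close> columns, then the terms of the expansion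
  that permute these columns vanish.\<close>

lemma vol_negligible:
  assumes Z: "Z \<in> carrier_mat d L" and j: "j < L" and zero: "\<And>i. i < L \<Longrightarrow> Z $$ (i, j) = 0"
  shows "((\<lambda>t. vol (\<Phi> t * Z) / \<rho> t) \<longlongrightarrow> 0) at_top"
proof -
  obtain K \<eta> where K0: "0 < K" "0 < \<eta>" and K1: "\<forall>t\<ge>0. \<forall>g\<in>index_maps L d. g ` {0..<L} \<noteq> {0..<L} \<longrightarrow>
    vol (select_cols (\<Phi> t) L g) \<le> K * exp (- \<eta> * t) * \<rho> t"
    using select_cols_small by (elim exE conjE) simp
  have K2: "vol (select_cols (\<Phi> t) L g) \<le> K * exp (- \<eta> * t) * \<rho> t"
    if "0 \<le> t" "g \<in> index_maps L d" "g ` {0..<L} \<noteq> {0..<L}" for t g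
    using K1[rule_format, OF that] .
  note K = K0 K2
  define P where "P = (\<Sum>g\<in>index_maps L d. \<Prod>j=0..<L. \<bar>Z $$ (g j, j)\<bar>)"
  have le: "vol (\<Phi> t * Z) / \<rho> t \<le> P * (K * exp (- \<eta> * t))" if t: "0 \<le> t" for t
  proof -
    have "vol (\<Phi> t * Z) \<le> (\<Sum>g\<in>index_maps L d. (\<Prod>j=0..<L. \<bar>Z $$ (g j, j)\<bar>) * vol (select_cols (\<Phi> t) L g))"
      by (rule vol_mult_expand[OF \<Phi>(1)[OF t] Z])
    also have "\<dots> \<le> (\<Sum>g\<in>index_maps L d. (\<Prod>j=0..<L. \<bar>Z $$ (g j, j)\<bar>) * (K * exp (- \<eta> * t) * \<rho> t))"
    proof (rule sum_mono)
      fix g assume g: "g \<in> index_maps L d"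
      show "(\<Prod>j=0..<L. \<bar>Z $$ (g j, j)\<bar>) * vol (select_cols (\<Phi> t) L g) \<le>
        (\<Prod>j=0..<L. \<bar>Z $$ (g j, j)\<bar>) * (K * exp (- \<eta> * t) * \<rho> t)"
      proof (cases "g ` {0..<L} = {0..<L}")
        case True
        then have "g j < L" using j by (metis atLeastLessThan_iff imageI le0)
        then have "(\<Prod>j=0..<L. \<bar>Z $$ (g j, j)\<bar>) = 0" using zero j by (intro prod_zero bexI[of _ j]) auto
        then show ?thesis by (simp only: mult_zero_left order_refl)
      next
        case False
        then show ?thesis using K(3)[OF t g] by (intro mult_left_mono prod_nonneg) auto
      qed
    qed
    also have "\<dots> = P * (K * exp (- \<eta> * t)) * \<rho> t" by (simp only: P_def sum_distrib_right mult.assoc)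
    finally show ?thesis using \<rho>_pos[OF t] by (simp add: field_simps)
  qed
  have "filterlim (\<lambda>t::real. - \<eta> * t) at_bot at_top"
    using K(2) by (intro filterlim_tendsto_neg_mult_at_bot[OF tendsto_const] filterlim_ident) auto
  then have "((\<lambda>t. exp (- \<eta> * t)) \<longlongrightarrow> 0) at_top" by (rule filterlim_compose[OF exp_at_bot])
  then have lim: "((\<lambda>t. P * (K * exp (- \<eta> * t))) \<longlongrightarrow> 0) at_top"
    by (intro tendsto_mult_right_zero)
  show ?thesis
  proof (rule tendsto_sandwich[OF _ _ tendsto_const lim])
    show "eventually (\<lambda>t. 0 \<le> vol (\<Phi> t * Z) / \<rho> t) at_top" by (intro always_eventually allI) simp
    show "eventually (\<lambda>t. vol (\<Phi> t * Z) / \<rho> t \<le> P * (K * exp (- \<eta> * t))) at_top"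
      using eventually_ge_at_top[of 0] le by (rule eventually_mono)
  qed
qed

abbreviation transition :: "real \<Rightarrow> real \<Rightarrow> real mat" where
  "transition t s \<equiv> \<Phi> t * inv_mat (\<Phi> s)"

abbreviation top_singular :: "real mat \<Rightarrow> real" where
  "top_singular M \<equiv> \<Prod>k=1..L. singular_value k M"

lemma transition:
  assumes "0 \<le> s" "0 \<le> t"
  shows "transition t s \<in> carrier_mat d d" "Determinant.det (transition t s) \<noteq> 0"
    "\<And>Z m. Z \<in> carrier_mat d m \<Longrightarrow> transition t s * (\<Phi> s * Z) = \<Phi> t * Z"
proof -
  note i = inv_mat_inverse[OF \<Phi>[OF assms(1)]]
  note P = \<Phi>(1)[OF assms(1)] \<Phi>(1)[OF assms(2)]
  show c: "transition t s \<in> carrier_mat d d" using P(2) i(1) by simp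
  have "Determinant.det (inv_mat (\<Phi> s)) \<noteq> 0" using inv_mat_unique(2)[OF i(1) P(1) i(2)] .
  then show "Determinant.det (transition t s) \<noteq> 0" using det_mult[OF P(2) i(1)] \<Phi>(2)[OF assms(2)] by simp
  fix Z :: "real mat" and m assume Z: "Z \<in> carrier_mat d m"
  have "transition t s * (\<Phi> s * Z) = \<Phi> t * (inv_mat (\<Phi> s) * (\<Phi> s * Z))"
    using P i(1) Z by (intro assoc_mult_mat) auto
  also have "inv_mat (\<Phi> s) * (\<Phi> s * Z) = (inv_mat (\<Phi> s) * \<Phi> s) * Z"
    using P i(1) Z by (intro assoc_mult_mat[symmetric]) auto
  finally show "transition t s * (\<Phi> s * Z) = \<Phi> t * Z" unfolding i(3) using Z by simp
qed

text \<open>By \<open>vol_uniformly_dominated\<close> the largest expansion of volume by \<open>transition t 0\<close> is at most a multiple of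
  \<open>\<rho> t\<close>, and \<open>\<rho> s\<close> is at most a multiple of the one by \<open>transition s 0\<close>. Inserting both into the inequality
  for the products of singular values leaves an inequality between volumes.\<close>

theorem volume_dominated:
  assumes FI: "\<And>s t. 0 \<le> s \<Longrightarrow> s \<le> t \<Longrightarrow>
    top_singular (transition t s) * top_singular (transition s 0) \<le> C * top_singular (transition t 0)" and C: "0 \<le> C"
  shows "\<exists>K. volume_dominated d L \<Phi> K"
proof -
  note P0 = \<Phi>(1)[of 0, simplified]
  note i0 = inv_mat_inverse[OF \<Phi>(1)[OF order_refl] \<Phi>(2)[OF order_refl]]
  \<comment> \<open>A bound for the entries of \<open>inv_mat (\<Phi> 0) * Z\<close> when \<open>Z\<close> has orthonormal columns.\<close>
  define B where "B = real d * (op_norm (inv_mat (\<Phi> 0)) * 1)"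
  obtain K where K0: "0 \<le> K" and K1: "\<forall>t\<ge>0. \<forall>Z\<in>carrier_mat d L. (\<forall>i<d. \<forall>j<L. \<bar>Z $$ (i, j)\<bar> \<le> B) \<longrightarrow> vol (\<Phi> t * Z) \<le> K * \<rho> t"
    using vol_uniformly_dominated[of B] by (elim exE conjE) simp
  have K2: "vol (\<Phi> t * Z) \<le> K * \<rho> t"
    if "0 \<le> t" "Z \<in> carrier_mat d L" "\<And>i j. i < d \<Longrightarrow> j < L \<Longrightarrow> \<bar>Z $$ (i, j)\<bar> \<le> B" for t Z
    using K1[rule_format, OF that(1,2)] that(3) by blast
  note K = K0 K2
  have top: "top_singular (transition t 0) \<le> K * \<rho> t" if t: "0 \<le> t" for t
  proof -
    note tr = transition[OF order_refl t]
    obtain Z where Z: "Z \<in> carrier_mat d L" "transpose_mat Z * Z = 1\<^sub>m L"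
      "vol (transition t 0 * Z) = top_singular (transition t 0)"
      using singular_value_product(2)[OF tr(1,2) less_imp_le[OF L(2)]] by blast
    let ?Y = "inv_mat (\<Phi> 0) * Z"
    have Y: "?Y \<in> carrier_mat d L" using i0(1) Z by simp
    have "transition t 0 * Z = \<Phi> t * ?Y" using \<Phi>(1)[OF t] i0(1) Z(1) by (intro assoc_mult_mat) auto
    moreover have "\<bar>?Y $$ (i, j)\<bar> \<le> B" if ij: "i < d" "j < L" for i j
    proof -
      have colZ: "col Z j \<in> carrier_vec d" using Z(1) ij by auto
      have "(transpose_mat Z * Z) $$ (j, j) = col Z j \<bullet> col Z j" using Z(1) ij by simp
      then have "euclid_norm (col Z j) = 1" unfolding Z(2) euclid_norm_def using ij by simp
      then have zk: "\<bar>Z $$ (k, j)\<bar> \<le> 1" if "k < d" for k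
        using abs_vec_index_le_euclid_norm[of k "col Z j"] Z(1) that ij by simp
      have "\<bar>?Y $$ (i, j)\<bar> = \<bar>\<Sum>k<d. inv_mat (\<Phi> 0) $$ (i, k) * Z $$ (k, j)\<bar>"
        using i0(1) Z(1) ij by (simp add: scalar_prod_def lessThan_atLeast0)
      also have "\<dots> \<le> (\<Sum>k<d. \<bar>inv_mat (\<Phi> 0) $$ (i, k) * Z $$ (k, j)\<bar>)" by (rule sum_abs)
      also have "\<dots> \<le> (\<Sum>k<d. op_norm (inv_mat (\<Phi> 0)) * 1)"
        unfolding abs_mult using abs_mat_index_le_op_norm[OF i0(1) ij(1)] zk op_norm_nonneg by (intro sum_mono mult_mono) auto
      finally show ?thesis by (simp add: B_def)
    qed
    ultimately show ?thesis using K(2)[OF t Y] Z(3) by simp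
  qed
  have dom: "vol (\<Phi> t * Z) * \<rho> s \<le> (C * K * \<rho> 0) * \<rho> t * vol (\<Phi> s * Z)"
    if s: "0 \<le> s" "s \<le> t" and Z: "Z \<in> carrier_mat d L" for s t Z
  proof -
    have t: "0 \<le> t" using s by simp
    have e: "\<Phi> s = transition s 0 * \<Phi> 0"
      using transition(3)[OF order_refl s(1), of "1\<^sub>m d" d] P0 \<Phi>(1)[OF s(1)] by simp
    have "first_cols (\<Phi> s) L = transition s 0 * first_cols (\<Phi> 0) L"
      using mult_first_cols[OF transition(1)[OF order_refl s(1)] P0, of L] L e by simp
    then have 1: "\<rho> s \<le> top_singular (transition s 0) * \<rho> 0"
      using singular_value_product(1)[OF transition(1,2)[OF order_refl s(1)], of L "first_cols (\<Phi> 0) L"] L first_cols_carrier[OF P0] by simp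
    have "\<Phi> s * Z \<in> carrier_mat d L" using \<Phi>(1)[OF s(1)] Z by simp
    from singular_value_product(1)[OF transition(1,2)[OF s(1) t] _ this]
    have 2: "vol (\<Phi> t * Z) \<le> top_singular (transition t s) * vol (\<Phi> s * Z)"
      unfolding transition(3)[OF s(1) t Z] using L by simp
    have nn: "0 \<le> top_singular (transition t s)"
      using singular_value_pos[OF transition(1,2)[OF s(1) t]] L by (intro prod_nonneg) (auto intro: less_imp_le)
    have "vol (\<Phi> t * Z) * \<rho> s \<le> (top_singular (transition t s) * vol (\<Phi> s * Z)) * (top_singular (transition s 0) * \<rho> 0)"
      using 1 2 nn by (intro mult_mono) auto
    also have "\<dots> = (top_singular (transition t s) * top_singular (transition s 0)) * (\<rho> 0 * vol (\<Phi> s * Z))"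
      by (simp only: mult_ac)
    also have "\<dots> \<le> (C * top_singular (transition t 0)) * (\<rho> 0 * vol (\<Phi> s * Z))"
      using FI[OF s] by (intro mult_right_mono) auto
    also have "\<dots> \<le> (C * (K * \<rho> t)) * (\<rho> 0 * vol (\<Phi> s * Z))"
      using top[OF t] C by (intro mult_right_mono mult_left_mono) auto
    finally show ?thesis by (simp only: mult_ac)
  qed
  have "volume_dominated d L \<Phi> (C * K * \<rho> 0)"
    by unfold_locales (use L \<Phi> dom vol_negligible in auto)
  then show ?thesis ..
qed

end

section \<open>Fundamental matrices adapted to the Lyapunov filtration\<close>

lemma (in vectorspace) extend_to_basis_of_subspace:
  assumes fd: "fin_dim" and W: "subspace K W V" and B: "B \<subseteq> W" "lin_indpt B"
  shows "\<exists>B'. finite B' \<and> B \<subseteq> B' \<and> B' \<subseteq> W \<and> lin_indpt B' \<and> span B' = W \<and>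
    card B' = vectorspace.dim K (vs W)"
proof -
  have sub: "submodule K W V" using W by simp
  have Wc: "W \<subseteq> carrier V" using sub by (simp add: submodule_def)
  let ?P = "\<lambda>S. B \<subseteq> S \<and> S \<subseteq> W \<and> lin_indpt S"
  have bound: "finite A \<and> card A \<le> dim" if "?P A" for A
    using li_le_dim[OF fd, of A] that Wc by blast
  obtain B' where B': "finite B'" "maximal B' ?P"
    using maximal_exists[of ?P dim B] bound B by blast
  then have P: "?P B'" by (simp add: maximal_def)
  have "W \<subseteq> span B'"
  proof
    fix w assume w: "w \<in> W"
    show "w \<in> span B'"
    proof (rule ccontr)
      assume n: "w \<notin> span B'"
      have B'c: "B' \<subseteq> carrier V" using P Wc by blast
      then have "w \<notin> B'" using n in_own_span by blast
      then have "lin_indpt (B' \<union> {w})"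
        using lin_dep_iff_in_span[of B' w] B'c P w Wc n by blast
      then have "?P (B' \<union> {w})" using P w by blast
      then have "B' \<union> {w} = B'" using B'(2) unfolding maximal_def by blast
      then show False using \<open>w \<notin> B'\<close> by blast
    qed
  qed
  moreover have "span B' \<subseteq> W" using span_is_subset[OF _ sub] P by blast
  ultimately have span: "span B' = W" by blast
  have vsW: "vectorspace K (vs W)" using subspace_is_vs[OF W] .
  have "vectorspace.basis K (vs W) B'"
    unfolding vectorspace.basis_def[OF vsW] using P span span_li_not_depend[OF _ sub, of B'] by simp
  then have "card B' = vectorspace.dim K (vs W)"
    using vectorspace.dim_basis[OF vsW B'(1)] by simp
  then show ?thesis using B'(1) P span by blast
qed

text \<open>Starting from the smallest subspace, each step puts new basis vectors in front of the list, so that the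
  bases of the smaller subspaces are its tails.\<close>

lemma (in vectorspace) basis_adapted_to_chain:
  assumes fd: "fin_dim" and W: "\<And>j. k \<le> j \<Longrightarrow> j \<le> q \<Longrightarrow> subspace K (W j) V"
    and mono: "\<And>j. k \<le> j \<Longrightarrow> j < q \<Longrightarrow> W (Suc j) \<subseteq> W j" and last: "W q = {\<zero>\<^bsub>V\<^esub>}" and "k \<le> q"
  defines "n \<equiv> \<lambda>j. vectorspace.dim K (vs (W j))"
  shows "\<exists>xs. distinct xs \<and> length xs = n k \<and> set xs \<subseteq> W k \<and> lin_indpt (set xs) \<and>
    (\<forall>j. k \<le> j \<longrightarrow> j \<le> q \<longrightarrow> n j \<le> n k \<and> span (set (drop (n k - n j) xs)) = W j)"
  using \<open>k \<le> q\<close> W mono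
proof (induction rule: inc_induct)
  case base
  have vsq: "vectorspace K (vs (W q))" using base subspace_is_vs by blast
  have s0: "span {} = {\<zero>\<^bsub>V\<^esub>}" by (rule span_empty)
  have li: "lin_indpt {}" by (simp add: lin_dep_def)
  obtain B' where "finite B'" "lin_indpt B'" "B' \<subseteq> W q" "card B' = n q"
    using extend_to_basis_of_subspace[OF fd base(1)[of q], of "{}"] li n_def by auto
  moreover have "\<zero>\<^bsub>V\<^esub> \<notin> B'"
    using vs_zero_lin_dep[of B'] \<open>lin_indpt B'\<close> \<open>B' \<subseteq> W q\<close> last by auto
  ultimately have "n q = 0" using last by (metis card.empty subset_singletonD singletonI)
  then show ?case using s0 li last by (intro exI[of _ "[]"]) auto
next
  case (step k)
  then obtain xs where xs: "distinct xs" "length xs = n (Suc k)" "set xs \<subseteq> W (Suc k)" "lin_indpt (set xs)"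
    and sp: "\<And>j. Suc k \<le> j \<Longrightarrow> j \<le> q \<Longrightarrow> n j \<le> n (Suc k) \<and> span (set (drop (n (Suc k) - n j) xs)) = W j"
    by (metis Suc_leD)
  have "set xs \<subseteq> W k" using xs(3) step by blast
  then obtain B' where B': "finite B'" "set xs \<subseteq> B'" "B' \<subseteq> W k" "lin_indpt B'" "span B' = W k" "card B' = n k"
    using extend_to_basis_of_subspace[OF fd step(4)[of k] _ xs(4)] step(1,2) unfolding n_def by auto
  obtain zs where zs: "set zs = B' - set xs" "distinct zs" using finite_distinct_list[of "B' - set xs"] B'(1) by auto
  let ?ys = "zs @ xs"
  have d: "distinct ?ys" using zs xs by auto
  have s: "set ?ys = B'" using zs B'(2) by auto
  have len: "length ?ys = n k" using distinct_card[OF d] s B'(6) by simp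
  have "n j \<le> n k \<and> span (set (drop (n k - n j) ?ys)) = W j" if j: "k \<le> j" "j \<le> q" for j
  proof (cases "j = k")
    case True
    then show ?thesis using s B'(5) by simp
  next
    case False
    then have j': "Suc k \<le> j" using j by simp
    have "length zs = n k - n (Suc k)" "n (Suc k) \<le> n k" using len xs(2) by auto
    moreover have "n j \<le> n (Suc k)" using sp[OF j' j(2)] by simp
    ultimately have "length zs \<le> n k - n j" "n k - n j - length zs = n (Suc k) - n j" by arith+
    then have "drop (n k - n j) ?ys = drop (n (Suc k) - n j) xs" by simp
    then show ?thesis using sp[OF j' j(2)] \<open>n (Suc k) \<le> n k\<close> by simp
  qed
  then show ?case using d len s B'(3,4) by (intro exI[of _ ?ys]) auto
qed

lemma solution_of_zero: "fundamental_matrix d A X \<Longrightarrow> solution_of X (0\<^sub>v d) = zero_solution d"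
  unfolding solution_of_def zero_solution_def
proof (intro restrict_ext)
  fix t :: real assume "fundamental_matrix d A X" "t \<in> {0..}"
  then have "X t \<in> carrier_mat d d" using fundamental_matrix_carrier by simp
  then show "X t *\<^sub>v 0\<^sub>v d = 0\<^sub>v d" by (intro eq_vecI) auto
qed

lemma solution_of_add:
  assumes "fundamental_matrix d A X" "c \<in> carrier_vec d" "c' \<in> carrier_vec d"
  shows "solution_of X (c + c') = (\<lambda>t\<in>{0..}. solution_of X c t + solution_of X c' t)"
  unfolding solution_of_def
  using mult_add_distrib_mat_vec[OF fundamental_matrix_carrier[OF assms(1)] assms(2,3)] by (intro restrict_ext) simp

lemma solution_of_smult:
  assumes "fundamental_matrix d A X" "c \<in> carrier_vec d"
  shows "solution_of X (k \<cdot>\<^sub>v c) = (\<lambda>t\<in>{0..}. k \<cdot>\<^sub>v solution_of X c t)"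
  unfolding solution_of_def
  using mult_mat_vec[OF fundamental_matrix_carrier[OF assms(1)] assms(2)] by (intro restrict_ext) simp

lemma solution_of_inj:
  assumes X: "fundamental_matrix d A X"
  shows "inj_on (solution_of X) (carrier_vec d)"
proof (rule inj_onI)
  fix c c' assume c: "c \<in> carrier_vec d" "c' \<in> carrier_vec d" and e: "solution_of X c = solution_of X c'"
  note Xc = fundamental_matrix_carrier[OF X order_refl]
  have "X 0 *\<^sub>v c = X 0 *\<^sub>v c'" using fun_cong[OF e, of 0] by (simp add: solution_of_def)
  then have "X 0 *\<^sub>v (c - c') = 0\<^sub>v d"
    using mult_minus_distrib_mat_vec[OF Xc c] mult_mat_vec_carrier[OF Xc c(2)] by simp
  then have "c - c' = 0\<^sub>v d"
    using mult_mat_vec_eq_0[OF Xc fundamental_matrix_det[OF X]] c by simp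
  then have "(c - c') $ i = 0" if "i < d" for i using that by simp
  then show "c = c'" using c by (intro eq_vecI) auto
qed

lemma fun_space_simps [simp]:
  "carrier (fun_space d V) = V" "\<zero>\<^bsub>fun_space d V\<^esub> = zero_solution d"
  "x \<oplus>\<^bsub>fun_space d V\<^esub> y = (\<lambda>t\<in>{0..}. x t + y t)"
  "k \<odot>\<^bsub>fun_space d V\<^esub> x = (\<lambda>t\<in>{0..}. k \<cdot>\<^sub>v x t)"
  by (simp_all add: fun_space_def)

lemma fun_space_restrict: "(fun_space d V)\<lparr>carrier := W\<rparr> = fun_space d W"
  by (simp add: fun_space_def)

text \<open>The solution space is the isomorphic image of the coefficient space under a fundamental matrix.\<close>

lemma solution_space_vectorspace:
  assumes A: "bounded_system d A" and X: "fundamental_matrix d A X"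
  shows "vectorspace (class_ring :: real ring) (fun_space d (solutions d A))"
    "linear_map (class_ring :: real ring) (module_vec TYPE(real) d) (fun_space d (solutions d A)) (solution_of X)"
proof -
  note sol = solutions_eq_image[OF A X]
  have repr: "\<exists>c\<in>carrier_vec d. x = solution_of X c" if "x \<in> solutions d A" for x using that sol by auto
  show vs: "vectorspace (class_ring :: real ring) (fun_space d (solutions d A))"
  proof (rule vs_criteria)
    show "field (class_ring :: real ring)" by (rule class_field)
    show "\<zero>\<^bsub>fun_space d (solutions d A)\<^esub> \<in> carrier (fun_space d (solutions d A))"
      using solution_of_zero[OF X] sol by (metis fun_space_simps(1,2) image_eqI zero_carrier_vec)
    have add: "(\<lambda>t\<in>{0..}. x t + y t) \<in> solutions d A" if "x \<in> solutions d A" "y \<in> solutions d A" for x y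
      using repr[OF that(1)] repr[OF that(2)] solution_of_add[OF X] solution_of_in_solutions[OF A X]
      by (metis add_carrier_vec)
    then show "\<forall>v w. v \<in> carrier (fun_space d (solutions d A)) \<and> w \<in> carrier (fun_space d (solutions d A)) \<longrightarrow>
        v \<oplus>\<^bsub>fun_space d (solutions d A)\<^esub> w \<in> carrier (fun_space d (solutions d A))" by simp
    have smult: "(\<lambda>t\<in>{0..}. k \<cdot>\<^sub>v x t) \<in> solutions d A" if "x \<in> solutions d A" for x k
      using repr[OF that] solution_of_smult[OF X] solution_of_in_solutions[OF A X] by (metis smult_carrier_vec)
    then show "\<forall>c v. c \<in> carrier (class_ring :: real ring) \<and> v \<in> carrier (fun_space d (solutions d A)) \<longrightarrow>
        c \<odot>\<^bsub>fun_space d (solutions d A)\<^esub> v \<in> carrier (fun_space d (solutions d A))" by simp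
    note c = solution_carrier[of _ d A]
    have ext: "x t = undefined" if "x \<in> solutions d A" "\<not> 0 \<le> t" for x t
      using that by (auto simp: solutions_def PiE_def extensional_def)
    show "\<forall>v\<in>carrier (fun_space d (solutions d A)). \<exists>neg_v\<in>carrier (fun_space d (solutions d A)).
        v \<oplus>\<^bsub>fun_space d (solutions d A)\<^esub> neg_v = \<zero>\<^bsub>fun_space d (solutions d A)\<^esub>"
    proof
      fix v assume "v \<in> carrier (fun_space d (solutions d A))"
      then have v: "v \<in> solutions d A" by simp
      have "v t + (-1) \<cdot>\<^sub>v v t = 0\<^sub>v d" if "0 \<le> t" for t using c[OF v that] by (intro eq_vecI) auto
      then have "(\<lambda>t\<in>{0..}. v t + (\<lambda>t\<in>{0..}. (-1) \<cdot>\<^sub>v v t) t) = zero_solution d"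
        by (auto simp: zero_solution_def intro!: ext)
      then show "\<exists>neg_v\<in>carrier (fun_space d (solutions d A)).
        v \<oplus>\<^bsub>fun_space d (solutions d A)\<^esub> neg_v = \<zero>\<^bsub>fun_space d (solutions d A)\<^esub>"
        using smult[OF v, of "-1"] by (intro bexI[of _ "\<lambda>t\<in>{0..}. (-1) \<cdot>\<^sub>v v t"]) auto
    qed
    show "\<forall>v w. v \<in> carrier (fun_space d (solutions d A)) \<and> w \<in> carrier (fun_space d (solutions d A)) \<longrightarrow>
        v \<oplus>\<^bsub>fun_space d (solutions d A)\<^esub> w = w \<oplus>\<^bsub>fun_space d (solutions d A)\<^esub> v"
      using c by (auto intro!: restrict_ext comm_add_vec[of _ d])
    show "\<forall>v w x. v \<in> carrier (fun_space d (solutions d A)) \<and> w \<in> carrier (fun_space d (solutions d A)) \<and> x \<in> carrier (fun_space d (solutions d A)) \<longrightarrow>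
        (v \<oplus>\<^bsub>fun_space d (solutions d A)\<^esub> w) \<oplus>\<^bsub>fun_space d (solutions d A)\<^esub> x =
        v \<oplus>\<^bsub>fun_space d (solutions d A)\<^esub> (w \<oplus>\<^bsub>fun_space d (solutions d A)\<^esub> x)"
      using c by (auto simp: assoc_add_vec[of _ d] intro!: ext)
    show "\<forall>v\<in>carrier (fun_space d (solutions d A)). v \<oplus>\<^bsub>fun_space d (solutions d A)\<^esub> \<zero>\<^bsub>fun_space d (solutions d A)\<^esub> = v"
    proof
      fix v assume "v \<in> carrier (fun_space d (solutions d A))"
      then have v: "v \<in> solutions d A" by simp
      have "(\<lambda>t\<in>{0..}. v t + zero_solution d t) t = v t" for t
        using c[OF v, of t] ext[OF v, of t] by (cases "0 \<le> t") (auto simp: zero_solution_def)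
      then show "v \<oplus>\<^bsub>fun_space d (solutions d A)\<^esub> \<zero>\<^bsub>fun_space d (solutions d A)\<^esub> = v" by (intro HOL.ext) simp
    qed
    show "\<forall>a b v. a \<in> carrier (class_ring :: real ring) \<and> b \<in> carrier (class_ring :: real ring) \<and> v \<in> carrier (fun_space d (solutions d A)) \<longrightarrow>
        (a \<otimes>\<^bsub>class_ring\<^esub> b) \<odot>\<^bsub>fun_space d (solutions d A)\<^esub> v = a \<odot>\<^bsub>fun_space d (solutions d A)\<^esub> (b \<odot>\<^bsub>fun_space d (solutions d A)\<^esub> v)"
      by (auto simp: class_ring_simps smult_smult_assoc intro!: ext)
    show "\<forall>v\<in>carrier (fun_space d (solutions d A)). \<one>\<^bsub>(class_ring :: real ring)\<^esub> \<odot>\<^bsub>fun_space d (solutions d A)\<^esub> v = v"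
    proof
      fix v assume "v \<in> carrier (fun_space d (solutions d A))"
      then have v: "v \<in> solutions d A" by simp
      have "(\<lambda>t\<in>{0..}. 1 \<cdot>\<^sub>v v t) t = v t" for t
        using ext[OF v, of t] by (cases "0 \<le> t") auto
      then show "\<one>\<^bsub>(class_ring :: real ring)\<^esub> \<odot>\<^bsub>fun_space d (solutions d A)\<^esub> v = v"
        by (intro HOL.ext) (simp add: class_ring_simps)
    qed
    show "\<forall>a b v. a \<in> carrier (class_ring :: real ring) \<and> b \<in> carrier (class_ring :: real ring) \<and> v \<in> carrier (fun_space d (solutions d A)) \<longrightarrow>
        (a \<oplus>\<^bsub>class_ring\<^esub> b) \<odot>\<^bsub>fun_space d (solutions d A)\<^esub> v =
        a \<odot>\<^bsub>fun_space d (solutions d A)\<^esub> v \<oplus>\<^bsub>fun_space d (solutions d A)\<^esub> (b \<odot>\<^bsub>fun_space d (solutions d A)\<^esub> v)"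
      by (auto simp: class_ring_simps add_smult_distrib_vec intro!: ext)
    show "\<forall>a v w. a \<in> carrier (class_ring :: real ring) \<and> v \<in> carrier (fun_space d (solutions d A)) \<and> w \<in> carrier (fun_space d (solutions d A)) \<longrightarrow>
        a \<odot>\<^bsub>fun_space d (solutions d A)\<^esub> (v \<oplus>\<^bsub>fun_space d (solutions d A)\<^esub> w) =
        a \<odot>\<^bsub>fun_space d (solutions d A)\<^esub> v \<oplus>\<^bsub>fun_space d (solutions d A)\<^esub> (a \<odot>\<^bsub>fun_space d (solutions d A)\<^esub> w)"
      using c by (auto simp: smult_add_distrib_vec[of _ d] intro!: ext)
  qed
  show "linear_map (class_ring :: real ring) (module_vec TYPE(real) d) (fun_space d (solutions d A)) (solution_of X)"
    unfolding linear_map_def mod_hom_def mod_hom_axioms_def module_hom_def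
    using vs vec_vs[where 'a = real, of d] vec_module[where 'a = real, of d]
      solution_of_add[OF X] solution_of_smult[OF X] solution_of_in_solutions[OF A X]
    by (auto simp: module_vec_simps vectorspace_def)
qed

lemma solution_space_dim:
  assumes A: "bounded_system d A"
  shows "vectorspace.fin_dim (class_ring :: real ring) (fun_space d (solutions d A))" "fun_dim d (solutions d A) = d"
proof -
  obtain X where X: "fundamental_matrix d A X" using fundamental_matrix_exists[OF A] by blast
  interpret T: linear_map "class_ring :: real ring" "module_vec TYPE(real) d" "fun_space d (solutions d A)" "solution_of X"
    by (rule solution_space_vectorspace(2)[OF A X])
  interpret v: vec_space "TYPE(real)" d .
  have surj: "solution_of X ` carrier (module_vec TYPE(real) d) = carrier (fun_space d (solutions d A))"
    using solutions_eq_image[OF A X] by (simp add: module_vec_simps)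
  have inj: "inj_on (solution_of X) (carrier (module_vec TYPE(real) d))"
    using solution_of_inj[OF X] by (simp add: module_vec_simps)
  have fd: "vectorspace.fin_dim (class_ring :: real ring) (module_vec TYPE(real) d)" by (rule v.fin_dim)
  show "vectorspace.fin_dim (class_ring :: real ring) (fun_space d (solutions d A))"
    by (rule T.surj_fin_dim[OF fd surj])
  show "fun_dim d (solutions d A) = d"
    unfolding fun_dim_def using T.dim_eq[OF fd inj surj] v.dim_is_n by simp
qed

lemma solution_lincomb:
  assumes A: "bounded_system d A" and S: "finite S" "S \<subseteq> solutions d A"
  shows "module.lincomb (fun_space d (solutions d A)) a S = (\<lambda>t\<in>{0..}. vec d (\<lambda>i. \<Sum>x\<in>S. a x * x t $ i))"
proof -
  obtain X where X: "fundamental_matrix d A X" using fundamental_matrix_exists[OF A] by blast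
  interpret V: vectorspace "class_ring :: real ring" "fun_space d (solutions d A)"
    by (rule solution_space_vectorspace(1)[OF A X])
  show ?thesis using S
  proof (induction S)
    case empty
    have "module.lincomb (fun_space d (solutions d A)) a {} = zero_solution d"
      by (simp add: V.lincomb_def)
    moreover have "(\<lambda>t\<in>{0..}. vec d (\<lambda>i. \<Sum>x\<in>{}. a x * x t $ i)) = zero_solution d"
      unfolding zero_solution_def by (intro restrict_ext eq_vecI) auto
    ultimately show ?case by simp
  next
    case (insert x S)
    have "module.lincomb (fun_space d (solutions d A)) a (insert x S) =
      a x \<odot>\<^bsub>fun_space d (solutions d A)\<^esub> x \<oplus>\<^bsub>fun_space d (solutions d A)\<^esub> module.lincomb (fun_space d (solutions d A)) a S"
      using V.lincomb_insert[of S a x] insert by (simp add: class_ring_simps)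
    also have "\<dots> = (\<lambda>t\<in>{0..}. vec d (\<lambda>i. \<Sum>x\<in>insert x S. a x * x t $ i))"
      unfolding insert.IH[OF insert_subset[THEN iffD1, OF insert.prems, THEN conjunct2]] fun_space_simps
    proof (rule restrict_ext)
      fix t :: real assume t: "t \<in> {0..}"
      have xt: "x t \<in> carrier_vec d" using solution_carrier[of x d A t] insert t by simp
      show "(\<lambda>t\<in>{0..}. a x \<cdot>\<^sub>v x t) t + (\<lambda>t\<in>{0..}. vec d (\<lambda>i. \<Sum>x\<in>S. a x * x t $ i)) t =
        vec d (\<lambda>i. \<Sum>x\<in>insert x S. a x * x t $ i)"
        using xt t insert(1,2) by (intro eq_vecI) auto
    qed
    finally show ?case .
  qed
qed

lemma char_exponent_zero: "char_exponent (zero_solution d) = -\<infinity>"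
proof -
  have "Limsup at_top (\<lambda>t::real. if euclid_norm (zero_solution d t) = 0 then -\<infinity> else ereal (1 / t * ln (euclid_norm (zero_solution d t)))) =
    Limsup at_top (\<lambda>t::real. -\<infinity>)"
    by (intro Limsup_eq eventually_mono[OF eventually_ge_at_top[of 0]]) (auto simp: zero_solution_def)
  then show ?thesis by (simp add: char_exponent_def Limsup_const)
qed

lemma char_exponent_smult_le:
  assumes x: "\<And>t. 0 \<le> t \<Longrightarrow> y t = k \<cdot>\<^sub>v x t" and \<chi>: "char_exponent x \<le> ereal l"
    and cont: "continuous_on {0..} (\<lambda>t. euclid_norm (x t))"
  shows "\<And>\<epsilon>. 0 < \<epsilon> \<Longrightarrow> \<exists>K>0. \<forall>t\<ge>0. euclid_norm (y t) \<le> K * exp ((l + \<epsilon>) * t)"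
proof -
  fix \<epsilon> :: real assume "0 < \<epsilon>"
  from exp_bound_of_char_exponent[OF cont \<chi> this] obtain K where
    K: "0 < K" "\<And>t. 0 \<le> t \<Longrightarrow> euclid_norm (x t) \<le> K * exp ((l + \<epsilon>) * t)" by blast
  have "euclid_norm (y t) \<le> (\<bar>k\<bar> + 1) * K * exp ((l + \<epsilon>) * t)" if t: "0 \<le> t" for t
  proof -
    have "\<bar>k\<bar> * euclid_norm (x t) \<le> (\<bar>k\<bar> + 1) * (K * exp ((l + \<epsilon>) * t))"
      using K(2)[OF t] by (intro mult_mono) auto
    then show ?thesis using x[OF t] by (simp add: euclid_norm_smult mult.assoc)
  qed
  then show "\<exists>K>0. \<forall>t\<ge>0. euclid_norm (y t) \<le> K * exp ((l + \<epsilon>) * t)"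
    using K(1) by (intro exI[of _ "(\<bar>k\<bar> + 1) * K"]) (auto intro!: mult_pos_pos)
qed

text \<open>Exponential bounds, rather than the limit superior itself, make it easy to see that sums of solutions do not
  have larger exponents.\<close>

lemma char_exponent_le_of_exp_bound:
  assumes "\<And>\<epsilon>. 0 < \<epsilon> \<Longrightarrow> \<exists>K>0. \<forall>t\<ge>0. euclid_norm (y t) \<le> K * exp ((l + \<epsilon>) * t)"
  shows "char_exponent y \<le> ereal l"
proof (rule ereal_le_epsilon2)
  fix \<epsilon> :: real assume \<epsilon>: "0 < \<epsilon>"
  have "0 < \<epsilon> / 2" using \<epsilon> by simp
  from assms[OF this] obtain K where K: "0 < K" "\<And>t. 0 \<le> t \<Longrightarrow> euclid_norm (y t) \<le> K * exp ((l + \<epsilon> / 2) * t)" by blast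
  have "eventually (\<lambda>t. (if euclid_norm (y t) = 0 then -\<infinity> else ereal (1 / t * ln (euclid_norm (y t)))) \<le> ereal (l + \<epsilon>)) at_top"
    using eventually_gt_at_top[of 0] eventually_ge_at_top[of "ln K / (\<epsilon> / 2)"]
  proof eventually_elim
    case (elim t)
    show ?case
    proof (cases "euclid_norm (y t) = 0")
      case False
      then have p: "0 < euclid_norm (y t)" using euclid_norm_nonneg[of "y t"] by linarith
      have "ln (euclid_norm (y t)) \<le> ln (K * exp ((l + \<epsilon> / 2) * t))"
        using K p elim(1) by (subst ln_le_cancel_iff) auto
      also have "\<dots> = ln K + (l + \<epsilon> / 2) * t" using K(1) by (simp add: ln_mult)
      also have "\<dots> \<le> \<epsilon> / 2 * t + (l + \<epsilon> / 2) * t" using elim \<epsilon> by (simp add: field_simps)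
      finally have "ln (euclid_norm (y t)) \<le> (l + \<epsilon>) * t" by (simp add: algebra_simps)
      then have "1 / t * ln (euclid_norm (y t)) \<le> l + \<epsilon>" using elim(1) by (simp add: field_simps)
      then show ?thesis using False by simp
    qed simp
  qed
  then have "char_exponent y \<le> ereal (l + \<epsilon>)" unfolding char_exponent_def by (rule Limsup_bounded)
  then show "char_exponent y \<le> ereal l + ereal \<epsilon>" by simp
qed

text \<open>The number of columns before block \<open>k\<close>; blocks are numbered from 1.\<close>

definition block_offset :: "(nat \<Rightarrow> nat) \<Rightarrow> nat \<Rightarrow> nat" where
  "block_offset m k = (\<Sum>i=1..<k. m i)"

lemma block_offset_Suc: "1 \<le> k \<Longrightarrow> block_offset m (Suc k) = block_offset m k + m k"
  by (simp add: block_offset_def)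

lemma block_offset_1 [simp]: "block_offset m (Suc 0) = 0"
  by (simp add: block_offset_def)

lemma block_offset_mono: "j \<le> k \<Longrightarrow> block_offset m j \<le> block_offset m k"
  unfolding block_offset_def by (intro sum_mono2) auto

lemma lyapunov_filtration_subspace:
  assumes A: "bounded_system d A"
  shows "subspace (class_ring :: real ring) (lyapunov_filtration d A p lam k) (fun_space d (solutions d A))"
proof -
  obtain X where X: "fundamental_matrix d A X" using fundamental_matrix_exists[OF A] by blast
  note vs = solution_space_vectorspace(1)[OF A X]
  interpret V: vectorspace "class_ring :: real ring" "fun_space d (solutions d A)" by (rule vs)
  have z: "zero_solution d \<in> solutions d A" using V.zero_closed by simp
  have cont: "continuous_on {0..} (\<lambda>t. euclid_norm (x t))" if "x \<in> solutions d A" for x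
    using solution_norm_continuous[OF X] that unfolding solutions_eq_image[OF A X] by blast
  have "submodule (class_ring :: real ring) (lyapunov_filtration d A p lam k) (fun_space d (solutions d A))"
  proof (cases "k = p + 1")
    case True
    have "(\<lambda>t\<in>{0..}. zero_solution d t + zero_solution d t) = zero_solution d"
      unfolding zero_solution_def by (intro restrict_ext) simp
    moreover have "(\<lambda>t\<in>{0..}. c \<cdot>\<^sub>v zero_solution d t) = zero_solution d" for c
      unfolding zero_solution_def by (intro restrict_ext eq_vecI) auto
    ultimately show ?thesis
      using z by (intro submodule.intro V.module_axioms) (simp_all add: lyapunov_filtration_def True)
  next
    case False
    have mem: "x \<in> lyapunov_filtration d A p lam k \<longleftrightarrow> x \<in> solutions d A \<and> char_exponent x \<le> ereal (lam k)" for x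
      using False by (simp add: lyapunov_filtration_def)
    show ?thesis
    proof (intro submodule.intro V.module_axioms)
      show "lyapunov_filtration d A p lam k \<subseteq> carrier (fun_space d (solutions d A))" using mem by auto
      show "\<zero>\<^bsub>fun_space d (solutions d A)\<^esub> \<in> lyapunov_filtration d A p lam k"
        using z by (simp add: mem char_exponent_zero)
      fix v assume v: "v \<in> lyapunov_filtration d A p lam k"
      then have vs: "v \<in> solutions d A" and v\<chi>: "char_exponent v \<le> ereal (lam k)" using mem by auto
      show "c \<odot>\<^bsub>fun_space d (solutions d A)\<^esub> v \<in> lyapunov_filtration d A p lam k" for c
        unfolding mem
      proof
        show "c \<odot>\<^bsub>fun_space d (solutions d A)\<^esub> v \<in> solutions d A"
          using V.smult_closed[of c v] vs by (simp add: class_ring_simps)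
        show "char_exponent (c \<odot>\<^bsub>fun_space d (solutions d A)\<^esub> v) \<le> ereal (lam k)"
          by (intro char_exponent_le_of_exp_bound char_exponent_smult_le[OF _ v\<chi> cont[OF vs], of _ c]) auto
      qed
      fix w assume w: "w \<in> lyapunov_filtration d A p lam k"
      then have ws: "w \<in> solutions d A" and w\<chi>: "char_exponent w \<le> ereal (lam k)" using mem by auto
      show "v \<oplus>\<^bsub>fun_space d (solutions d A)\<^esub> w \<in> lyapunov_filtration d A p lam k"
        unfolding mem
      proof
        show "v \<oplus>\<^bsub>fun_space d (solutions d A)\<^esub> w \<in> solutions d A"
          using V.a_closed[of v w] vs ws by simp
        show "char_exponent (v \<oplus>\<^bsub>fun_space d (solutions d A)\<^esub> w) \<le> ereal (lam k)"
        proof (rule char_exponent_le_of_exp_bound)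
          fix \<epsilon> :: real assume \<epsilon>: "0 < \<epsilon>"
          obtain K1 where K1: "0 < K1" "\<And>t. 0 \<le> t \<Longrightarrow> euclid_norm (v t) \<le> K1 * exp ((lam k + \<epsilon>) * t)"
            using exp_bound_of_char_exponent[OF cont[OF vs] v\<chi> \<epsilon>] by blast
          obtain K2 where K2: "0 < K2" "\<And>t. 0 \<le> t \<Longrightarrow> euclid_norm (w t) \<le> K2 * exp ((lam k + \<epsilon>) * t)"
            using exp_bound_of_char_exponent[OF cont[OF ws] w\<chi> \<epsilon>] by blast
          have "euclid_norm (v t + w t) \<le> (K1 + K2) * exp ((lam k + \<epsilon>) * t)" if t: "0 \<le> t" for t
            using euclid_norm_triangle[OF solution_carrier[OF vs t] solution_carrier[OF ws t]] K1(2)[OF t] K2(2)[OF t]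
            by (simp add: distrib_right)
          then show "\<exists>K>0. \<forall>t\<ge>0. euclid_norm ((v \<oplus>\<^bsub>fun_space d (solutions d A)\<^esub> w) t) \<le> K * exp ((lam k + \<epsilon>) * t)"
            using K1(1) K2(1) by (intro exI[of _ "K1 + K2"]) auto
        qed
      qed
    qed
  qed
  then show ?thesis by (intro subspace.intro vs)
qed

lemma fundamental_matrix_of_basis:
  assumes A: "bounded_system d A" and xs: "distinct xs" "length xs = d" "set xs \<subseteq> solutions d A"
    and li: "\<not> module.lin_dep (class_ring :: real ring) (fun_space d (solutions d A)) (set xs)"
  defines "\<Phi> \<equiv> \<lambda>t. mat d d (\<lambda>(i, j). (xs ! j) t $ i)"
  shows "fundamental_matrix d A \<Phi>"
    and "\<And>o'. o' \<le> d \<Longrightarrow> module.span (class_ring :: real ring) (fun_space d (solutions d A)) (set (drop o' xs)) =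
      solution_of \<Phi> ` {c \<in> carrier_vec d. \<forall>i<o'. c $ i = 0}"
proof -
  obtain X where X: "fundamental_matrix d A X" using fundamental_matrix_exists[OF A] by blast
  interpret V: vectorspace "class_ring :: real ring" "fun_space d (solutions d A)"
    by (rule solution_space_vectorspace(1)[OF A X])
  have xj: "xs ! j \<in> solutions d A" if "j < d" for j using xs that by auto
  have lc: "module.lincomb (fun_space d (solutions d A)) a (set (drop o' xs)) = solution_of \<Phi> c"
    if o': "o' \<le> d" and c: "c \<in> carrier_vec d" "\<And>i. i < o' \<Longrightarrow> c $ i = 0" and a: "\<And>j. o' \<le> j \<Longrightarrow> j < d \<Longrightarrow> a (xs ! j) = c $ j" for o' c a
  proof -
    have sub: "set (drop o' xs) \<subseteq> solutions d A" using xs set_drop_subset[of o' xs] by blast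
    have b: "bij_betw (\<lambda>j. xs ! j) {o'..<d} (set (drop o' xs))"
      unfolding bij_betw_def
    proof
      show "inj_on (\<lambda>j. xs ! j) {o'..<d}" using xs by (auto simp: inj_on_def nth_eq_iff_index_eq)
      show "(\<lambda>j. xs ! j) ` {o'..<d} = set (drop o' xs)"
      proof -
        have "drop o' xs = map ((!) xs) [o'..<d]" using xs(2) by (intro nth_equalityI) auto
        then show ?thesis by simp
      qed
    qed
    have "(\<Sum>x\<in>set (drop o' xs). a x * x t $ i) = (\<Phi> t *\<^sub>v c) $ i" if i: "i < d" for t i
    proof -
      have "(\<Sum>x\<in>set (drop o' xs). a x * x t $ i) = (\<Sum>j\<in>{o'..<d}. a (xs ! j) * (xs ! j) t $ i)"
        using sum.reindex_bij_betw[OF b, of "\<lambda>x. a x * x t $ i"] by simp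
      also have "\<dots> = (\<Sum>j\<in>{..<d}. \<Phi> t $$ (i, j) * c $ j)"
        using i a c(2) by (intro sum.mono_neutral_cong_left) (auto simp: \<Phi>_def not_le)
      also have "\<dots> = (\<Phi> t *\<^sub>v c) $ i"
        using mult_mat_vec_index_sum[OF _ c(1) i, of "\<Phi> t"] by (simp add: \<Phi>_def)
      finally show ?thesis .
    qed
    then show ?thesis
      unfolding solution_lincomb[OF A _ sub, simplified] solution_of_def
      by (intro restrict_ext eq_vecI) (auto simp: \<Phi>_def)
  qed
  show F: "fundamental_matrix d A \<Phi>"
    unfolding fundamental_matrix_def has_mat_derivative_def
  proof (intro conjI allI impI)
    have Pc: "\<Phi> t \<in> carrier_mat d d" for t by (simp add: \<Phi>_def)
    then show "mat_fun d \<Phi>" by (simp add: mat_fun_def)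
    show "mat_fun d (\<lambda>t. A t * \<Phi> t)"
      using Pc bounded_system_carrier[OF A] by (auto simp: mat_fun_def intro!: mult_carrier_mat)
    fix t :: real assume t: "0 \<le> t"
    show "((\<lambda>s. \<Phi> s $$ (i, j)) has_real_derivative (A t * \<Phi> t) $$ (i, j)) (at t within {0..})"
      if ij: "i < d" "j < d" for i j
    proof -
      have "((\<lambda>s. (xs ! j) s $ i) has_real_derivative (A t *\<^sub>v (xs ! j) t) $ i) (at t within {0..})"
        using xj[OF ij(2)] t ij(1) by (simp add: solutions_def)
      moreover have "col (\<Phi> t) j = (xs ! j) t"
        using solution_carrier[OF xj[OF ij(2)] t] ij(2) by (intro eq_vecI) (auto simp: \<Phi>_def)
      then have "(A t *\<^sub>v (xs ! j) t) $ i = (A t * \<Phi> t) $$ (i, j)"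
        using bounded_system_carrier[OF A t] ij Pc[of t] by simp
      moreover have "(\<lambda>s. (xs ! j) s $ i) = (\<lambda>s. \<Phi> s $$ (i, j))" using ij by (simp add: \<Phi>_def)
      ultimately show ?thesis by simp
    qed
    have "Determinant.det (\<Phi> t) \<noteq> 0"
    proof
      assume "Determinant.det (\<Phi> t) = 0"
      then obtain c where c: "c \<in> carrier_vec d" "c \<noteq> 0\<^sub>v d" "\<Phi> t *\<^sub>v c = 0\<^sub>v d"
        using det_0_iff_vec_prod_zero_field[OF Pc[of t]] by blast
      define a where "a = (\<lambda>x. c $ (THE j. j < d \<and> xs ! j = x))"
      have a: "a (xs ! j) = c $ j" if "j < d" for j
        unfolding a_def using xs that by (intro arg_cong[of _ _ "($) c"] the_equality) (auto simp: nth_eq_iff_index_eq)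
      have l: "module.lincomb (fun_space d (solutions d A)) a (set xs) = solution_of \<Phi> c"
        using lc[of 0 c a] a c(1) by simp
      have "solution_of \<Phi> c \<in> solutions d A"
        unfolding l[symmetric] using V.lincomb_closed[of "set xs" a] xs(3) by (simp add: class_ring_simps)
      then obtain e where e: "e \<in> carrier_vec d" "solution_of \<Phi> c = solution_of X e"
        using solutions_eq_image[OF A X] by blast
      have "X t *\<^sub>v e = 0\<^sub>v d" using fun_cong[OF e(2), of t] t c(3) by (simp add: solution_of_def)
      then have "e = 0\<^sub>v d"
        using mult_mat_vec_eq_0[OF fundamental_matrix_carrier[OF X t] fundamental_matrix_det[OF X t] e(1)] by simp
      then have "module.lincomb (fun_space d (solutions d A)) a (set xs) = \<zero>\<^bsub>fun_space d (solutions d A)\<^esub>"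
        using l e(2) solution_of_zero[OF X] by simp
      then have "a \<in> set xs \<rightarrow> {\<zero>\<^bsub>(class_ring :: real ring)\<^esub>}"
        using V.not_lindepD[OF li, of "set xs" a] by (simp add: class_ring_simps)
      then have "c $ j = 0" if "j < d" for j
        using a[OF that] xs(2) that nth_mem[of j xs] by (auto simp: class_ring_simps Pi_def)
      then have "c = 0\<^sub>v d" using c(1) by (intro eq_vecI) auto
      then show False using c(2) by simp
    qed
    then show "invertible_mat (\<Phi> t)" using invertible_mat_iff_det_nonzero[OF Pc] by blast
  qed
  fix o' assume o': "o' \<le> d"
  have sub: "set (drop o' xs) \<subseteq> carrier (fun_space d (solutions d A))" using xs set_drop_subset[of o' xs] by auto
  show "module.span (class_ring :: real ring) (fun_space d (solutions d A)) (set (drop o' xs)) =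
      solution_of \<Phi> ` {c \<in> carrier_vec d. \<forall>i<o'. c $ i = 0}"
  proof
    show "module.span (class_ring :: real ring) (fun_space d (solutions d A)) (set (drop o' xs)) \<subseteq>
      solution_of \<Phi> ` {c \<in> carrier_vec d. \<forall>i<o'. c $ i = 0}"
    proof
      fix x assume "x \<in> module.span (class_ring :: real ring) (fun_space d (solutions d A)) (set (drop o' xs))"
      then obtain a where a: "x = module.lincomb (fun_space d (solutions d A)) a (set (drop o' xs))"
        unfolding V.finite_span[OF List.finite_set sub] by blast
      have "x = solution_of \<Phi> (vec d (\<lambda>j. if j < o' then 0 else a (xs ! j)))"
        unfolding a using o' by (intro lc) auto
      then show "x \<in> solution_of \<Phi> ` {c \<in> carrier_vec d. \<forall>i<o'. c $ i = 0}"
        using o' by (intro image_eqI[of _ _ "vec d (\<lambda>j. if j < o' then 0 else a (xs ! j))"]) auto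
    qed
    show "solution_of \<Phi> ` {c \<in> carrier_vec d. \<forall>i<o'. c $ i = 0} \<subseteq>
      module.span (class_ring :: real ring) (fun_space d (solutions d A)) (set (drop o' xs))"
    proof
      fix x assume "x \<in> solution_of \<Phi> ` {c \<in> carrier_vec d. \<forall>i<o'. c $ i = 0}"
      then obtain c where c: "c \<in> carrier_vec d" "\<And>i. i < o' \<Longrightarrow> c $ i = 0" "x = solution_of \<Phi> c" by blast
      define a where "a = (\<lambda>x. c $ (THE j. j < d \<and> xs ! j = x))"
      have a: "a (xs ! j) = c $ j" if "j < d" for j
        unfolding a_def using xs that by (intro arg_cong[of _ _ "($) c"] the_equality) (auto simp: nth_eq_iff_index_eq)
      have "module.lincomb (fun_space d (solutions d A)) a (set (drop o' xs)) = x"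
        unfolding c(3) using o' c a by (intro lc) auto
      then show "x \<in> module.span (class_ring :: real ring) (fun_space d (solutions d A)) (set (drop o' xs))"
        unfolding V.finite_span[OF List.finite_set sub] by (auto simp: class_ring_simps)
    qed
  qed
qed

lemma strict_antimono_le_iff:
  fixes lam :: "nat \<Rightarrow> real"
  assumes "strict_antimono_on {1..p} lam" "i \<in> {1..p}" "j \<in> {1..p}"
  shows "lam i \<le> lam j \<longleftrightarrow> j \<le> i"
proof
  show "j \<le> i" if "lam i \<le> lam j"
  proof (rule ccontr)
    assume "\<not> j \<le> i"
    then have "lam j < lam i" using monotone_onD[OF assms(1,2,3)] by simp
    then show False using that by simp
  qed
  show "lam i \<le> lam j" if "j \<le> i"
    using that monotone_onD[OF assms(1,3,2)] by (cases "j = i") auto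
qed

locale lyapunov_spectrum =
  fixes d :: nat and A :: "real \<Rightarrow> real mat" and p :: nat and lam :: "nat \<Rightarrow> real" and m :: "nat \<Rightarrow> nat"
  assumes A: "bounded_system d A" and spectrum: "has_lyapunov_spectrum d A p lam m" and p: "1 \<le> p"
begin

abbreviation filt :: "nat \<Rightarrow> (real \<Rightarrow> real vec) set" where "filt \<equiv> lyapunov_filtration d A p lam"
abbreviation off :: "nat \<Rightarrow> nat" where "off \<equiv> block_offset m"

lemma lam_le_iff: "i \<in> {1..p} \<Longrightarrow> j \<in> {1..p} \<Longrightarrow> lam i \<le> lam j \<longleftrightarrow> j \<le> i"
  using spectrum strict_antimono_le_iff unfolding has_lyapunov_spectrum_def by blast

lemma exponent_cases:
  assumes "x \<in> solutions d A" "x \<noteq> zero_solution d"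
  obtains j where "j \<in> {1..p}" "char_exponent x = ereal (lam j)"
proof -
  have "char_exponent x \<in> lyapunov_exponents d A" using assms by (auto simp: lyapunov_exponents_def)
  then show thesis using that spectrum unfolding has_lyapunov_spectrum_def by auto
qed

lemma filt_last: "filt (Suc p) = {zero_solution d}" by (simp add: lyapunov_filtration_def)

lemma filt_iff: "k \<in> {1..p} \<Longrightarrow> x \<in> filt k \<longleftrightarrow> x \<in> solutions d A \<and> char_exponent x \<le> ereal (lam k)"
  by (simp add: lyapunov_filtration_def)

lemma filt_first: "filt 1 = solutions d A"
proof -
  have "char_exponent x \<le> ereal (lam 1)" if x: "x \<in> solutions d A" for x
  proof (cases "x = zero_solution d")
    case False
    then obtain j where "j \<in> {1..p}" "char_exponent x = ereal (lam j)" using exponent_cases[OF x] by blast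
    then show ?thesis using lam_le_iff[of j 1] p by simp
  qed (simp add: char_exponent_zero)
  then show ?thesis using p filt_iff[of 1] by auto
qed

lemma filt_mono:
  assumes "1 \<le> j" "j < Suc p"
  shows "filt (Suc j) \<subseteq> filt j"
proof
  fix x assume x: "x \<in> filt (Suc j)"
  show "x \<in> filt j"
  proof (cases "j = p")
    case True
    obtain X where X: "fundamental_matrix d A X" using fundamental_matrix_exists[OF A] by blast
    have "zero_solution d \<in> solutions d A"
      using solution_of_in_solutions[OF A X, of "0\<^sub>v d"] solution_of_zero[OF X] by simp
    then show ?thesis using x True p filt_last by (simp add: filt_iff char_exponent_zero)
  next
    case False
    then have "lam (Suc j) \<le> lam j" using lam_le_iff[of "Suc j" j] assms by simp
    then show ?thesis using x False assms by (auto simp: filt_iff intro: order_trans)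
  qed
qed

text \<open>In a basis adapted to the filtration the coefficients of a solution show to which members of the
  filtration it belongs.\<close>

theorem adapted_fundamental_matrix:
  "\<exists>\<Phi>. fundamental_matrix d A \<Phi> \<and> off (Suc p) = d \<and>
    (\<forall>k\<in>{1..Suc p}. filt k = solution_of \<Phi> ` {c \<in> carrier_vec d. \<forall>i<off k. c $ i = 0})"
proof -
  obtain X where X: "fundamental_matrix d A X" using fundamental_matrix_exists[OF A] by blast
  let ?V = "fun_space d (solutions d A)" and ?K = "class_ring :: real ring"
  interpret V: vectorspace ?K ?V by (rule solution_space_vectorspace(1)[OF A X])
  have fd: "V.fin_dim" by (rule solution_space_dim(1)[OF A])
  have sub: "subspace ?K (filt j) ?V" for j by (rule lyapunov_filtration_subspace[OF A])
  define n where "n = (\<lambda>j. vectorspace.dim ?K (V.vs (filt j)))"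
  have n_fun_dim: "n j = fun_dim d (filt j)" for j by (simp add: n_def fun_dim_def fun_space_restrict)
  have last: "filt (Suc p) = {\<zero>\<^bsub>?V\<^esub>}" by (simp add: filt_last)
  have chain: "\<exists>xs. distinct xs \<and> length xs = n k \<and> set xs \<subseteq> filt k \<and> V.lin_indpt (set xs) \<and>
      (\<forall>j. k \<le> j \<longrightarrow> j \<le> Suc p \<longrightarrow> n j \<le> n k \<and> V.span (set (drop (n k - n j) xs)) = filt j)"
    if "1 \<le> k" "k \<le> Suc p" for k
    unfolding n_def by (rule V.basis_adapted_to_chain[where W = filt and q = "Suc p" and k = k])
      (use fd sub filt_mono last that in auto)
  have n1: "n 1 = d" using n_fun_dim filt_first solution_space_dim(2)[OF A] by simp
  have nlast: "n (Suc p) = 0"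
  proof -
    obtain xs where xs: "length xs = n (Suc p)" "set xs \<subseteq> {\<zero>\<^bsub>?V\<^esub>}" "V.lin_indpt (set xs)"
      using chain[of "Suc p"] unfolding last by auto
    have "\<zero>\<^bsub>?V\<^esub> \<notin> set xs" using V.vs_zero_lin_dep[OF _ xs(3)] xs(2) V.zero_closed by blast
    then have "xs = []" using xs(2) by (cases xs) auto
    then show ?thesis using xs(1) by simp
  qed
  have one: "1 \<le> Suc p" by simp
  obtain xs where xs: "distinct xs" "length xs = n 1" "set xs \<subseteq> filt 1" "V.lin_indpt (set xs)"
    and sp: "\<forall>j. 1 \<le> j \<longrightarrow> j \<le> Suc p \<longrightarrow> n j \<le> n 1 \<and> V.span (set (drop (n 1 - n j) xs)) = filt j"
    using chain[OF order_refl one] by blast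
  have offn: "int (off j) = int (n 1) - int (n j)" if "1 \<le> j" "j \<le> Suc p" for j
    using that
  proof (induction j rule: dec_induct)
    case (step j)
    have "int (m j) = int (n j) - int (n (Suc j))"
      using spectrum step unfolding has_lyapunov_spectrum_def n_fun_dim by simp
    then show ?case using step block_offset_Suc[OF step(1), of m] by simp
  qed simp
  have off: "off j = n 1 - n j" "off j \<le> d" if "1 \<le> j" "j \<le> Suc p" for j
    using offn[OF that] sp[rule_format, OF that] n1 by auto
  have xs_sub: "set xs \<subseteq> solutions d A" using xs(3) filt_first by simp
  note b = fundamental_matrix_of_basis[OF A xs(1) xs(2)[unfolded n1] xs_sub xs(4)]
  have "filt k = solution_of (\<lambda>t. mat d d (\<lambda>(i, j). (xs ! j) t $ i)) ` {c \<in> carrier_vec d. \<forall>i<off k. c $ i = 0}"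
    if k: "k \<in> {1..Suc p}" for k
  proof -
    have "V.span (set (drop (off k) xs)) = filt k" using off(1)[of k] sp[rule_format, of k] k by simp
    then show ?thesis using b(2)[of "off k"] off(2)[of k] k by (simp add: filt_first)
  qed
  moreover have "off (Suc p) = d" using off(1)[of "Suc p"] n1 nlast by simp
  ultimately show ?thesis using b(1) by blast
qed

end

text \<open>The columns of \<open>\<Phi>\<close> are grouped into blocks, one for each exponent, in decreasing order.\<close>

locale adapted_system = lyapunov_spectrum +
  fixes \<Phi> :: "real \<Rightarrow> real mat"
  assumes \<Phi>: "fundamental_matrix d A \<Phi>" and off_last: "off (Suc p) = d"
    and filt: "\<And>k. k \<in> {1..Suc p} \<Longrightarrow> filt k = solution_of \<Phi> ` {c \<in> carrier_vec d. \<forall>i<off k. c $ i = 0}"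
begin

lemma in_filt_iff:
  assumes "k \<in> {1..Suc p}" "c \<in> carrier_vec d"
  shows "solution_of \<Phi> c \<in> filt k \<longleftrightarrow> (\<forall>i<off k. c $ i = 0)"
proof
  assume "solution_of \<Phi> c \<in> filt k"
  then obtain c' where c': "c' \<in> carrier_vec d" "\<forall>i<off k. c' $ i = 0" "solution_of \<Phi> c = solution_of \<Phi> c'"
    using filt[OF assms(1)] by auto
  then have "c = c'" using solution_of_inj[OF \<Phi>] assms(2) by (auto dest: inj_onD)
  then show "\<forall>i<off k. c $ i = 0" using c'(2) by simp
next
  assume "\<forall>i<off k. c $ i = 0"
  then show "solution_of \<Phi> c \<in> filt k" using filt[OF assms(1)] assms(2) by auto
qed

text \<open>The exponent is decided by the first block in which some coefficient does not vanish.\<close>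

lemma block_exponent:
  assumes k: "k \<in> {1..p}" and c: "c \<in> carrier_vec d" and zero: "\<And>i. i < off k \<Longrightarrow> c $ i = 0"
    and nz: "i < off (Suc k)" "c $ i \<noteq> 0"
  shows "char_exponent (solution_of \<Phi> c) = ereal (lam k)"
proof -
  have k': "k \<in> {1..Suc p}" "Suc k \<in> {1..Suc p}" using k by auto
  have x: "solution_of \<Phi> c \<in> filt k" using in_filt_iff[OF k'(1) c] zero by blast
  have nx: "solution_of \<Phi> c \<notin> filt (Suc k)" using in_filt_iff[OF k'(2) c] nz by blast
  have s: "solution_of \<Phi> c \<in> solutions d A" using x filt_iff[OF k] by blast
  have "solution_of \<Phi> c \<noteq> zero_solution d"
  proof
    assume "solution_of \<Phi> c = zero_solution d"
    then have "solution_of \<Phi> c \<in> filt (Suc p)" by (simp add: filt_last)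
    then have "\<forall>i<d. c $ i = 0" using in_filt_iff[of "Suc p" c] c off_last by simp
    moreover have "off (Suc k) \<le> d" using block_offset_mono[of "Suc k" "Suc p" m] k off_last by simp
    ultimately show False using nz by auto
  qed
  then obtain j where j: "j \<in> {1..p}" "char_exponent (solution_of \<Phi> c) = ereal (lam j)" using exponent_cases[OF s] by blast
  have "lam j \<le> lam k" using x j(2) filt_iff[OF k] by simp
  then have kj: "k \<le> j" using lam_le_iff[OF j(1) k] by simp
  have "j = k"
  proof (rule ccontr)
    assume "j \<noteq> k"
    then have "Suc k \<in> {1..p}" "Suc k \<le> j" using kj j(1) k by auto
    then have "solution_of \<Phi> c \<in> filt (Suc k)" using s j(2) lam_le_iff[of j "Suc k"] j(1) filt_iff[of "Suc k"] by simp
    then show False using nx by simp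
  qed
  then show ?thesis using j(2) by simp
qed

text \<open>A block of size 0 would make two consecutive members of the filtration equal, although the exponent of the
  larger one is attained.\<close>

lemma block_size_pos: "k \<in> {1..p} \<Longrightarrow> 1 \<le> m k"
proof (rule ccontr)
  assume k: "k \<in> {1..p}" and "\<not> 1 \<le> m k"
  then have e: "off (Suc k) = off k" using block_offset_Suc[of k m] by simp
  have k': "k \<in> {1..Suc p}" "Suc k \<in> {1..Suc p}" using k by auto
  have eq: "filt (Suc k) = filt k" unfolding filt[OF k'(1)] filt[OF k'(2)] e ..
  have "ereal (lam k) \<in> lyapunov_exponents d A" using spectrum k unfolding has_lyapunov_spectrum_def by auto
  then obtain x where x: "x \<in> solutions d A" "x \<noteq> zero_solution d" "char_exponent x = ereal (lam k)"
    unfolding lyapunov_exponents_def by (elim imageE) auto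
  then have xk: "x \<in> filt (Suc k)" using eq filt_iff[OF k] by simp
  show False
  proof (cases "k = p")
    case True
    then show ?thesis using xk x(2) filt_last by simp
  next
    case False
    then have "Suc k \<in> {1..p}" using k by auto
    then show ?thesis using xk x(3) filt_iff[of "Suc k"] lam_le_iff[of k "Suc k"] k by simp
  qed
qed

lemma off_strict: "k \<in> {1..p} \<Longrightarrow> off k < off (Suc k)"
  using block_size_pos[of k] block_offset_Suc[of k m] by simp

lemma off_le: "k \<le> Suc p \<Longrightarrow> off k \<le> d"
  using block_offset_mono[of k "Suc p" m] off_last by simp

definition block_of :: "nat \<Rightarrow> nat" where
  "block_of c = (LEAST k. c < off (Suc k))"

lemma block_of:
  assumes "c < d"
  shows "block_of c \<in> {1..p}" "off (block_of c) \<le> c" "c < off (Suc (block_of c))"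
proof -
  have ex: "c < off (Suc p)" using assms off_last by simp
  show lt: "c < off (Suc (block_of c))" unfolding block_of_def by (rule LeastI[of _ p]) (rule ex)
  have le: "block_of c \<le> p" unfolding block_of_def by (rule Least_le) (rule ex)
  have ge: "1 \<le> block_of c"
  proof (rule ccontr)
    assume "\<not> 1 \<le> block_of c"
    then have "block_of c = 0" by simp
    then show False using lt by simp
  qed
  then show "block_of c \<in> {1..p}" using le by simp
  obtain k where k: "block_of c = Suc k" using ge by (cases "block_of c") auto
  have "\<not> c < off (Suc k)" using not_less_Least[of k "\<lambda>k. c < off (Suc k)"] k unfolding block_of_def by simp
  then show "off (block_of c) \<le> c" using k by simp
qed

lemma block_of_unique:
  assumes "k \<in> {1..p}" "off k \<le> c" "c < off (Suc k)"
  shows "block_of c = k"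
proof -
  have cd: "c < d" using assms off_le[of "Suc k"] by simp
  note b = block_of[OF cd]
  have "\<not> block_of c < k" using block_offset_mono[of "Suc (block_of c)" k m] b assms by auto
  moreover have "\<not> k < block_of c" using block_offset_mono[of "Suc k" "block_of c" m] b assms by auto
  ultimately show ?thesis by simp
qed

abbreviation \<mu> :: "nat \<Rightarrow> real" where "\<mu> c \<equiv> lam (block_of c)"

lemma \<mu>_antitone:
  assumes "i \<le> j" "j < d"
  shows "\<mu> j \<le> \<mu> i"
proof -
  have id: "i < d" using assms by simp
  have "\<not> block_of j < block_of i"
    using block_offset_mono[of "Suc (block_of j)" "block_of i" m] block_of[OF assms(2)] block_of[OF id] assms by auto
  then show ?thesis using lam_le_iff[OF block_of(1)[OF assms(2)] block_of(1)[OF id]] by simp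
qed

lemma \<mu>_sum: "(\<Sum>c=0..<d. \<mu> c) = (\<Sum>k=1..p. real (m k) * lam k)"
proof -
  have "(\<Sum>c=0..<off (Suc k). \<mu> c) = (\<Sum>k=1..k. real (m k) * lam k)" if "k \<le> p" for k
    using that
  proof (induction k)
    case (Suc k)
    have s: "off (Suc (Suc k)) = off (Suc k) + m (Suc k)" by (simp add: block_offset_Suc)
    have "(\<Sum>c=0..<off (Suc (Suc k)). \<mu> c) = (\<Sum>c=0..<off (Suc k). \<mu> c) + (\<Sum>c\<in>{off (Suc k)..<off (Suc (Suc k))}. \<mu> c)"
      using s by (subst sum.atLeastLessThan_concat) auto
    also have "(\<Sum>c\<in>{off (Suc k)..<off (Suc (Suc k))}. \<mu> c) = (\<Sum>c\<in>{off (Suc k)..<off (Suc (Suc k))}. lam (Suc k))"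
      using block_of_unique[of "Suc k"] Suc(2) by (intro sum.cong) auto
    finally show ?case using Suc s by simp
  qed simp
  from this[of p] show ?thesis using off_last by simp
qed

lemma fast_invertibility_bound:
  assumes FI: "strongly_fast_invertible d A L"
  shows "\<exists>C\<ge>0. \<forall>s t. 0 \<le> s \<longrightarrow> s \<le> t \<longrightarrow>
    (\<Prod>k=1..L. singular_value k (\<Phi> t * inv_mat (\<Phi> s))) * (\<Prod>k=1..L. singular_value k (\<Phi> s * inv_mat (\<Phi> 0)))
    \<le> C * (\<Prod>k=1..L. singular_value k (\<Phi> t * inv_mat (\<Phi> 0)))"
proof -
  let ?P = "\<lambda>M. \<Prod>k=1..L. singular_value k M"
  let ?f = "\<lambda>(t, s, u). ereal (\<Prod>k=1..L. singular_value k (cauchy_matrix d A t s) * singular_value k (cauchy_matrix d A s u)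
     / singular_value k (cauchy_matrix d A t u))"
  let ?I = "{(t::real, s, u). t \<ge> s \<and> s \<ge> u \<and> u \<ge> 0}"
  have lt: "Sup (?f ` ?I) < \<infinity>" and Ld: "L \<le> d"
    using FI by (auto simp: strongly_fast_invertible_def fast_invertibility_const_def)
  obtain C where C: "Sup (?f ` ?I) \<le> ereal C"
    using lt by (cases "Sup (?f ` ?I)") auto
  have "?P (\<Phi> t * inv_mat (\<Phi> s)) * ?P (\<Phi> s * inv_mat (\<Phi> 0)) \<le> max 0 C * ?P (\<Phi> t * inv_mat (\<Phi> 0))"
    if s: "0 \<le> s" "s \<le> t" for s t
  proof -
    have t: "0 \<le> t" using s by simp
    have "?f (t, s, 0) \<le> Sup (?f ` ?I)" using s by (intro Sup_upper) force
    then have "?f (t, s, 0) \<le> ereal C" using C by (rule order_trans)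
    then have le: "(\<Prod>k=1..L. singular_value k (\<Phi> t * inv_mat (\<Phi> s)) * singular_value k (\<Phi> s * inv_mat (\<Phi> 0))
      / singular_value k (\<Phi> t * inv_mat (\<Phi> 0))) \<le> C"
      using cauchy_matrix_eq[OF A \<Phi> t s(1)] cauchy_matrix_eq[OF A \<Phi> s(1) order_refl] cauchy_matrix_eq[OF A \<Phi> t order_refl] by simp
    note Pc = fundamental_matrix_carrier[OF \<Phi>] and Pd = fundamental_matrix_det[OF \<Phi>]
    note i = inv_mat_inverse[OF Pc[OF order_refl] Pd[OF order_refl]]
    have M: "\<Phi> t * inv_mat (\<Phi> 0) \<in> carrier_mat d d" using Pc[OF t] i(1) by simp
    have "Determinant.det (inv_mat (\<Phi> 0)) \<noteq> 0" using inv_mat_unique(2)[OF i(1) Pc[OF order_refl] i(2)] .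
    then have "Determinant.det (\<Phi> t * inv_mat (\<Phi> 0)) \<noteq> 0" using det_mult[OF Pc[OF t] i(1)] Pd[OF t] by simp
    then have pos: "0 < ?P (\<Phi> t * inv_mat (\<Phi> 0))" using singular_value_pos[OF M] Ld by (intro prod_pos) auto
    have "?P (\<Phi> t * inv_mat (\<Phi> s)) * ?P (\<Phi> s * inv_mat (\<Phi> 0)) / ?P (\<Phi> t * inv_mat (\<Phi> 0)) \<le> C"
      using le by (simp only: prod_dividef prod.distrib)
    then have "?P (\<Phi> t * inv_mat (\<Phi> s)) * ?P (\<Phi> s * inv_mat (\<Phi> 0)) \<le> C * ?P (\<Phi> t * inv_mat (\<Phi> 0))"
      using pos by (simp only: pos_divide_le_eq)
    also have "\<dots> \<le> max 0 C * ?P (\<Phi> t * inv_mat (\<Phi> 0))" using pos by (intro mult_right_mono) auto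
    finally show ?thesis .
  qed
  then show ?thesis by (intro exI[of _ "max 0 C"]) auto
qed

text \<open>The hypotheses of \<open>regular_growth\<close> for the boundary between two blocks: \<open>\<mu> c\<close> is the exponent of column \<open>c\<close>, and it
  drops strictly at the boundary.\<close>

theorem volume_dominated_at_offset:
  assumes reg: "regular_system d A p lam m" and l: "l \<in> {1..<p}"
    and FI: "strongly_fast_invertible d A (off (Suc l))"
  shows "\<exists>K. volume_dominated d (off (Suc l)) \<Phi> K"
proof -
  have l1: "l \<in> {1..p}" "Suc l \<in> {1..p}" using l by auto
  have L: "0 < off (Suc l)" "off (Suc l) < d"
    using off_strict[OF l1(1)] off_strict[OF l1(2)] off_le[of "Suc (Suc l)"] l by auto
  have "regular_growth d (off (Suc l)) \<Phi> \<mu>"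
  proof
    show "0 < off (Suc l)" "off (Suc l) < d" by fact+
    show "\<Phi> t \<in> carrier_mat d d" "Determinant.det (\<Phi> t) \<noteq> 0" if "0 \<le> t" for t
      using fundamental_matrix_carrier[OF \<Phi> that] fundamental_matrix_det[OF \<Phi> that] .
    show "\<mu> j \<le> \<mu> i" if "i \<le> j" "j < d" for i j using \<mu>_antitone[OF that] .
    have "block_of (off (Suc l)) = Suc l" using off_strict[OF l1(2)] by (intro block_of_unique l1) auto
    moreover have "block_of (off (Suc l) - 1) = l" using off_strict[OF l1(1)] by (intro block_of_unique l1) auto
    ultimately show "\<mu> (off (Suc l)) < \<mu> (off (Suc l) - 1)"
      using lam_le_iff[OF l1] by simp
    show "\<exists>K>0. \<forall>t\<ge>0. euclid_norm (col (\<Phi> t) c) \<le> K * exp ((\<mu> c + \<epsilon>) * t)" if \<epsilon>: "0 < \<epsilon>" and c: "c < d" for \<epsilon> c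
    proof -
      note b = block_of[OF c]
      have "char_exponent (solution_of \<Phi> (unit_vec d c)) = ereal (\<mu> c)"
        using b c off_le[of "Suc (block_of c)"] by (intro block_exponent[of _ _ c]) auto
      then have le: "char_exponent (solution_of \<Phi> (unit_vec d c)) \<le> ereal (\<mu> c)" by simp
      obtain K where K: "0 < K" "\<forall>t\<ge>0. euclid_norm (solution_of \<Phi> (unit_vec d c) t) \<le> K * exp ((\<mu> c + \<epsilon>) * t)"
        using exp_bound_of_char_exponent[OF solution_norm_continuous[OF \<Phi> unit_vec_carrier] le \<epsilon>] by blast
      have "solution_of \<Phi> (unit_vec d c) t = col (\<Phi> t) c" if "0 \<le> t" for t
        using fundamental_matrix_carrier[OF \<Phi> that] c that by (intro eq_vecI) (auto simp: solution_of_def)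
      then show ?thesis using K by auto
    qed
    show "\<exists>k>0. \<forall>t\<ge>0. k * exp (((\<Sum>c=0..<d. \<mu> c) - \<epsilon>) * t) \<le> \<bar>Determinant.det (\<Phi> t)\<bar>" if \<epsilon>: "0 < \<epsilon>" for \<epsilon>
      using regular_det_lower_bound[OF A \<Phi> _ \<epsilon>] reg unfolding \<mu>_sum regular_system_def by blast
  qed
  then interpret G: regular_growth d "off (Suc l)" \<Phi> \<mu> .
  obtain C where C: "0 \<le> C" and FI': "\<forall>s t. 0 \<le> s \<longrightarrow> s \<le> t \<longrightarrow>
    G.top_singular (\<Phi> t * inv_mat (\<Phi> s)) * G.top_singular (\<Phi> s * inv_mat (\<Phi> 0)) \<le> C * G.top_singular (\<Phi> t * inv_mat (\<Phi> 0))"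
    using fast_invertibility_bound[OF FI] by (elim exE conjE) simp
  show ?thesis by (rule G.volume_dominated[OF _ C]) (use FI' in simp)
qed

end

section \<open>Triangularisation of a block of solutions\<close>

text \<open>The point 0 is included: it is not isolated in the half-line.\<close>

lemma half_line_derivative_unique:
  fixes f :: "real \<Rightarrow> real"
  assumes "(f has_real_derivative D) (at t within {0..})" "(f has_real_derivative E) (at t within {0..})" "0 \<le> t"
  shows "D = E"
proof (rule has_field_derivative_unique[OF assms(1,2)])
  have "closure {t<..} \<subseteq> closure ({0..} - {t})" using assms(3) by (intro closure_mono) auto
  then show "at t within {0..} \<noteq> bot" unfolding at_within_eq_bot_iff by auto
qed

lemma differentiable_prod:
  fixes f :: "'i \<Rightarrow> real \<Rightarrow> real"
  assumes "\<And>i. i \<in> I \<Longrightarrow> f i differentiable at t within S"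
  shows "(\<lambda>s. \<Prod>i\<in>I. f i s) differentiable at t within S"
  using assms
proof (induction I rule: infinite_finite_induct)
  case (insert x F)
  have "(\<lambda>s. f x s * (\<Prod>i\<in>F. f i s)) differentiable at t within S"
    by (intro differentiable_mult insert.IH insert.prems) auto
  then show ?case using insert.hyps by simp
qed auto

lemma differentiable_det:
  fixes M :: "real \<Rightarrow> real mat"
  assumes "\<And>s. M s \<in> carrier_mat n n"
    and "\<And>i j. i < n \<Longrightarrow> j < n \<Longrightarrow> (\<lambda>s. M s $$ (i, j)) differentiable at t within S"
  shows "(\<lambda>s. Determinant.det (M s)) differentiable at t within S"
  unfolding det_def'[OF assms(1)]
proof (intro differentiable_sum ballI differentiable_mult differentiable_const differentiable_prod assms(2))
  fix p i assume "p \<in> {p. p permutes {0..<n}}" "i \<in> {0..<n}"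
  then show "p i < n" using permutes_in_image[of p "{0..<n}" i] by simp
qed (auto simp: finite_permutations)

lemma differentiable_mult_mat:
  fixes M N :: "real \<Rightarrow> real mat"
  assumes "\<And>s. M s \<in> carrier_mat n k" "\<And>s. N s \<in> carrier_mat k m" "i < n" "j < m"
    and "\<And>l. l < k \<Longrightarrow> (\<lambda>s. M s $$ (i, l)) differentiable at t within S"
    and "\<And>l. l < k \<Longrightarrow> (\<lambda>s. N s $$ (l, j)) differentiable at t within S"
  shows "(\<lambda>s. (M s * N s) $$ (i, j)) differentiable at t within S"
proof -
  have e: "(M s * N s) $$ (i, j) = (\<Sum>l\<in>{0..<k}. M s $$ (i, l) * N s $$ (l, j))" for s
    using assms(1)[of s] assms(2)[of s] assms(3,4) by (simp add: scalar_prod_def)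
  show ?thesis unfolding e by (intro differentiable_sum ballI differentiable_mult assms(5,6)) auto
qed

lemma differentiable_Gram:
  fixes Z :: "real \<Rightarrow> real mat"
  assumes "\<And>s. Z s \<in> carrier_mat d n" "i < n" "j < n"
    and "\<And>i j. i < d \<Longrightarrow> j < n \<Longrightarrow> (\<lambda>s. Z s $$ (i, j)) differentiable at t within S"
  shows "(\<lambda>s. (transpose_mat (Z s) * Z s) $$ (i, j)) differentiable at t within S"
proof (rule differentiable_mult_mat[OF _ assms(1,2,3)])
  have "(\<lambda>s. transpose_mat (Z s) $$ (i, l)) = (\<lambda>s. Z s $$ (l, i))" if "l < d" for l
    using assms(2) that carrier_matD[OF assms(1)] by (intro ext) simp
  then show "(\<lambda>s. transpose_mat (Z s) $$ (i, l)) differentiable at t within S" if "l < d" for l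
    using assms(4)[OF that assms(2)] that by simp
qed (use assms in auto)

lemma differentiable_cofactor:
  fixes M :: "real \<Rightarrow> real mat"
  assumes M: "\<And>s. M s \<in> carrier_mat n n" and "i < n" "j < n"
    and d: "\<And>i j. i < n \<Longrightarrow> j < n \<Longrightarrow> (\<lambda>s. M s $$ (i, j)) differentiable at t within S"
  shows "(\<lambda>s. cofactor (M s) i j) differentiable at t within S"
  unfolding cofactor_def
proof (intro differentiable_mult differentiable_const differentiable_det)
  have dims: "dim_row (M s) = n" "dim_col (M s) = n" for s using M[of s] by auto
  show "mat_delete (M s) i j \<in> carrier_mat (n - 1) (n - 1)" for s by (rule carrier_matI) (simp_all add: dims mat_delete_def)
  fix i' j' assume "i' < n - 1" "j' < n - 1"
  then show "(\<lambda>s. mat_delete (M s) i j $$ (i', j')) differentiable at t within S"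
    by (simp add: mat_delete_def dims d)
qed

text \<open>Gram determinants and cofactors are polynomials in the entries of \<open>X\<close>, and the square roots in the
  denominators have positive arguments.\<close>

lemma differentiable_orthonormalizer:
  fixes X :: "real \<Rightarrow> real mat"
  assumes X: "\<And>s. X s \<in> carrier_mat d m" and ij: "i < m" "j < m" and pos: "0 < gdet (X t)"
    and D: "\<And>i j. i < d \<Longrightarrow> j < m \<Longrightarrow> (\<lambda>s. X s $$ (i, j)) differentiable at t within S"
  shows "(\<lambda>s. orthonormalizer (X s) $$ (i, j)) differentiable at t within S"
proof -
  have dims: "dim_row (X s) = d" "dim_col (X s) = m" for s using X[of s] by auto
  have FC: "first_cols (X s) k \<in> carrier_mat d k" for s k
    by (rule carrier_matI) (simp_all add: select_cols_def dims)
  have G: "transpose_mat (first_cols (X s) k) * first_cols (X s) k \<in> carrier_mat k k" for s k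
    by (rule carrier_matI) (simp_all add: select_cols_def)
  have FD: "(\<lambda>s. first_cols (X s) k $$ (a, b)) differentiable at t within S" if "k \<le> m" "a < d" "b < k" for k a b
    using that by (simp add: select_cols_def dims D)
  have GD: "(\<lambda>s. (transpose_mat (first_cols (X s) k) * first_cols (X s) k) $$ (a, b)) differentiable at t within S"
    if "k \<le> m" "a < k" "b < k" for k a b
    by (rule differentiable_Gram[OF FC that(2,3) FD[OF that(1)]])
  have gd: "(\<lambda>s. gdet (first_cols (X s) k)) differentiable at t within S" if "k \<le> m" for k
    by (rule differentiable_det[OF G GD[OF that]])
  show ?thesis
  proof (cases "i \<le> j")
    case True
    have e: "orthonormalizer (X s) $$ (i, j) =
        cofactor (transpose_mat (first_cols (X s) (Suc j)) * first_cols (X s) (Suc j)) j i /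
        sqrt (gdet (first_cols (X s) j) * gdet (first_cols (X s) (Suc j)))" for s
    proof -
      have "residual_coeffs (first_cols (X s) (Suc j)) j $ i =
          cofactor (transpose_mat (first_cols (X s) (Suc j)) * first_cols (X s) (Suc j)) j i"
        using G[where s = s and k = "Suc j"] True
        by (simp add: residual_coeffs_def adj_mat_def carrier_matD select_cols_def)
      then show ?thesis using True ij by (simp add: orthonormalizer_def dims)
    qed
    have g: "0 < gdet (first_cols (X t) j) * gdet (first_cols (X t) (Suc j))"
      using gdet_first_cols_pos[OF X pos] ij by (intro mult_pos_pos) auto
    show ?thesis unfolding e
    proof (intro differentiable_divide differentiable_cofactor[OF G])
      show "(\<lambda>s. sqrt (gdet (first_cols (X s) j) * gdet (first_cols (X s) (Suc j)))) differentiable at t within S"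
      proof (rule differentiable_compose[of sqrt])
        show "sqrt differentiable at (gdet (first_cols (X t) j) * gdet (first_cols (X t) (Suc j)))"
          using DERIV_real_sqrt[OF g] unfolding real_differentiable_def by blast
        show "(\<lambda>s. gdet (first_cols (X s) j) * gdet (first_cols (X s) (Suc j))) differentiable at t within S"
          using gd ij by (intro differentiable_mult) auto
      qed
      show "sqrt (gdet (first_cols (X t) j) * gdet (first_cols (X t) (Suc j))) \<noteq> 0"
        using g unfolding real_sqrt_eq_zero_cancel_iff by linarith
    qed (use True ij GD in auto)
  next
    case False
    then show ?thesis using ij by (simp add: orthonormalizer_def dims)
  qed
qed

lemma Gram_derivative:
  assumes X: "\<And>s. 0 \<le> s \<Longrightarrow> X s \<in> carrier_mat n m" and X': "X' \<in> carrier_mat n m" and t: "0 \<le> t" and ij: "i < m" "j < m"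
    and D: "\<And>i j. i < n \<Longrightarrow> j < m \<Longrightarrow> ((\<lambda>s. X s $$ (i, j)) has_real_derivative X' $$ (i, j)) (at t within {0..})"
  shows "((\<lambda>s. (transpose_mat (X s) * X s) $$ (i, j)) has_real_derivative
    (transpose_mat X' * X t + transpose_mat (X t) * X') $$ (i, j)) (at t within {0..})"
proof -
  have "((\<lambda>s. \<Sum>k<n. X s $$ (k, i) * X s $$ (k, j)) has_real_derivative
    (\<Sum>k<n. X' $$ (k, i) * X t $$ (k, j) + X' $$ (k, j) * X t $$ (k, i))) (at t within {0..})"
    using D ij by (intro DERIV_sum DERIV_mult) auto
  also have "(\<Sum>k<n. X' $$ (k, i) * X t $$ (k, j) + X' $$ (k, j) * X t $$ (k, i)) =
      (transpose_mat X' * X t + transpose_mat (X t) * X') $$ (i, j)"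
    using X[OF t] X' ij by (simp add: scalar_prod_def lessThan_atLeast0 sum.distrib mult.commute)
  finally show ?thesis
  proof (rule DERIV_cong_half_line[OF _ t])
    fix s :: real assume s: "0 \<le> s"
    show "(\<Sum>k<n. X s $$ (k, i) * X s $$ (k, j)) = (transpose_mat (X s) * X s) $$ (i, j)"
      using X[OF s] ij by (simp add: scalar_prod_def lessThan_atLeast0)
  qed
qed

lemma orthonormal_entry_le_1:
  fixes Q :: "real mat"
  assumes Q: "Q \<in> carrier_mat n m" and o: "transpose_mat Q * Q = 1\<^sub>m m" and ij: "i < n" "j < m"
  shows "\<bar>Q $$ (i, j)\<bar> \<le> 1"
proof -
  have "(Q $$ (i, j))\<^sup>2 \<le> (\<Sum>k<n. (Q $$ (k, j))\<^sup>2)" using ij by (intro member_le_sum) auto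
  also have "\<dots> = (transpose_mat Q * Q) $$ (j, j)"
    using Q ij by (simp add: scalar_prod_def power2_eq_square lessThan_atLeast0)
  also have "\<dots> = 1" using o ij by simp
  finally show ?thesis by (simp add: abs_square_le_1)
qed

text \<open>Matrix solutions with linearly independent columns, of which one block of an adapted fundamental matrix is
  the example. The decomposition \<open>X = Q R\<close> of such a solution transforms the system on the span of the
  columns into a triangular one.\<close>

locale injective_solution =
  fixes d m :: nat and A X :: "real \<Rightarrow> real mat"
  assumes A: "bounded_system d A" and X: "\<And>s. X s \<in> carrier_mat d m"
    and deriv: "\<And>t i j. 0 \<le> t \<Longrightarrow> i < d \<Longrightarrow> j < m \<Longrightarrow>
      ((\<lambda>s. X s $$ (i, j)) has_real_derivative (A t * X t) $$ (i, j)) (at t within {0..})"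
    and pos: "\<And>t. 0 \<le> t \<Longrightarrow> 0 < gdet (X t)"
begin

definition T :: "real \<Rightarrow> real mat" where "T t = orthonormalizer (X t)"
definition Q :: "real \<Rightarrow> real mat" where "Q t = X t * T t"
definition R :: "real \<Rightarrow> real mat" where "R t = transpose_mat (Q t) * X t"

text \<open>An entrywise choice of the derivative, which is unique on the half-line.\<close>

definition R' :: "real \<Rightarrow> real mat" where
  "R' t = mat m m (\<lambda>(i, j). SOME D. ((\<lambda>s. R s $$ (i, j)) has_real_derivative D) (at t within {0..}))"

definition B :: "real \<Rightarrow> real mat" where "B t = R' t * T t"

lemma carriers: "T t \<in> carrier_mat m m" "Q t \<in> carrier_mat d m" "R t \<in> carrier_mat m m"
  "R' t \<in> carrier_mat m m" "B t \<in> carrier_mat m m"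
proof -
  show T: "T t \<in> carrier_mat m m" using X[of t] unfolding T_def orthonormalizer_def by auto
  show Q: "Q t \<in> carrier_mat d m" unfolding Q_def by (rule mult_carrier_mat[OF X T])
  show "R t \<in> carrier_mat m m" unfolding R_def using Q by (intro mult_carrier_mat[OF _ X]) simp
  show R': "R' t \<in> carrier_mat m m" by (simp add: R'_def)
  show "B t \<in> carrier_mat m m" unfolding B_def by (rule mult_carrier_mat[OF R' T])
qed

lemma
  assumes t: "0 \<le> t"
  shows T_triangular: "upper_triangular (T t)" and Q_orthonormal: "transpose_mat (Q t) * Q t = 1\<^sub>m m"
    and R_triangular: "upper_triangular (R t)" and TR: "T t * R t = 1\<^sub>m m" and RT: "R t * T t = 1\<^sub>m m"
    and T_det: "Determinant.det (T t) \<noteq> 0"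
  using orthonormalizer[OF X[of t] pos[OF t]] unfolding R_def Q_def T_def by simp_all

lemma
  assumes t: "0 \<le> t" and ij: "j < m"
  shows T_differentiable: "i < m \<Longrightarrow> (\<lambda>s. T s $$ (i, j)) differentiable at t within {0..}"
    and Q_differentiable: "i < d \<Longrightarrow> (\<lambda>s. Q s $$ (i, j)) differentiable at t within {0..}"
    and R_differentiable: "i < m \<Longrightarrow> (\<lambda>s. R s $$ (i, j)) differentiable at t within {0..}"
proof -
  have XD: "(\<lambda>s. X s $$ (i, j)) differentiable at t within {0..}" if "i < d" "j < m" for i j
    using deriv[OF t that] unfolding real_differentiable_def by blast
  have TD: "(\<lambda>s. T s $$ (i, j)) differentiable at t within {0..}" if "i < m" "j < m" for i j
    unfolding T_def by (rule differentiable_orthonormalizer[OF X that pos[OF t] XD])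
  then show "(\<lambda>s. T s $$ (i, j)) differentiable at t within {0..}" if "i < m" using that ij .
  have QD: "(\<lambda>s. Q s $$ (i, j)) differentiable at t within {0..}" if "i < d" "j < m" for i j
    unfolding Q_def by (rule differentiable_mult_mat[OF X carriers(1) that]) (use XD TD that in auto)
  then show "(\<lambda>s. Q s $$ (i, j)) differentiable at t within {0..}" if "i < d" using that ij .
  show "(\<lambda>s. R s $$ (i, j)) differentiable at t within {0..}" if i: "i < m"
    unfolding R_def
  proof (rule differentiable_mult_mat[OF _ X i ij])
    show "transpose_mat (Q s) \<in> carrier_mat m d" for s using carriers(2)[of s] by simp
    have "(\<lambda>s. transpose_mat (Q s) $$ (i, l)) = (\<lambda>s. Q s $$ (l, i))" if "l < d" for l
      using that i carrier_matD[OF carriers(2)] by (intro ext) simp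
    then show "(\<lambda>s. transpose_mat (Q s) $$ (i, l)) differentiable at t within {0..}" if "l < d" for l
      using QD[OF that i] that by simp
  qed (use XD ij in auto)
qed

lemma R_derivative:
  assumes "0 \<le> t" "i < m" "j < m"
  shows "((\<lambda>s. R s $$ (i, j)) has_real_derivative R' t $$ (i, j)) (at t within {0..})"
proof -
  have "\<exists>D. ((\<lambda>s. R s $$ (i, j)) has_real_derivative D) (at t within {0..})"
    using R_differentiable[OF assms(1,3,2)] unfolding real_differentiable_def .
  from someI_ex[OF this] show ?thesis using assms by (simp add: R'_def)
qed

lemma R'_triangular:
  assumes t: "0 \<le> t"
  shows "upper_triangular (R' t)"
proof (rule upper_triangularI)
  fix i j assume ji: "j < i" and "i < dim_row (R' t)"
  then have i: "i < m" "j < m" using carriers(4)[of t] by auto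
  have z: "R s $$ (i, j) = 0" if "0 \<le> s" for s
    using upper_triangularD[OF R_triangular[OF that] ji] i carriers(3)[of s] by simp
  have "((\<lambda>s. 0) has_real_derivative R' t $$ (i, j)) (at t within {0..})"
    by (rule DERIV_cong_half_line[OF R_derivative[OF t i] t z])
  then show "R' t $$ (i, j) = 0" using half_line_derivative_unique[OF _ DERIV_const t] by blast
qed

lemma R'_eq:
  assumes t: "0 \<le> t"
  shows "R' t = B t * R t"
  unfolding B_def using TR[OF t] carriers[of t] by (simp add: assoc_mult_mat[of _ m m _ m _ m])

lemma B_triangular: "0 \<le> t \<Longrightarrow> upper_triangular (B t)"
  unfolding B_def by (rule upper_triangular_mult[OF carriers(4) R'_triangular carriers(1) T_triangular])

lemma R_fundamental: "fundamental_matrix m B R"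
  unfolding fundamental_matrix_def has_mat_derivative_def
proof (intro conjI allI impI)
  show "mat_fun m R" "mat_fun m (\<lambda>t. B t * R t)"
    using carriers by (auto simp: mat_fun_def intro!: mult_carrier_mat)
  fix t :: real assume t: "0 \<le> t"
  show "((\<lambda>s. R s $$ (i, j)) has_real_derivative (B t * R t) $$ (i, j)) (at t within {0..})" if "i < m" "j < m" for i j
    using R_derivative[OF t that] R'_eq[OF t] by simp
  show "invertible_mat (R t)"
    using inv_mat_unique(2)[OF carriers(3) carriers(1) TR[OF t]] invertible_mat_iff_det_nonzero[OF carriers(3)] by blast
qed

lemma QR: "0 \<le> t \<Longrightarrow> Q t * R t = X t"
  unfolding Q_def using TR right_mult_one_mat[OF X] by (simp add: assoc_mult_mat[OF X carriers(1,3)])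

lemma R_Gram:
  assumes t: "0 \<le> t"
  shows "transpose_mat (R t) * R t = transpose_mat (X t) * X t"
proof -
  have "transpose_mat (X t) * X t = transpose_mat (Q t * R t) * (Q t * R t)" using QR[OF t] by simp
  also have "\<dots> = transpose_mat (R t) * R t"
    by (rule gram_orthonormal_mult[OF carriers(2) Q_orthonormal[OF t] carriers(3)])
  finally show ?thesis ..
qed

text \<open>Differentiating the identity of the Gram matrices of \<open>X\<close> and \<open>R\<close> determines the symmetric part of
  \<open>B\<close>, hence \<open>B\<close> itself, because \<open>B\<close> is triangular.\<close>

lemma B_symmetric_part:
  assumes t: "0 \<le> t"
  shows "transpose_mat (B t) + B t = transpose_mat (Q t) * ((transpose_mat (A t) + A t) * Q t)"
proof -
  note c = carriers[of t]
  have At: "A t \<in> carrier_mat d d" by (rule bounded_system_carrier[OF A t])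
  note Xt = X[of t]
  have BR: "B t * R t \<in> carrier_mat m m" using c by auto
  have AX: "A t * X t \<in> carrier_mat d m" using At Xt by auto
  have e: "transpose_mat (B t * R t) * R t + transpose_mat (R t) * (B t * R t) =
      transpose_mat (A t * X t) * X t + transpose_mat (X t) * (A t * X t)"
  proof (rule eq_matI)
    fix i j
    assume "i < dim_row (transpose_mat (A t * X t) * X t + transpose_mat (X t) * (A t * X t))"
      "j < dim_col (transpose_mat (A t * X t) * X t + transpose_mat (X t) * (A t * X t))"
    then have ij: "i < m" "j < m" using Xt by auto
    have "((\<lambda>s. (transpose_mat (R s) * R s) $$ (i, j)) has_real_derivative
      (transpose_mat (B t * R t) * R t + transpose_mat (R t) * (B t * R t)) $$ (i, j)) (at t within {0..})"
      using R_derivative[OF t] R'_eq[OF t] by (intro Gram_derivative[OF carriers(3) BR t ij]) simp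
    from DERIV_cong_half_line[OF this t] have "((\<lambda>s. (transpose_mat (X s) * X s) $$ (i, j)) has_real_derivative
      (transpose_mat (B t * R t) * R t + transpose_mat (R t) * (B t * R t)) $$ (i, j)) (at t within {0..})"
      using R_Gram by simp
    from half_line_derivative_unique[OF this Gram_derivative[OF X AX t ij deriv[OF t]] t]
    show "(transpose_mat (B t * R t) * R t + transpose_mat (R t) * (B t * R t)) $$ (i, j) =
      (transpose_mat (A t * X t) * X t + transpose_mat (X t) * (A t * X t)) $$ (i, j)" .
  qed (use c Xt in auto)
  define M where "M = transpose_mat (B t) + B t"
  define S where "S = transpose_mat (A t) + A t"
  have M: "M \<in> carrier_mat m m" and S: "S \<in> carrier_mat d d" using c At by (auto simp: M_def S_def)
  have "transpose_mat (R t) * (M * R t) = transpose_mat (B t * R t) * R t + transpose_mat (R t) * (B t * R t)"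
  proof -
    have "transpose_mat (B t * R t) * R t = transpose_mat (R t) * (transpose_mat (B t) * R t)"
      using c by (simp add: transpose_mult[of _ m m _ m] assoc_mult_mat[of _ m m _ m _ m])
    moreover have "M * R t = transpose_mat (B t) * R t + B t * R t"
      unfolding M_def using c by (intro add_mult_distrib_mat[of _ m m]) auto
    ultimately show ?thesis using c BR
      by (simp add: mult_add_distrib_mat[of "transpose_mat (R t)" m m "transpose_mat (B t) * R t" m "B t * R t"])
  qed
  moreover have "transpose_mat (X t) * (S * X t) = transpose_mat (A t * X t) * X t + transpose_mat (X t) * (A t * X t)"
  proof -
    have tX: "transpose_mat (X t) \<in> carrier_mat m d" "transpose_mat (A t) \<in> carrier_mat d d" using Xt At by auto
    have "transpose_mat (A t * X t) * X t = transpose_mat (X t) * (transpose_mat (A t) * X t)"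
      unfolding transpose_mult[OF At Xt] by (rule assoc_mult_mat[OF tX Xt])
    moreover have "S * X t = transpose_mat (A t) * X t + A t * X t"
      unfolding S_def using At Xt by (intro add_mult_distrib_mat[of _ d d]) auto
    ultimately show ?thesis
      using mult_add_distrib_mat[OF tX(1), of "transpose_mat (A t) * X t" m "A t * X t"] tX Xt AX by auto
  qed
  ultimately have eq: "transpose_mat (R t) * (M * R t) = transpose_mat (X t) * (S * X t)" using e by simp
  have tT: "transpose_mat (T t) \<in> carrier_mat m m" "transpose_mat (R t) \<in> carrier_mat m m" using c by auto
  have "transpose_mat (T t) * transpose_mat (R t) = 1\<^sub>m m"
    using RT[OF t] transpose_mult[OF c(3) c(1)] by simp
  then have "M = transpose_mat (T t) * (transpose_mat (R t) * (M * R t)) * T t"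
    using M tT c RT[OF t]
    by (simp add: assoc_mult_mat[of _ m m _ m _ m] assoc_mult_mat[symmetric, of "transpose_mat (T t)" m m "transpose_mat (R t)" m "M" m])
  also have "\<dots> = transpose_mat (T t) * (transpose_mat (X t) * (S * X t)) * T t" unfolding eq ..
  also have "\<dots> = transpose_mat (Q t) * (S * Q t)"
  proof -
    have tX: "transpose_mat (X t) \<in> carrier_mat m d" using Xt by simp
    have SX: "S * X t \<in> carrier_mat d m" using S Xt by auto
    have "transpose_mat (T t) * (transpose_mat (X t) * (S * X t)) = transpose_mat (Q t) * (S * X t)"
      unfolding Q_def transpose_mult[OF Xt c(1)] by (rule assoc_mult_mat[OF tT(1) tX SX, symmetric])
    moreover have "transpose_mat (Q t) * (S * X t) * T t = transpose_mat (Q t) * (S * X t * T t)"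
      using c(2) by (intro assoc_mult_mat[OF _ SX c(1)]) simp
    moreover have "S * X t * T t = S * Q t" unfolding Q_def by (rule assoc_mult_mat[OF S Xt c(1)])
    ultimately show ?thesis by simp
  qed
  finally show ?thesis unfolding M_def S_def .
qed

text \<open>An entry of \<open>B\<close> above the diagonal is an entry of \<open>B\<^sup>T + B\<close>, and a diagonal entry is half of one. Both are
  bounded because \<open>A\<close> is bounded and the entries of \<open>Q\<close> are at most 1.\<close>

lemma B_bounded_system: "bounded_system m B"
proof -
  let ?S = "\<lambda>t. transpose_mat (Q t) * ((transpose_mat (A t) + A t) * Q t)"
  have Se: "?S t $$ (i, j) = (\<Sum>k<d. Q t $$ (k, i) * (\<Sum>l<d. (A t $$ (l, k) + A t $$ (k, l)) * Q t $$ (l, j)))"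
    if "0 \<le> t" "i < m" "j < m" for t i j
    using carriers(2)[of t] bounded_system_carrier[OF A that(1)] that(2,3) by (simp add: scalar_prod_def lessThan_atLeast0)
  have e: "B t $$ (i, j) = (if i < j then ?S t $$ (i, j) else if i = j then ?S t $$ (i, j) / 2 else 0)"
    if t: "0 \<le> t" and ij: "i < m" "j < m" for t i j
  proof -
    have "B t $$ (j, i) + B t $$ (i, j) = ?S t $$ (i, j)"
      using arg_cong[OF B_symmetric_part[OF t], of "\<lambda>M. M $$ (i, j)"] carriers(5)[of t] ij by simp
    moreover have "j < i \<Longrightarrow> B t $$ (i, j) = 0" "i < j \<Longrightarrow> B t $$ (j, i) = 0"
      using upper_triangularD[OF B_triangular[OF t]] carriers(5)[of t] ij by auto
    ultimately show ?thesis by (cases i j rule: linorder_cases) auto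
  qed
  obtain K where K: "\<And>t i j. 0 \<le> t \<Longrightarrow> i < d \<Longrightarrow> j < d \<Longrightarrow> \<bar>A t $$ (i, j)\<bar> \<le> K"
    using bounded_system_entry(2)[OF A] by blast
  have Sb: "\<bar>?S t $$ (i, j)\<bar> \<le> (\<Sum>k<d. 1 * (\<Sum>l<d. (K + K) * 1))" if t: "0 \<le> t" and ij: "i < m" "j < m" for t i j
  proof -
    note q = orthonormal_entry_le_1[OF carriers(2) Q_orthonormal[OF t]]
    show ?thesis unfolding Se[OF t ij]
    proof (rule order_trans[OF sum_abs], rule sum_mono)
      fix k assume k: "k \<in> {..<d}"
      have "\<bar>\<Sum>l<d. (A t $$ (l, k) + A t $$ (k, l)) * Q t $$ (l, j)\<bar> \<le> (\<Sum>l<d. (K + K) * 1)"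
      proof (rule order_trans[OF sum_abs], rule sum_mono)
        fix l assume l: "l \<in> {..<d}"
        have "\<bar>A t $$ (l, k) + A t $$ (k, l)\<bar> \<le> K + K" using K[OF t, of l k] K[OF t, of k l] k l by simp
        then show "\<bar>(A t $$ (l, k) + A t $$ (k, l)) * Q t $$ (l, j)\<bar> \<le> (K + K) * 1"
          using q[of l j] l ij unfolding abs_mult by (intro mult_mono) auto
      qed
      then show "\<bar>Q t $$ (k, i) * (\<Sum>l<d. (A t $$ (l, k) + A t $$ (k, l)) * Q t $$ (l, j))\<bar> \<le> 1 * (\<Sum>l<d. (K + K) * 1)"
        using q[of k i] k ij unfolding abs_mult by (intro mult_mono) auto
    qed
  qed
  have Qc: "continuous_on {0..} (\<lambda>t. Q t $$ (i, j))" if "i < d" "j < m" for i j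
    using Q_differentiable[OF _ that(2,1)] differentiable_imp_continuous_within
    unfolding continuous_on_eq_continuous_within by auto
  have Sc: "continuous_on {0..} (\<lambda>t. ?S t $$ (i, j))" if ij: "i < m" "j < m" for i j
  proof -
    have "continuous_on {0..} (\<lambda>t. \<Sum>k<d. Q t $$ (k, i) * (\<Sum>l<d. (A t $$ (l, k) + A t $$ (k, l)) * Q t $$ (l, j)))"
      using Qc ij bounded_system_entry(1)[OF A] by (intro continuous_intros) auto
    then show ?thesis by (rule continuous_on_cong[THEN iffD1, rotated 2]) (use Se ij in auto)
  qed
  show ?thesis
  proof (rule bounded_systemI)
    show "B t \<in> carrier_mat m m" for t by (rule carriers(5))
    fix i j assume ij: "i < m" "j < m"
    have "continuous_on {0..} (\<lambda>t. if i < j then ?S t $$ (i, j) else if i = j then ?S t $$ (i, j) / 2 else 0)"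
      using Sc[OF ij] by (cases i j rule: linorder_cases) (auto intro: continuous_intros)
    then show "continuous_on {0..} (\<lambda>t. B t $$ (i, j))"
      by (rule continuous_on_cong[THEN iffD1, rotated 2]) (use e ij in auto)
    have "\<bar>B t $$ (i, j)\<bar> \<le> (\<Sum>k<d. 1 * (\<Sum>l<d. (K + K) * 1))" if t: "0 \<le> t" for t
    proof -
      have "\<bar>if a then x else if b then x / 2 else 0\<bar> \<le> \<bar>x\<bar>" for a b and x :: real by auto
      then show ?thesis unfolding e[OF t ij] using Sb[OF t ij] by (rule order_trans)
    qed
    then show "\<exists>K. \<forall>t\<ge>0. \<bar>B t $$ (i, j)\<bar> \<le> K" by blast
  qed
qed

text \<open>The derivative of an inverse, here read off from \<open>T R = 1\<close>.\<close>

lemma T_derivative: "has_mat_derivative m T (\<lambda>t. - (T t * B t))"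
proof -
  define T' where "T' = (\<lambda>t. mat m m (\<lambda>(i, j). SOME D. ((\<lambda>s. T s $$ (i, j)) has_real_derivative D) (at t within {0..})))"
  have T'c: "T' t \<in> carrier_mat m m" for t by (simp add: T'_def)
  have T': "has_mat_derivative m T T'"
    unfolding has_mat_derivative_def
  proof (intro conjI allI impI)
    show "mat_fun m T" "mat_fun m T'" using carriers T'c by (auto simp: mat_fun_def)
    fix t :: real and i j assume "0 \<le> t" "i < m" "j < m"
    then have "\<exists>D. ((\<lambda>s. T s $$ (i, j)) has_real_derivative D) (at t within {0..})"
      using T_differentiable unfolding real_differentiable_def by blast
    from someI_ex[OF this] show "((\<lambda>s. T s $$ (i, j)) has_real_derivative T' t $$ (i, j)) (at t within {0..})"
      using \<open>i < m\<close> \<open>j < m\<close> by (simp add: T'_def)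
  qed
  have R: "has_mat_derivative m R (\<lambda>t. B t * R t)" using R_fundamental by (simp add: fundamental_matrix_def)
  note D = has_mat_derivative_mult[OF T' R]
  have "T' t = - (T t * B t)" if t: "0 \<le> t" for t
  proof -
    note c = carriers[of t]
    have z: "T' t * R t + T t * (B t * R t) = 0\<^sub>m m m"
    proof (rule eq_matI)
      fix i j assume "i < dim_row (0\<^sub>m m m :: real mat)" "j < dim_col (0\<^sub>m m m :: real mat)"
      then have ij: "i < m" "j < m" by auto
      have "((\<lambda>s. (T s * R s) $$ (i, j)) has_real_derivative (T' t * R t + T t * (B t * R t)) $$ (i, j)) (at t within {0..})"
        using D t ij by (simp add: has_mat_derivative_def)
      then have "((\<lambda>s. (1\<^sub>m m :: real mat) $$ (i, j)) has_real_derivative (T' t * R t + T t * (B t * R t)) $$ (i, j)) (at t within {0..})"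
        by (rule DERIV_cong_half_line[OF _ t]) (simp add: TR)
      then show "(T' t * R t + T t * (B t * R t)) $$ (i, j) = 0\<^sub>m m m $$ (i, j)"
        using half_line_derivative_unique[OF _ DERIV_const t] ij by auto
    qed (use c T'c[of t] in auto)
    define W where "W = T t * B t"
    have TB: "W \<in> carrier_mat m m" using c by (auto simp: W_def)
    have "(T' t + W) * R t = 0\<^sub>m m m"
      using z add_mult_distrib_mat[OF T'c TB c(3)] assoc_mult_mat[OF c(1) c(5) c(3), folded W_def] by simp
    then have "(T' t + W) * R t * T t = 0\<^sub>m m m" using c by simp
    moreover have "(T' t + W) * R t * T t = T' t + W"
      using assoc_mult_mat[of "T' t + W" m m "R t" m "T t" m] RT[OF t] c T'c[of t] TB by simp
    ultimately have "T' t + W = 0\<^sub>m m m" by simp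
    show "T' t = - (T t * B t)" unfolding W_def[symmetric]
    proof (rule eq_matI)
      fix i j assume "i < dim_row (- (W))" "j < dim_col (- (W))"
      then have ij: "i < m" "j < m" using TB by auto
      then have "T' t $$ (i, j) + (W) $$ (i, j) = 0"
        using arg_cong[OF \<open>T' t + W = 0\<^sub>m m m\<close>, of "\<lambda>M. M $$ (i, j)"] TB T'c[of t] by auto
      then show "T' t $$ (i, j) = (- (W)) $$ (i, j)" using TB ij by auto
    qed (use TB T'c[of t] in auto)
  qed
  then show ?thesis by (rule has_mat_derivative_cong[OF T' refl])
qed

end

section \<open>Block diagonal matrices\<close>

text \<open>Indices of block matrices are written as the offset of a block plus an index inside it, so that sums over
  all indices become iterated sums over the blocks.\<close>

lemma sum_block_offset:
  "(\<Sum>i<block_offset m (Suc p). f i) = (\<Sum>k=1..p. \<Sum>a<m k. f (block_offset m k + a))"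
proof (induction p)
  case (Suc p)
  have "(\<Sum>i<n + k. f i) = (\<Sum>i<n. f i) + (\<Sum>a<k. f (n + a))" for n k
    by (induction k) (simp_all add: add.assoc)
  then show ?case using Suc by (simp add: block_offset_Suc)
qed simp

lemma block_offset_decompose:
  assumes "i < block_offset m (Suc p)"
  obtains k a where "k \<in> {1..p}" "a < m k" "i = block_offset m k + a"
  using assms
proof (induction p arbitrary: thesis)
  case (Suc p)
  show ?case
  proof (cases "i < block_offset m (Suc p)")
    case True
    then obtain k a where "k \<in> {1..p}" "a < m k" "i = block_offset m k + a" using Suc.IH by blast
    then show ?thesis using Suc.prems(1)[of k a] by simp
  next
    case False
    then show ?thesis
      using Suc.prems(1)[of "Suc p" "i - block_offset m (Suc p)"] Suc.prems(2) by (simp add: block_offset_Suc)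
  qed
qed simp

lemma block_index_less: "k \<in> {1..p} \<Longrightarrow> a < m k \<Longrightarrow> block_offset m k + a < block_offset m (Suc p)"
  using block_offset_mono[of "Suc k" "Suc p" m] block_offset_Suc[of k m] by simp

definition block_mat :: "nat \<Rightarrow> (nat \<Rightarrow> real mat) \<Rightarrow> real mat" where
  "block_mat p F = diag_block_mat (map F [1..<p + 1])"

lemma block_diag_eq_block_mat: "block_diag p B t = block_mat p (\<lambda>k. B k t)"
  by (simp add: block_diag_def block_mat_def)

lemma block_mat_0: "block_mat 0 F = 0\<^sub>m 0 0"
  by (simp add: block_mat_def)

lemma block_mat_Suc:
  "block_mat (Suc p) F = four_block_mat (block_mat p F) (0\<^sub>m (dim_row (block_mat p F)) (dim_col (F (Suc p))))
    (0\<^sub>m (dim_row (F (Suc p))) (dim_col (block_mat p F))) (F (Suc p))"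
  by (simp add: block_mat_def diag_block_mat_last Let_def)

lemma block_mat_carrier:
  assumes "\<forall>k\<in>{1..p}. F k \<in> carrier_mat (m k) (m k)"
  shows "block_mat p F \<in> carrier_mat (block_offset m (Suc p)) (block_offset m (Suc p))"
  using assms
proof (induction p)
  case (Suc p)
  then have "block_mat p F \<in> carrier_mat (block_offset m (Suc p)) (block_offset m (Suc p))" by simp
  from four_block_carrier_mat[OF this bspec[OF Suc.prems, of "Suc p"]]
  show ?case unfolding block_mat_Suc by (simp add: block_offset_Suc)
qed (simp add: block_mat_0)

lemma block_mat_index:
  assumes "\<forall>k\<in>{1..p}. F k \<in> carrier_mat (m k) (m k)"
    and "k \<in> {1..p}" "l \<in> {1..p}" "a < m k" "b < m l"
  shows "block_mat p F $$ (block_offset m k + a, block_offset m l + b) = (if k = l then F k $$ (a, b) else 0)"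
  using assms
proof (induction p)
  case (Suc p)
  have c: "block_mat p F \<in> carrier_mat (block_offset m (Suc p)) (block_offset m (Suc p))"
    using Suc.prems(1) by (intro block_mat_carrier) simp
  have s: "F (Suc p) \<in> carrier_mat (m (Suc p)) (m (Suc p))" using Suc.prems(1) by simp
  have less: "block_offset m k + a < block_offset m (Suc p)" if "k \<in> {1..Suc p}" "k \<noteq> Suc p" "a < m k" for k a
    using block_index_less[of k p a m] that by simp
  have less': "block_offset m k + a < block_offset m (Suc p) + m (Suc p)" if "k \<in> {1..Suc p}" "a < m k" for k a
    using block_index_less[of k "Suc p" a m] that by (simp add: block_offset_Suc)
  have cd: "dim_row (block_mat p F) = block_offset m (Suc p)" "dim_col (block_mat p F) = block_offset m (Suc p)"
    "dim_row (F (Suc p)) = m (Suc p)" "dim_col (F (Suc p)) = m (Suc p)" using c s by auto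
  have "block_mat (Suc p) F $$ (block_offset m k + a, block_offset m l + b) =
    (if block_offset m k + a < block_offset m (Suc p)
     then if block_offset m l + b < block_offset m (Suc p) then block_mat p F $$ (block_offset m k + a, block_offset m l + b) else 0
     else if block_offset m l + b < block_offset m (Suc p) then 0
     else F (Suc p) $$ (block_offset m k + a - block_offset m (Suc p), block_offset m l + b - block_offset m (Suc p)))"
    using less'[OF Suc.prems(2,4)] less'[OF Suc.prems(3,5)] unfolding block_mat_Suc by (simp add: cd)
  then show ?case
    using Suc less[OF Suc.prems(2) _ Suc.prems(4)] less[OF Suc.prems(3) _ Suc.prems(5)]
    by (cases "k = Suc p"; cases "l = Suc p") auto
qed simp

lemma block_mat_eqI:
  assumes "M \<in> carrier_mat (block_offset m (Suc p)) (block_offset m (Suc p))"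
    "N \<in> carrier_mat (block_offset m (Suc p)) (block_offset m (Suc p))"
    and "\<And>k l a b. k \<in> {1..p} \<Longrightarrow> l \<in> {1..p} \<Longrightarrow> a < m k \<Longrightarrow> b < m l \<Longrightarrow>
      M $$ (block_offset m k + a, block_offset m l + b) = N $$ (block_offset m k + a, block_offset m l + b)"
  shows "M = N"
proof (rule eq_matI)
  fix i j assume "i < dim_row N" "j < dim_col N"
  then have "i < block_offset m (Suc p)" "j < block_offset m (Suc p)" using assms(2) by auto
  then show "M $$ (i, j) = N $$ (i, j)" using assms(3) by (elim block_offset_decompose) blast
qed (use assms(1,2) in auto)

lemma mult_block_mat_index:
  assumes F: "\<forall>k\<in>{1..p}. F k \<in> carrier_mat (m k) (m k)"
    and M: "M \<in> carrier_mat n (block_offset m (Suc p))" and i: "i < n" and l: "l \<in> {1..p}" and b: "b < m l"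
  shows "(M * block_mat p F) $$ (i, block_offset m l + b) = (\<Sum>c<m l. M $$ (i, block_offset m l + c) * F l $$ (c, b))"
proof -
  note c = block_mat_carrier[of p F m, OF F]
  have "(M * block_mat p F) $$ (i, block_offset m l + b) =
    (\<Sum>j<block_offset m (Suc p). M $$ (i, j) * block_mat p F $$ (j, block_offset m l + b))"
    using M i c block_index_less[where m = m, OF l b] by (simp add: scalar_prod_def lessThan_atLeast0)
  also have "\<dots> = (\<Sum>k=1..p. \<Sum>c<m k. if k = l then M $$ (i, block_offset m l + c) * F l $$ (c, b) else 0)"
    unfolding sum_block_offset using block_mat_index[of p F m, OF F _ l _ b] by (intro sum.cong refl) auto
  also have "\<dots> = (\<Sum>k=1..p. if k = l then (\<Sum>c<m l. M $$ (i, block_offset m l + c) * F l $$ (c, b)) else 0)"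
    by (intro sum.cong refl) auto
  also have "\<dots> = (\<Sum>c<m l. M $$ (i, block_offset m l + c) * F l $$ (c, b))" using l by simp
  finally show ?thesis .
qed

lemma block_mat_mult:
  assumes F: "\<forall>k\<in>{1..p}. F k \<in> carrier_mat (m k) (m k)" and G: "\<forall>k\<in>{1..p}. G k \<in> carrier_mat (m k) (m k)"
  shows "block_mat p F * block_mat p G = block_mat p (\<lambda>k. F k * G k)"
proof (rule block_mat_eqI)
  note cF = block_mat_carrier[of p F m, OF F] and cG = block_mat_carrier[of p G m, OF G]
  have FG: "\<forall>k\<in>{1..p}. F k * G k \<in> carrier_mat (m k) (m k)" using F G by (auto intro: mult_carrier_mat)
  show "block_mat p F * block_mat p G \<in> carrier_mat (block_offset m (Suc p)) (block_offset m (Suc p))"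
    using cF cG by (rule mult_carrier_mat)
  show "block_mat p (\<lambda>k. F k * G k) \<in> carrier_mat (block_offset m (Suc p)) (block_offset m (Suc p))"
    using FG by (rule block_mat_carrier)
  fix k l a b assume kl: "k \<in> {1..p}" "l \<in> {1..p}" and ab: "a < m k" "b < m l"
  have "(block_mat p F * block_mat p G) $$ (block_offset m k + a, block_offset m l + b) =
    (\<Sum>c<m l. (if k = l then F k $$ (a, c) else 0) * G l $$ (c, b))"
    unfolding mult_block_mat_index[of p G m, OF G cF block_index_less[where m = m, OF kl(1) ab(1)] kl(2) ab(2)]
    using block_mat_index[of p F m, OF F kl ab(1)] by (intro sum.cong refl) auto
  also have "\<dots> = (if k = l then (F k * G k) $$ (a, b) else 0)"
    using bspec[OF F kl(1)] bspec[OF G kl(2)] ab by (auto simp: scalar_prod_def lessThan_atLeast0)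
  also have "\<dots> = block_mat p (\<lambda>k. F k * G k) $$ (block_offset m k + a, block_offset m l + b)"
    using block_mat_index[of p "\<lambda>k. F k * G k" m, OF FG kl ab] by simp
  finally show "(block_mat p F * block_mat p G) $$ (block_offset m k + a, block_offset m l + b) =
    block_mat p (\<lambda>k. F k * G k) $$ (block_offset m k + a, block_offset m l + b)" .
qed

lemma block_mat_one: "block_mat p (\<lambda>k. 1\<^sub>m (m k)) = 1\<^sub>m (block_offset m (Suc p))"
proof (rule block_mat_eqI[of _ m p])
  show "block_mat p (\<lambda>k. 1\<^sub>m (m k)) \<in> carrier_mat (block_offset m (Suc p)) (block_offset m (Suc p))"
    by (rule block_mat_carrier) simp
  fix k l a b assume kl: "k \<in> {1..p}" "l \<in> {1..p}" and ab: "a < m k" "b < m l"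
  have "block_offset m k + a \<noteq> block_offset m l + b" if "k \<noteq> l"
    using that block_offset_mono[of "Suc k" l m] block_offset_mono[of "Suc l" k m] kl ab
    by (cases k l rule: linorder_cases) (auto simp: block_offset_Suc)
  then show "block_mat p (\<lambda>k. 1\<^sub>m (m k)) $$ (block_offset m k + a, block_offset m l + b) =
      1\<^sub>m (block_offset m (Suc p)) $$ (block_offset m k + a, block_offset m l + b)"
    using block_mat_index[of p "\<lambda>k. 1\<^sub>m (m k)" m, OF _ kl ab, simplified] block_index_less[where m = m, OF kl(1) ab(1)] block_index_less[where m = m, OF kl(2) ab(2)] ab
    by auto
qed simp

lemma block_mat_cong: "(\<And>k. k \<in> {1..p} \<Longrightarrow> F k = G k) \<Longrightarrow> block_mat p F = block_mat p G"
  unfolding block_mat_def by (intro arg_cong[of _ _ diag_block_mat] map_cong) auto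

lemma block_mat_inverse:
  assumes F: "\<forall>k\<in>{1..p}. F k \<in> carrier_mat (m k) (m k)" and G: "\<forall>k\<in>{1..p}. G k \<in> carrier_mat (m k) (m k)"
    and FG: "\<And>k. k \<in> {1..p} \<Longrightarrow> F k * G k = 1\<^sub>m (m k)"
  shows "block_mat p F * block_mat p G = 1\<^sub>m (block_offset m (Suc p))"
  unfolding block_mat_mult[OF F G] block_mat_one[symmetric] by (rule block_mat_cong[OF FG])

lemma block_mat_has_derivative:
  assumes D: "\<And>k. k \<in> {1..p} \<Longrightarrow> has_mat_derivative (m k) (F k) (F' k)"
  shows "has_mat_derivative (block_offset m (Suc p)) (\<lambda>t. block_mat p (\<lambda>k. F k t)) (\<lambda>t. block_mat p (\<lambda>k. F' k t))"
  unfolding has_mat_derivative_def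
proof (intro conjI allI impI)
  have c: "\<forall>k\<in>{1..p}. F k t \<in> carrier_mat (m k) (m k)" "\<forall>k\<in>{1..p}. F' k t \<in> carrier_mat (m k) (m k)" if "0 \<le> t" for t
    using D that by (auto simp: has_mat_derivative_def mat_fun_def)
  show "mat_fun (block_offset m (Suc p)) (\<lambda>t. block_mat p (\<lambda>k. F k t))"
    "mat_fun (block_offset m (Suc p)) (\<lambda>t. block_mat p (\<lambda>k. F' k t))"
    unfolding mat_fun_def using block_mat_carrier[OF c(1)] block_mat_carrier[OF c(2)] by simp_all
  fix t :: real and i j assume t: "0 \<le> t" and ij: "i < block_offset m (Suc p)" "j < block_offset m (Suc p)"
  obtain k a where k: "k \<in> {1..p}" "a < m k" "i = block_offset m k + a" using ij(1) by (rule block_offset_decompose)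
  obtain l b where l: "l \<in> {1..p}" "b < m l" "j = block_offset m l + b" using ij(2) by (rule block_offset_decompose)
  have "((\<lambda>s. if k = l then F k s $$ (a, b) else 0) has_real_derivative (if k = l then F' k t $$ (a, b) else 0)) (at t within {0..})"
    using D[OF k(1)] t k(2) l(2) by (auto simp: has_mat_derivative_def)
  moreover have "(if k = l then F' k t $$ (a, b) else 0) = block_mat p (\<lambda>k. F' k t) $$ (i, j)"
    using block_mat_index[OF c(2)[OF t] k(1) l(1) k(2) l(2)] unfolding k(3) l(3) by simp
  ultimately have "((\<lambda>s. if k = l then F k s $$ (a, b) else 0) has_real_derivative block_mat p (\<lambda>k. F' k t) $$ (i, j)) (at t within {0..})"
    by simp
  then show "((\<lambda>s. block_mat p (\<lambda>k. F k s) $$ (i, j)) has_real_derivative block_mat p (\<lambda>k. F' k t) $$ (i, j)) (at t within {0..})"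
    by (rule DERIV_cong_half_line[OF _ t]) (use block_mat_index[OF c(1) k(1) l(1) k(2) l(2)] k(3) l(3) in simp)
qed

lemma block_mat_bounded_system:
  assumes B: "\<And>k. k \<in> {1..p} \<Longrightarrow> bounded_system (m k) (B k)"
  shows "bounded_system (block_offset m (Suc p)) (\<lambda>t. block_mat p (\<lambda>k. B k t))"
proof (rule bounded_systemI)
  have c: "\<forall>k\<in>{1..p}. B k t \<in> carrier_mat (m k) (m k)" if "0 \<le> t" for t
    using bounded_system_carrier[OF B] that by simp
  show "block_mat p (\<lambda>k. B k t) \<in> carrier_mat (block_offset m (Suc p)) (block_offset m (Suc p))" if "0 \<le> t" for t
    using c[OF that] by (rule block_mat_carrier)
  fix i j assume ij: "i < block_offset m (Suc p)" "j < block_offset m (Suc p)"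
  obtain k a where k: "k \<in> {1..p}" "a < m k" "i = block_offset m k + a" using ij(1) by (rule block_offset_decompose)
  obtain l b where l: "l \<in> {1..p}" "b < m l" "j = block_offset m l + b" using ij(2) by (rule block_offset_decompose)
  have e: "block_mat p (\<lambda>k. B k t) $$ (i, j) = (if k = l then B k t $$ (a, b) else 0)" if "0 \<le> t" for t
    using block_mat_index[OF c[OF that] k(1) l(1) k(2) l(2)] k(3) l(3) by simp
  have "continuous_on {0..} (\<lambda>t. if k = l then B k t $$ (a, b) else 0)"
    using bounded_system_entry(1)[OF B[OF k(1)] k(2), of b] l by (cases "k = l") auto
  then show "continuous_on {0..} (\<lambda>t. block_mat p (\<lambda>k. B k t) $$ (i, j))"
    by (rule continuous_on_cong[THEN iffD1, rotated 2]) (use e in auto)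
  obtain K where "K \<ge> 0" "\<forall>t\<ge>0. \<forall>i<m k. \<forall>j<m k. \<bar>B k t $$ (i, j)\<bar> \<le> K"
    using bounded_system_entry(2)[OF B[OF k(1)]] by blast
  then have "\<forall>t\<ge>0. \<bar>block_mat p (\<lambda>k. B k t) $$ (i, j)\<bar> \<le> K" using e k(2) l(2) by auto
  then show "\<exists>K. \<forall>t\<ge>0. \<bar>block_mat p (\<lambda>k. B k t) $$ (i, j)\<bar> \<le> K" ..
qed

lemma bounded_system_mult:
  assumes F: "bounded_system d F" and G: "bounded_system d G"
  shows "bounded_system d (\<lambda>t. F t * G t)"
proof (rule bounded_systemI)
  note c = bounded_system_carrier[OF F] bounded_system_carrier[OF G]
  show "F t * G t \<in> carrier_mat d d" if "0 \<le> t" for t using c that by (intro mult_carrier_mat) auto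
  fix i j assume ij: "i < d" "j < d"
  have e: "(F t * G t) $$ (i, j) = (\<Sum>k<d. F t $$ (i, k) * G t $$ (k, j))" if "0 \<le> t" for t
    using c[OF that] ij by (simp add: scalar_prod_def lessThan_atLeast0)
  have "continuous_on {0..} (\<lambda>t. \<Sum>k<d. F t $$ (i, k) * G t $$ (k, j))"
    using bounded_system_entry(1)[OF F] bounded_system_entry(1)[OF G] ij by (intro continuous_intros) auto
  then show "continuous_on {0..} (\<lambda>t. (F t * G t) $$ (i, j))"
    by (rule continuous_on_cong[THEN iffD1, rotated 2]) (use e in auto)
  obtain K where K: "K \<ge> 0" "\<forall>t\<ge>0. \<forall>i<d. \<forall>j<d. \<bar>F t $$ (i, j)\<bar> \<le> K" using bounded_system_entry(2)[OF F] by blast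
  obtain K' where K': "K' \<ge> 0" "\<forall>t\<ge>0. \<forall>i<d. \<forall>j<d. \<bar>G t $$ (i, j)\<bar> \<le> K'" using bounded_system_entry(2)[OF G] by blast
  have "\<bar>(F t * G t) $$ (i, j)\<bar> \<le> (\<Sum>k<d. K * K')" if t: "0 \<le> t" for t
    unfolding e[OF t] using K K' t ij
    by (intro order_trans[OF sum_abs] sum_mono) (auto simp: abs_mult intro!: mult_mono)
  then show "\<exists>K. \<forall>t\<ge>0. \<bar>(F t * G t) $$ (i, j)\<bar> \<le> K" by blast
qed

lemma bounded_system_minus:
  assumes F: "bounded_system d F" and G: "bounded_system d G"
  shows "bounded_system d (\<lambda>t. F t - G t)"
proof (rule bounded_systemI)
  note c = bounded_system_carrier[OF F] bounded_system_carrier[OF G]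
  show "F t - G t \<in> carrier_mat d d" if "0 \<le> t" for t using c that by (intro minus_carrier_mat) auto
  fix i j assume ij: "i < d" "j < d"
  have e: "(F t - G t) $$ (i, j) = F t $$ (i, j) - G t $$ (i, j)" if "0 \<le> t" for t using c[OF that] ij by simp
  have "continuous_on {0..} (\<lambda>t. F t $$ (i, j) - G t $$ (i, j))"
    using bounded_system_entry(1)[OF F] bounded_system_entry(1)[OF G] ij by (intro continuous_intros) auto
  then show "continuous_on {0..} (\<lambda>t. (F t - G t) $$ (i, j))"
    by (rule continuous_on_cong[THEN iffD1, rotated 2]) (use e in auto)
  obtain K where K: "K \<ge> 0" "\<forall>t\<ge>0. \<forall>i<d. \<forall>j<d. \<bar>F t $$ (i, j)\<bar> \<le> K" using bounded_system_entry(2)[OF F] by blast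
  obtain K' where K': "K' \<ge> 0" "\<forall>t\<ge>0. \<forall>i<d. \<forall>j<d. \<bar>G t $$ (i, j)\<bar> \<le> K'" using bounded_system_entry(2)[OF G] by blast
  have "\<bar>(F t - G t) $$ (i, j)\<bar> \<le> K + K'" if t: "0 \<le> t" for t
  proof -
    have "\<bar>F t $$ (i, j)\<bar> \<le> K" "\<bar>G t $$ (i, j)\<bar> \<le> K'" using K K' t ij by auto
    then show ?thesis unfolding e[OF t] by linarith
  qed
  then show "\<exists>K. \<forall>t\<ge>0. \<bar>(F t - G t) $$ (i, j)\<bar> \<le> K" by blast
qed

section \<open>Reduction to block diagonal form\<close>

lemma gdet_pos:
  assumes Z: "Z \<in> carrier_mat n m" and inj: "\<And>v. v \<in> carrier_vec m \<Longrightarrow> Z *\<^sub>v v = 0\<^sub>v n \<Longrightarrow> v = 0\<^sub>v m"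
  shows "0 < gdet Z"
proof -
  have G: "transpose_mat Z * Z \<in> carrier_mat m m" using Z by auto
  have "gdet Z \<noteq> 0"
  proof
    assume "gdet Z = 0"
    then obtain v where v: "v \<in> carrier_vec m" "v \<noteq> 0\<^sub>v m" "(transpose_mat Z * Z) *\<^sub>v v = 0\<^sub>v m"
      using det_0_iff_vec_prod_zero_field[OF G] by blast
    have Zv: "Z *\<^sub>v v \<in> carrier_vec n" using Z v(1) by auto
    have tZ: "transpose_mat Z \<in> carrier_mat m n" using Z by simp
    have "(Z *\<^sub>v v) \<bullet> (Z *\<^sub>v v) = (transpose_mat Z *\<^sub>v (Z *\<^sub>v v)) \<bullet> v"
      by (rule transpose_vec_mult_scalar[OF Z v(1) Zv, symmetric])
    also have "transpose_mat Z *\<^sub>v (Z *\<^sub>v v) = 0\<^sub>v m"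
      using assoc_mult_mat_vec[OF tZ Z v(1)] v(3) by simp
    finally have "euclid_norm (Z *\<^sub>v v) = 0" using v(1) by (simp add: euclid_norm_def)
    then have "Z *\<^sub>v v = 0\<^sub>v n" using euclid_norm_eq_0_iff[OF Zv] by blast
    then show False using inj v by blast
  qed
  then show ?thesis using gdet_nonneg[of Z] by linarith
qed

lemma block_mat_mult_vec_index:
  assumes F: "\<forall>k\<in>{1..p}. F k \<in> carrier_mat (m k) (m k)" and y: "y \<in> carrier_vec (block_offset m (Suc p))"
    and k: "k \<in> {1..p}" "a < m k"
  shows "(block_mat p F *\<^sub>v y) $ (block_offset m k + a) = (F k *\<^sub>v vec (m k) (\<lambda>b. y $ (block_offset m k + b))) $ a"
proof -
  have "(block_mat p F *\<^sub>v y) $ (block_offset m k + a) =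
      (\<Sum>l=1..p. \<Sum>b<m l. if l = k then F k $$ (a, b) * y $ (block_offset m k + b) else 0)"
    unfolding mult_mat_vec_index_sum[OF block_mat_carrier[OF F] y block_index_less[where m = m, OF k]] sum_block_offset
    using block_mat_index[OF F k(1) _ k(2)] by (intro sum.cong refl) auto
  also have "\<dots> = (\<Sum>l=1..p. if l = k then (\<Sum>b<m k. F k $$ (a, b) * y $ (block_offset m k + b)) else 0)"
    by (intro sum.cong refl) auto
  also have "\<dots> = (\<Sum>b<m k. F k $$ (a, b) * y $ (block_offset m k + b))" using k by simp
  also have "\<dots> = (F k *\<^sub>v vec (m k) (\<lambda>b. y $ (block_offset m k + b))) $ a"
    using mult_mat_vec_index_sum[OF bspec[OF F k(1)] _ k(2), of "vec (m k) (\<lambda>b. y $ (block_offset m k + b))"] by simp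
  finally show ?thesis .
qed

lemma block_mat_uminus:
  assumes F: "\<forall>k\<in>{1..p}. F k \<in> carrier_mat (m k) (m k)"
  shows "block_mat p (\<lambda>k. - F k) = - block_mat p F"
proof (rule block_mat_eqI)
  have nF: "\<forall>k\<in>{1..p}. - F k \<in> carrier_mat (m k) (m k)" using F by simp
  note c = block_mat_carrier[OF F]
  show "block_mat p (\<lambda>k. - F k) \<in> carrier_mat (block_offset m (Suc p)) (block_offset m (Suc p))"
    by (rule block_mat_carrier[OF nF])
  show "- block_mat p F \<in> carrier_mat (block_offset m (Suc p)) (block_offset m (Suc p))" using c by simp
  fix k l a b assume kl: "k \<in> {1..p}" "l \<in> {1..p}" and ab: "a < m k" "b < m l"
  show "block_mat p (\<lambda>k. - F k) $$ (block_offset m k + a, block_offset m l + b) =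
    (- block_mat p F) $$ (block_offset m k + a, block_offset m l + b)"
    using block_mat_index[OF F kl ab] block_mat_index[OF nF kl ab] bspec[OF F kl(1)] ab
      c block_index_less[where m = m, OF kl(1) ab(1)] block_index_less[where m = m, OF kl(2) ab(2)] by auto
qed

lemma op_norm_inverse_pos:
  assumes M: "M \<in> carrier_mat n n" and N: "N \<in> carrier_mat n n" "M * N = 1\<^sub>m n" and n: "0 < n"
  shows "0 < op_norm N"
proof -
  have u: "unit_vec n 0 \<in> carrier_vec n" by simp
  have "unit_vec n 0 = M *\<^sub>v (N *\<^sub>v unit_vec n 0)"
    using assoc_mult_mat_vec[OF M N(1) u] N(2) u by simp
  moreover have "1 \<le> euclid_norm (unit_vec n 0 :: real vec)"
    using abs_vec_index_le_euclid_norm[of 0 "unit_vec n 0"] n by simp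
  moreover have Nu: "N *\<^sub>v unit_vec n 0 \<in> carrier_vec n" using N(1) by simp
  ultimately have one: "1 \<le> op_norm M * euclid_norm (N *\<^sub>v unit_vec n 0)"
    using mult_mat_vec_norm_le[OF M Nu] by simp
  have le: "euclid_norm (N *\<^sub>v unit_vec n 0) \<le> op_norm N * euclid_norm (unit_vec n 0 :: real vec)"
    by (rule mult_mat_vec_norm_le[OF N(1) u])
  have "op_norm N \<noteq> 0"
  proof
    assume "op_norm N = 0"
    then have "euclid_norm (N *\<^sub>v unit_vec n 0) = 0" using le by (simp add: antisym)
    then show False using one by simp
  qed
  then show ?thesis using op_norm_nonneg[of N] by linarith
qed

text \<open>The smallest stretching factor of \<open>M\<close> is \<open>1 / op_norm M'\<close>. The bound follows by taking suprema, first over \<open>z\<close>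
  and then, with \<open>y = M' w\<close>, over \<open>w\<close>.\<close>

lemma op_norm_mult_inverse_le:
  assumes M: "M \<in> carrier_mat n n" and M': "M' \<in> carrier_mat n n" "M * M' = 1\<^sub>m n" and N: "N \<in> carrier_mat l l"
    and K: "0 \<le> K" and le: "\<And>y z. y \<in> carrier_vec n \<Longrightarrow> z \<in> carrier_vec l \<Longrightarrow>
      euclid_norm (N *\<^sub>v z) * euclid_norm y \<le> K * euclid_norm (M *\<^sub>v y) * euclid_norm z"
  shows "op_norm N * op_norm M' \<le> K"
proof -
  have one: "op_norm N * euclid_norm (M' *\<^sub>v w) \<le> K * euclid_norm w" if w: "w \<in> carrier_vec n" for w
  proof (cases "euclid_norm (M' *\<^sub>v w) = 0")
    case False
    then have p: "0 < euclid_norm (M' *\<^sub>v w)" using euclid_norm_nonneg[of "M' *\<^sub>v w"] by linarith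
    have M'w: "M' *\<^sub>v w \<in> carrier_vec n" using M'(1) w by auto
    have "M *\<^sub>v (M' *\<^sub>v w) = w" using assoc_mult_mat_vec[OF M M'(1) w] M'(2) w by simp
    then have "euclid_norm (N *\<^sub>v z) \<le> K * euclid_norm w / euclid_norm (M' *\<^sub>v w) * euclid_norm z" if "z \<in> carrier_vec l" for z
      using le[OF M'w that] p by (simp add: field_simps)
    then have "op_norm N \<le> K * euclid_norm w / euclid_norm (M' *\<^sub>v w)"
      using K by (intro op_norm_le[OF N]) auto
    then show ?thesis using p by (simp add: field_simps)
  qed (use K in simp)
  show ?thesis
  proof (cases "op_norm N = 0")
    case False
    then have p: "0 < op_norm N" using op_norm_nonneg[of N] by linarith
    have "op_norm M' \<le> K / op_norm N"
      using one p K by (intro op_norm_le[OF M'(1)]) (auto simp: field_simps)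
    then show ?thesis using p by (simp add: field_simps)
  qed (use K in simp)
qed

context adapted_system
begin

definition X :: "nat \<Rightarrow> real \<Rightarrow> real mat" where
  "X k t = mat d (m k) (\<lambda>(i, a). \<Phi> t $$ (i, off k + a))"

definition embed :: "nat \<Rightarrow> real vec \<Rightarrow> real vec" where
  "embed k v = vec d (\<lambda>i. if off k \<le> i \<and> i < off (Suc k) then v $ (i - off k) else 0)"

lemma X_carrier: "X k t \<in> carrier_mat d (m k)"
  by (simp add: X_def)

lemma embed_carrier: "embed k v \<in> carrier_vec d"
  by (simp add: embed_def)

lemma off_index_less: "k \<in> {1..p} \<Longrightarrow> a < m k \<Longrightarrow> off k + a < d"
  using block_index_less[where m = m and p = p] off_last by simp

lemma embed_index:
  assumes kl: "k \<in> {1..p}" "l \<in> {1..p}" and a: "a < m l"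
  shows "embed k v $ (off l + a) = (if l = k then v $ a else 0)"
proof -
  have "off k \<le> off l + a \<and> off l + a < off (Suc k) \<longleftrightarrow> l = k"
  proof
    assume h: "off k \<le> off l + a \<and> off l + a < off (Suc k)"
    have "block_of (off l + a) = k" using h by (intro block_of_unique kl) auto
    moreover have "block_of (off l + a) = l" using a kl by (intro block_of_unique kl) (auto simp: block_offset_Suc)
    ultimately show "l = k" by simp
  qed (use a kl in \<open>auto simp: block_offset_Suc\<close>)
  then show ?thesis using off_index_less[OF kl(2) a] by (auto simp: embed_def)
qed

lemma X_mult:
  assumes t: "0 \<le> t" and k: "k \<in> {1..p}" and v: "v \<in> carrier_vec (m k)"
  shows "X k t *\<^sub>v v = \<Phi> t *\<^sub>v embed k v"
proof (rule eq_vecI)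
  note c = fundamental_matrix_carrier[OF \<Phi> t]
  show "dim_vec (X k t *\<^sub>v v) = dim_vec (\<Phi> t *\<^sub>v embed k v)" using c X_carrier[of k t] by simp
  fix i assume "i < dim_vec (\<Phi> t *\<^sub>v embed k v)"
  then have i: "i < d" using c by simp
  have "(\<Phi> t *\<^sub>v embed k v) $ i = (\<Sum>l=1..p. \<Sum>a<m l. \<Phi> t $$ (i, off l + a) * embed k v $ (off l + a))"
    unfolding mult_mat_vec_index_sum[OF c embed_carrier i]
    using sum_block_offset[of "\<lambda>j. \<Phi> t $$ (i, j) * embed k v $ j" m p] off_last by simp
  also have "\<dots> = (\<Sum>l=1..p. if l = k then (\<Sum>a<m k. \<Phi> t $$ (i, off k + a) * v $ a) else 0)"
    by (intro sum.cong refl) (auto simp: embed_index[OF k])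
  also have "\<dots> = (\<Sum>a<m k. \<Phi> t $$ (i, off k + a) * v $ a)" using k by simp
  also have "\<dots> = (X k t *\<^sub>v v) $ i"
    unfolding mult_mat_vec_index_sum[OF X_carrier v i] using i by (simp add: X_def)
  finally show "(X k t *\<^sub>v v) $ i = (\<Phi> t *\<^sub>v embed k v) $ i" ..
qed

lemma block:
  assumes k: "k \<in> {1..p}"
  shows "injective_solution d (m k) A (X k)"
proof
  show "bounded_system d A" by (rule A)
  show "X k s \<in> carrier_mat d (m k)" for s by (rule X_carrier)
  fix t :: real assume t: "0 \<le> t"
  note c = fundamental_matrix_carrier[OF \<Phi> t]
  show "((\<lambda>s. X k s $$ (i, j)) has_real_derivative (A t * X k t) $$ (i, j)) (at t within {0..})"
    if ij: "i < d" "j < m k" for i j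
  proof -
    note o = off_index_less[OF k ij(2)]
    have "((\<lambda>s. \<Phi> s $$ (i, off k + j)) has_real_derivative (A t * \<Phi> t) $$ (i, off k + j)) (at t within {0..})"
      using \<Phi> t ij(1) o by (simp add: fundamental_matrix_def has_mat_derivative_def)
    moreover have "(A t * \<Phi> t) $$ (i, off k + j) = (A t * X k t) $$ (i, j)"
    proof -
      have "col (X k t) j = col (\<Phi> t) (off k + j)" using c ij(2) o by (intro eq_vecI) (auto simp: X_def)
      then show ?thesis using bounded_system_carrier[OF A t] c X_carrier[of k t] ij o by simp
    qed
    moreover have "(\<lambda>s. X k s $$ (i, j)) = (\<lambda>s. \<Phi> s $$ (i, off k + j))" using ij by (simp add: X_def)
    ultimately show ?thesis by simp
  qed
  show "0 < gdet (X k t)"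
  proof (rule gdet_pos[OF X_carrier])
    fix v assume v: "v \<in> carrier_vec (m k)" "X k t *\<^sub>v v = 0\<^sub>v d"
    then have "\<Phi> t *\<^sub>v embed k v = 0\<^sub>v d" using X_mult[OF t k v(1)] by simp
    then have z: "embed k v = 0\<^sub>v d"
      by (rule mult_mat_vec_eq_0[OF c fundamental_matrix_det[OF \<Phi> t] embed_carrier])
    have "v $ a = 0" if "a < m k" for a
      using arg_cong[OF z, of "\<lambda>v. v $ (off k + a)"] embed_index[OF k k that] off_index_less[OF k that] by simp
    then show "v = 0\<^sub>v (m k)" using v(1) by (intro eq_vecI) auto
  qed
qed

abbreviation "T k \<equiv> injective_solution.T (X k)"
abbreviation "Q k \<equiv> injective_solution.Q (X k)"
abbreviation "R k \<equiv> injective_solution.R (X k)"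
abbreviation "B k \<equiv> injective_solution.B (m k) (X k)"

lemma block_carriers:
  assumes k: "k \<in> {1..p}"
  shows "T k t \<in> carrier_mat (m k) (m k)" "Q k t \<in> carrier_mat d (m k)" "R k t \<in> carrier_mat (m k) (m k)"
    "B k t \<in> carrier_mat (m k) (m k)"
  using injective_solution.carriers[OF block[OF k]] by auto

text \<open>The orthonormal columns of \<open>Q\<close> drop out of the norm. This identity transports exponents and domination
  from \<open>\<Phi>\<close> to the triangular blocks.\<close>

lemma norm_R:
  assumes t: "0 \<le> t" and k: "k \<in> {1..p}" and v: "v \<in> carrier_vec (m k)"
  shows "euclid_norm (R k t *\<^sub>v v) = euclid_norm (\<Phi> t *\<^sub>v embed k v)"
proof -
  interpret I: injective_solution d "m k" A "X k" by (rule block[OF k])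
  note c = block_carriers[OF k, of t]
  have Rv: "R k t *\<^sub>v v \<in> carrier_vec (m k)" using c v by auto
  have "\<Phi> t *\<^sub>v embed k v = Q k t *\<^sub>v (R k t *\<^sub>v v)"
    unfolding X_mult[OF t k v, symmetric] I.QR[OF t, symmetric] by (rule assoc_mult_mat_vec[OF c(2,3) v])
  then show ?thesis using euclid_norm_orthonormal_mult[OF c(2) I.Q_orthonormal[OF t] Rv] by simp
qed

lemma triangular: "triangular_blocks p m B"
  unfolding triangular_blocks_def using block_carriers injective_solution.B_triangular[OF block] by blast

lemma exponents: "block_exponents p m lam B"
  unfolding block_exponents_def
proof (intro ballI)
  fix k y assume k: "k \<in> {1..p}" and y: "y \<in> solutions (m k) (B k) - {zero_solution (m k)}"
  interpret I: injective_solution d "m k" A "X k" by (rule block[OF k])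
  obtain c where c: "c \<in> carrier_vec (m k)" and yc: "y = solution_of (R k) c"
    using y solutions_eq_image[OF I.B_bounded_system I.R_fundamental] by auto
  have "c \<noteq> 0\<^sub>v (m k)" using solution_of_zero[OF I.R_fundamental] y yc by auto
  then obtain a where a: "a < m k" "c $ a \<noteq> 0" using c 
    by (metis carrier_vecD eq_vecI index_zero_vec(1) index_zero_vec(2))
  have e: "euclid_norm (y t) = euclid_norm (solution_of \<Phi> (embed k c) t)" if "0 \<le> t" for t
    using norm_R[OF that k c] that unfolding yc solution_of_def by simp
  have "char_exponent y = char_exponent (solution_of \<Phi> (embed k c))"
    unfolding char_exponent_def
    by (intro Limsup_eq eventually_mono[OF eventually_ge_at_top[of 0]]) (simp add: e)
  also have "\<dots> = ereal (lam k)"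
  proof (rule block_exponent[OF k embed_carrier])
    show "embed k c $ i = 0" if "i < off k" for i
      using that off_le[of k] k by (simp add: embed_def)
    show "off k + a < off (Suc k)" using a k by (simp add: block_offset_Suc)
    show "embed k c $ (off k + a) \<noteq> 0" using embed_index[OF k k a(1)] a(2) by simp
  qed
  finally show "char_exponent y = ereal (lam k)" .
qed

definition L :: "real \<Rightarrow> real mat" where "L t = \<Phi> t * block_mat p (\<lambda>k. T k t)"

definition L_inv :: "real \<Rightarrow> real mat" where "L_inv t = block_mat p (\<lambda>k. R k t) * inv_mat (\<Phi> t)"

lemma block_mat_carriers:
  "block_mat p (\<lambda>k. T k t) \<in> carrier_mat d d" "block_mat p (\<lambda>k. R k t) \<in> carrier_mat d d"
  "block_mat p (\<lambda>k. B k t) \<in> carrier_mat d d"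
  using block_carriers by (intro block_mat_carrier[of p _ m, unfolded off_last] ballI; simp)+

lemma
  assumes t: "0 \<le> t"
  shows L_carrier: "L t \<in> carrier_mat d d" and L_inv_carrier: "L_inv t \<in> carrier_mat d d"
    and L_inv_L: "L_inv t * L t = 1\<^sub>m d" and L_det: "Determinant.det (L t) \<noteq> 0" and inv_L: "inv_mat (L t) = L_inv t"
proof -
  note c = fundamental_matrix_carrier[OF \<Phi> t]
  note i = inv_mat_inverse[OF c fundamental_matrix_det[OF \<Phi> t]]
  let ?T = "block_mat p (\<lambda>k. T k t)" and ?R = "block_mat p (\<lambda>k. R k t)"
  note bc = block_mat_carriers[of t]
  show L: "L t \<in> carrier_mat d d" unfolding L_def by (rule mult_carrier_mat[OF c bc(1)])
  show Li: "L_inv t \<in> carrier_mat d d" unfolding L_inv_def by (rule mult_carrier_mat[OF bc(2) i(1)])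
  have "inv_mat (\<Phi> t) * L t = ?T"
    unfolding L_def using assoc_mult_mat[OF i(1) c bc(1)] i(3) left_mult_one_mat[OF bc(1)] by simp
  then have "L_inv t * L t = ?R * ?T"
    unfolding L_inv_def using assoc_mult_mat[OF bc(2) i(1) L] by simp
  also have "\<dots> = 1\<^sub>m d"
    using block_carriers injective_solution.RT[OF block t]
    by (subst block_mat_inverse[of p "\<lambda>k. R k t" m]) (auto simp: off_last)
  finally show LL: "L_inv t * L t = 1\<^sub>m d" .
  show "Determinant.det (L t) \<noteq> 0" "inv_mat (L t) = L_inv t" using inv_mat_unique[OF L Li LL] by auto
qed

lemma L_derivative: "has_mat_derivative d L (\<lambda>t. A t * L t - L t * block_mat p (\<lambda>k. B k t))"
proof -
  have DT: "has_mat_derivative d (\<lambda>t. block_mat p (\<lambda>k. T k t)) (\<lambda>t. block_mat p (\<lambda>k. - (T k t * B k t)))"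
    using block_mat_has_derivative[of p m T "\<lambda>k t. - (T k t * B k t)"] injective_solution.T_derivative[OF block]
    by (simp add: off_last)
  have D\<Phi>: "has_mat_derivative d \<Phi> (\<lambda>t. A t * \<Phi> t)" using \<Phi> by (simp add: fundamental_matrix_def)
  show ?thesis
  proof (rule has_mat_derivative_cong[OF has_mat_derivative_mult[OF D\<Phi> DT]])
    fix t :: real assume t: "0 \<le> t"
    show "\<Phi> t * block_mat p (\<lambda>k. T k t) = L t" by (simp add: L_def)
    let ?T = "block_mat p (\<lambda>k. T k t)" and ?B = "block_mat p (\<lambda>k. B k t)"
    note c = fundamental_matrix_carrier[OF \<Phi> t] and bc = block_mat_carriers[of t] and Ac = bounded_system_carrier[OF A t]
    have "block_mat p (\<lambda>k. - (T k t * B k t)) = - block_mat p (\<lambda>k. T k t * B k t)"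
      by (intro block_mat_uminus[of _ _ m] ballI mult_carrier_mat[OF block_carriers(1,4)])
    also have "block_mat p (\<lambda>k. T k t * B k t) = ?T * ?B"
      using block_carriers by (intro block_mat_mult[of _ _ m, symmetric]) auto
    finally have "\<Phi> t * block_mat p (\<lambda>k. - (T k t * B k t)) = - (\<Phi> t * (?T * ?B))"
      using c bc by (simp add: uminus_mult_right_mat)
    also have "\<Phi> t * (?T * ?B) = L t * ?B" unfolding L_def by (rule assoc_mult_mat[OF c bc(1,3), symmetric])
    finally have "\<Phi> t * block_mat p (\<lambda>k. - (T k t * B k t)) = - (L t * ?B)" .
    moreover have "A t * \<Phi> t * ?T = A t * L t" unfolding L_def by (rule assoc_mult_mat[OF Ac c bc(1)])
    moreover have "A t * L t \<in> carrier_mat d d" "L t * ?B \<in> carrier_mat d d" using Ac L_carrier[OF t] bc by auto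
    ultimately show "A t * \<Phi> t * ?T + \<Phi> t * block_mat p (\<lambda>k. - (T k t * B k t)) = A t * L t - L t * ?B"
      by (simp add: add_uminus_minus_mat)
  qed
qed

lemma L_entry:
  assumes k: "k \<in> {1..p}" "a < m k" and i: "i < d" and t: "0 \<le> t"
  shows "L t $$ (i, off k + a) = Q k t $$ (i, a)"
proof -
  have F: "\<forall>k\<in>{1..p}. T k t \<in> carrier_mat (m k) (m k)" using block_carriers by simp
  note c = fundamental_matrix_carrier[OF \<Phi> t]
  have "L t $$ (i, off k + a) = (\<Sum>c<m k. \<Phi> t $$ (i, off k + c) * T k t $$ (c, a))"
    unfolding L_def using mult_block_mat_index[OF F c[folded off_last] i[folded off_last] k] i off_last by simp
  also have "\<dots> = (X k t * T k t) $$ (i, a)"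
    using i k X_carrier[of k t] block_carriers(1)[OF k(1), of t]
    by (simp add: scalar_prod_def lessThan_atLeast0 X_def)
  also have "\<dots> = Q k t $$ (i, a)" by (simp add: injective_solution.Q_def[OF block[OF k(1)]])
  finally show ?thesis .
qed

lemma L_bounded_system: "bounded_system d L"
proof (rule bounded_systemI)
  show "L t \<in> carrier_mat d d" if "0 \<le> t" for t by (rule L_carrier[OF that])
  fix i j assume ij: "i < d" "j < d"
  show "continuous_on {0..} (\<lambda>t. L t $$ (i, j))"
    using L_derivative ij unfolding has_mat_derivative_def by (intro DERIV_continuous_on) auto
  obtain k a where k: "k \<in> {1..p}" "a < m k" "j = off k + a" using ij(2) unfolding off_last[symmetric] by (rule block_offset_decompose)
  have "\<bar>L t $$ (i, j)\<bar> \<le> 1" if t: "0 \<le> t" for t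
    unfolding k(3) L_entry[OF k(1,2) ij(1) t]
    by (rule orthonormal_entry_le_1[OF block_carriers(2)[OF k(1)] injective_solution.Q_orthonormal[OF block[OF k(1)] t] ij(1) k(2)])
  then show "\<exists>K. \<forall>t\<ge>0. \<bar>L t $$ (i, j)\<bar> \<le> K" by blast
qed

end

locale dominated_system = adapted_system +
  assumes dominated: "\<And>l. l \<in> {1..<p} \<Longrightarrow> \<exists>C. volume_dominated d (off (Suc l)) \<Phi> C"
begin

definition cut :: "nat \<Rightarrow> real vec \<Rightarrow> real vec" where
  "cut l v = vec d (\<lambda>i. if i < off (Suc l) then v $ i else 0)"

text \<open>At an inner block boundary this is the angle estimate; at the two ends the cut is zero or everything.\<close>

lemma cut_norm_le:
  "\<exists>K\<ge>0. \<forall>t\<ge>0. \<forall>v\<in>carrier_vec d. \<forall>l\<le>p. euclid_norm (\<Phi> t *\<^sub>v cut l v) \<le> K * euclid_norm (\<Phi> t *\<^sub>v v)"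
proof -
  have "\<exists>K\<ge>0. \<forall>t\<ge>0. \<forall>v\<in>carrier_vec d. euclid_norm (\<Phi> t *\<^sub>v cut l v) \<le> K * euclid_norm (\<Phi> t *\<^sub>v v)" if l: "l \<le> p" for l
  proof -
    consider "l = 0" | "l = p" | "l \<in> {1..<p}" using l by force
    then show ?thesis
    proof cases
      case 1
      have "cut l v = 0\<^sub>v d" for v using 1 by (intro eq_vecI) (auto simp: cut_def)
      then have "euclid_norm (\<Phi> t *\<^sub>v cut l v) = 0" if "0 \<le> t" for t v
        using mult_mat_vec_norm_le[OF fundamental_matrix_carrier[OF \<Phi> that], of "0\<^sub>v d"] by (simp add: antisym)
      then show ?thesis by (intro exI[of _ 0]) simp
    next
      case 2
      have "cut l v = v" if "v \<in> carrier_vec d" for v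
        using 2 that by (intro eq_vecI) (auto simp: cut_def off_last)
      then show ?thesis by (intro exI[of _ 1]) simp
    next
      case 3
      obtain C where C: "volume_dominated d (off (Suc l)) \<Phi> C" using dominated[OF 3] by blast
      interpret V: volume_dominated d "off (Suc l)" \<Phi> C by (rule C)
      have "euclid_norm (\<Phi> t *\<^sub>v cut l v) \<le> real (off (Suc l)) * C * euclid_norm (\<Phi> t *\<^sub>v v)"
        if t: "0 \<le> t" and v: "v \<in> carrier_vec d" for t and v :: "real vec"
      proof -
        let ?b = "vec d (\<lambda>i. if i < off (Suc l) then 0 else v $ i)"
        have "cut l v + ?b = v" using v by (intro eq_vecI) (auto simp: cut_def)
        moreover have "cut l v \<in> V.fast" by (auto simp: cut_def)
        moreover have "?b \<in> V.slow" using off_le[of "Suc l"] l by auto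
        ultimately show ?thesis using V.norm_fast_le[OF t, of "cut l v" ?b] by simp
      qed
      then show ?thesis using V.C_nonneg by (intro exI[of _ "real (off (Suc l)) * C"]) auto
    qed
  qed
  then have "\<forall>l. \<exists>K. l \<le> p \<longrightarrow> 0 \<le> K \<and> (\<forall>t\<ge>0. \<forall>v\<in>carrier_vec d. euclid_norm (\<Phi> t *\<^sub>v cut l v) \<le> K * euclid_norm (\<Phi> t *\<^sub>v v))"
    by blast
  from choice[OF this] obtain K where K: "\<And>l. l \<le> p \<Longrightarrow> 0 \<le> K l \<and> (\<forall>t\<ge>0. \<forall>v\<in>carrier_vec d. euclid_norm (\<Phi> t *\<^sub>v cut l v) \<le> K l * euclid_norm (\<Phi> t *\<^sub>v v))"
    by blast
  show ?thesis
  proof (intro exI[of _ "\<Sum>l\<le>p. K l"] conjI allI impI ballI)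
    show "0 \<le> (\<Sum>l\<le>p. K l)" using K by (intro sum_nonneg) auto
    fix t :: real and v :: "real vec" and l assume h: "0 \<le> t" "v \<in> carrier_vec d" "l \<le> p"
    have "K l \<le> (\<Sum>l\<le>p. K l)" using K h(3) by (intro member_le_sum) auto
    then have "K l * euclid_norm (\<Phi> t *\<^sub>v v) \<le> (\<Sum>l\<le>p. K l) * euclid_norm (\<Phi> t *\<^sub>v v)"
      by (rule mult_right_mono) simp
    then show "euclid_norm (\<Phi> t *\<^sub>v cut l v) \<le> (\<Sum>l\<le>p. K l) * euclid_norm (\<Phi> t *\<^sub>v v)"
      using K[OF h(3)] h by force
  qed
qed

text \<open>The component of \<open>v\<close> in block \<open>k\<close> is the difference of two consecutive cuts, and the norm of its image
  is the norm of the \<open>k\<close>-th part of \<open>y\<close>.\<close>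

lemma L_norm_ge: "\<exists>K\<ge>0. \<forall>t\<ge>0. \<forall>y\<in>carrier_vec d. euclid_norm y \<le> K * euclid_norm (L t *\<^sub>v y)"
proof -
  obtain K where K: "K \<ge> 0" "\<And>t v l. 0 \<le> t \<Longrightarrow> v \<in> carrier_vec d \<Longrightarrow> l \<le> p \<Longrightarrow>
      euclid_norm (\<Phi> t *\<^sub>v cut l v) \<le> K * euclid_norm (\<Phi> t *\<^sub>v v)"
    using cut_norm_le by blast
  have "euclid_norm y \<le> real d * (2 * K * euclid_norm (L t *\<^sub>v y))" if t: "0 \<le> t" and y: "y \<in> carrier_vec d" for t y
  proof (rule euclid_norm_le_of_abs_le[OF y])
    note c = fundamental_matrix_carrier[OF \<Phi> t]
    fix i assume "i < d"
    then obtain k a where k: "k \<in> {1..p}" "a < m k" "i = off k + a"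
      unfolding off_last[symmetric] by (rule block_offset_decompose)
    interpret I: injective_solution d "m k" A "X k" by (rule block[OF k(1)])
    define v where "v = block_mat p (\<lambda>k. T k t) *\<^sub>v y"
    have v: "v \<in> carrier_vec d" unfolding v_def by (rule mult_mat_vec_carrier[OF block_mat_carriers(1) y])
    have Lv: "L t *\<^sub>v y = \<Phi> t *\<^sub>v v"
      unfolding L_def v_def by (rule assoc_mult_mat_vec[OF c block_mat_carriers(1) y])
    define yk where "yk = vec (m k) (\<lambda>b. y $ (off k + b))"
    have yk: "yk \<in> carrier_vec (m k)" by (simp add: yk_def)
    note bc = block_carriers[OF k(1), of t]
    have Ty: "T k t *\<^sub>v yk \<in> carrier_vec (m k)" by (rule mult_mat_vec_carrier[OF bc(1) yk])
    have F: "\<forall>k\<in>{1..p}. T k t \<in> carrier_mat (m k) (m k)" using block_carriers by simp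
    have vk: "v $ (off k + b) = (T k t *\<^sub>v yk) $ b" if "b < m k" for b
      unfolding v_def yk_def by (rule block_mat_mult_vec_index[OF F y[folded off_last] k(1) that])
    \<comment> \<open>For \<open>k = 1\<close> the second cut is at \<open>off 1 = 0\<close> and removes everything.\<close>
    have "cut k v + - cut (k - 1) v = embed k (T k t *\<^sub>v yk)"
    proof (rule eq_vecI)
      fix i assume "i < dim_vec (embed k (T k t *\<^sub>v yk))"
      then have i: "i < d" by (simp add: embed_def)
      have kk: "Suc (k - 1) = k" using k(1) by simp
      have "off k \<le> i \<Longrightarrow> i < off (Suc k) \<Longrightarrow> v $ i = (T k t *\<^sub>v yk) $ (i - off k)"
        using vk[of "i - off k"] k(1) by (simp add: block_offset_Suc)
      moreover have "off k \<le> off (Suc k)" by (rule block_offset_mono) simp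
      ultimately show "(cut k v + - cut (k - 1) v) $ i = embed k (T k t *\<^sub>v yk) $ i"
        using i unfolding embed_def cut_def kk by auto
    qed (simp add: cut_def embed_def)
    moreover have cc: "cut l v \<in> carrier_vec d" for l by (simp add: cut_def)
    moreover have "\<Phi> t *\<^sub>v - cut (k - 1) v = - (\<Phi> t *\<^sub>v cut (k - 1) v)"
      using c cc[of "k - 1"] by (intro eq_vecI) auto
    ultimately have e: "\<Phi> t *\<^sub>v embed k (T k t *\<^sub>v yk) = \<Phi> t *\<^sub>v cut k v + - (\<Phi> t *\<^sub>v cut (k - 1) v)"
      using mult_add_distrib_mat_vec[OF c cc[of k], of "- cut (k - 1) v"] cc[of "k - 1"] by simp
    have "\<bar>y $ i\<bar> \<le> euclid_norm yk"
      using abs_vec_index_le_euclid_norm[of a yk] k by (simp add: yk_def)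
    also have "euclid_norm yk = euclid_norm (\<Phi> t *\<^sub>v embed k (T k t *\<^sub>v yk))"
      unfolding norm_R[OF t k(1) Ty, symmetric]
      using assoc_mult_mat_vec[OF bc(3,1) yk] I.RT[OF t] yk by simp
    also have "\<dots> \<le> euclid_norm (\<Phi> t *\<^sub>v cut k v) + euclid_norm (\<Phi> t *\<^sub>v cut (k - 1) v)"
      unfolding e using euclid_norm_triangle[of "\<Phi> t *\<^sub>v cut k v" d "- (\<Phi> t *\<^sub>v cut (k - 1) v)"]
        mult_mat_vec_carrier[OF c cc[of k]] mult_mat_vec_carrier[OF c cc[of "k - 1"]]
      by (simp add: euclid_norm_uminus)
    also have "\<dots> \<le> 2 * K * euclid_norm (L t *\<^sub>v y)"
    proof -
      have "k \<le> p" "k - 1 \<le> p" using k(1) by auto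
      from K(2)[OF t v this(1)] K(2)[OF t v this(2)] show ?thesis unfolding Lv by linarith
    qed
    finally show "\<bar>y $ i\<bar> \<le> 2 * K * euclid_norm (L t *\<^sub>v y)" .
  qed
  then show ?thesis using K(1) by (intro exI[of _ "real d * (2 * K)"]) (auto simp: mult.assoc)
qed

lemma L_inv_bounded: "mat_bounded L_inv"
proof -
  obtain K where K: "K \<ge> 0" "\<And>t y. 0 \<le> t \<Longrightarrow> y \<in> carrier_vec d \<Longrightarrow> euclid_norm y \<le> K * euclid_norm (L t *\<^sub>v y)"
    using L_norm_ge by blast
  have "op_norm (L_inv t) \<le> K" if t: "0 \<le> t" for t
  proof (rule op_norm_le[OF L_inv_carrier[OF t] _ K(1)])
    fix z :: "real vec" assume z: "z \<in> carrier_vec d"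
    have Lz: "L_inv t *\<^sub>v z \<in> carrier_vec d" using L_inv_carrier[OF t] z by auto
    have "L t * L_inv t = 1\<^sub>m d"
      using inv_mat_inverse(2)[OF L_carrier[OF t] L_det[OF t]] inv_L[OF t] by simp
    then have "L t *\<^sub>v (L_inv t *\<^sub>v z) = z"
      using assoc_mult_mat_vec[OF L_carrier[OF t] L_inv_carrier[OF t] z] z by simp
    then show "euclid_norm (L_inv t *\<^sub>v z) \<le> K * euclid_norm z" using K(2)[OF t Lz] by simp
  qed
  then show ?thesis unfolding mat_bounded_def by blast
qed

theorem reducible: "lyapunov_reducible d A (block_diag p B)"
proof -
  let ?B = "\<lambda>t. block_mat p (\<lambda>k. B k t)"
  let ?L' = "\<lambda>t. A t * L t - L t * ?B t"
  have Bb: "bounded_system d ?B"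
    using block_mat_bounded_system[of p m B] injective_solution.B_bounded_system[OF block] by (simp add: off_last)
  have L'b: "bounded_system d ?L'"
    by (intro bounded_system_minus bounded_system_mult A L_bounded_system Bb)
  have "lyapunov_transformation d L ?L'"
    unfolding lyapunov_transformation_def
  proof (intro conjI allI impI)
    show "has_mat_derivative d L ?L'" by (rule L_derivative)
    show "mat_continuous d ?L'" "mat_bounded ?L'" "mat_bounded L"
      using L'b L_bounded_system by (auto simp: bounded_system_def)
    show "invertible_mat (L t)" if "0 \<le> t" for t
      using invertible_mat_iff_det_nonzero[OF L_carrier[OF that]] L_det[OF that] by blast
    show "mat_bounded (\<lambda>t. inv_mat (L t))"
      using L_inv_bounded inv_L unfolding mat_bounded_def by simp
  qed
  moreover have "block_diag p B t = inv_mat (L t) * A t * L t - inv_mat (L t) * ?L' t" if t: "0 \<le> t" for t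
  proof -
    note c = L_inv_carrier[OF t] bounded_system_carrier[OF A t] L_carrier[OF t] block_mat_carriers(3)[of t]
    have AL: "A t * L t \<in> carrier_mat d d" "L t * ?B t \<in> carrier_mat d d" using c by auto
    have "L_inv t * (L t * ?B t) = ?B t"
      using assoc_mult_mat[OF c(1,3,4)] L_inv_L[OF t] left_mult_one_mat[OF c(4)] by simp
    then have "L_inv t * ?L' t = L_inv t * A t * L t - ?B t"
      using mult_minus_distrib_mat[OF c(1) AL] assoc_mult_mat[OF c(1,2,3)] by simp
    moreover have "M - (M - ?B t) = ?B t" if "M \<in> carrier_mat d d" for M
      using that c(4) by (intro eq_matI) auto
    moreover have "L_inv t * A t * L t \<in> carrier_mat d d" using c by auto
    ultimately show ?thesis by (simp add: inv_L[OF t] block_diag_eq_block_mat)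
  qed
  ultimately show ?thesis unfolding lyapunov_reducible_def by blast
qed

text \<open>Applied to a vector of block \<open>k\<close> and one of the next block, the comparison of fast and slow solutions at the
  boundary between them bounds the product of the two operator norms.\<close>

theorem domination: "block_domination p m B"
proof -
  have "\<exists>K\<ge>0. \<forall>t s. 0 \<le> s \<longrightarrow> s \<le> t \<longrightarrow>
    op_norm (cauchy_matrix (m (Suc k)) (B (Suc k)) t s) * op_norm (inv_mat (cauchy_matrix (m k) (B k) t s)) \<le> K \<and>
    0 < op_norm (inv_mat (cauchy_matrix (m k) (B k) t s))" if k: "k \<in> {1..<p}" for k
  proof -
    have k': "k \<in> {1..p}" "Suc k \<in> {1..p}" using k by auto
    obtain C where C: "volume_dominated d (off (Suc k)) \<Phi> C" using dominated[OF k] by blast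
    interpret V: volume_dominated d "off (Suc k)" \<Phi> C by (rule C)
    interpret I: injective_solution d "m k" A "X k" by (rule block[OF k'(1)])
    interpret J: injective_solution d "m (Suc k)" A "X (Suc k)" by (rule block[OF k'(2)])
    let ?K = "real (off (Suc k)) * C * (1 + real (off (Suc k)) * C)"
    have K: "0 \<le> ?K" using V.C_nonneg by simp
    have "op_norm (cauchy_matrix (m (Suc k)) (B (Suc k)) t s) * op_norm (inv_mat (cauchy_matrix (m k) (B k) t s)) \<le> ?K \<and>
      0 < op_norm (inv_mat (cauchy_matrix (m k) (B k) t s))" if s: "0 \<le> s" and st: "s \<le> t" for t s
    proof -
      have t: "0 \<le> t" using s st by simp
      note c = block_carriers[OF k'(1)] and c' = block_carriers[OF k'(2)]
      have M: "cauchy_matrix (m k) (B k) t s = R k t * T k s"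
        using cauchy_matrix_eq[OF I.B_bounded_system I.R_fundamental t s] inv_mat_unique(1)[OF c(3) c(1) I.TR[OF s]] by simp
      have N: "cauchy_matrix (m (Suc k)) (B (Suc k)) t s = R (Suc k) t * T (Suc k) s"
        using cauchy_matrix_eq[OF J.B_bounded_system J.R_fundamental t s] inv_mat_unique(1)[OF c'(3) c'(1) J.TR[OF s]] by simp
      have Mc: "R k t * T k s \<in> carrier_mat (m k) (m k)" using c by (auto intro: mult_carrier_mat)
      have Nc: "R (Suc k) t * T (Suc k) s \<in> carrier_mat (m (Suc k)) (m (Suc k))" using c' by (auto intro: mult_carrier_mat)
      have "Determinant.det (R k t) \<noteq> 0" "Determinant.det (T k s) \<noteq> 0"
        using fundamental_matrix_det[OF I.R_fundamental t] I.T_det[OF s] by auto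
      then have "Determinant.det (R k t * T k s) \<noteq> 0" using det_mult[OF c(3) c(1)] by simp
      note Mi = inv_mat_inverse[OF Mc this]
      have "euclid_norm (R (Suc k) t * T (Suc k) s *\<^sub>v z) * euclid_norm y \<le>
          ?K * euclid_norm (R k t * T k s *\<^sub>v y) * euclid_norm z"
        if y: "y \<in> carrier_vec (m k)" and z: "z \<in> carrier_vec (m (Suc k))" for y z
      proof -
        let ?a = "embed k (T k s *\<^sub>v y)" and ?b = "embed (Suc k) (T (Suc k) s *\<^sub>v z)"
        have Ty: "T k s *\<^sub>v y \<in> carrier_vec (m k)" by (rule mult_mat_vec_carrier[OF c(1) y])
        have Tz: "T (Suc k) s *\<^sub>v z \<in> carrier_vec (m (Suc k))" by (rule mult_mat_vec_carrier[OF c'(1) z])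
        have "?a \<in> V.fast" "?b \<in> V.slow" using off_le[of "Suc k"] k by (auto simp: embed_def)
        from V.fast_dominates_slow[OF s st this]
        have main: "euclid_norm (R (Suc k) t *\<^sub>v (T (Suc k) s *\<^sub>v z)) * euclid_norm (R k s *\<^sub>v (T k s *\<^sub>v y)) \<le>
            ?K * euclid_norm (R k t *\<^sub>v (T k s *\<^sub>v y)) * euclid_norm (R (Suc k) s *\<^sub>v (T (Suc k) s *\<^sub>v z))"
          unfolding norm_R[OF t k'(1) Ty] norm_R[OF s k'(1) Ty] norm_R[OF t k'(2) Tz] norm_R[OF s k'(2) Tz] .
        have "R k s *\<^sub>v (T k s *\<^sub>v y) = y"
          using assoc_mult_mat_vec[OF c(3,1) y, of s s] I.RT[OF s] y by simp
        moreover have "R (Suc k) s *\<^sub>v (T (Suc k) s *\<^sub>v z) = z"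
          using assoc_mult_mat_vec[OF c'(3,1) z, of s s] J.RT[OF s] z by simp
        ultimately show ?thesis
          using main assoc_mult_mat_vec[OF c(3,1) y, of t s] assoc_mult_mat_vec[OF c'(3,1) z, of t s] by simp
      qed
      then have "op_norm (R (Suc k) t * T (Suc k) s) * op_norm (inv_mat (R k t * T k s)) \<le> ?K"
        by (rule op_norm_mult_inverse_le[OF Mc Mi(1,2) Nc K])
      moreover have "0 < op_norm (inv_mat (R k t * T k s))"
        using block_size_pos[OF k'(1)] by (intro op_norm_inverse_pos[OF Mc Mi(1,2)]) simp
      ultimately show ?thesis unfolding M N by blast
    qed
    then show ?thesis using K by (intro exI[of _ ?K]) blast
  qed
  then have "\<forall>k. \<exists>K. k \<in> {1..<p} \<longrightarrow> 0 \<le> K \<and> (\<forall>t s. 0 \<le> s \<longrightarrow> s \<le> t \<longrightarrow>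
    op_norm (cauchy_matrix (m (Suc k)) (B (Suc k)) t s) * op_norm (inv_mat (cauchy_matrix (m k) (B k) t s)) \<le> K \<and>
    0 < op_norm (inv_mat (cauchy_matrix (m k) (B k) t s)))" by blast
  from choice[OF this] obtain K where K: "\<And>k. k \<in> {1..<p} \<Longrightarrow> 0 \<le> K k \<and> (\<forall>t s. 0 \<le> s \<longrightarrow> s \<le> t \<longrightarrow>
    op_norm (cauchy_matrix (m (Suc k)) (B (Suc k)) t s) * op_norm (inv_mat (cauchy_matrix (m k) (B k) t s)) \<le> K k \<and>
    0 < op_norm (inv_mat (cauchy_matrix (m k) (B k) t s)))"
    by blast
  define S where "S = 1 + (\<Sum>k\<in>{1..<p}. K k)"
  have S: "0 < S" unfolding S_def using K by (intro add_pos_nonneg sum_nonneg) auto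
  show ?thesis unfolding block_domination_def
  proof (intro exI[of _ "1 / S"] conjI allI ballI impI)
    show "0 < 1 / S" using S by simp
    fix t s :: real and k assume k: "k \<in> {1..<p}" and st: "s \<le> t \<and> 0 \<le> s"
    let ?N = "op_norm (cauchy_matrix (m (k + 1)) (B (k + 1)) t s)" and ?M = "op_norm (inv_mat (cauchy_matrix (m k) (B k) t s))"
    have "K k \<le> (\<Sum>k\<in>{1..<p}. K k)" using K k by (intro member_le_sum) auto
    then have "?N * ?M \<le> S" "0 < ?M" using K[OF k] st unfolding S_def by force+
    then show "1 / S * ?N \<le> inverse ?M" using S by (simp add: field_simps)
  qed
qed

end

section \<open>Singular values of dominated block diagonal systems\<close>

lemma sorted_nth_ge_iff:
  fixes xs :: "real list"
  assumes "sorted_wrt (\<ge>) xs" "i < length xs"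
  shows "c \<le> xs ! i \<longleftrightarrow> i < size (filter_mset (\<lambda>x. c \<le> x) (mset xs))"
  using assms
proof (induction xs arbitrary: i)
  case (Cons x xs)
  show ?case
  proof (cases "c \<le> x")
    case True
    then show ?thesis using Cons by (cases i) auto
  next
    case False
    then have no: "\<not> c \<le> y" if "y \<in> set (x # xs)" for y using that Cons.prems(1) by auto
    have "filter_mset (\<lambda>x. c \<le> x) (mset (x # xs)) = {#}"
    proof (rule ccontr)
      assume "\<not> ?thesis"
      then obtain y where "y \<in># filter_mset (\<lambda>x. c \<le> x) (mset (x # xs))" by (rule multiset_nonemptyE)
      then show False using no[of y] False by auto
    qed
    moreover have "\<not> c \<le> (x # xs) ! i" using no nth_mem[OF Cons.prems(2)] by blast
    ultimately show ?thesis by simp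
  qed
qed simp

text \<open>At most \<open>i\<close> elements of \<open>as\<close> exceed \<open>as ! i\<close>, and none of \<open>bs\<close> exceeds \<open>K * as ! i\<close>, so at most \<open>i\<close> elements
  of the union exceed \<open>K * as ! i\<close>.\<close>

lemma sorted_union_nth_bounds:
  fixes as bs xs :: "real list"
  assumes sorted: "sorted_wrt (\<ge>) as" "sorted_wrt (\<ge>) xs" and mset: "mset xs = mset as + mset bs"
    and pos: "\<And>a. a \<in> set as \<Longrightarrow> 0 \<le> a" and K: "1 \<le> K" and le: "\<And>a b. a \<in> set as \<Longrightarrow> b \<in> set bs \<Longrightarrow> b \<le> K * a"
    and i: "i < length as"
  shows "as ! i \<le> xs ! i" "xs ! i \<le> K * as ! i"
proof -
  have "size (mset xs) = size (mset as) + size (mset bs)" unfolding mset by (rule size_union)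
  then have i': "i < length xs" using i by simp
  have "i < size (filter_mset (\<lambda>x. as ! i \<le> x) (mset as))" using sorted_nth_ge_iff[OF sorted(1) i, of "as ! i"] by simp
  then have "i < size (filter_mset (\<lambda>x. as ! i \<le> x) (mset xs))" unfolding mset by simp
  then show "as ! i \<le> xs ! i" using sorted_nth_ge_iff[OF sorted(2) i'] by blast
  have ai: "as ! i \<in> set as" using i by simp
  show "xs ! i \<le> K * as ! i"
  proof (cases "filter_mset (\<lambda>x. xs ! i \<le> x) (mset bs) = {#}")
    case True
    have "i < size (filter_mset (\<lambda>x. xs ! i \<le> x) (mset xs))" using sorted_nth_ge_iff[OF sorted(2) i', of "xs ! i"] by simp
    then have "i < size (filter_mset (\<lambda>x. xs ! i \<le> x) (mset as))" unfolding mset using True by simp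
    then have "xs ! i \<le> as ! i" using sorted_nth_ge_iff[OF sorted(1) i] by blast
    also have "\<dots> \<le> K * as ! i" using mult_right_mono[OF K pos[OF ai]] by simp
    finally show ?thesis .
  next
    case False
    then obtain b where "b \<in># filter_mset (\<lambda>x. xs ! i \<le> x) (mset bs)" by (rule multiset_nonemptyE)
    then have "b \<in> set bs" "xs ! i \<le> b" by auto
    then show ?thesis using le[OF ai] by force
  qed
qed

lemma singular_vectors:
  assumes M: "M \<in> carrier_mat n n" "Determinant.det M \<noteq> 0"
  shows "\<exists>es. length es = n \<and> sorted_wrt (\<ge>) es \<and> proots (char_poly (transpose_mat M * M)) = mset es \<and>
    (\<forall>e\<in>set es. 0 < e \<and> (\<exists>u\<in>carrier_vec n. euclid_norm u = 1 \<and> (euclid_norm (M *\<^sub>v u))\<^sup>2 = e)) \<and>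
    (\<forall>i<n. singular_value (Suc i) M = sqrt (es ! i))"
proof -
  let ?S = "transpose_mat M * M"
  obtain U es where
    U: "U \<in> carrier_mat n n" "transpose_mat U * U = 1\<^sub>m n"
    and es: "length es = n" "sorted_wrt (\<ge>) es" "proots (char_poly ?S) = mset es"
    and D: "transpose_mat U * ?S * U = mat_diag n (\<lambda>i. es ! i)"
    and pos: "\<And>i. i < n \<Longrightarrow> 0 < es ! i"
    and sv: "\<And>i. i < n \<Longrightarrow> singular_value (Suc i) M = sqrt (es ! i)"
    using diagonalized_Gram[OF M] by auto
  have "0 < e \<and> (\<exists>u\<in>carrier_vec n. euclid_norm u = 1 \<and> (euclid_norm (M *\<^sub>v u))\<^sup>2 = e)" if "e \<in> set es" for e
  proof -
    obtain i where i: "i < n" and e: "e = es ! i" using \<open>e \<in> set es\<close> es(1) by (auto simp: in_set_conv_nth)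
    have u: "col U i \<in> carrier_vec n" using U i by auto
    have "(euclid_norm (col U i))\<^sup>2 = (transpose_mat U * U) $$ (i, i)" using U(1) i by (simp add: euclid_norm_power2)
    then have "(euclid_norm (col U i))\<^sup>2 = 1" unfolding U(2) using i by simp
    then have one: "euclid_norm (col U i) = 1" using euclid_norm_nonneg[of "col U i"] by (simp add: power2_eq_1_iff)
    have "e = (transpose_mat U * ?S * U) $$ (i, i)" unfolding D e using i by (simp add: mat_diag_def)
    also have "transpose_mat U * ?S * U = transpose_mat (M * U) * (M * U)"
      using M U by (simp add: transpose_mult[of _ n n _ n] assoc_mult_mat[of _ n n _ n _ n])
    also have "\<dots> $$ (i, i) = col (M * U) i \<bullet> col (M * U) i" using M U i by simp
    also have "col (M * U) i = M *\<^sub>v col U i" using col_mult2[OF M(1) U(1) i] .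
    finally have "(euclid_norm (M *\<^sub>v col U i))\<^sup>2 = e" by (simp add: euclid_norm_power2)
    then show ?thesis using u one pos[OF i] unfolding e by (intro conjI bexI[of _ "col U i"])
  qed
  then show ?thesis using es sv by blast
qed

lemma prod_singular_values:
  assumes M: "M \<in> carrier_mat n n" "Determinant.det M \<noteq> 0"
  shows "(\<Prod>k=1..n. singular_value k M) = \<bar>Determinant.det M\<bar>"
proof -
  obtain Z where Z: "Z \<in> carrier_mat n n" "transpose_mat Z * Z = 1\<^sub>m n" "vol (M * Z) = (\<Prod>k=1..n. singular_value k M)"
    using singular_value_product(2)[OF M order_refl] by blast
  have "\<bar>Determinant.det Z\<bar> = vol Z" using vol_square[OF Z(1)] by simp
  also have "\<dots> = 1" using Z(2) by (simp add: vol_def)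
  finally show ?thesis using vol_mult_square[OF M(1) Z(1)] vol_square[OF M(1)] Z(3) by simp
qed

lemma proots_char_poly_Gram_block:
  assumes P: "P \<in> carrier_mat n n" and S: "S \<in> carrier_mat r r"
  defines "M \<equiv> four_block_mat P (0\<^sub>m n r) (0\<^sub>m r n) S"
  shows "proots (char_poly (transpose_mat M * M)) =
    proots (char_poly (transpose_mat P * P)) + proots (char_poly (transpose_mat S * (S :: real mat)))"
proof -
  have PP: "transpose_mat P * P \<in> carrier_mat n n" and SS: "transpose_mat S * S \<in> carrier_mat r r" using P S by auto
  have tPS: "transpose_mat P \<in> carrier_mat n n" "transpose_mat S \<in> carrier_mat r r" using P S by auto
  have z: "0\<^sub>m n r \<in> carrier_mat n r" "0\<^sub>m r n \<in> carrier_mat r n" by auto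
  have "transpose_mat M = four_block_mat (transpose_mat P) (0\<^sub>m n r) (0\<^sub>m r n) (transpose_mat S)"
    unfolding M_def using transpose_four_block_mat[OF P z S] by simp
  then have e: "transpose_mat M * M = four_block_mat (transpose_mat P * P) (0\<^sub>m n r) (0\<^sub>m r n) (transpose_mat S * S)"
    unfolding M_def using mult_four_block_mat[OF tPS(1) z tPS(2) P z S] PP SS tPS P S by simp
  have sym: "transpose_mat (transpose_mat N * N) = transpose_mat N * N" if "N \<in> carrier_mat k k" for N :: "real mat" and k
    using that by (simp add: transpose_mult[of _ k k _ k])
  have "char_poly (transpose_mat M * M) = char_poly (transpose_mat P * P) * char_poly (transpose_mat S * S)"
    by (rule char_poly_0_block[OF e _ _ PP z(1) SS])
      (use symmetric_char_poly_splits[OF PP sym[OF P]] symmetric_char_poly_splits[OF SS sym[OF S]] in blast)+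
  moreover have "char_poly (transpose_mat P * P) \<noteq> 0" "char_poly (transpose_mat S * S) \<noteq> 0"
    using degree_monic_char_poly[OF PP] degree_monic_char_poly[OF SS] by auto
  ultimately show ?thesis by (simp add: proots_mult)
qed

text \<open>The squared singular values of \<open>M\<close> are those of \<open>P\<close> and \<open>S\<close> together, and those of \<open>S\<close> are at most \<open>K\<^sup>2\<close>
  times any of \<open>P\<close>. Adding \<open>S\<close> therefore changes the \<open>k\<close>-th largest one at most by the factor \<open>K\<close>.\<close>

lemma block_singular_value_bounds:
  assumes P: "P \<in> carrier_mat n n" "Determinant.det P \<noteq> 0" and S: "S \<in> carrier_mat r r" "Determinant.det S \<noteq> 0"
    and low: "\<And>v. v \<in> carrier_vec n \<Longrightarrow> \<alpha> * euclid_norm v \<le> euclid_norm (P *\<^sub>v v)"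
    and up: "\<And>w. w \<in> carrier_vec r \<Longrightarrow> euclid_norm (S *\<^sub>v w) \<le> K * \<alpha> * euclid_norm w"
    and \<alpha>: "0 < \<alpha>" and K: "1 \<le> K" and k: "k \<in> {1..n}"
  defines "M \<equiv> four_block_mat P (0\<^sub>m n r) (0\<^sub>m r n) S"
  shows "singular_value k P \<le> singular_value k M" "singular_value k M \<le> K * singular_value k P"
proof -
  have z: "0\<^sub>m n r \<in> carrier_mat n r" by simp
  have Mc: "M \<in> carrier_mat (n + r) (n + r)" unfolding M_def using P S by auto
  have "Determinant.det M = Determinant.det P * Determinant.det S"
    unfolding M_def by (rule det_four_block_mat_lower_left_zero[OF P(1) z refl S(1)])
  then have Md: "Determinant.det M \<noteq> 0" using P S by simp
  obtain as where as: "length as = n" "sorted_wrt (\<ge>) as" "proots (char_poly (transpose_mat P * P)) = mset as"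
    and asv: "\<forall>e\<in>set as. 0 < e \<and> (\<exists>u\<in>carrier_vec n. euclid_norm u = 1 \<and> (euclid_norm (P *\<^sub>v u))\<^sup>2 = e)"
    and as_sv: "\<forall>i<n. singular_value (Suc i) P = sqrt (as ! i)"
    using singular_vectors[OF P] by blast
  obtain bs where bs: "proots (char_poly (transpose_mat S * S)) = mset bs"
    and bsv: "\<forall>e\<in>set bs. 0 < e \<and> (\<exists>u\<in>carrier_vec r. euclid_norm u = 1 \<and> (euclid_norm (S *\<^sub>v u))\<^sup>2 = e)"
    using singular_vectors[OF S] by blast
  obtain xs where xs: "length xs = n + r" "sorted_wrt (\<ge>) xs" "proots (char_poly (transpose_mat M * M)) = mset xs"
    and xs_sv: "\<forall>i<n+r. singular_value (Suc i) M = sqrt (xs ! i)"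
    using singular_vectors[OF Mc Md] by blast
  have m: "mset xs = mset as + mset bs"
    using proots_char_poly_Gram_block[OF P(1) S(1)] unfolding M_def[symmetric] as bs xs .
  have le: "b \<le> K\<^sup>2 * a" if a: "a \<in> set as" and b: "b \<in> set bs" for a b
  proof -
    obtain u where u: "u \<in> carrier_vec n" "euclid_norm u = 1" "(euclid_norm (P *\<^sub>v u))\<^sup>2 = a" using asv a by blast
    obtain w where w: "w \<in> carrier_vec r" "euclid_norm w = 1" "(euclid_norm (S *\<^sub>v w))\<^sup>2 = b" using bsv b by blast
    have "\<alpha>\<^sup>2 \<le> a" using power_mono[OF low[OF u(1)], of 2] \<alpha> u by simp
    moreover have "b \<le> (K * \<alpha>)\<^sup>2" using power_mono[OF up[OF w(1)] euclid_norm_nonneg, of 2] w by simp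
    ultimately show ?thesis
      using mult_left_mono[of "\<alpha>\<^sup>2" a "K\<^sup>2"] by (simp add: power_mult_distrib)
  qed
  obtain i where i: "k = Suc i" "i < n" using k by (cases k) auto
  have K2: "1 \<le> K\<^sup>2" using K by (simp add: one_le_power)
  have b: "as ! i \<le> xs ! i" "xs ! i \<le> K\<^sup>2 * as ! i"
    using sorted_union_nth_bounds[OF as(2) xs(2) m _ K2 le, of i] asv as(1) i(2) by (auto simp: less_imp_le)
  have e: "singular_value k P = sqrt (as ! i)" "singular_value k M = sqrt (xs ! i)" using as_sv xs_sv i by auto
  show "singular_value k P \<le> singular_value k M" unfolding e using b(1) by simp
  have "sqrt (xs ! i) \<le> sqrt (K\<^sup>2 * as ! i)" using b(2) by simp
  also have "\<dots> = K * sqrt (as ! i)" using K by (simp add: real_sqrt_mult)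
  finally show "singular_value k M \<le> K * singular_value k P" unfolding e .
qed

lemma block_norm_power2:
  assumes "v \<in> carrier_vec (block_offset m (Suc p))"
  shows "(euclid_norm v)\<^sup>2 = (\<Sum>k=1..p. (euclid_norm (vec (m k) (\<lambda>a. v $ (block_offset m k + a))))\<^sup>2)"
proof -
  have e: "(euclid_norm v)\<^sup>2 = (\<Sum>i<n. (v $ i)\<^sup>2)" if "v \<in> carrier_vec n" for v :: "real vec" and n
    unfolding euclid_norm_power2 using that by (simp add: scalar_prod_def power2_eq_square lessThan_atLeast0)
  show ?thesis unfolding e[OF assms] sum_block_offset
    by (intro sum.cong refl) (subst e[OF vec_carrier], simp)
qed

lemma
  assumes F: "\<forall>k\<in>{1..p}. F k \<in> carrier_mat (m k) (m k)" and v: "v \<in> carrier_vec (block_offset m (Suc p))"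
    and c: "0 \<le> c"
  shows block_mat_norm_le: "(\<And>k w. k \<in> {1..p} \<Longrightarrow> w \<in> carrier_vec (m k) \<Longrightarrow> euclid_norm (F k *\<^sub>v w) \<le> c * euclid_norm w) \<Longrightarrow>
      euclid_norm (block_mat p F *\<^sub>v v) \<le> c * euclid_norm v"
    and block_mat_norm_ge: "(\<And>k w. k \<in> {1..p} \<Longrightarrow> w \<in> carrier_vec (m k) \<Longrightarrow> c * euclid_norm w \<le> euclid_norm (F k *\<^sub>v w)) \<Longrightarrow>
      c * euclid_norm v \<le> euclid_norm (block_mat p F *\<^sub>v v)"
proof -
  let ?v = "\<lambda>k. vec (m k) (\<lambda>a. v $ (block_offset m k + a))"
  have Fv: "block_mat p F *\<^sub>v v \<in> carrier_vec (block_offset m (Suc p))"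
    by (rule mult_mat_vec_carrier[OF block_mat_carrier[OF F] v])
  have "vec (m k) (\<lambda>a. (block_mat p F *\<^sub>v v) $ (block_offset m k + a)) = F k *\<^sub>v ?v k" if "k \<in> {1..p}" for k
    using block_mat_mult_vec_index[OF F v that] bspec[OF F that] by (intro eq_vecI) auto
  then have e: "(euclid_norm (block_mat p F *\<^sub>v v))\<^sup>2 = (\<Sum>k=1..p. (euclid_norm (F k *\<^sub>v ?v k))\<^sup>2)"
    unfolding block_norm_power2[OF Fv] by (intro sum.cong) auto
  have e': "(c * euclid_norm v)\<^sup>2 = (\<Sum>k=1..p. (c * euclid_norm (?v k))\<^sup>2)"
    unfolding power_mult_distrib block_norm_power2[OF v] sum_distrib_left ..
  show "euclid_norm (block_mat p F *\<^sub>v v) \<le> c * euclid_norm v"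
    if h: "\<And>k w. k \<in> {1..p} \<Longrightarrow> w \<in> carrier_vec (m k) \<Longrightarrow> euclid_norm (F k *\<^sub>v w) \<le> c * euclid_norm w"
  proof (rule power2_le_imp_le)
    show "(euclid_norm (block_mat p F *\<^sub>v v))\<^sup>2 \<le> (c * euclid_norm v)\<^sup>2"
      unfolding e e' using h by (intro sum_mono power_mono) auto
  qed (use c in simp)
  show "c * euclid_norm v \<le> euclid_norm (block_mat p F *\<^sub>v v)"
    if h: "\<And>k w. k \<in> {1..p} \<Longrightarrow> w \<in> carrier_vec (m k) \<Longrightarrow> c * euclid_norm w \<le> euclid_norm (F k *\<^sub>v w)"
  proof (rule power2_le_imp_le)
    show "(c * euclid_norm v)\<^sup>2 \<le> (euclid_norm (block_mat p F *\<^sub>v v))\<^sup>2"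
      unfolding e e' using h c by (intro sum_mono power_mono) auto
  qed simp
qed

lemma block_mat_split:
  assumes F: "\<forall>k\<in>{1..p}. F k \<in> carrier_mat (m k) (m k)" and l: "l \<le> p"
  defines "n \<equiv> block_offset m (Suc l)" and "r \<equiv> block_offset (\<lambda>k. m (k + l)) (Suc (p - l))"
  shows "block_mat p F = four_block_mat (block_mat l F) (0\<^sub>m n r) (0\<^sub>m r n) (block_mat (p - l) (\<lambda>k. F (k + l)))"
proof -
  have "[1..<p + 1] = [1..<l + 1] @ [l + 1..<p + 1]"
    using upt_add_eq_append[of 1 "l + 1" "p - l"] l by (simp del: upt_Suc)
  moreover have "map F [l + 1..<p + 1] = map (\<lambda>k. F (k + l)) [1..<p - l + 1]"
    using l by (intro nth_equalityI) (auto simp: add.commute add.left_commute simp del: upt_Suc)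
  ultimately have e: "map F [1..<p + 1] = map F [1..<l + 1] @ map (\<lambda>k. F (k + l)) [1..<p - l + 1]" by simp
  have "block_mat l F \<in> carrier_mat n n"
    unfolding n_def using F l by (intro block_mat_carrier) auto
  moreover have "block_mat (p - l) (\<lambda>k. F (k + l)) \<in> carrier_mat r r"
    unfolding r_def using F l by (intro block_mat_carrier[of "p - l" _ "\<lambda>k. m (k + l)"]) auto
  ultimately show ?thesis unfolding block_mat_def e diag_block_mat_append Let_def by auto
qed

lemma det_block_mat_nonzero:
  assumes F: "\<forall>k\<in>{1..p}. F k \<in> carrier_mat (m k) (m k) \<and> Determinant.det (F k) \<noteq> 0"
  shows "Determinant.det (block_mat p F) \<noteq> 0"
    and "inv_mat (block_mat p F) = block_mat p (\<lambda>k. inv_mat (F k))"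
proof -
  have Fc: "\<forall>k\<in>{1..p}. F k \<in> carrier_mat (m k) (m k)" using F by blast
  have Gc: "\<forall>k\<in>{1..p}. inv_mat (F k) \<in> carrier_mat (m k) (m k)" using inv_mat_inverse(1) F by blast
  have "inv_mat (F k) * F k = 1\<^sub>m (m k)" if "k \<in> {1..p}" for k using inv_mat_inverse(3) F that by blast
  from inv_mat_unique[OF block_mat_carrier[OF Fc] block_mat_carrier[OF Gc] block_mat_inverse[OF Gc Fc this]]
  show "inv_mat (block_mat p F) = block_mat p (\<lambda>k. inv_mat (F k))" "Determinant.det (block_mat p F) \<noteq> 0" by auto
qed

locale dominated_blocks =
  fixes p :: nat and m :: "nat \<Rightarrow> nat" and B :: "nat \<Rightarrow> real \<Rightarrow> real mat"
  assumes size: "\<And>k. k \<in> {1..p} \<Longrightarrow> 1 \<le> m k"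
    and carrier: "\<And>k t. k \<in> {1..p} \<Longrightarrow> 0 \<le> t \<Longrightarrow> B k t \<in> carrier_mat (m k) (m k)"
    and bounded: "bounded_system (block_offset m (Suc p)) (block_diag p B)"
    and domination: "block_domination p m B"
begin

abbreviation D :: nat where "D \<equiv> block_offset m (Suc p)"

lemma blocks_bounded_system:
  assumes k: "k \<in> {1..p}"
  shows "bounded_system (m k) (B k)"
proof (rule bounded_systemI)
  show "B k t \<in> carrier_mat (m k) (m k)" if "0 \<le> t" for t by (rule carrier[OF k that])
  fix i j assume ij: "i < m k" "j < m k"
  let ?i = "block_offset m k + i" and ?j = "block_offset m k + j"
  have lt: "?i < D" "?j < D" using block_index_less[where m = m and p = p] k ij by auto
  have e: "block_diag p B t $$ (?i, ?j) = B k t $$ (i, j)" if "0 \<le> t" for t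
    using block_mat_index[of p "\<lambda>k. B k t" m, OF _ k k ij] carrier that by (simp add: block_diag_eq_block_mat)
  show "continuous_on {0..} (\<lambda>t. B k t $$ (i, j))"
    by (rule continuous_on_cong[THEN iffD1, OF refl _ bounded_system_entry(1)[OF bounded lt]]) (use e in simp)
  obtain K where "K \<ge> 0" "\<forall>t\<ge>0. \<forall>i<D. \<forall>j<D. \<bar>block_diag p B t $$ (i, j)\<bar> \<le> K"
    using bounded_system_entry(2)[OF bounded] by blast
  then have "\<forall>t\<ge>0. \<bar>B k t $$ (i, j)\<bar> \<le> K" using e lt by metis
  then show "\<exists>K. \<forall>t\<ge>0. \<bar>B k t $$ (i, j)\<bar> \<le> K" ..
qed

definition F :: "nat \<Rightarrow> real \<Rightarrow> real mat" where "F k = fund_mat (m k) (B k)"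

lemma F: "k \<in> {1..p} \<Longrightarrow> fundamental_matrix (m k) (B k) (F k)"
  unfolding F_def fund_mat_def using fundamental_matrix_exists[OF blocks_bounded_system] by (metis someI_ex)

lemma F_carrier: "k \<in> {1..p} \<Longrightarrow> 0 \<le> t \<Longrightarrow> F k t \<in> carrier_mat (m k) (m k)"
  by (rule fundamental_matrix_carrier[OF F])

lemma F_det: "k \<in> {1..p} \<Longrightarrow> 0 \<le> t \<Longrightarrow> Determinant.det (F k t) \<noteq> 0"
  by (rule fundamental_matrix_det[OF F])

abbreviation Y :: "real \<Rightarrow> real \<Rightarrow> nat \<Rightarrow> real mat" where "Y t s k \<equiv> cauchy_matrix (m k) (B k) t s"

lemma Y_eq: "Y t s k = F k t * inv_mat (F k s)"
  by (simp add: cauchy_matrix_def F_def)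

lemma
  assumes k: "k \<in> {1..p}" and s: "0 \<le> s" and t: "0 \<le> t"
  shows Y_carrier: "Y t s k \<in> carrier_mat (m k) (m k)" and Y_det: "Determinant.det (Y t s k) \<noteq> 0"
proof -
  note i = inv_mat_inverse[OF F_carrier[OF k s] F_det[OF k s]]
  show "Y t s k \<in> carrier_mat (m k) (m k)" unfolding Y_eq by (rule mult_carrier_mat[OF F_carrier[OF k t] i(1)])
  have "Determinant.det (inv_mat (F k s)) \<noteq> 0" using inv_mat_unique(2)[OF i(1) F_carrier[OF k s] i(2)] .
  then show "Determinant.det (Y t s k) \<noteq> 0"
    unfolding Y_eq using det_mult[OF F_carrier[OF k t] i(1)] F_det[OF k t] by simp
qed

lemma Y_trans:
  assumes k: "k \<in> {1..p}" and t: "0 \<le> t" "0 \<le> s" "0 \<le> u"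
  shows "Y t s k * Y s u k = Y t u k"
proof -
  note i = inv_mat_inverse[OF F_carrier[OF k t(2)] F_det[OF k t(2)]]
  note i' = inv_mat_inverse[OF F_carrier[OF k t(3)] F_det[OF k t(3)]]
  note Fc = F_carrier[OF k t(1)] F_carrier[OF k t(2)]
  have "Y t s k * Y s u k = F k t * (inv_mat (F k s) * (F k s * inv_mat (F k u)))"
    unfolding Y_eq by (rule assoc_mult_mat[OF Fc(1) i(1) mult_carrier_mat[OF Fc(2) i'(1)]])
  also have "inv_mat (F k s) * (F k s * inv_mat (F k u)) = inv_mat (F k u)"
    using assoc_mult_mat[OF i(1) Fc(2) i'(1)] i(3) left_mult_one_mat[OF i'(1)] by simp
  finally show ?thesis unfolding Y_eq .
qed

lemma cauchy_block_diag:
  assumes s: "0 \<le> s" and t: "0 \<le> t"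
  shows "cauchy_matrix D (block_diag p B) t s = block_mat p (Y t s)"
proof -
  have "has_mat_derivative D (\<lambda>t. block_mat p (\<lambda>k. F k t)) (\<lambda>t. block_mat p (\<lambda>k. B k t * F k t))"
    using F by (intro block_mat_has_derivative) (auto simp: fundamental_matrix_def)
  then have "has_mat_derivative D (\<lambda>t. block_mat p (\<lambda>k. F k t)) (\<lambda>t. block_diag p B t * block_mat p (\<lambda>k. F k t))"
  proof (rule has_mat_derivative_cong[OF _ refl])
    fix t :: real assume "0 \<le> t"
    then show "block_mat p (\<lambda>k. B k t * F k t) = block_diag p B t * block_mat p (\<lambda>k. F k t)"
      unfolding block_diag_eq_block_mat using carrier F_carrier by (intro block_mat_mult[of _ _ m, symmetric]) auto
  qed
  moreover have c: "block_mat p (\<lambda>k. F k t) \<in> carrier_mat D D" if "0 \<le> t" for t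
    using F_carrier that by (intro block_mat_carrier) auto
  moreover have d: "Determinant.det (block_mat p (\<lambda>k. F k t)) \<noteq> 0"
      "inv_mat (block_mat p (\<lambda>k. F k t)) = block_mat p (\<lambda>k. inv_mat (F k t))" if "0 \<le> t" for t
    using det_block_mat_nonzero[of p "\<lambda>k. F k t" m] F_carrier F_det that by auto
  ultimately have "fundamental_matrix D (block_diag p B) (\<lambda>t. block_mat p (\<lambda>k. F k t))"
    unfolding fundamental_matrix_def using invertible_mat_iff_det_nonzero by blast
  from cauchy_matrix_eq[OF bounded this t s]
  have "cauchy_matrix D (block_diag p B) t s = block_mat p (\<lambda>k. F k t) * block_mat p (\<lambda>k. inv_mat (F k s))"
    unfolding d(2)[OF s] .
  also have "\<dots> = block_mat p (Y t s)"
    unfolding Y_eq using F_carrier inv_mat_inverse(1)[OF F_carrier F_det] s t by (intro block_mat_mult[of _ _ m]) auto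
  finally show ?thesis .
qed

definition low :: "real \<Rightarrow> real \<Rightarrow> nat \<Rightarrow> real" where
  "low t s k = inverse (op_norm (inv_mat (Y t s k)))"

lemma
  assumes k: "k \<in> {1..p}" and s: "0 \<le> s" and t: "0 \<le> t"
  shows low_pos: "0 < low t s k" and low_le: "low t s k \<le> op_norm (Y t s k)"
    and low_norm: "\<And>v. v \<in> carrier_vec (m k) \<Longrightarrow> low t s k * euclid_norm v \<le> euclid_norm (Y t s k *\<^sub>v v)"
proof -
  note c = Y_carrier[OF k s t] and i = inv_mat_inverse[OF Y_carrier[OF k s t] Y_det[OF k s t]]
  have p: "0 < op_norm (inv_mat (Y t s k))" using size[OF k] by (intro op_norm_inverse_pos[OF c i(1,2)]) simp
  then show "0 < low t s k" by (simp add: low_def)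
  show n: "low t s k * euclid_norm v \<le> euclid_norm (Y t s k *\<^sub>v v)" if v: "v \<in> carrier_vec (m k)" for v
  proof -
    have Yv: "Y t s k *\<^sub>v v \<in> carrier_vec (m k)" by (rule mult_mat_vec_carrier[OF c v])
    have "inv_mat (Y t s k) *\<^sub>v (Y t s k *\<^sub>v v) = v"
      using assoc_mult_mat_vec[OF i(1) c v] i(3) v by simp
    then have "euclid_norm v \<le> op_norm (inv_mat (Y t s k)) * euclid_norm (Y t s k *\<^sub>v v)"
      using mult_mat_vec_norm_le[OF i(1) Yv] by simp
    then show ?thesis using p by (simp add: low_def field_simps)
  qed
  have u: "unit_vec (m k) 0 \<in> carrier_vec (m k)" by simp
  have "1 \<le> euclid_norm (unit_vec (m k) 0 :: real vec)"
    using abs_vec_index_le_euclid_norm[of 0 "unit_vec (m k) 0"] size[OF k] by simp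
  moreover have "low t s k * euclid_norm (unit_vec (m k) 0 :: real vec) \<le> op_norm (Y t s k) * euclid_norm (unit_vec (m k) 0 :: real vec)"
    using n[OF u] mult_mat_vec_norm_le[OF c u] by (rule order_trans)
  ultimately show "low t s k \<le> op_norm (Y t s k)" by (simp add: mult_le_cancel_right)
qed

text \<open>The upper bound of a block is at least its lower bound, so the hypothesis on neighbouring blocks can be
  iterated; \<open>p\<close> steps at most cost the factor \<open>K\<close>.\<close>

lemma domination_chain:
  "\<exists>K\<ge>1. \<forall>t s j k. 0 \<le> s \<longrightarrow> s \<le> t \<longrightarrow> j \<in> {1..p} \<longrightarrow> k \<in> {1..p} \<longrightarrow> j < k \<longrightarrow> op_norm (Y t s k) \<le> K * low t s j"
proof -
  obtain b where b: "0 < b" and dom: "\<And>t s i. i \<in> {1..<p} \<Longrightarrow> s \<le> t \<Longrightarrow> 0 \<le> s \<Longrightarrow> b * op_norm (Y t s (i + 1)) \<le> low t s i"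
    using domination unfolding block_domination_def low_def by blast
  \<comment> \<open>At least 1, so that its powers increase and \<open>p\<close> is a common exponent for all pairs of blocks.\<close>
  define c where "c = max 1 (1 / b)"
  have c1: "1 \<le> c" by (simp add: c_def)
  have step: "op_norm (Y t s (Suc i)) \<le> c * low t s i" if i: "i \<in> {1..<p}" and st: "0 \<le> s" "s \<le> t" for t s i
  proof -
    have "op_norm (Y t s (Suc i)) \<le> 1 / b * low t s i" using dom[OF i st(2,1)] b by (simp add: field_simps)
    also have "\<dots> \<le> c * low t s i"
      using low_pos[of i s t] i st by (intro mult_right_mono) (auto simp: c_def)
    finally show ?thesis .
  qed
  have chain: "op_norm (Y t s k) \<le> c ^ (k - j) * low t s j"
    if st: "0 \<le> s" "s \<le> t" and j: "1 \<le> j" and jk: "Suc j \<le> k" and k: "k \<le> p" for t s j k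
    using jk k
  proof (induction k rule: dec_induct)
    case base
    then show ?case using step[of j s t] j st by simp
  next
    case (step k)
    have "op_norm (Y t s (Suc k)) \<le> c * low t s k" using \<open>\<And>t s i. i \<in> {1..<p} \<Longrightarrow> 0 \<le> s \<Longrightarrow> s \<le> t \<Longrightarrow> op_norm (Y t s (Suc i)) \<le> c * low t s i\<close>[of k s t] step j st by simp
    also have "\<dots> \<le> c * op_norm (Y t s k)" using low_le[of k s t] step j st c1 by (intro mult_left_mono) auto
    also have "\<dots> \<le> c * (c ^ (k - j) * low t s j)" using step c1 by (intro mult_left_mono) auto
    finally show ?case using step(1) by (simp add: Suc_diff_le)
  qed
  show ?thesis
  proof (intro exI[of _ "c ^ p"] conjI allI impI)
    show "1 \<le> c ^ p" using c1 by simp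
    fix t s j k assume h: "(0 :: real) \<le> s" "s \<le> t" "j \<in> {1..p}" "k \<in> {1..p}" "j < k"
    have "op_norm (Y t s k) \<le> c ^ (k - j) * low t s j" using chain h by simp
    also have "\<dots> \<le> c ^ p * low t s j"
      using low_pos[of j s t] h c1 by (intro mult_right_mono power_increasing) auto
    finally show "op_norm (Y t s k) \<le> c ^ p * low t s j" .
  qed
qed

text \<open>Up to the factor \<open>K\<close> in each singular value, the product of the largest singular values is the determinant
  of the leading blocks, which is multiplicative along the evolution.\<close>

theorem fast_invertible:
  assumes l: "l \<in> {1..p}"
  shows "strongly_fast_invertible D (block_diag p B) (block_offset m (Suc l))"
proof -
  let ?n = "block_offset m (Suc l)" and ?m = "\<lambda>k. m (k + l)"
  let ?r = "block_offset ?m (Suc (p - l))"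
  obtain K where K: "1 \<le> K" and dom: "\<And>t s j k. 0 \<le> s \<Longrightarrow> s \<le> t \<Longrightarrow> j \<in> {1..p} \<Longrightarrow> k \<in> {1..p} \<Longrightarrow> j < k \<Longrightarrow>
      op_norm (Y t s k) \<le> K * low t s j"
    using domination_chain by blast
  let ?P = "\<lambda>t s. block_mat l (Y t s)"
  let ?M = "cauchy_matrix D (block_diag p B)"
  have Pc: "?P t s \<in> carrier_mat ?n ?n" and Pd: "Determinant.det (?P t s) \<noteq> 0" if "0 \<le> s" "0 \<le> t" for t s
  proof -
    have "\<forall>k\<in>{1..l}. Y t s k \<in> carrier_mat (m k) (m k) \<and> Determinant.det (Y t s k) \<noteq> 0"
      using Y_carrier[OF _ that] Y_det[OF _ that] l by auto
    then show "?P t s \<in> carrier_mat ?n ?n" "Determinant.det (?P t s) \<noteq> 0"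
      using det_block_mat_nonzero(1)[of l "Y t s" m] by (auto intro: block_mat_carrier)
  qed
  have sv: "singular_value k (?P t s) \<le> singular_value k (?M t s)" "singular_value k (?M t s) \<le> K * singular_value k (?P t s)"
    if s: "0 \<le> s" and st: "s \<le> t" and k: "k \<in> {1..?n}" for t s k
  proof -
    have t: "0 \<le> t" using s st by simp
    let ?S = "block_mat (p - l) (\<lambda>k. Y t s (k + l))"
    \<comment> \<open>The smallest expansion by the leading blocks; it is the lower bound of one of them, which dominates the rest.\<close>
    define \<alpha> where "\<alpha> = Min (low t s ` {1..l})"
    have \<alpha>_le: "\<alpha> \<le> low t s j" if "j \<in> {1..l}" for j unfolding \<alpha>_def using that by (intro Min_le) auto
    have "\<alpha> \<in> low t s ` {1..l}" unfolding \<alpha>_def using l by (intro Min_in) auto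
    then obtain j where j: "j \<in> {1..l}" "\<alpha> = low t s j" by blast
    have \<alpha>: "0 < \<alpha>" using low_pos[of j s t] j l s t by simp
    have Sb: "\<forall>k\<in>{1..p-l}. Y t s (k + l) \<in> carrier_mat (m (k + l)) (m (k + l)) \<and> Determinant.det (Y t s (k + l)) \<noteq> 0"
      using Y_carrier[OF _ s t] Y_det[OF _ s t] by auto
    have S: "?S \<in> carrier_mat ?r ?r" "Determinant.det ?S \<noteq> 0"
      using det_block_mat_nonzero(1)[of "p - l" "\<lambda>k. Y t s (k + l)" ?m] block_mat_carrier[of "p - l" "\<lambda>k. Y t s (k + l)" ?m] Sb by auto
    have M: "?M t s = four_block_mat (?P t s) (0\<^sub>m ?n ?r) (0\<^sub>m ?r ?n) ?S"
      unfolding cauchy_block_diag[OF s t] using Y_carrier[OF _ s t] l by (intro block_mat_split) auto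
    have low': "\<alpha> * euclid_norm v \<le> euclid_norm (?P t s *\<^sub>v v)" if v: "v \<in> carrier_vec ?n" for v
    proof (rule block_mat_norm_ge[OF _ v])
      show "\<forall>k\<in>{1..l}. Y t s k \<in> carrier_mat (m k) (m k)" using Y_carrier[OF _ s t] l by simp
      fix k and w :: "real vec" assume k: "k \<in> {1..l}" and w: "w \<in> carrier_vec (m k)"
      have "\<alpha> * euclid_norm w \<le> low t s k * euclid_norm w" using \<alpha>_le[OF k] by (intro mult_right_mono) auto
      also have "\<dots> \<le> euclid_norm (Y t s k *\<^sub>v w)" using low_norm[OF _ s t w] k l by simp
      finally show "\<alpha> * euclid_norm w \<le> euclid_norm (Y t s k *\<^sub>v w)" .
    qed (use \<alpha> in simp)
    have up: "euclid_norm (?S *\<^sub>v w) \<le> K * \<alpha> * euclid_norm w" if w: "w \<in> carrier_vec ?r" for w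
    proof (rule block_mat_norm_le[OF _ w])
      show "\<forall>k\<in>{1..p-l}. Y t s (k + l) \<in> carrier_mat (m (k + l)) (m (k + l))" using Sb by blast
      fix k and z :: "real vec" assume k: "k \<in> {1..p-l}" and z: "z \<in> carrier_vec (m (k + l))"
      have "euclid_norm (Y t s (k + l) *\<^sub>v z) \<le> op_norm (Y t s (k + l)) * euclid_norm z"
        using Sb k by (intro mult_mat_vec_norm_le[OF _ z]) blast
      also have "\<dots> \<le> K * \<alpha> * euclid_norm z"
        unfolding j(2) using k j(1) l by (intro mult_right_mono dom[OF s st]) auto
      finally show "euclid_norm (Y t s (k + l) *\<^sub>v z) \<le> K * \<alpha> * euclid_norm z" .
    qed (use \<alpha> K in simp)
    show "singular_value k (?P t s) \<le> singular_value k (?M t s)" "singular_value k (?M t s) \<le> K * singular_value k (?P t s)"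
      unfolding M by (rule block_singular_value_bounds[OF Pc[OF s t] Pd[OF s t] S low' up \<alpha> K k]; assumption)+
  qed
  have prod: "\<bar>Determinant.det (?P t s)\<bar> \<le> (\<Prod>k=1..?n. singular_value k (?M t s))"
    "(\<Prod>k=1..?n. singular_value k (?M t s)) \<le> K ^ ?n * \<bar>Determinant.det (?P t s)\<bar>" if s: "0 \<le> s" and st: "s \<le> t" for t s
  proof -
    have t: "0 \<le> t" using s st by simp
    note e = prod_singular_values[OF Pc[OF s t] Pd[OF s t]] and pos = singular_value_pos[OF Pc[OF s t] Pd[OF s t]]
    show "\<bar>Determinant.det (?P t s)\<bar> \<le> (\<Prod>k=1..?n. singular_value k (?M t s))"
      unfolding e[symmetric] using sv(1)[OF s st] pos by (intro prod_mono) (auto simp: less_imp_le)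
    have "(\<Prod>k=1..?n. singular_value k (?M t s)) \<le> (\<Prod>k=1..?n. K * singular_value k (?P t s))"
      using sv[OF s st] pos by (intro prod_mono) (auto intro: order_trans[OF less_imp_le[OF pos]])
    then show "(\<Prod>k=1..?n. singular_value k (?M t s)) \<le> K ^ ?n * \<bar>Determinant.det (?P t s)\<bar>"
      unfolding e[symmetric] by (simp add: prod.distrib)
  qed
  have bound: "(\<Prod>k=1..?n. singular_value k (?M t s) * singular_value k (?M s u) / singular_value k (?M t u)) \<le> K ^ ?n * K ^ ?n"
    if h: "u \<ge> 0" "s \<ge> u" "t \<ge> s" for t s u
  proof -
    have s: "0 \<le> s" and t: "0 \<le> t" and ut: "u \<le> t" using h by auto
    have P: "?P t s * ?P s u = ?P t u"
    proof -
      have "?P t s * ?P s u = block_mat l (\<lambda>k. Y t s k * Y s u k)"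
        using Y_carrier[of _ s t] Y_carrier[of _ u s] l s t h by (intro block_mat_mult[of _ _ m]) auto
      also have "\<dots> = ?P t u" using Y_trans l s t h by (intro block_mat_cong) auto
      finally show ?thesis .
    qed
    have det: "\<bar>Determinant.det (?P t s)\<bar> * \<bar>Determinant.det (?P s u)\<bar> = \<bar>Determinant.det (?P t u)\<bar>"
      unfolding P[symmetric] det_mult[OF Pc[OF s t] Pc[OF h(1) s]] abs_mult ..
    have p: "0 < \<bar>Determinant.det (?P t u)\<bar>" using Pd[OF h(1) t] by simp
    have "(\<Prod>k=1..?n. singular_value k (?M t s)) * (\<Prod>k=1..?n. singular_value k (?M s u)) \<le>
        (K ^ ?n * \<bar>Determinant.det (?P t s)\<bar>) * (K ^ ?n * \<bar>Determinant.det (?P s u)\<bar>)"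
      using prod(2)[OF s h(3)] prod(2)[OF h(1,2)] order_trans[OF abs_ge_zero prod(1)[OF s h(3)]] order_trans[OF abs_ge_zero prod(1)[OF h(1,2)]] K
      by (intro mult_mono) auto
    also have "\<dots> = K ^ ?n * K ^ ?n * \<bar>Determinant.det (?P t u)\<bar>" unfolding det[symmetric] by simp
    also have "\<dots> \<le> K ^ ?n * K ^ ?n * (\<Prod>k=1..?n. singular_value k (?M t u))"
      using prod(1)[OF h(1) ut] K by (intro mult_left_mono) auto
    finally show ?thesis
      using less_le_trans[OF p prod(1)[OF h(1) ut]] by (simp add: prod.distrib prod_dividef pos_divide_le_eq)
  qed
  have "fast_invertibility_const D (block_diag p B) ?n \<le> ereal (K ^ ?n * K ^ ?n)"
    unfolding fast_invertibility_const_def by (rule SUP_least) (use bound in auto)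
  also have "\<dots> < \<infinity>" by simp
  finally have "fast_invertibility_const D (block_diag p B) ?n < \<infinity>" .
  moreover have "?n \<le> D" using l by (intro block_offset_mono) simp
  moreover have "m l \<le> ?n" using l by (simp add: block_offset_Suc)
  then have "1 \<le> ?n" using size[OF l] by simp
  ultimately show ?thesis unfolding strongly_fast_invertible_def by blast
qed

end

section \<open>The two directions\<close>

text \<open>A system of positive dimension has a nontrivial solution, hence an exponent.\<close>

lemma empty_spectrum_dim:
  assumes A: "bounded_system d A" and spec: "has_lyapunov_spectrum d A 0 lam m"
  shows "d = 0"
proof (rule ccontr)
  assume d: "d \<noteq> 0"
  obtain X where X: "fundamental_matrix d A X" using fundamental_matrix_exists[OF A] by blast
  have u: "unit_vec d 0 \<in> carrier_vec d" by simp
  have "lyapunov_exponents d A = {}" using spec by (simp add: has_lyapunov_spectrum_def)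
  then have "solution_of X (unit_vec d 0) = zero_solution d"
    using solution_of_in_solutions[OF A X u] by (auto simp: lyapunov_exponents_def)
  then have "solution_of X (unit_vec d 0) = solution_of X (0\<^sub>v d)" using solution_of_zero[OF X] by simp
  then have "unit_vec d 0 = (0\<^sub>v d :: real vec)" using solution_of_inj[OF X] u by (auto dest: inj_onD)
  then have "(unit_vec d 0 :: real vec) $ 0 = 0\<^sub>v d $ 0" by simp
  then show False using d by simp
qed

lemma trivial_reducible:
  assumes "mat_fun 0 A"
  shows "lyapunov_reducible 0 A (block_diag 0 B)"
proof -
  have c: "M = 0\<^sub>m 0 0" if "M \<in> carrier_mat 0 0" for M :: "real mat" using that by (intro eq_matI) auto
  have e: "mat_fun 0 (\<lambda>t. 0\<^sub>m 0 0)" by (simp add: mat_fun_def)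
  have b: "mat_bounded (\<lambda>t. 0\<^sub>m 0 0)" unfolding mat_bounded_iff_entries_bounded[OF e] by simp
  have det: "Determinant.det (0\<^sub>m 0 0 :: real mat) \<noteq> 0" by simp
  have i: "inv_mat (0\<^sub>m 0 0) = 0\<^sub>m 0 0" by (rule c[OF inv_mat_inverse(1)[OF zero_carrier_mat det]])
  have "lyapunov_transformation 0 (\<lambda>t. 0\<^sub>m 0 0) (\<lambda>t. 0\<^sub>m 0 0)"
    unfolding lyapunov_transformation_def
    using e b invertible_mat_iff_det_nonzero[OF zero_carrier_mat, of 0] det
    by (simp add: has_mat_derivative_def mat_continuous_def i)
  moreover have "block_diag 0 B t = inv_mat (0\<^sub>m 0 0) * A t * 0\<^sub>m 0 0 - inv_mat (0\<^sub>m 0 0) * 0\<^sub>m 0 0" if "0 \<le> t" for t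
    unfolding i block_diag_eq_block_mat block_mat_0 using assms that
    by (intro eq_matI) (auto simp: mat_fun_def)
  ultimately show ?thesis unfolding lyapunov_reducible_def by blast
qed

text \<open>The case \<open>p = 0\<close> is separate: the dimension is 0 and there is no exponent to start from.\<close>

theorem block_reduction:
  assumes A: "bounded_system d A" and spec: "has_lyapunov_spectrum d A p lam m"
    and reg: "regular_system d A p lam m"
    and FI: "\<forall>l\<in>{1..p}. strongly_fast_invertible d A (\<Sum>i=1..l. m i)"
  shows "\<exists>B. triangular_blocks p m B \<and> lyapunov_reducible d A (block_diag p B) \<and>
    block_exponents p m lam B \<and> block_domination p m B"
proof (cases "p = 0")
  case True
  have d: "d = 0" using empty_spectrum_dim[OF A] spec True by blast
  have "mat_fun 0 A" using A d by (simp add: bounded_system_def mat_continuous_def)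
  from trivial_reducible[OF this] show ?thesis
    unfolding True d
    by (intro exI[of _ "\<lambda>_ _. 0\<^sub>m 0 0"] conjI)
      (auto simp: triangular_blocks_def block_exponents_def block_domination_def intro: exI[of _ 1])
next
  case False
  interpret S: lyapunov_spectrum d A p lam m by unfold_locales (use A spec False in auto)
  obtain \<Phi> where \<Phi>: "fundamental_matrix d A \<Phi>" "block_offset m (Suc p) = d"
    "\<forall>k\<in>{1..Suc p}. lyapunov_filtration d A p lam k = solution_of \<Phi> ` {c \<in> carrier_vec d. \<forall>i<block_offset m k. c $ i = 0}"
    using S.adapted_fundamental_matrix by blast
  interpret A: adapted_system d A p lam m \<Phi> by unfold_locales (use \<Phi> in auto)
  have FI': "strongly_fast_invertible d A (block_offset m (Suc l))" if "l \<in> {1..<p}" for l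
    using FI that by (simp add: block_offset_def atLeastLessThanSuc_atLeastAtMost)
  interpret D: dominated_system d A p lam m \<Phi>
    by unfold_locales (use A.volume_dominated_at_offset[OF reg _ FI'] in blast)
  show ?thesis using A.triangular D.reducible A.exponents D.domination by blast
qed

theorem block_diag_fast_invertible:
  assumes m: "\<forall>i\<in>{1..p}. 1 \<le> m i" and tri: "triangular_blocks p m B"
    and B: "bounded_system (\<Sum>i=1..p. m i) (block_diag p B)" and dom: "block_domination p m B" and l: "l \<in> {1..p}"
  shows "strongly_fast_invertible (\<Sum>i=1..p. m i) (block_diag p B) (\<Sum>i=1..l. m i)"
proof -
  have e: "block_offset m (Suc k) = (\<Sum>i=1..k. m i)" for k
    by (simp add: block_offset_def atLeastLessThanSuc_atLeastAtMost)
  interpret dominated_blocks p m B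
    by unfold_locales (use m tri B dom in \<open>auto simp: triangular_blocks_def e\<close>)
  show ?thesis using fast_invertible[OF l] unfolding e .
qed

theorem theorem3p33:
  shows
    "(\<forall>(d::nat) (A :: real \<Rightarrow> real mat) (p::nat) (lam :: nat \<Rightarrow> real) (m :: nat \<Rightarrow> nat).
        mat_continuous d A \<and> mat_bounded A \<and>
        has_lyapunov_spectrum d A p lam m \<and>
        regular_system d A p lam m \<and>
        (\<forall>l\<in>{1..p}. strongly_fast_invertible d A (\<Sum>i=1..l. m i))
        \<longrightarrow> (\<exists>B :: nat \<Rightarrow> real \<Rightarrow> real mat.
              triangular_blocks p m B \<and>
              lyapunov_reducible d A (block_diag p B) \<and>
              block_exponents p m lam B \<and>
              block_domination p m B))
     \<and>
     (\<forall>(p::nat) (lam :: nat \<Rightarrow> real) (m :: nat \<Rightarrow> nat) (B :: nat \<Rightarrow> real \<Rightarrow> real mat).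
        (\<forall>i\<in>{1..p}. m i \<ge> 1) \<and>
        triangular_blocks p m B \<and>
        mat_continuous (\<Sum>i=1..p. m i) (block_diag p B) \<and> mat_bounded (block_diag p B) \<and>
        strict_antimono_on {1..p} lam \<and>
        block_exponents p m lam B \<and>
        block_domination p m B
        \<longrightarrow> (\<forall>l\<in>{1..p}. strongly_fast_invertible (\<Sum>i=1..p. m i) (block_diag p B) (\<Sum>i=1..l. m i)))"
proof (intro conjI allI impI ballI; elim conjE)
  fix d p :: nat and A :: "real \<Rightarrow> real mat" and lam :: "nat \<Rightarrow> real" and m :: "nat \<Rightarrow> nat"
  assume "mat_continuous d A" "mat_bounded A" and h: "has_lyapunov_spectrum d A p lam m" "regular_system d A p lam m"
    "\<forall>l\<in>{1..p}. strongly_fast_invertible d A (\<Sum>i=1..l. m i)"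
  then have "bounded_system d A" by (simp add: bounded_system_def)
  from block_reduction[OF this h]
  show "\<exists>B. triangular_blocks p m B \<and> lyapunov_reducible d A (block_diag p B) \<and>
      block_exponents p m lam B \<and> block_domination p m B" .
next
  fix p l :: nat and lam :: "nat \<Rightarrow> real" and m :: "nat \<Rightarrow> nat" and B :: "nat \<Rightarrow> real \<Rightarrow> real mat"
  assume "\<forall>i\<in>{1..p}. 1 \<le> m i" "triangular_blocks p m B"
    "mat_continuous (\<Sum>i=1..p. m i) (block_diag p B)" "mat_bounded (block_diag p B)"
    "block_domination p m B" "l \<in> {1..p}"
  then show "strongly_fast_invertible (\<Sum>i=1..p. m i) (block_diag p B) (\<Sum>i=1..l. m i)"
    by (intro block_diag_fast_invertible) (auto simp: bounded_system_def)
qed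

end
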